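(* Fix $s>-\frac16$, let $b>\frac12$ and $b'\in\left(\frac{5-6s}{12},\frac12\right)$, and let $0\le a<\frac12\left(3\min\{0,s\}+6b'-\frac52\right)$. Then, for all $u_1,u_2,u_3,u_4\in X^{s,b}$, $$\|\partial_x(u_1u_2u_3u_4)\|_{X^{s+a,-b'}}\lesssim\prod_{j=1}^4\|u_j\|_{X^{s,b}},$$ with an implicit constant independent of the $u_j$.
   Context: For functions on $\mathbb{R}_x\times\mathbb{R}_t$ with space-time Fourier transform $\widehat u(\xi,\tau)$ (convention $\widehat f(\xi)=\int e^{-ix\xi}f(x)\,dx$ in each variable), $\|u\|_{X^{s,b}}=\|\langle\xi\rangle^s\langle\tau-\xi^3\rangle^b\widehat u(\xi,\tau)\|_{L^2_{\xi,\tau}}$, where $\langle\xi\rangle=\sqrt{1+|\xi|^2}$. *)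

theory Defs
  imports "HOL-Analysis.Analysis"
begin

text \<open>Points of the space-time plane are pairs \<open>(x, t)\<close>, those of the frequency plane are
  pairs \<open>(\<xi>, \<tau>)\<close>.\<close>

definition partial_x :: "(real \<times> real \<Rightarrow> complex) \<Rightarrow> real \<times> real \<Rightarrow> complex" where
  "partial_x f z = frechet_derivative f (at z) (1, 0)"

definition partial_t :: "(real \<times> real \<Rightarrow> complex) \<Rightarrow> real \<times> real \<Rightarrow> complex" where
  "partial_t f z = frechet_derivative f (at z) (0, 1)"

definition mixed_partial :: "nat \<Rightarrow> nat \<Rightarrow> (real \<times> real \<Rightarrow> complex) \<Rightarrow> real \<times> real \<Rightarrow> complex" where
  "mixed_partial j k f = (partial_x ^^ j) ((partial_t ^^ k) f)"

text \<open>Frechet differentiability of all these mixed partials makes them continuous, so the order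
  of differentiation is immaterial and the function is smooth.\<close>

definition schwartz :: "(real \<times> real \<Rightarrow> complex) \<Rightarrow> bool" where
  "schwartz f \<longleftrightarrow>
     (\<forall>j k. mixed_partial j k f differentiable_on UNIV \<and>
            (\<forall>m::nat. bounded (range (\<lambda>z. (1 + norm z) ^ m * norm (mixed_partial j k f z)))))"

definition schwartz_norm :: "nat \<Rightarrow> (real \<times> real \<Rightarrow> complex) \<Rightarrow> real" where
  "schwartz_norm N f =
     (\<Sum>j\<le>N. \<Sum>k\<le>N. SUP z. (1 + norm z) ^ N * norm (mixed_partial j k f z))"

text \<open>A tempered distribution is a continuous linear functional on the Schwartz space. It is
  encoded by a total functional, whose values off the Schwartz space are irrelevant.\<close>

type_synonym distr = "(real \<times> real \<Rightarrow> complex) \<Rightarrow> complex"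

definition tempered :: "distr \<Rightarrow> bool" where
  "tempered U \<longleftrightarrow>
     (\<forall>f g. schwartz f \<longrightarrow> schwartz g \<longrightarrow> U (\<lambda>z. f z + g z) = U f + U g) \<and>
     (\<forall>c f. schwartz f \<longrightarrow> U (\<lambda>z. c * f z) = c * U f) \<and>
     (\<exists>C N. \<forall>f. schwartz f \<longrightarrow> norm (U f) \<le> C * schwartz_norm N f)"

definition tempered_function :: "(real \<times> real \<Rightarrow> complex) \<Rightarrow> bool" where
  "tempered_function u \<longleftrightarrow>
     u \<in> borel_measurable borel \<and> (\<forall>f. schwartz f \<longrightarrow> integrable lborel (\<lambda>z. u z * f z))"

definition distr_of :: "(real \<times> real \<Rightarrow> complex) \<Rightarrow> distr" where
  "distr_of u f = (LINT z|lborel. u z * f z)"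

definition represents :: "(real \<times> real \<Rightarrow> complex) \<Rightarrow> distr \<Rightarrow> bool" where
  "represents u U \<longleftrightarrow> tempered_function u \<and> (\<forall>f. schwartz f \<longrightarrow> U f = distr_of u f)"

definition distr_dx :: "distr \<Rightarrow> distr" where
  "distr_dx U f = - U (partial_x f)"

definition fourier :: "(real \<times> real \<Rightarrow> complex) \<Rightarrow> real \<times> real \<Rightarrow> complex" where
  "fourier f = (\<lambda>(\<xi>, \<tau>). LINT (x, t)|lborel. exp (- \<i> * of_real (x * \<xi> + t * \<tau>)) * f (x, t))"

definition distr_fourier :: "distr \<Rightarrow> distr" where
  "distr_fourier U f = U (fourier f)"

text \<open>The Fourier transform of \<open>U\<close> as a function, meaningful when that transform is a regular
  distribution; the choice is then unique up to null sets.\<close>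

definition fourier_fun :: "distr \<Rightarrow> real \<times> real \<Rightarrow> complex" where
  "fourier_fun U = (SOME g. represents g (distr_fourier U))"

definition japanese :: "real \<Rightarrow> real" where
  "japanese y = sqrt (1 + \<bar>y\<bar>\<^sup>2)"

definition X_integrand :: "real \<Rightarrow> real \<Rightarrow> distr \<Rightarrow> real \<times> real \<Rightarrow> real" where
  "X_integrand s b U = (\<lambda>(\<xi>, \<tau>).
     (japanese \<xi> powr s * japanese (\<tau> - \<xi> ^ 3) powr b * norm (fourier_fun U (\<xi>, \<tau>)))\<^sup>2)"

definition X_space :: "real \<Rightarrow> real \<Rightarrow> distr set" where
  "X_space s b = {U. tempered U \<and> (\<exists>g. represents g (distr_fourier U)) \<and>
                     integrable lborel (X_integrand s b U)}"

definition X_norm :: "real \<Rightarrow> real \<Rightarrow> distr \<Rightarrow> real" where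
  "X_norm s b U = sqrt (LINT z|lborel. X_integrand s b U z)"

end

theory Submission
  imports Defs "HOL-Probability.Probability"
begin

text \<open>By duality the estimate bounds an integral of five nonnegative functions over the hyperplane
  \<open>u\<^sub>1 + \<dots> + u\<^sub>5 = 0\<close> of the frequency planes. At every point of the hyperplane the five
  variables split into a pair and a triple such that the weighted symbol is at most a constant times
  a kernel of the pair, which pays for the derivative by the square root of
  \<open>\<bar>a\<^sup>2 - b\<^sup>2\<bar>\<close>, times a kernel of the triple.
  Both kernels are square integrable over the fibres of fixed sum, uniformly in the sum: for the pair
  because \<open>a\<^sup>2 - b\<^sup>2\<close> is the derivative of the phase \<open>a\<^sup>3 + b\<^sup>3\<close> up to a
  factor, for the triple by a
  critical point analysis of the phase \<open>a\<^sup>3 + b\<^sup>3 + c\<^sup>3\<close>. Two applications of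
  the Cauchy--Schwarz inequality then bound the form.

  The pointwise product is meaningful because the three-wave kernel also embeds the space into
  \<open>L\<^sup>6\<close>, with an \<open>L\<^sup>6\<close> majorant for the inverse transforms of the truncated functions.
  Dominated convergence therefore carries the convolution formula over from the truncations, which are
  handled by Gaussian summability, and the convolution is controlled by the form.\<close>

section \<open>Phase integrals in one variable\<close>

text \<open>Duality gives the fifth function only the modulation exponent \<open>b'\<close> < 1/2,
  while the kernels need an exponent \<open>be\<close> > 1/2 in every modulation they use. Write
  \<open><M>\<close> for \<open>japanese M\<close>, with \<open>M\<close> the largest of the five
  frequencies. The modulation of the fifth variable is compared with \<open><M>^3\<close>. If it is
  larger, it is worth \<open><M> powr (- 3 * b')\<close>, and the fifth variable is placed in the
  pair, where one summand of the kernel ignores it. If it is smaller, raising \<open>b'\<close> to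
  \<open>be\<close> costs \<open><M> powr (3 * (be - b'))\<close>, and the kernels must win a power
  just below 3/2: the pair supplies \<open><M>\<close>, the triple almost
  \<open><M> powr (1 / 2)\<close>. Such a pair exists because four numbers of modulus close to
  \<open>M\<close> never add up to one of modulus \<open>M\<close>. Derivative and regularity cost
  \<open><M> powr (1 + al - 3 * min 0 s)\<close>, where \<open>al\<close> is the \<open>a\<close> of
  the theorem. So \<open>e = 3 * b' - (1 + al - 3 * min 0 s)\<close> must be positive, which the
  bound on \<open>al\<close> gives for \<open>s\<close> > -1/6. The same threshold governs the
  \<open>L^6\<close> embedding: three weights \<open><M> powr (1 / 6)\<close> against the
  \<open><M> powr (1 / 2)\<close> of the triple.\<close>

lemma japanese_ge1: "1 \<le> japanese y"
  by (simp add: japanese_def)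

lemma japanese_pos[simp]: "0 < japanese y"
  using japanese_ge1[of y] by linarith

lemma japanese_nonneg[simp]: "0 \<le> japanese y" and japanese_neq0[simp]: "japanese y \<noteq> 0"
  using japanese_pos[of y] by linarith+

lemma japanese_powr_pos[simp]: "0 < japanese y powr p"
  by simp

lemma abs_le_japanese: "\<bar>y\<bar> \<le> japanese y"
  unfolding japanese_def by (rule real_le_rsqrt) simp

lemma japanese_le: "japanese y \<le> 1 + \<bar>y\<bar>"
  unfolding japanese_def by (rule real_le_lsqrt) (auto simp: power2_eq_square algebra_simps)

lemma japanese_mono: "\<bar>x\<bar> \<le> \<bar>y\<bar> \<Longrightarrow> japanese x \<le> japanese y"
  unfolding japanese_def by (simp add: abs_le_square_iff)

lemma japanese_minus[simp]: "japanese (- y) = japanese y"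
  by (simp add: japanese_def)

lemma continuous_on_japanese[continuous_intros]:
  "continuous_on A f \<Longrightarrow> continuous_on A (\<lambda>x. japanese (f x))"
  unfolding japanese_def by (intro continuous_intros)

lemma borel_measurable_japanese[measurable (raw)]:
  "f \<in> borel_measurable M \<Longrightarrow> (\<lambda>x. japanese (f x)) \<in> borel_measurable M"
  unfolding japanese_def by measurable

text \<open>The function \<open>tanh (\<delta> * arsinh v)\<close> is a bounded smooth primitive of
  a function comparable to \<open>japanese v powr - (1 + 2 * \<delta>)\<close>.\<close>

lemma japanese_powr_primitive:
  fixes d v :: real
  assumes "d > 0"
  defines "h \<equiv> \<lambda>v. (1 - (tanh (d * arsinh v))\<^sup>2) * (d / sqrt (v\<^sup>2 + 1))"
  shows "((\<lambda>v. tanh (d * arsinh v)) has_real_derivative h v) (at v)"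
    and "japanese v powr - (1 + 2 * d) \<le> (4 powr d / d) * h v"
proof -
  show "((\<lambda>v. tanh (d * arsinh v)) has_real_derivative h v) (at v)"
    unfolding h_def by (auto intro!: derivative_eq_intros)
  have s: "sqrt (v\<^sup>2 + 1) = japanese v" by (simp add: japanese_def add.commute)
  \<comment> \<open>The derivative of tanh is the inverse square of cosh, so the lower bound wanted
    for \<open>h\<close> becomes an upper bound for cosh.\<close>
  have e: "1 - (tanh (d * arsinh v))\<^sup>2 = 1 / (cosh (d * arsinh v))\<^sup>2"
  proof -
    define c where "c = cosh (d * arsinh v)"
    have c: "c > 0" "(sinh (d * arsinh v))\<^sup>2 = c\<^sup>2 - 1"
      unfolding c_def using cosh_real_pos[of "d * arsinh v"] by (auto simp: cosh_square_eq)
    have "(tanh (d * arsinh v))\<^sup>2 = (c\<^sup>2 - 1) / c\<^sup>2"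
      unfolding tanh_def power_divide c(2) c_def[symmetric] ..
    then show ?thesis using c(1) unfolding c_def[symmetric] by (simp add: field_simps)
  qed
  have p: "0 < \<bar>v\<bar> + japanese v" using japanese_pos[of v] by linarith
  \<comment> \<open>Since \<open>exp (arsinh |v|) = |v| + japanese v\<close>, cosh is at most
    \<open>(2 * japanese v) powr d\<close>; the exponent \<open>2 * d\<close> and the factor
    \<open>4 powr d\<close> of the comparison come from squaring this.\<close>
  have "cosh (d * arsinh v) = cosh (d * arsinh \<bar>v\<bar>)"
    by (cases "v \<ge> 0") auto
  also have "\<dots> \<le> exp (d * arsinh \<bar>v\<bar>)"
  proof -
    have "0 \<le> d * arsinh \<bar>v\<bar>"
    proof (intro mult_nonneg_nonneg)
      show "0 \<le> arsinh \<bar>v\<bar>" 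
      proof -
        have "1 \<le> \<bar>v\<bar> + japanese v" using japanese_ge1[of v] by linarith
        then show ?thesis by (simp add: arsinh_real_def s)
      qed
    qed (use assms in auto)
    moreover have "cosh y \<le> exp y" if "0 \<le> y" for y :: real
      using that by (simp add: cosh_def)
    ultimately show ?thesis by blast
  qed
  also have "\<dots> = (\<bar>v\<bar> + japanese v) powr d"
    using p s by (simp add: arsinh_real_def powr_def)
  also have "\<dots> \<le> (2 * japanese v) powr d"
    using assms abs_le_japanese[of v] by (intro powr_mono2) auto
  finally have c: "cosh (d * arsinh v) \<le> (2 * japanese v) powr d" .
  have "(cosh (d * arsinh v))\<^sup>2 \<le> ((2 * japanese v) powr d)\<^sup>2"
    using c by (intro power_mono) (auto simp: less_imp_le)
  also have "\<dots> = 4 powr d * japanese v powr (2 * d)"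
  proof -
    have "4 powr d = 2 powr (2 * d)" using powr_powr[of 2 2 d] by simp
    then show ?thesis by (simp add: powr_mult power_mult_distrib powr_power mult.commute)
  qed
  finally have c2: "(cosh (d * arsinh v))\<^sup>2 \<le> 4 powr d * japanese v powr (2 * d)" .
  have "japanese v powr - (1 + 2 * d) = 1 / (japanese v powr (2*d) * japanese v)"
    by (simp add: powr_minus powr_add powr_diff divide_simps)
  also have "\<dots> \<le> 4 powr d / ((cosh (d * arsinh v))\<^sup>2 * japanese v)"
    using c2 by (simp add: divide_simps mult_right_mono mult.commute)
  also have "\<dots> = (4 powr d / d) * h v"
    using assms by (simp add: h_def e s)
  finally show "japanese v powr - (1 + 2 * d) \<le> (4 powr d / d) * h v" .
qed

text \<open>Where the phase is monotone, the integrand is dominated by the derivative of the bounded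
  primitive composed with \<open>q\<close>, so the fundamental theorem bounds the integral by an
  oscillation. This is why \<open>K\<close> depends on \<open>p\<close> only, neither on the phase
  nor on the interval.\<close>

lemma nn_integral_monotone_phase:
  fixes p :: real
  assumes "p > 1"
  obtains K where "K > 0" 
    "\<And>q q' a b. a \<le> b \<Longrightarrow> (\<And>x. (q has_real_derivative q' x) (at x)) \<Longrightarrow>
       continuous_on UNIV q' \<Longrightarrow> (\<forall>x\<in>{a..b}. 0 \<le> q' x) \<or> (\<forall>x\<in>{a..b}. q' x \<le> 0) \<Longrightarrow>
       (\<integral>\<^sup>+x. ennreal (japanese (q x) powr - p * \<bar>q' x\<bar>) * indicator {a..b} x \<partial>lborel) \<le> ennreal K"
proof -
  define d where "d = (p - 1) / 2"
  have d: "d > 0" "p = 1 + 2 * d" using assms by (auto simp: d_def field_simps)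
  define C where "C = 4 powr d / d"
  have C: "C > 0" using d by (simp add: C_def)
  define h where "h v = (1 - (tanh (d * arsinh v))\<^sup>2) * (d / sqrt (v\<^sup>2 + 1))" for v
  define H where "H v = tanh (d * arsinh v)" for v :: real
  have H: "(H has_real_derivative h v) (at v)" for v
    unfolding H_def h_def using japanese_powr_primitive(1)[OF d(1)] by simp
  have jh: "japanese v powr - p \<le> C * h v" for v
    unfolding C_def d(2) h_def using japanese_powr_primitive(2)[OF d(1)] by simp
  have hpos: "h v \<ge> 0" for v
    using order_trans[OF less_imp_le[OF japanese_powr_pos] jh[of v]] C by (simp add: zero_le_mult_iff)
  have Hb: "\<bar>H v\<bar> \<le> 1" for v
    unfolding H_def using tanh_real_lt_1[of "d * arsinh v"] tanh_real_gt_neg1[of "d * arsinh v"] by linarith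
  have key: "(\<integral>\<^sup>+x. ennreal (japanese (q x) powr - p * \<bar>q' x\<bar>) * indicator {a..b} x \<partial>lborel) \<le> ennreal (2 * C)"
    if ab: "a \<le> b" and q: "\<And>x. (q has_real_derivative q' x) (at x)" and
       q': "continuous_on UNIV q'" and s: "\<forall>x\<in>{a..b}. 0 \<le> q' x" for q q' and a b :: real
  proof -
    have cq: "continuous_on UNIV q"
      using q by (meson DERIV_continuous_on has_field_derivative_at_within)
    have chq: "(\<lambda>x. h (q x)) \<in> borel_measurable borel" unfolding h_def
      by (intro borel_measurable_continuous_onI continuous_intros cq) (auto simp: add_nonneg_eq_0_iff)
    have m[measurable]: "q' \<in> borel_measurable borel"
      using q' by (rule borel_measurable_continuous_onI)
    have "(\<integral>\<^sup>+x. ennreal (japanese (q x) powr - p * \<bar>q' x\<bar>) * indicator {a..b} x \<partial>lborel)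
      \<le> (\<integral>\<^sup>+x. ennreal (C * (h (q x) * q' x)) * indicator {a..b} x \<partial>lborel)"
    proof (intro nn_integral_mono)
      fix x
      show "ennreal (japanese (q x) powr - p * \<bar>q' x\<bar>) * indicator {a..b} x
        \<le> ennreal (C * (h (q x) * q' x)) * indicator {a..b} x"
        using s jh[of "q x"] mult_right_mono[OF jh[of "q x"], of "q' x"]
        by (auto simp: indicator_def mult.assoc intro!: ennreal_leI)
    qed
    also have "\<dots> = C * H (q b) - C * H (q a)"
    proof (rule nn_integral_FTC_Icc)
      show "(\<lambda>x. C * (h (q x) * q' x)) \<in> borel_measurable borel" using chq by measurable
      show "((\<lambda>x. C * H (q x)) has_real_derivative C * (h (q x) * q' x)) (at x)" for x
        by (intro DERIV_cmult DERIV_chain2[OF H q])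
      show "0 \<le> C * (h (q x) * q' x)" if "x \<in> {a..b}" for x
        using that s hpos[of "q x"] C by auto
    qed fact
    also have "\<dots> \<le> ennreal (2 * C)"
    proof (rule ennreal_leI)
      have "C * (H (q b) - H (q a)) \<le> C * 2"
        using Hb[of "q b"] Hb[of "q a"] C by (intro mult_left_mono) auto
      then show "C * H (q b) - C * H (q a) \<le> 2 * C" by (simp add: algebra_simps)
    qed
    finally show ?thesis .
  qed
  show ?thesis
  proof (rule that[of "2 * C"])
    fix q q' and a b :: real
    assume ab: "a \<le> b" and q: "\<And>x. (q has_real_derivative q' x) (at x)" and
       q': "continuous_on UNIV q'" and s: "(\<forall>x\<in>{a..b}. 0 \<le> q' x) \<or> (\<forall>x\<in>{a..b}. q' x \<le> 0)"
    show "(\<integral>\<^sup>+x. ennreal (japanese (q x) powr - p * \<bar>q' x\<bar>) * indicator {a..b} x \<partial>lborel) \<le> ennreal (2 * C)"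
      using s
    proof
      assume "\<forall>x\<in>{a..b}. 0 \<le> q' x"
      then show ?thesis using key[OF ab q q'] by auto
    next
      \<comment> \<open>The bracket is even, so negating the phase reduces this case to the
        increasing one.\<close>
      assume "\<forall>x\<in>{a..b}. q' x \<le> 0"
      then show ?thesis
        using key[OF ab, of "\<lambda>x. - q x" "\<lambda>x. - q' x"] q q'
        by (auto simp: continuous_on_minus DERIV_minus)
    qed
  qed (use C in auto)
qed

text \<open>Monotone convergence along intervals with a free centre \<open>e\<close>: placing it at
  the critical point of a phase cuts every interval into two monotone halves.\<close>

lemma nn_integral_le_exhaust:
  fixes e :: real and f :: "real \<Rightarrow> ennreal"
  assumes [measurable]: "f \<in> borel_measurable borel"
    and K: "\<And>n::nat. (\<integral>\<^sup>+x. f x * indicator {e - n..e + n} x \<partial>lborel) \<le> K"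
  shows "(\<integral>\<^sup>+x. f x \<partial>lborel) \<le> K"
proof -
  have "(\<integral>\<^sup>+x. f x \<partial>lborel) = (\<integral>\<^sup>+x. (SUP n::nat. f x * indicator {e - n..e + n} x) \<partial>lborel)"
  proof (intro nn_integral_cong)
    fix x
    obtain n :: nat where "\<bar>x - e\<bar> \<le> n" using real_arch_simple by blast
    then have n: "x \<in> {e - n..e + n}" by (auto simp: abs_le_iff)
    show "f x = (SUP n::nat. f x * indicator {e - n..e + n} x)"
      by (intro antisym SUP_upper2[of n] SUP_least) (use n in \<open>auto simp: indicator_def\<close>)
  qed
  also have "\<dots> = (SUP n::nat. \<integral>\<^sup>+x. f x * indicator {e - n..e + n} x \<partial>lborel)"
    by (intro nn_integral_monotone_convergence_SUP)
      (auto simp: incseq_def le_fun_def indicator_def split: if_splits intro!: mult_left_mono)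
  also have "\<dots> \<le> K" using K by (intro SUP_least)
  finally show ?thesis .
qed

text \<open>The phase changes its monotonicity only at the vertex \<open>e\<close>, so the uniform
  monotone bound is paid twice.\<close>

lemma nn_integral_quadratic_phase:
  fixes p :: real
  assumes "p > 1"
  obtains K where "K > 0"
    "\<And>A C e. (\<integral>\<^sup>+x. ennreal (japanese (A + C * (x - e)\<^sup>2) powr - p * \<bar>2 * C * (x - e)\<bar>) \<partial>lborel) \<le> ennreal K"
proof -
  obtain K where K: "K > 0" and
    *: "\<And>q q' a b. a \<le> b \<Longrightarrow> (\<And>x. (q has_real_derivative q' x) (at x)) \<Longrightarrow>
       continuous_on UNIV q' \<Longrightarrow> (\<forall>x\<in>{a..b}. 0 \<le> q' x) \<or> (\<forall>x\<in>{a..b}. q' x \<le> 0) \<Longrightarrow>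
       (\<integral>\<^sup>+x. ennreal (japanese (q x) powr - p * \<bar>q' x\<bar>) * indicator {a..b} x \<partial>lborel) \<le> ennreal K"
    using nn_integral_monotone_phase[OF assms] by blast
  show ?thesis
  proof (rule that[of "K + K"])
    fix A C e :: real
    let ?f = "\<lambda>x. ennreal (japanese (A + C * (x - e)\<^sup>2) powr - p * \<bar>2 * C * (x - e)\<bar>)"
    have KK: "ennreal (K + K) = ennreal K + ennreal K" using K by (simp add: ennreal_plus[symmetric] del: ennreal_plus)
    have d: "((\<lambda>x. A + C * (x - e)\<^sup>2) has_real_derivative 2 * C * (x - e)) (at x)" for x
      by (auto intro!: derivative_eq_intros)
    have c: "continuous_on UNIV (\<lambda>x. 2 * C * (x - e))" by (intro continuous_intros)
    show "(\<integral>\<^sup>+x. ?f x \<partial>lborel) \<le> ennreal (K + K)"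
    proof (rule nn_integral_le_exhaust[where e = e])
      fix n :: nat
      have "(\<integral>\<^sup>+x. ?f x * indicator {e - n..e + n} x \<partial>lborel)
        \<le> (\<integral>\<^sup>+x. ?f x * indicator {e - n..e} x + ?f x * indicator {e..e + n} x \<partial>lborel)"
        by (intro nn_integral_mono) (auto simp: indicator_def)
      also have "\<dots> = (\<integral>\<^sup>+x. ?f x * indicator {e - n..e} x \<partial>lborel) + (\<integral>\<^sup>+x. ?f x * indicator {e..e + n} x \<partial>lborel)"
        by (intro nn_integral_add) measurable
      also have "\<dots> \<le> ennreal K + ennreal K"
      proof (intro add_mono)
        show "(\<integral>\<^sup>+x. ?f x * indicator {e - n..e} x \<partial>lborel) \<le> K"
          by (rule *[OF _ d c]) (cases "C \<ge> 0"; auto simp: mult_nonneg_nonpos mult_nonpos_nonpos mult_nonneg_nonneg)+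
        show "(\<integral>\<^sup>+x. ?f x * indicator {e..e + n} x \<partial>lborel) \<le> K"
          by (rule *[OF _ d c]) (cases "C \<ge> 0"; auto simp: mult_nonpos_nonneg mult_nonneg_nonneg)+
      qed
      finally show "(\<integral>\<^sup>+x. ?f x * indicator {e - n..e + n} x \<partial>lborel) \<le> ennreal (K + K)"
        unfolding KK .
    qed measurable
  qed (use K in simp)
qed

lemma nn_integral_japanese_powr:
  fixes p :: real
  assumes "p > 1"
  obtains K where "K > 0" "\<And>c. (\<integral>\<^sup>+x. ennreal (japanese (x - c) powr - p) \<partial>lborel) \<le> ennreal K"
proof -
  obtain K where K: "K > 0" and
    *: "\<And>q q' a b. a \<le> b \<Longrightarrow> (\<And>x. (q has_real_derivative q' x) (at x)) \<Longrightarrow>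
       continuous_on UNIV q' \<Longrightarrow> (\<forall>x\<in>{a..b}. 0 \<le> q' x) \<or> (\<forall>x\<in>{a..b}. q' x \<le> 0) \<Longrightarrow>
       (\<integral>\<^sup>+x. ennreal (japanese (q x) powr - p * \<bar>q' x\<bar>) * indicator {a..b} x \<partial>lborel) \<le> ennreal K"
    using nn_integral_monotone_phase[OF assms] by blast
  have "(\<integral>\<^sup>+x. ennreal (japanese (x - c) powr - p) \<partial>lborel) \<le> ennreal K" for c
  proof (rule nn_integral_le_exhaust[where e = 0])
    have d: "((\<lambda>x. x - c) has_real_derivative 1) (at x)" for x by (auto intro!: derivative_eq_intros)
    show "(\<integral>\<^sup>+x. ennreal (japanese (x - c) powr - p) * indicator {0 - real n..0 + real n} x \<partial>lborel) \<le> K" for n :: nat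
      using *[OF _ d, of "0 - real n" "0 + real n"] by simp
  qed measurable
  then show ?thesis using that K by blast
qed

text \<open>For a fixed sum \<open>z\<close> the cubes of \<open>x\<close> cancel and the phase is
  quadratic with vertex \<open>z / 2\<close>. Its derivative is -3 times
  \<open>x^2 - (z - x)^2\<close>, so the weight is the Jacobian of the phase up to the factor
  3.\<close>

lemma nn_integral_cubic_phase:
  fixes p :: real
  assumes "p > 1"
  obtains K where "K > 0"
    "\<And>A z. (\<integral>\<^sup>+x. ennreal (japanese (A - x ^ 3 - (z - x) ^ 3) powr - p * \<bar>x\<^sup>2 - (z - x)\<^sup>2\<bar>) \<partial>lborel) \<le> ennreal K"
proof -
  obtain K where K: "K > 0" and
    *: "\<And>A C e. (\<integral>\<^sup>+x. ennreal (japanese (A + C * (x - e)\<^sup>2) powr - p * \<bar>2 * C * (x - e)\<bar>) \<partial>lborel) \<le> ennreal K"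
    using nn_integral_quadratic_phase[OF assms] by blast
  have "(\<integral>\<^sup>+x. ennreal (japanese (A - x ^ 3 - (z - x) ^ 3) powr - p * \<bar>x\<^sup>2 - (z - x)\<^sup>2\<bar>) \<partial>lborel) \<le> ennreal K" for A z
  proof -
    have 1: "A - x ^ 3 - (z - x) ^ 3 = (A - z ^ 3 / 4) + (- 3 * z) * (x - z / 2)\<^sup>2" for x
      by (simp add: power2_eq_square power3_eq_cube field_simps)
    have 2: "\<bar>2 * (- 3 * z) * (x - z / 2)\<bar> = 3 * \<bar>x\<^sup>2 - (z - x)\<^sup>2\<bar>" for x
    proof -
      have "2 * (- 3 * z) * (x - z / 2) = - 3 * (x\<^sup>2 - (z - x)\<^sup>2)"
        by (simp add: power2_eq_square field_simps)
      then have "\<bar>2 * (- 3 * z) * (x - z / 2)\<bar> = \<bar>- 3 * (x\<^sup>2 - (z - x)\<^sup>2)\<bar>" by (rule arg_cong)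
      then show ?thesis by (simp only: abs_mult)
    qed
    have "(\<integral>\<^sup>+x. ennreal (japanese (A - x ^ 3 - (z - x) ^ 3) powr - p * \<bar>x\<^sup>2 - (z - x)\<^sup>2\<bar>) \<partial>lborel)
      \<le> (\<integral>\<^sup>+x. ennreal (japanese ((A - z ^ 3 / 4) + (- 3 * z) * (x - z / 2)\<^sup>2) powr - p * \<bar>2 * (- 3 * z) * (x - z / 2)\<bar>) \<partial>lborel)"
      unfolding 1 2 by (intro nn_integral_mono ennreal_leI mult_left_mono) auto
    also note *
    finally show ?thesis .
  qed
  then show ?thesis using that K by blast
qed

text \<open>One of \<open>u\<close>, \<open>v\<close> has at least half the modulus of
  \<open>u + v\<close>. Hence the smaller of the two factors already has the claimed size, and the
  other one is integrated away.\<close>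

lemma japanese_convolution:
  fixes p :: real
  assumes "p > 1"
  obtains K where "K > 0"
    "\<And>A B. (\<integral>\<^sup>+x. ennreal (japanese (x - A) powr - p * japanese (B - x) powr - p) \<partial>lborel)
        \<le> ennreal (K * japanese (B - A) powr - p)"
proof -
  obtain K where K: "K > 0" and *: "\<And>c. (\<integral>\<^sup>+x. ennreal (japanese (x - c) powr - p) \<partial>lborel) \<le> ennreal K"
    using nn_integral_japanese_powr[OF assms] by blast
  have m: "min (japanese u powr - p) (japanese v powr - p) \<le> 2 powr p * japanese (u + v) powr - p" for u v
  proof -
    have aux: "japanese u powr - p \<le> 2 powr p * japanese (u + v) powr - p" if "\<bar>v\<bar> \<le> \<bar>u\<bar>" for u v
    proof -
      have "japanese (u + v) \<le> 2 * japanese u"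
      proof -
        have "\<bar>u + v\<bar> \<le> 2 * \<bar>u\<bar>" using that by linarith
        then have "(u+v)\<^sup>2 \<le> (2 * u)\<^sup>2" by (metis abs_le_square_iff abs_mult abs_numeral)
        then have "1 + (u + v)\<^sup>2 \<le> 4 * (1 + u\<^sup>2)" by (simp add: power_mult_distrib)
        then have "sqrt (1 + (u + v)\<^sup>2) \<le> sqrt (4 * (1 + u\<^sup>2))" by (rule real_sqrt_le_mono)
        then show ?thesis by (simp only: japanese_def real_sqrt_mult power2_abs) simp
      qed
      then have "(2 * japanese u) powr - p \<le> japanese (u + v) powr - p"
        using assms by (intro powr_mono2') auto
      then show ?thesis by (simp add: powr_mult powr_minus field_simps)
    qed
    show ?thesis using aux[of v u] aux[of u v] by (cases "\<bar>v\<bar> \<le> \<bar>u\<bar>") (auto simp: add.commute min_le_iff_disj)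
  qed
  show ?thesis
  proof (rule that[of "2 powr p * (K + K)"])
    fix A B
    let ?c = "2 powr p * japanese (B - A) powr - p"
    have "(\<integral>\<^sup>+x. ennreal (japanese (x - A) powr - p * japanese (B - x) powr - p) \<partial>lborel)
       \<le> (\<integral>\<^sup>+x. ennreal ?c * (ennreal (japanese (x - A) powr - p) + ennreal (japanese (x - B) powr - p)) \<partial>lborel)"
    proof (intro nn_integral_mono)
      fix x
      have s: "japanese (x - B) = japanese (B - x)" using japanese_minus[of "B - x"] by simp
      have 1: "min (japanese (x - A) powr - p) (japanese (B - x) powr - p) \<le> ?c"
        using m[of "x - A" "B - x"] by (simp add: algebra_simps)
      \<comment> \<open>The smaller factor is at most \<open>c\<close> and the larger one at most
        the sum; this replaces a splitting of the domain of integration.\<close>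
      have "a * b \<le> c * (a + b)" if "min a b \<le> c" "0 \<le> a" "0 \<le> b" for a b c :: real
      proof (cases "a \<le> b")
        case True
        then have "a * b \<le> c * b" using that by (auto intro: mult_right_mono)
        also have "\<dots> \<le> c * (a + b)" using that True by (intro mult_left_mono) auto
        finally show ?thesis .
      next
        case False
        then have "a * b \<le> a * c" using that by (auto intro: mult_left_mono)
        also have "\<dots> \<le> (a + b) * c" using that False by (intro mult_right_mono) auto
        finally show ?thesis by (simp add: mult.commute)
      qed
      from this[OF 1] show "ennreal (japanese (x - A) powr - p * japanese (B - x) powr - p) \<le>
         ennreal ?c * (ennreal (japanese (x - A) powr - p) + ennreal (japanese (x - B) powr - p))"
        by (simp add: s ennreal_plus[symmetric] ennreal_mult'[symmetric] ennreal_leI del: ennreal_plus)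
    qed
    also have "\<dots> = ennreal ?c * ((\<integral>\<^sup>+x. ennreal (japanese (x - A) powr - p) \<partial>lborel) + (\<integral>\<^sup>+x. ennreal (japanese (x - B) powr - p) \<partial>lborel))"
      by (subst nn_integral_cmult) (auto simp: nn_integral_add)
    also have "\<dots> \<le> ennreal ?c * (ennreal K + ennreal K)"
      by (intro mult_left_mono add_mono *) auto
    also have "\<dots> = ennreal (2 powr p * (K + K) * japanese (B - A) powr - p)"
      using K by (simp add: ennreal_plus[symmetric] ennreal_mult'[symmetric] mult_ac del: ennreal_plus)
    finally show "(\<integral>\<^sup>+x. ennreal (japanese (x - A) powr - p * japanese (B - x) powr - p) \<partial>lborel)
        \<le> ennreal (2 powr p * (K + K) * japanese (B - A) powr - p)" .
  qed (use K in auto)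
qed

section \<open>Changes of variables for nonnegative integrals\<close>

lemma borel_measurable_fst_comp[measurable (raw)]:
  fixes f :: "'c \<Rightarrow> 'a::second_countable_topology \<times> 'b::second_countable_topology"
  shows "f \<in> borel_measurable M \<Longrightarrow> (\<lambda>x. fst (f x)) \<in> borel_measurable M"
  by (erule measurable_compose) (intro borel_measurable_continuous_onI continuous_intros)

lemma borel_measurable_snd_comp[measurable (raw)]:
  fixes f :: "'c \<Rightarrow> 'a::second_countable_topology \<times> 'b::second_countable_topology"
  shows "f \<in> borel_measurable M \<Longrightarrow> (\<lambda>x. snd (f x)) \<in> borel_measurable M"
  by (erule measurable_compose) (intro borel_measurable_continuous_onI continuous_intros)

lemma nn_integral_plane:
  fixes f :: "'a::euclidean_space \<times> 'b::euclidean_space \<Rightarrow> ennreal"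
  assumes [measurable]: "f \<in> borel_measurable borel"
  shows "(\<integral>\<^sup>+z. f z \<partial>lborel) = (\<integral>\<^sup>+x. \<integral>\<^sup>+t. f (x, t) \<partial>lborel \<partial>lborel)"
  by (subst lborel_prod[symmetric], subst lborel.nn_integral_fst[symmetric])
     (simp_all add: lborel_prod)

lemma nn_integral_swap:
  fixes f :: "'a::euclidean_space \<Rightarrow> 'b::euclidean_space \<Rightarrow> ennreal"
  assumes "(\<lambda>z. f (fst z) (snd z)) \<in> borel_measurable borel"
  shows "(\<integral>\<^sup>+x. \<integral>\<^sup>+y. f x y \<partial>lborel \<partial>lborel) = (\<integral>\<^sup>+y. \<integral>\<^sup>+x. f x y \<partial>lborel \<partial>lborel)"
  by (rule lborel_pair.Fubini'[symmetric]) (use assms in \<open>simp add: lborel_prod case_prod_beta'\<close>)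

lemma nn_integral_translate:
  fixes f :: "'a::euclidean_space \<Rightarrow> ennreal"
  assumes [measurable]: "f \<in> borel_measurable borel"
  shows "(\<integral>\<^sup>+x. f (c + x) \<partial>lborel) = (\<integral>\<^sup>+x. f x \<partial>lborel)"
  by (subst (2) lborel_distr_plus[of c, symmetric]) (simp add: nn_integral_distr)

lemma lborel_distr_uminus_euclidean:
  "distr lborel borel uminus = (lborel :: 'a::euclidean_space measure)"
  by (subst lborel_affine[of "-1" 0]) (auto simp: density_1 one_ennreal_def[symmetric])

lemma nn_integral_reflect:
  fixes f :: "'a::euclidean_space \<Rightarrow> ennreal"
  assumes [measurable]: "f \<in> borel_measurable borel"
  shows "(\<integral>\<^sup>+x. f (c - x) \<partial>lborel) = (\<integral>\<^sup>+x. f x \<partial>lborel)"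
proof -
  have "(\<integral>\<^sup>+x. f x \<partial>lborel) = (\<integral>\<^sup>+x. f (c + x) \<partial>lborel)"
    by (rule nn_integral_translate[symmetric]) fact
  also have "\<dots> = (\<integral>\<^sup>+x. f (c + - x) \<partial>lborel)"
    by (subst lborel_distr_uminus_euclidean[symmetric]) (simp add: nn_integral_distr)
  finally show ?thesis by simp
qed

section \<open>Three waves of fixed total frequency\<close>

text \<open>On the set of resonant frequencies with \<open>\<bar>a\<bar> \<ge> \<bar>b\<bar> \<ge> \<bar>c\<bar>\<close> the phase \<open>a\<^sup>3 + b\<^sup>3 + c\<^sup>3\<close>
  has, for fixed sum, the critical points \<open>(x, x, x) / 3\<close> and the permutations of \<open>(x, x, -x)\<close>.
  The gradient controls the distance of the median to the corresponding coordinate.\<close>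

lemma median_distance_sorted:
  fixes a b c :: real
  assumes "\<bar>b\<bar> \<le> \<bar>a\<bar>" "\<bar>c\<bar> \<le> \<bar>b\<bar>"
  shows "\<exists>v\<in>{(a + b + c) / 3, a + b + c, - (a + b + c)}. \<bar>a\<bar> * \<bar>b - v\<bar> \<le> \<bar>a\<^sup>2 - c\<^sup>2\<bar>"
proof -
  \<comment> \<open>Factoring the difference of squares reduces the claim to a distance bound by
    \<open>|a| - |c|\<close>, which is linear once the signs are fixed.\<close>
  have D: "\<bar>a\<bar> * (\<bar>a\<bar> - \<bar>c\<bar>) \<le> \<bar>a\<^sup>2 - c\<^sup>2\<bar>"
  proof -
    have "\<bar>a\<bar> * (\<bar>a\<bar> - \<bar>c\<bar>) \<le> (\<bar>a\<bar> + \<bar>c\<bar>) * (\<bar>a\<bar> - \<bar>c\<bar>)" using assms by (intro mult_right_mono) auto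
    also have "\<dots> = \<bar>a\<bar>\<^sup>2 - \<bar>c\<bar>\<^sup>2" by (simp add: power2_eq_square algebra_simps)
    finally show ?thesis by simp
  qed
  have "\<exists>v\<in>{(a + b + c) / 3, a + b + c, - (a + b + c)}. \<bar>b - v\<bar> \<le> \<bar>a\<bar> - \<bar>c\<bar>"
  proof -
    have nonneg: "\<exists>v\<in>{(a + b + c) / 3, a + b + c, - (a + b + c)}. \<bar>b - v\<bar> \<le> \<bar>a\<bar> - \<bar>c\<bar>"
      if "\<bar>b\<bar> \<le> \<bar>a\<bar>" "\<bar>c\<bar> \<le> \<bar>b\<bar>" "0 \<le> a" for a b c :: real
    proof -
      \<comment> \<open>The signs decide which critical point is close. If all agree it is the
        symmetric one; otherwise the coordinate of odd sign corresponds to the entry equal to minus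
        the sum, and \<open>v\<close> is the entry at the position of the median.\<close>
      consider "0 \<le> b" "0 \<le> c" | "0 \<le> b" "c \<le> 0" | "b \<le> 0" "0 \<le> c" | "b \<le> 0" "c \<le> 0" by linarith
      then show ?thesis
      proof cases
        case 1
        then have "\<bar>b - (a + b + c) / 3\<bar> \<le> \<bar>a\<bar> - \<bar>c\<bar>" using that by (simp add: abs_le_iff field_simps)
        then show ?thesis by blast
      next
        case 2
        then have "\<bar>b - (a + b + c)\<bar> \<le> \<bar>a\<bar> - \<bar>c\<bar>" using that by (simp add: abs_le_iff)
        then show ?thesis by blast
      next
        case 3
        then have "\<bar>b - - (a + b + c)\<bar> \<le> \<bar>a\<bar> - \<bar>c\<bar>" using that by (simp add: abs_le_iff)
        then show ?thesis by blast
      next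
        case 4
        then have "\<bar>b - (a + b + c)\<bar> \<le> \<bar>a\<bar> - \<bar>c\<bar>" using that by (simp add: abs_le_iff)
        then show ?thesis by blast
      qed
    qed
    show ?thesis
    proof (cases "0 \<le> a")
      case True
      then show ?thesis using nonneg assms by blast
    next
      case False
      have "\<exists>v\<in>{(- a + - b + - c) / 3, - a + - b + - c, - (- a + - b + - c)}. \<bar>- b - v\<bar> \<le> \<bar>- a\<bar> - \<bar>- c\<bar>"
        by (rule nonneg) (use assms False in auto)
      then obtain v where "v \<in> {(- a + - b + - c) / 3, - a + - b + - c, - (- a + - b + - c)}" "\<bar>- b - v\<bar> \<le> \<bar>- a\<bar> - \<bar>- c\<bar>"
        by blast
      then have "- v \<in> {(a + b + c) / 3, a + b + c, - (a + b + c)}" "\<bar>b - - v\<bar> \<le> \<bar>a\<bar> - \<bar>c\<bar>"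
        by (auto simp: field_simps)
      then show ?thesis by blast
    qed
  qed
  then obtain v where v: "v\<in>{(a + b + c) / 3, a + b + c, - (a + b + c)}" "\<bar>b - v\<bar> \<le> \<bar>a\<bar> - \<bar>c\<bar>" by blast
  have "\<bar>a\<bar> * \<bar>b - v\<bar> \<le> \<bar>a\<bar> * (\<bar>a\<bar> - \<bar>c\<bar>)" using v by (intro mult_left_mono) auto
  also note D
  finally show ?thesis using v(1) by blast
qed

definition max3 :: "real \<Rightarrow> real \<Rightarrow> real \<Rightarrow> real" where
  "max3 x y z = max \<bar>x\<bar> (max \<bar>y\<bar> \<bar>z\<bar>)"

text \<open>Only the position of the median matters, because \<open>|a^2 - c^2|\<close> is symmetric
  in the outer two frequencies; hence three arrangements instead of six. The bounds by
  \<open>max3\<close> provide the size information for the later case analysis.\<close>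

lemma median_distance:
  fixes x y w :: real
  obtains b a c v where "(b, a, c) \<in> {(x, y, w), (y, x, w), (w, x, y)}"
    "v \<in> {(x + y + w) / 3, x + y + w, - (x + y + w)}" "max3 x y w * \<bar>b - v\<bar> \<le> \<bar>a\<^sup>2 - c\<^sup>2\<bar>"
    "\<bar>a\<bar> \<le> max3 x y w" "\<bar>b\<bar> \<le> max3 x y w" "\<bar>b - v\<bar> \<le> 4 * max3 x y w"
proof -
  note main = that
  have P: thesis if h: "\<bar>b\<bar> \<le> \<bar>a\<bar>" "\<bar>c\<bar> \<le> \<bar>b\<bar>" "max3 x y w = \<bar>a\<bar>" "a + b + c = x + y + w" 
    "(b, a, c) \<in> {(x, y, w), (y, x, w), (w, x, y)} \<or> (b, c, a) \<in> {(x, y, w), (y, x, w), (w, x, y)}" for a b c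
  proof -
    obtain v where v: "v \<in> {(x + y + w) / 3, x + y + w, - (x + y + w)}" "\<bar>a\<bar> * \<bar>b - v\<bar> \<le> \<bar>a\<^sup>2 - c\<^sup>2\<bar>"
      using median_distance_sorted[OF h(1,2), unfolded h(4)] by blast
    \<comment> \<open>Every candidate \<open>v\<close> is therefore at most \<open>3 * max3\<close>
      in modulus, and the median adds one more \<open>max3\<close>.\<close>
    have "\<bar>x + y + w\<bar> \<le> 3 * max3 x y w" by (auto simp: max3_def)
    then have v4: "\<bar>b - v\<bar> \<le> 4 * max3 x y w" using v(1) h by auto
    have m: "\<bar>a\<bar> \<le> max3 x y w" "\<bar>b\<bar> \<le> max3 x y w" "\<bar>c\<bar> \<le> max3 x y w"
      using h by auto
    from h(5) show thesis
    proof
      assume "(b, a, c) \<in> {(x, y, w), (y, x, w), (w, x, y)}"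
      then show thesis using main[of b a c v] v v4 m h(3) by simp
    next
      assume "(b, c, a) \<in> {(x, y, w), (y, x, w), (w, x, y)}"
      then show thesis using main[of b c a v] v v4 m h(3) by (simp add: abs_minus_commute)
    qed
  qed
  consider "\<bar>w\<bar> \<le> \<bar>y\<bar>" "\<bar>y\<bar> \<le> \<bar>x\<bar>" | "\<bar>w\<bar> \<le> \<bar>x\<bar>" "\<bar>x\<bar> \<le> \<bar>y\<bar>" | "\<bar>x\<bar> \<le> \<bar>w\<bar>" "\<bar>w\<bar> \<le> \<bar>y\<bar>"
    | "\<bar>y\<bar> \<le> \<bar>w\<bar>" "\<bar>w\<bar> \<le> \<bar>x\<bar>" | "\<bar>x\<bar> \<le> \<bar>y\<bar>" "\<bar>y\<bar> \<le> \<bar>w\<bar>" | "\<bar>y\<bar> \<le> \<bar>x\<bar>" "\<bar>x\<bar> \<le> \<bar>w\<bar>"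
    by linarith
  then show thesis
  proof cases
    case 1 then show thesis by (intro P[of y x w]) (auto simp: max3_def)
  next
    case 2 then show thesis by (intro P[of x y w]) (auto simp: max3_def)
  next
    case 3 then show thesis by (intro P[of w y x]) (auto simp: max3_def)
  next
    case 4 then show thesis by (intro P[of w x y]) (auto simp: max3_def)
  next
    case 5 then show thesis by (intro P[of y w x]) (auto simp: max3_def)
  next
    case 6 then show thesis by (intro P[of x w y]) (auto simp: max3_def)
  qed
qed

section \<open>An integrable majorant for the three-wave kernel\<close>

lemma nn_integral_abs_powr_near_0:
  fixes a :: real
  assumes "a > - 1"
  shows "(\<integral>\<^sup>+x. ennreal (\<bar>x\<bar> powr a) * indicator {-1..1} x \<partial>lborel) < \<infinity>"
proof -
  have 1: "(\<integral>\<^sup>+x. ennreal (\<bar>x\<bar> powr a) * indicator {0..1} x \<partial>lborel) < \<infinity>" (is "?I < _")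
  proof -
    have "?I = ennreal (1 powr (a + 1) / (a + 1))"
    proof (rule nn_integral_has_integral_lebesgue')
      show "((\<lambda>x. \<bar>x\<bar> powr a) has_integral 1 powr (a + 1) / (a + 1)) {0..1}"
        using has_integral_powr_from_0[OF assms, of 1] by (rule has_integral_eq[rotated]) auto
    qed auto
    then show ?thesis by simp
  qed
  have "(\<integral>\<^sup>+x. ennreal (\<bar>x\<bar> powr a) * indicator {-1..1} x \<partial>lborel)
     \<le> (\<integral>\<^sup>+x. ennreal (\<bar>x\<bar> powr a) * indicator {0..1} x + ennreal (\<bar>0 - x\<bar> powr a) * indicator {0..1} (0 - x) \<partial>lborel)"
    by (intro nn_integral_mono) (auto simp: indicator_def)
  also have "\<dots> = ?I + (\<integral>\<^sup>+x. ennreal (\<bar>0 - x\<bar> powr a) * indicator {0..1} (0 - x) \<partial>lborel)"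
    by (intro nn_integral_add) auto
  also have "(\<integral>\<^sup>+x. ennreal (\<bar>0 - x\<bar> powr a) * indicator {0..1} (0 - x) \<partial>lborel) = ?I"
    by (rule nn_integral_reflect) auto
  finally show ?thesis using 1 by (auto simp: le_less_trans ennreal_add_less_top)
qed

text \<open>For fixed sum \<open>x\<close> of the three frequencies, \<open>b\<close> is the median, \<open>a\<close> and
  \<open>x - b - a\<close> are the other two, and \<open>w\<close> is the distance of \<open>b\<close> to a critical value.
  The infinite value at \<open>w = 0\<close> is harmless, as this is a null set.\<close>

definition median_weight :: "real \<Rightarrow> real \<Rightarrow> ennreal" where
  "median_weight e w = ennreal (32 * japanese w powr - (1 + e)) +
     2 * (ennreal (\<bar>w\<bar> powr (e / 4 - 1)) * indicator {-1..1} w)"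

text \<open>Near a critical value, with all frequencies at most \<open>|w| powr (- 1 / 4)\<close>,
  no gain is taken from the gradient. The kernel is at most \<open>2 * |w| powr (- 1 / 4)\<close>
  and \<open>a\<close> lies in an interval of length \<open>2 * |w| powr (- 1 / 4)\<close>, so the
  integral in \<open>a\<close> is \<open>4 * |w| powr (- 1 / 2)\<close>, which is integrable at
  0.\<close>

definition median_small :: "real \<Rightarrow> real \<Rightarrow> ennreal" where
  "median_small w a = 2 * ennreal (\<bar>w\<bar> powr (- 1 / 4)) * indicator {-1..1} w *
      indicator {-(\<bar>w\<bar> powr (- 1 / 4))..\<bar>w\<bar> powr (- 1 / 4)} a + \<infinity> * indicator {0} w"

text \<open>The sum runs over a set, so critical values that coincide for \<open>x = 0\<close> are
  counted once. The last summand covers triples with all frequencies below 1, where transversality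
  gives nothing.\<close>

definition median_majorant :: "real \<Rightarrow> real \<Rightarrow> real \<Rightarrow> real \<Rightarrow> real \<Rightarrow> real \<Rightarrow> ennreal" where
  "median_majorant p e A x b a =
     (\<Sum>v\<in>{x / 3, x, - x}. median_weight e (b - v) *
        ennreal (japanese (A - b ^ 3 - a ^ 3 - (x - b - a) ^ 3) powr - p * \<bar>a\<^sup>2 - (x - b - a)\<^sup>2\<bar>)
      + median_small (b - v) a)
     + 2 * indicator {-1..1} b * indicator {-1..1} a"

lemma measurable_median_majorant[measurable]:
  assumes [measurable]: "f \<in> borel_measurable M" "g \<in> borel_measurable M"
  shows "(\<lambda>z. median_majorant p e A x (f z) (g z)) \<in> borel_measurable M"
  unfolding median_majorant_def median_weight_def median_small_def indicator_def atLeastAtMost_iff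
  by measurable

text \<open>Here \<open>m\<close> is the largest frequency, \<open>w\<close> the displacement of the
  median from a critical value and \<open>D\<close> the gradient. From
  \<open>m * |w| \<le> D\<close> the power \<open>m powr (1 - e)\<close> is at most
  \<open>D / |w| * m powr (- e)\<close>. The spare factor makes \<open>1 / |w|\<close> integrable at
  both ends: at infinity through \<open>|w| \<le> 4 * m\<close>, at 0 through
  \<open>m \<ge> |w| powr (- 1 / 4)\<close>.\<close>

lemma median_weight_bound:
  fixes m w D F e p :: real
  assumes "0 < e" "e < 1" "m * \<bar>w\<bar> \<le> D" "\<bar>a\<bar> \<le> m" "\<bar>b\<bar> \<le> m" "\<bar>w\<bar> \<le> 4 * m" "0 \<le> F" "F \<le> 1"
  shows "ennreal (japanese m powr (1 - e) * F) \<le> median_weight e w * ennreal (F * D) + median_small w a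
    + 2 * indicator {-1..1} b * indicator {-1..1} a"
proof (cases "m < 1")
  case True
  have "japanese m powr (1 - e) \<le> 2 powr (1 - e)"
    using assms True japanese_le[of m] by (intro powr_mono2) auto
  also have "\<dots> \<le> 2 powr 1" using assms by (intro powr_mono) auto
  finally have "japanese m powr (1 - e) * F \<le> 2 * 1" using assms by (intro mult_mono) auto
  then have "ennreal (japanese m powr (1 - e) * F) \<le> ennreal 2" by (intro ennreal_leI) simp
  also have "\<dots> = 2 * indicator {-1..1} b * indicator {-1..1} a" using assms True by (auto simp: indicator_def)
  also have "\<dots> \<le> median_weight e w * ennreal (F * D) + median_small w a
    + 2 * indicator {-1..1} b * indicator {-1..1} a" by simp
  finally show ?thesis .
next
  case False
  then have m: "1 \<le> m" by simp
  have "japanese m powr (1 - e) \<le> (2 * m) powr (1 - e)"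
    using assms m japanese_le[of m] by (intro powr_mono2) auto
  also have "\<dots> = 2 powr (1 - e) * m powr (1 - e)" using m by (simp add: powr_mult)
  also have "\<dots> \<le> 2 powr 1 * m powr (1 - e)" using assms by (intro mult_right_mono powr_mono) auto
  finally have jm: "japanese m powr (1 - e) \<le> 2 * m powr (1 - e)" by simp
  have mm: "m powr (1 - e) = m * m powr (- e)" using m by (simp add: powr_diff powr_minus divide_inverse)
  consider "w = 0" | "1 \<le> \<bar>w\<bar>" | "w \<noteq> 0" "\<bar>w\<bar> < 1" "m \<le> \<bar>w\<bar> powr (- 1 / 4)" | "w \<noteq> 0" "\<bar>w\<bar> < 1" "\<bar>w\<bar> powr (- 1 / 4) \<le> m"
    by linarith
  then show ?thesis
  proof cases
    case 1
    then show ?thesis by (simp add: median_small_def)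
  next
    case 2
    have "m powr (- e) \<le> (\<bar>w\<bar> / 4) powr (- e)" using assms 2 by (intro powr_mono2') auto
    also have "\<dots> = 4 powr e * \<bar>w\<bar> powr (- e)" by (simp add: powr_divide powr_minus field_simps)
    also have "\<dots> \<le> 4 powr 1 * \<bar>w\<bar> powr (- e)" using assms by (intro mult_right_mono powr_mono) auto
    finally have a1: "m powr (- e) \<le> 4 * \<bar>w\<bar> powr (- e)" by simp
    have a2: "m \<le> D / \<bar>w\<bar>" using assms 2 by (simp add: field_simps)
    have D0: "0 \<le> D" using assms m by (meson abs_ge_zero mult_nonneg_nonneg order_trans zero_le_one)
    have "\<bar>w\<bar> powr (- (1 + e)) \<le> (japanese w / 2) powr (- (1 + e))"
      using assms 2 japanese_le[of w] by (intro powr_mono2') auto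
    also have "\<dots> = 2 powr (1 + e) * japanese w powr (- (1 + e))"
      by (simp add: powr_divide powr_minus[of _ "1 + e"] field_simps del: minus_add_distrib)
    also have "\<dots> \<le> 2 powr 2 * japanese w powr (- (1 + e))" using assms by (intro mult_right_mono powr_mono) auto
    finally have a3: "\<bar>w\<bar> powr (- (1 + e)) \<le> 4 * japanese w powr (- (1 + e))" by simp
    have "japanese m powr (1 - e) \<le> 2 * (m * m powr (- e))" using jm mm by simp
    also have "\<dots> \<le> 2 * ((D / \<bar>w\<bar>) * (4 * \<bar>w\<bar> powr (- e)))"
      using a1 a2 m D0 by (intro mult_left_mono mult_mono) auto
    also have "\<dots> = 8 * D * \<bar>w\<bar> powr (- (1 + e))"
      using 2 by (simp add: powr_diff powr_minus divide_inverse powr_add)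
    also have "\<dots> \<le> 8 * D * (4 * japanese w powr (- (1 + e)))"
      using a3 D0 by (intro mult_left_mono) auto
    finally have "japanese m powr (1 - e) * F \<le> (8 * D * (4 * japanese w powr (- (1 + e)))) * F"
      using assms by (intro mult_right_mono) auto
    then have "ennreal (japanese m powr (1 - e) * F) \<le> ennreal (32 * japanese w powr (- (1 + e)) * (F * D))"
      by (intro ennreal_leI) (simp add: mult_ac)
    also have "\<dots> = ennreal (32 * japanese w powr (- (1 + e))) * ennreal (F * D)"
      by (rule ennreal_mult') (use D0 assms in auto)
    also have "\<dots> \<le> median_weight e w * ennreal (F * D)"
      unfolding median_weight_def by (intro mult_right_mono) auto
    also have "\<dots> \<le> median_weight e w * ennreal (F * D) + median_small w a + 2 * indicator {-1..1} b * indicator {-1..1} a"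
      by (simp add: add.assoc)
    finally show ?thesis .
  next
    case 3
    have "m powr (1 - e) \<le> m powr 1" using m assms by (intro powr_mono) auto
    then have "japanese m powr (1 - e) * F \<le> (2 * \<bar>w\<bar> powr (- 1 / 4)) * 1"
      using assms m jm 3 by (intro mult_mono) auto
    then have "ennreal (japanese m powr (1 - e) * F) \<le> ennreal (2 * \<bar>w\<bar> powr (- 1 / 4))"
      by (intro ennreal_leI) simp
    also have "\<dots> = 2 * ennreal (\<bar>w\<bar> powr (- 1 / 4))" by (simp add: ennreal_mult')
    also have "\<dots> \<le> median_small w a" using 3 assms by (auto simp: median_small_def indicator_def)
    also have "\<dots> \<le> median_weight e w * ennreal (F * D) + median_small w a + 2 * indicator {-1..1} b * indicator {-1..1} a"
      by (rule add_increasing2[OF _ add_increasing]) auto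
    finally show ?thesis .
  next
    case 4
    have "m powr (- e) \<le> (\<bar>w\<bar> powr (- 1 / 4)) powr (- e)" using assms 4 by (intro powr_mono2') auto
    then have a1: "m powr (- e) \<le> \<bar>w\<bar> powr (e / 4)" by (simp add: powr_powr)
    have a2: "m \<le> D / \<bar>w\<bar>" using assms 4 by (simp add: field_simps)
    have D0: "0 \<le> D" using assms m by (meson abs_ge_zero mult_nonneg_nonneg order_trans zero_le_one)
    have "japanese m powr (1 - e) \<le> 2 * (m * m powr (- e))" using jm mm by simp
    also have "\<dots> \<le> 2 * ((D / \<bar>w\<bar>) * \<bar>w\<bar> powr (e / 4))"
      using a1 a2 m D0 by (intro mult_left_mono mult_mono) auto
    also have "\<dots> = 2 * \<bar>w\<bar> powr (e / 4 - 1) * D"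
      using 4 by (simp add: powr_diff)
    finally have "japanese m powr (1 - e) * F \<le> (2 * \<bar>w\<bar> powr (e / 4 - 1) * D) * F"
      using assms by (intro mult_right_mono) auto
    then have "ennreal (japanese m powr (1 - e) * F) \<le> ennreal (2 * \<bar>w\<bar> powr (e / 4 - 1) * (F * D))"
      by (intro ennreal_leI) (simp add: mult_ac)
    also have "\<dots> = 2 * (ennreal (\<bar>w\<bar> powr (e / 4 - 1)) * indicator {-1..1} w) * ennreal (F * D)"
      using 4(1,2) D0 assms(7) by (auto simp: ennreal_mult' ennreal_mult'' indicator_def abs_le_iff abs_less_iff)
    also have "\<dots> \<le> median_weight e w * ennreal (F * D)"
      unfolding median_weight_def by (intro mult_right_mono) auto
    also have "\<dots> \<le> median_weight e w * ennreal (F * D) + median_small w a + 2 * indicator {-1..1} b * indicator {-1..1} a"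
      by (simp add: add.assoc)
    finally show ?thesis .
  qed
qed

text \<open>The three summands are the three possible positions of the median.
  \<open>median_majorant\<close> takes the median first, then one of the outer frequencies, and
  recovers the third from the sum.\<close>

lemma median_majorant_bound:
  fixes p e A x b a :: real
  assumes "0 < e" "e < 1" "0 \<le> p"
  shows "ennreal (japanese (max3 b a (x - b - a)) powr (1 - e) * japanese (A - b ^ 3 - a ^ 3 - (x - b - a) ^ 3) powr - p)
    \<le> median_majorant p e A x b a + median_majorant p e A x a b + median_majorant p e A x (x - b - a) b"
proof -
  let ?w = "x - b - a" and ?M = "median_majorant p e A x"
  define F where "F = japanese (A - b ^ 3 - a ^ 3 - ?w ^ 3) powr - p"
  have F: "0 \<le> F" "F \<le> 1" unfolding F_def using assms japanese_ge1
    by (auto intro: ge_one_powr_ge_zero simp: powr_minus inverse_le_1_iff)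
  obtain b' a' c' v where *: "(b', a', c') \<in> {(b, a, ?w), (a, b, ?w), (?w, b, a)}"
    "v \<in> {(b + a + ?w) / 3, b + a + ?w, - (b + a + ?w)}" "max3 b a ?w * \<bar>b' - v\<bar> \<le> \<bar>a'\<^sup>2 - c'\<^sup>2\<bar>"
    "\<bar>a'\<bar> \<le> max3 b a ?w" "\<bar>b'\<bar> \<le> max3 b a ?w" "\<bar>b' - v\<bar> \<le> 4 * max3 b a ?w"
    by (rule median_distance[of b a ?w]) blast
  have s: "b + a + ?w = x" by simp
  have c': "c' = x - b' - a'" using *(1) by auto
  have F': "F = japanese (A - b' ^ 3 - a' ^ 3 - (x - b' - a') ^ 3) powr - p"
    using *(1) by (auto simp: F_def algebra_simps)
  let ?t = "\<lambda>v. median_weight e (b' - v) * ennreal (F * \<bar>a'\<^sup>2 - (x - b' - a')\<^sup>2\<bar>) + median_small (b' - v) a'"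
  have "ennreal (japanese (max3 b a ?w) powr (1 - e) * F) \<le> ?t v + 2 * indicator {-1..1} b' * indicator {-1..1} a'"
    using median_weight_bound[OF assms(1,2) *(3-6) F] c' by simp
  also have "\<dots> \<le> ?M b' a'"
    unfolding median_majorant_def F'[symmetric]
    by (intro add_right_mono member_le_sum) (use *(2) s in auto)
  also have "\<dots> \<le> ?M b a + ?M a b + ?M ?w b"
    using *(1) by (auto simp: add_increasing add_increasing2)
  finally show ?thesis unfolding F_def .
qed

lemma nn_integral_median_weight:
  assumes "0 < e"
  shows "(\<integral>\<^sup>+w. median_weight e w \<partial>lborel) < \<infinity>"
proof -
  obtain K where K: "\<And>c. (\<integral>\<^sup>+x. ennreal (japanese (x - c) powr - (1 + e)) \<partial>lborel) \<le> ennreal K"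
    using nn_integral_japanese_powr[of "1 + e"] assms by auto
  have "(\<integral>\<^sup>+w. median_weight e w \<partial>lborel) = 32 * (\<integral>\<^sup>+w. ennreal (japanese w powr - (1 + e)) \<partial>lborel)
    + 2 * (\<integral>\<^sup>+w. ennreal (\<bar>w\<bar> powr (e / 4 - 1)) * indicator {-1..1} w \<partial>lborel)"
    unfolding median_weight_def
    by (subst nn_integral_add) (simp_all add: nn_integral_cmult ennreal_mult' del: minus_add_distrib)
  also have "\<dots> < \<infinity>"
    using K[of 0] nn_integral_abs_powr_near_0[of "e / 4 - 1"] assms
    by (auto simp: ennreal_mult_less_top le_less_trans[OF _ ennreal_less_top] simp del: minus_add_distrib)
  finally show ?thesis .
qed

lemma measurable_median_weight[measurable]:
  assumes [measurable]: "f \<in> borel_measurable M"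
  shows "(\<lambda>z. median_weight e (f z)) \<in> borel_measurable M"
  unfolding median_weight_def indicator_def atLeastAtMost_iff by measurable

lemma measurable_median_small[measurable]:
  assumes [measurable]: "f \<in> borel_measurable M" "g \<in> borel_measurable M"
  shows "(\<lambda>z. median_small (f z) (g z)) \<in> borel_measurable M"
  unfolding median_small_def indicator_def atLeastAtMost_iff by measurable

lemma nn_integral_median_small:
  "(\<integral>\<^sup>+w. \<integral>\<^sup>+a. median_small w a \<partial>lborel \<partial>lborel) < \<infinity>"
proof -
  have "(\<integral>\<^sup>+w. \<integral>\<^sup>+a. median_small w a \<partial>lborel \<partial>lborel)
     = (\<integral>\<^sup>+w. 4 * (ennreal (\<bar>w\<bar> powr (- 1 / 2)) * indicator {-1..1} w) \<partial>lborel)"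
  proof (rule nn_integral_cong_AE)
    have "AE w in lborel. w \<noteq> (0::real)" by (rule AE_lborel_singleton)
    then show "AE w in lborel. (\<integral>\<^sup>+a. median_small w a \<partial>lborel) = 4 * (ennreal (\<bar>w\<bar> powr (- 1 / 2)) * indicator {-1..1} w)"
    proof eventually_elim
      case (elim w)
      let ?r = "\<bar>w\<bar> powr (- 1 / 4)"
      have "(\<integral>\<^sup>+a. median_small w a \<partial>lborel) = (\<integral>\<^sup>+a. (2 * ennreal ?r * indicator {-1..1} w) * indicator {-?r..?r} a \<partial>lborel)"
        using elim by (intro nn_integral_cong) (simp add: median_small_def)
      also have "\<dots> = (2 * ennreal ?r * indicator {-1..1} w) * ennreal (?r - (- ?r))"
        by (subst nn_integral_cmult_indicator) auto
      also have "ennreal (?r - (- ?r)) = ennreal (2 * ?r)" by simp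
      also have "\<dots> = 2 * ennreal ?r" by (subst ennreal_mult) auto
      also have "(2 * ennreal ?r * indicator {-1..1} w) * (2 * ennreal ?r) = 4 * ((ennreal ?r * ennreal ?r) * indicator {-1..1} w)"
        by (simp add: mult_ac)
      also have "ennreal ?r * ennreal ?r = ennreal (\<bar>w\<bar> powr (- 1 / 2))"
        by (simp add: ennreal_mult'[symmetric] powr_add[symmetric])
      finally show ?case .
    qed
  qed
  also have "\<dots> = 4 * (\<integral>\<^sup>+w. (ennreal (\<bar>w\<bar> powr (- 1 / 2)) * indicator {-1..1} w) \<partial>lborel)"
    by (rule nn_integral_cmult) simp
  also have "\<dots> < \<infinity>" using nn_integral_abs_powr_near_0[of "- 1 / 2"] by (simp add: ennreal_mult_less_top)
  finally show ?thesis .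
qed

text \<open>The inner integral is taken at fixed median \<open>b\<close>: the weight does not see
  \<open>a\<close>, and what is left is the two-wave phase of sum \<open>x - b\<close>. Translation
  in \<open>b\<close> then removes the critical value, which makes the bound uniform in
  \<open>A\<close> and \<open>x\<close>.\<close>

lemma nn_integral_median_majorant:
  assumes "p > 1" "0 < e"
  obtains K where "K < \<infinity>" "\<And>A x. (\<integral>\<^sup>+b. \<integral>\<^sup>+a. median_majorant p e A x b a \<partial>lborel \<partial>lborel) \<le> K"
proof -
  obtain K2 where K2: 
    "\<And>A z. (\<integral>\<^sup>+x. ennreal (japanese (A - x ^ 3 - (z - x) ^ 3) powr - p * \<bar>x\<^sup>2 - (z - x)\<^sup>2\<bar>) \<partial>lborel) \<le> ennreal K2"
    using nn_integral_cubic_phase[OF assms(1)] by blast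
  define W where "W = (\<integral>\<^sup>+w. median_weight e w \<partial>lborel)"
  define S where "S w = (\<integral>\<^sup>+a. median_small w a \<partial>lborel)" for w
  have S[measurable]: "S \<in> borel_measurable borel" unfolding S_def by measurable
  define S1 where "S1 = (\<integral>\<^sup>+w. S w \<partial>lborel)"
  have fin: "W < \<infinity>" "S1 < \<infinity>"
    using nn_integral_median_weight[OF assms(2)] nn_integral_median_small by (auto simp: W_def S1_def S_def)
  \<comment> \<open>At most three critical values occur; the 8 is twice the area of the square
    \<open>[-1, 1]^2\<close>.\<close>
  let ?K = "3 * (W * ennreal K2 + S1) + 8"
  show thesis
  proof (rule that[of ?K])
    show "?K < \<infinity>" using fin by (auto simp: ennreal_mult_less_top)
    fix A x :: real
    let ?V = "{x / 3, x, - x}"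
    have "(\<integral>\<^sup>+b. \<integral>\<^sup>+a. median_majorant p e A x b a \<partial>lborel \<partial>lborel)
      \<le> (\<integral>\<^sup>+b. (\<Sum>v\<in>?V. median_weight e (b - v) * ennreal K2 + S (b - v)) + 4 * indicator {-1..1} b \<partial>lborel)"
    proof (rule nn_integral_mono)
      fix b
      let ?E = "\<lambda>a. ennreal (japanese (A - b ^ 3 - a ^ 3 - (x - b - a) ^ 3) powr - p * \<bar>a\<^sup>2 - (x - b - a)\<^sup>2\<bar>)"
      have "(\<integral>\<^sup>+a. median_majorant p e A x b a \<partial>lborel)
        = (\<Sum>v\<in>?V. median_weight e (b - v) * (\<integral>\<^sup>+a. ?E a \<partial>lborel) + S (b - v)) + 2 * indicator {-1..1} b * (\<integral>\<^sup>+a. indicator {-1..1::real} a \<partial>lborel)"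
        unfolding median_majorant_def S_def
        by (simp add: nn_integral_add nn_integral_sum nn_integral_cmult)
      also have "\<dots> \<le> (\<Sum>v\<in>?V. median_weight e (b - v) * ennreal K2 + S (b - v)) + 4 * indicator {-1..1} b"
        by (intro add_mono sum_mono mult_left_mono) (use K2[of "A - b ^ 3" "x - b"] in \<open>auto simp: mult_ac\<close>)
      finally show "(\<integral>\<^sup>+a. median_majorant p e A x b a \<partial>lborel)
        \<le> (\<Sum>v\<in>?V. median_weight e (b - v) * ennreal K2 + S (b - v)) + 4 * indicator {-1..1} b" .
    qed
    also have "\<dots> = (\<Sum>v\<in>?V. (\<integral>\<^sup>+b. median_weight e (b - v) \<partial>lborel) * ennreal K2 + (\<integral>\<^sup>+b. S (b - v) \<partial>lborel)) + 4 * 2"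
      by (simp add: nn_integral_add nn_integral_sum nn_integral_cmult nn_integral_multc)
    also have "\<dots> = (\<Sum>v\<in>?V. W * ennreal K2 + S1) + 8"
      using nn_integral_translate[of "median_weight e" "- v" for v] nn_integral_translate[of S "- v" for v]
      by (simp add: W_def S1_def)
    also have "\<dots> \<le> ?K"
    proof -
      have "card ?V \<le> 3" by (simp add: card_insert_if)
      then have "of_nat (card ?V) \<le> (3::ennreal)"
        using of_nat_mono[where 'a = ennreal] by fastforce
      then show ?thesis by (simp only: sum_constant) (intro add_mono mult_right_mono; simp)
    qed
    finally show "(\<integral>\<^sup>+b. \<integral>\<^sup>+a. median_majorant p e A x b a \<partial>lborel \<partial>lborel) \<le> ?K" .
  qed
qed

lemma measurable_max3[measurable]:
  assumes [measurable]: "f \<in> borel_measurable M" "g \<in> borel_measurable M" "h \<in> borel_measurable M"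
  shows "(\<lambda>z. max3 (f z) (g z) (h z)) \<in> borel_measurable M"
  unfolding max3_def by measurable

text \<open>The three positions of the median contribute equally: reflecting \<open>a\<close> to
  \<open>x - b - a\<close> and exchanging the integrals carries each of them to the first.\<close>

lemma nn_integral_three_waves:
  assumes "p > 1" "0 < e" "e < 1"
  obtains K where "K < \<infinity>" "\<And>A x. (\<integral>\<^sup>+b. \<integral>\<^sup>+a. ennreal (japanese (max3 b a (x - b - a)) powr (1 - e)
      * japanese (A - b ^ 3 - a ^ 3 - (x - b - a) ^ 3) powr - p) \<partial>lborel \<partial>lborel) \<le> K"
proof -
  obtain K where K: "K < \<infinity>" "\<And>A x. (\<integral>\<^sup>+b. \<integral>\<^sup>+a. median_majorant p e A x b a \<partial>lborel \<partial>lborel) \<le> K"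
    using nn_integral_median_majorant[OF assms(1,2)] by blast
  show thesis
  proof (rule that[of "K + K + K"])
    show "K + K + K < \<infinity>" using K by simp
    fix A x :: real
    let ?M = "median_majorant p e A x"
    have "(\<integral>\<^sup>+b. \<integral>\<^sup>+a. ennreal (japanese (max3 b a (x - b - a)) powr (1 - e)
      * japanese (A - b ^ 3 - a ^ 3 - (x - b - a) ^ 3) powr - p) \<partial>lborel \<partial>lborel)
      \<le> (\<integral>\<^sup>+b. \<integral>\<^sup>+a. ?M b a + ?M a b + ?M (x - b - a) b \<partial>lborel \<partial>lborel)"
      using assms by (intro nn_integral_mono median_majorant_bound) auto
    also have "\<dots> = (\<integral>\<^sup>+b. \<integral>\<^sup>+a. ?M b a \<partial>lborel \<partial>lborel) + (\<integral>\<^sup>+b. \<integral>\<^sup>+a. ?M a b \<partial>lborel \<partial>lborel)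
       + (\<integral>\<^sup>+b. \<integral>\<^sup>+a. ?M (x - b - a) b \<partial>lborel \<partial>lborel)"
      by (simp add: nn_integral_add)
    also have "(\<integral>\<^sup>+b. \<integral>\<^sup>+a. ?M (x - b - a) b \<partial>lborel \<partial>lborel) = (\<integral>\<^sup>+b. \<integral>\<^sup>+a. ?M a b \<partial>lborel \<partial>lborel)"
      by (intro nn_integral_cong nn_integral_reflect) measurable
    also have "(\<integral>\<^sup>+b. \<integral>\<^sup>+a. ?M a b \<partial>lborel \<partial>lborel) = (\<integral>\<^sup>+b. \<integral>\<^sup>+a. ?M b a \<partial>lborel \<partial>lborel)"
      by (intro nn_integral_swap) measurable
    also have "(\<integral>\<^sup>+b. \<integral>\<^sup>+a. ?M b a \<partial>lborel \<partial>lborel) + (\<integral>\<^sup>+b. \<integral>\<^sup>+a. ?M b a \<partial>lborel \<partial>lborel)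
       + (\<integral>\<^sup>+b. \<integral>\<^sup>+a. ?M b a \<partial>lborel \<partial>lborel) \<le> K + K + K"
      by (intro add_mono K)
    finally show "(\<integral>\<^sup>+b. \<integral>\<^sup>+a. ennreal (japanese (max3 b a (x - b - a)) powr (1 - e)
      * japanese (A - b ^ 3 - a ^ 3 - (x - b - a) ^ 3) powr - p) \<partial>lborel \<partial>lborel) \<le> K + K + K" .
  qed
qed

section \<open>Square integrals of the kernels over fibres of fixed sum\<close>

definition modulation :: "real \<Rightarrow> real \<times> real \<Rightarrow> real" where
  "modulation p z = japanese (snd z - fst z ^ 3) powr p"

lemma measurable_modulation[measurable]:
  assumes [measurable]: "f \<in> borel_measurable M"
  shows "(\<lambda>z. modulation p (f z)) \<in> borel_measurable M"
  unfolding modulation_def by measurable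

lemma modulation_pos[simp]: "0 < modulation p z" "0 \<le> modulation p z" "modulation p z \<noteq> 0"
  by (auto simp: modulation_def)

text \<open>No phase is involved: a modulation and a power above 1 of the frequency of one and the
  same variable are integrable over the plane. It serves pairs in which the second variable
  contributes nothing.\<close>

lemma nn_integral_pair_frequency:
  assumes "p > 1" "q > 1"
  obtains K where "K < \<infinity>"
    "(\<integral>\<^sup>+z. ennreal (japanese (fst z) powr - q * modulation (- p) z) \<partial>lborel) \<le> K"
proof -
  obtain K1 where K1: "\<And>c. (\<integral>\<^sup>+x. ennreal (japanese (x - c) powr - p) \<partial>lborel) \<le> ennreal K1"
    using nn_integral_japanese_powr[OF assms(1)] by blast
  obtain K2 where K2: "\<And>c. (\<integral>\<^sup>+x. ennreal (japanese (x - c) powr - q) \<partial>lborel) \<le> ennreal K2"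
    using nn_integral_japanese_powr[OF assms(2)] by blast
  have "(\<integral>\<^sup>+z. ennreal (japanese (fst z) powr - q * modulation (- p) z) \<partial>lborel)
     = (\<integral>\<^sup>+x. ennreal (japanese x powr - q) * (\<integral>\<^sup>+t. ennreal (japanese (t - x ^ 3) powr - p) \<partial>lborel) \<partial>lborel)"
    by (subst nn_integral_plane) (simp_all add: modulation_def ennreal_mult'' nn_integral_cmult)
  also have "\<dots> \<le> (\<integral>\<^sup>+x. ennreal (japanese x powr - q) * ennreal K1 \<partial>lborel)"
    by (intro nn_integral_mono mult_left_mono K1) auto
  also have "\<dots> = (\<integral>\<^sup>+x. ennreal (japanese (x - 0) powr - q) \<partial>lborel) * ennreal K1"
    by (subst nn_integral_multc) auto
  also have "\<dots> \<le> ennreal K2 * ennreal K1" by (intro mult_right_mono K2) auto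
  finally show thesis by (rule that[rotated]) (simp add: ennreal_mult_less_top)
qed

text \<open>Integrating the time frequency first merges both modulations into one bracket of the
  phase, after which the factor \<open>|x^2 - (fst z - x)^2|\<close> is the Jacobian of that
  phase.\<close>

lemma nn_integral_pair_transversal:
  assumes "p > 1"
  obtains K where "K < \<infinity>"
    "\<And>z. (\<integral>\<^sup>+y. ennreal (\<bar>(fst y)\<^sup>2 - (fst (z - y))\<^sup>2\<bar> * modulation (- p) y * modulation (- p) (z - y)) \<partial>lborel) \<le> K"
proof -
  obtain K1 where K1: "K1 > 0"
    "\<And>A B. (\<integral>\<^sup>+x. ennreal (japanese (x - A) powr - p * japanese (B - x) powr - p) \<partial>lborel)
        \<le> ennreal (K1 * japanese (B - A) powr - p)"
    using japanese_convolution[OF assms] by blast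
  obtain K2 where K2: 
    "\<And>A z. (\<integral>\<^sup>+x. ennreal (japanese (A - x ^ 3 - (z - x) ^ 3) powr - p * \<bar>x\<^sup>2 - (z - x)\<^sup>2\<bar>) \<partial>lborel) \<le> ennreal K2"
    using nn_integral_cubic_phase[OF assms(1)] by blast
  show thesis
  proof (rule that[of "ennreal K1 * ennreal K2"])
    fix z :: "real \<times> real"
    have "(\<integral>\<^sup>+y. ennreal (\<bar>(fst y)\<^sup>2 - (fst (z - y))\<^sup>2\<bar> * modulation (- p) y * modulation (- p) (z - y)) \<partial>lborel)
      = (\<integral>\<^sup>+x. \<integral>\<^sup>+t. ennreal \<bar>x\<^sup>2 - (fst z - x)\<^sup>2\<bar> * ennreal (japanese (t - x ^ 3) powr - p *
           japanese ((snd z - (fst z - x) ^ 3) - t) powr - p) \<partial>lborel \<partial>lborel)"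
      by (subst nn_integral_plane)
        (auto simp: modulation_def mult.assoc ennreal_mult'[symmetric] algebra_simps intro!: nn_integral_cong)
    also have "\<dots> = (\<integral>\<^sup>+x. ennreal \<bar>x\<^sup>2 - (fst z - x)\<^sup>2\<bar> * (\<integral>\<^sup>+t. ennreal (japanese (t - x ^ 3) powr - p *
           japanese ((snd z - (fst z - x) ^ 3) - t) powr - p) \<partial>lborel) \<partial>lborel)"
      by (intro nn_integral_cong nn_integral_cmult) measurable
    also have "\<dots> \<le> (\<integral>\<^sup>+x. ennreal \<bar>x\<^sup>2 - (fst z - x)\<^sup>2\<bar> *
         ennreal (K1 * japanese ((snd z - (fst z - x) ^ 3) - x ^ 3) powr - p) \<partial>lborel)"
      by (intro nn_integral_mono mult_left_mono K1) auto
    also have "\<dots> = (\<integral>\<^sup>+x. ennreal K1 * ennreal (japanese (snd z - x ^ 3 - (fst z - x) ^ 3) powr - p * \<bar>x\<^sup>2 - (fst z - x)\<^sup>2\<bar>) \<partial>lborel)"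
      using K1(1) by (intro nn_integral_cong) (simp add: ennreal_mult'[symmetric] algebra_simps)
    also have "\<dots> = ennreal K1 * (\<integral>\<^sup>+x. ennreal (japanese (snd z - x ^ 3 - (fst z - x) ^ 3) powr - p * \<bar>x\<^sup>2 - (fst z - x)\<^sup>2\<bar>) \<partial>lborel)"
      by (intro nn_integral_cmult) measurable
    also have "\<dots> \<le> ennreal K1 * ennreal K2" by (intro mult_left_mono K2) auto
    finally show "(\<integral>\<^sup>+y. ennreal (\<bar>(fst y)\<^sup>2 - (fst (z - y))\<^sup>2\<bar> * modulation (- p) y * modulation (- p) (z - y)) \<partial>lborel)
      \<le> ennreal K1 * ennreal K2" .
  qed (simp add: ennreal_mult_less_top)
qed

text \<open>Two convolutions in the time frequencies merge the three modulations into one bracket of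
  the three-wave phase, each at the cost \<open>K1\<close>; only the two spatial frequencies
  remain.\<close>

lemma nn_integral_triple:
  assumes "p > 1" "0 < e" "e < 1"
  obtains K where "K < \<infinity>"
    "\<And>z. (\<integral>\<^sup>+u. \<integral>\<^sup>+v. ennreal (japanese (max3 (fst u) (fst v) (fst (z - u - v))) powr (1 - e) *
       (modulation (- p) u * (modulation (- p) v * modulation (- p) (z - u - v)))) \<partial>lborel \<partial>lborel) \<le> K"
proof -
  obtain K1 where K1: "K1 > 0"
    "\<And>A B. (\<integral>\<^sup>+x. ennreal (japanese (x - A) powr - p * japanese (B - x) powr - p) \<partial>lborel)
        \<le> ennreal (K1 * japanese (B - A) powr - p)"
    using japanese_convolution[OF assms(1)] by blast
  obtain K2 where K2: "K2 < \<infinity>" "\<And>A x. (\<integral>\<^sup>+b. \<integral>\<^sup>+a. ennreal (japanese (max3 b a (x - b - a)) powr (1 - e)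
      * japanese (A - b ^ 3 - a ^ 3 - (x - b - a) ^ 3) powr - p) \<partial>lborel \<partial>lborel) \<le> K2"
    using nn_integral_three_waves[OF assms] by blast
  show thesis
  proof (rule that[of "ennreal (K1 * K1) * K2"])
    show "ennreal (K1 * K1) * K2 < \<infinity>" using K2 by (simp add: ennreal_mult_less_top)
    fix z :: "real \<times> real"
    obtain x t where z: "z = (x, t)" by (cases z)
    let ?M = "\<lambda>b a. ennreal (japanese (max3 b a (x - b - a)) powr (1 - e))"
    let ?j = "\<lambda>y. japanese y powr - p"
    have "(\<integral>\<^sup>+u. \<integral>\<^sup>+v. ennreal (japanese (max3 (fst u) (fst v) (fst (z - u - v))) powr (1 - e) *
       (modulation (- p) u * (modulation (- p) v * modulation (- p) (z - u - v)))) \<partial>lborel \<partial>lborel)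
      = (\<integral>\<^sup>+b. \<integral>\<^sup>+r. \<integral>\<^sup>+a. \<integral>\<^sup>+s. (?M b a * ennreal (?j (r - b ^ 3))) *
           ennreal (?j (s - a ^ 3) * ?j (t - r - (x - b - a) ^ 3 - s)) \<partial>lborel \<partial>lborel \<partial>lborel \<partial>lborel)"
      by (subst nn_integral_plane, measurable, subst nn_integral_plane, measurable)
        (auto simp: modulation_def z ennreal_mult'[symmetric] algebra_simps intro!: nn_integral_cong)
    also have "\<dots> \<le> (\<integral>\<^sup>+b. \<integral>\<^sup>+r. \<integral>\<^sup>+a. (?M b a * ennreal (?j (r - b ^ 3))) *
           ennreal (K1 * ?j (t - r - (x - b - a) ^ 3 - a ^ 3)) \<partial>lborel \<partial>lborel \<partial>lborel)"
      by (intro nn_integral_mono, subst nn_integral_cmult, measurable) (intro mult_left_mono K1; simp)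
    also have "\<dots> = (\<integral>\<^sup>+b. \<integral>\<^sup>+a. \<integral>\<^sup>+r. (?M b a * ennreal (?j (r - b ^ 3))) *
           ennreal (K1 * ?j (t - r - (x - b - a) ^ 3 - a ^ 3)) \<partial>lborel \<partial>lborel \<partial>lborel)"
      by (intro nn_integral_cong nn_integral_swap) measurable
    also have "\<dots> = (\<integral>\<^sup>+b. \<integral>\<^sup>+a. \<integral>\<^sup>+r. (?M b a * ennreal K1) *
           ennreal (?j (r - b ^ 3) * ?j (t - (x - b - a) ^ 3 - a ^ 3 - r)) \<partial>lborel \<partial>lborel \<partial>lborel)"
      using K1(1) by (intro nn_integral_cong) (simp add: ennreal_mult'[symmetric] algebra_simps)
    also have "\<dots> \<le> (\<integral>\<^sup>+b. \<integral>\<^sup>+a. (?M b a * ennreal K1) *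
           ennreal (K1 * ?j (t - (x - b - a) ^ 3 - a ^ 3 - b ^ 3)) \<partial>lborel \<partial>lborel)"
      by (intro nn_integral_mono, subst nn_integral_cmult, measurable) (intro mult_left_mono K1; simp)
    also have "\<dots> = (\<integral>\<^sup>+b. \<integral>\<^sup>+a. ennreal (K1 * K1) * ennreal (japanese (max3 b a (x - b - a)) powr (1 - e)
      * ?j (t - b ^ 3 - a ^ 3 - (x - b - a) ^ 3)) \<partial>lborel \<partial>lborel)"
      using K1(1) by (intro nn_integral_cong) (simp add: ennreal_mult'[symmetric] algebra_simps)
    also have "\<dots> = ennreal (K1 * K1) * (\<integral>\<^sup>+b. \<integral>\<^sup>+a. ennreal (japanese (max3 b a (x - b - a)) powr (1 - e)
      * ?j (t - b ^ 3 - a ^ 3 - (x - b - a) ^ 3)) \<partial>lborel \<partial>lborel)"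
      by (subst nn_integral_cmult[symmetric], measurable, intro nn_integral_cong nn_integral_cmult) measurable
    also have "\<dots> \<le> ennreal (K1 * K1) * K2" by (intro mult_left_mono K2) auto
    finally show "(\<integral>\<^sup>+u. \<integral>\<^sup>+v. ennreal (japanese (max3 (fst u) (fst v) (fst (z - u - v))) powr (1 - e) *
       (modulation (- p) u * (modulation (- p) v * modulation (- p) (z - u - v)))) \<partial>lborel \<partial>lborel)
      \<le> ennreal (K1 * K1) * K2" .
  qed
qed

section \<open>Forms on a hyperplane\<close>

text \<open>The crude factor is harmless since \<open>A\<close> will be the fixed list of ten ways
  to split five variables.\<close>

lemma power2_sum_le_card:
  fixes f :: "'a \<Rightarrow> ennreal"
  assumes "finite A" "\<And>a. a \<in> A \<Longrightarrow> (f a)\<^sup>2 \<le> B"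
  shows "(\<Sum>a\<in>A. f a)\<^sup>2 \<le> (of_nat (card A))\<^sup>2 * B"
proof (cases "A = {}")
  case False
  then obtain a where a: "a \<in> A" "Max (f ` A) = f a"
    using assms by (metis (no_types, lifting) Max_in finite_imageI image_iff image_is_empty)
  have "(\<Sum>a\<in>A. f a) \<le> of_nat (card A) * f a"
    using assms a by (intro sum_bounded_above) (metis Max_ge finite_imageI imageI)
  then have "(\<Sum>a\<in>A. f a)\<^sup>2 \<le> (of_nat (card A) * f a)\<^sup>2" by (intro power_mono) auto
  also have "\<dots> \<le> (of_nat (card A))\<^sup>2 * B"
    unfolding power_mult_distrib using assms a by (intro mult_left_mono) auto
  finally show ?thesis .
qed simp

lemma nn_integral_convolution_swap:
  fixes F :: "'a::euclidean_space \<Rightarrow> 'a \<Rightarrow> ennreal"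
  assumes [measurable]: "(\<lambda>z. F (fst z) (snd z)) \<in> borel_measurable borel"
  shows "(\<integral>\<^sup>+z. \<integral>\<^sup>+y. F y (z - y) \<partial>lborel \<partial>lborel) = (\<integral>\<^sup>+y. \<integral>\<^sup>+x. F y x \<partial>lborel \<partial>lborel)"
proof -
  have [measurable (raw)]: "(\<lambda>z. F (f z) (g z)) \<in> borel_measurable M"
    if [measurable]: "f \<in> borel_measurable M" "g \<in> borel_measurable M" for f g and M :: "'a measure"
    using measurable_compose[OF borel_measurable_Pair[OF that] assms] by simp
  have "(\<integral>\<^sup>+z. \<integral>\<^sup>+y. F y (z - y) \<partial>lborel \<partial>lborel) = (\<integral>\<^sup>+y. \<integral>\<^sup>+z. F y (z - y) \<partial>lborel \<partial>lborel)"
    by (intro nn_integral_swap measurable_compose[OF borel_measurable_Pair assms, simplified]) measurable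
  also have "\<dots> = (\<integral>\<^sup>+y. \<integral>\<^sup>+x. F y x \<partial>lborel \<partial>lborel)"
  proof (rule nn_integral_cong)
    fix y
    show "(\<integral>\<^sup>+z. F y (z - y) \<partial>lborel) = (\<integral>\<^sup>+x. F y x \<partial>lborel)"
      using nn_integral_translate[of "F y" "- y"] by simp
  qed
  finally show ?thesis .
qed

text \<open>Cauchy--Schwarz in the fibre over each \<open>z\<close> separates the kernel, bounded
  there by \<open>K\<close>, from the functions; the integral over \<open>z\<close> then decouples
  the functions by translation.\<close>

lemma bilinear_convolution_L2:
  fixes f g :: "'a::euclidean_space \<Rightarrow> ennreal" and k :: "'a \<times> 'a \<Rightarrow> ennreal"
  assumes [measurable]: "f \<in> borel_measurable borel" "g \<in> borel_measurable borel" "k \<in> borel_measurable borel"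
    and K: "\<And>z. (\<integral>\<^sup>+y. (k (y, z - y))\<^sup>2 \<partial>lborel) \<le> K"
  shows "(\<integral>\<^sup>+z. (\<integral>\<^sup>+y. f y * g (z - y) * k (y, z - y) \<partial>lborel)\<^sup>2 \<partial>lborel)
    \<le> K * ((\<integral>\<^sup>+z. (f z)\<^sup>2 \<partial>lborel) * (\<integral>\<^sup>+z. (g z)\<^sup>2 \<partial>lborel))"
proof -
  have "(\<integral>\<^sup>+z. (\<integral>\<^sup>+y. f y * g (z - y) * k (y, z - y) \<partial>lborel)\<^sup>2 \<partial>lborel)
    \<le> (\<integral>\<^sup>+z. (\<integral>\<^sup>+y. (f y * g (z - y))\<^sup>2 \<partial>lborel) * (\<integral>\<^sup>+y. (k (y, z - y))\<^sup>2 \<partial>lborel) \<partial>lborel)"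
    by (intro nn_integral_mono Cauchy_Schwarz_nn_integral) measurable
  also have "\<dots> \<le> (\<integral>\<^sup>+z. (\<integral>\<^sup>+y. (f y)\<^sup>2 * (g (z - y))\<^sup>2 \<partial>lborel) * K \<partial>lborel)"
    unfolding power_mult_distrib by (intro nn_integral_mono mult_left_mono K) auto
  also have "\<dots> = (\<integral>\<^sup>+z. \<integral>\<^sup>+y. (f y)\<^sup>2 * (g (z - y))\<^sup>2 \<partial>lborel \<partial>lborel) * K"
    by (intro nn_integral_multc) measurable
  also have "(\<integral>\<^sup>+z. \<integral>\<^sup>+y. (f y)\<^sup>2 * (g (z - y))\<^sup>2 \<partial>lborel \<partial>lborel) = (\<integral>\<^sup>+y. \<integral>\<^sup>+x. (f y)\<^sup>2 * (g x)\<^sup>2 \<partial>lborel \<partial>lborel)"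
    by (rule nn_integral_convolution_swap) measurable
  also have "\<dots> = (\<integral>\<^sup>+z. (f z)\<^sup>2 \<partial>lborel) * (\<integral>\<^sup>+z. (g z)\<^sup>2 \<partial>lborel)"
    by (simp add: nn_integral_cmult nn_integral_multc)
  finally show ?thesis by (simp add: mult.commute)
qed

lemma trilinear_convolution_L2:
  fixes f g h :: "'a::euclidean_space \<Rightarrow> ennreal" and k :: "'a \<times> 'a \<times> 'a \<Rightarrow> ennreal"
  assumes [measurable]: "f \<in> borel_measurable borel" "g \<in> borel_measurable borel" "h \<in> borel_measurable borel"
      "k \<in> borel_measurable borel"
    and K: "\<And>z. (\<integral>\<^sup>+u. \<integral>\<^sup>+v. (k (u, v, z - u - v))\<^sup>2 \<partial>lborel \<partial>lborel) \<le> K"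
  shows "(\<integral>\<^sup>+z. (\<integral>\<^sup>+u. \<integral>\<^sup>+v. f u * g v * h (z - u - v) * k (u, v, z - u - v) \<partial>lborel \<partial>lborel)\<^sup>2 \<partial>lborel)
    \<le> K * ((\<integral>\<^sup>+z. (f z)\<^sup>2 \<partial>lborel) * (\<integral>\<^sup>+z. (g z)\<^sup>2 \<partial>lborel) * (\<integral>\<^sup>+z. (h z)\<^sup>2 \<partial>lborel))"
proof -
  have "(\<integral>\<^sup>+z. (\<integral>\<^sup>+u. \<integral>\<^sup>+v. f u * g v * h (z - u - v) * k (u, v, z - u - v) \<partial>lborel \<partial>lborel)\<^sup>2 \<partial>lborel)
    \<le> (\<integral>\<^sup>+z. (\<integral>\<^sup>+u. \<integral>\<^sup>+v. (f u)\<^sup>2 * ((g v)\<^sup>2 * (h (z - u - v))\<^sup>2) \<partial>lborel \<partial>lborel) * K \<partial>lborel)"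
  proof (intro nn_integral_mono)
    fix z :: 'a
    have "(\<integral>\<^sup>+u. \<integral>\<^sup>+v. f u * g v * h (z - u - v) * k (u, v, z - u - v) \<partial>lborel \<partial>lborel)\<^sup>2
      = (\<integral>\<^sup>+q. (f (fst q) * g (snd q) * h (z - fst q - snd q)) * k (fst q, snd q, z - fst q - snd q) \<partial>lborel)\<^sup>2"
      by (subst nn_integral_plane) (simp_all)
    also have "\<dots> \<le> (\<integral>\<^sup>+q. (f (fst q) * g (snd q) * h (z - fst q - snd q))\<^sup>2 \<partial>lborel)
       * (\<integral>\<^sup>+q. (k (fst q, snd q, z - fst q - snd q))\<^sup>2 \<partial>lborel)"
      by (intro Cauchy_Schwarz_nn_integral) measurable
    also have "(\<integral>\<^sup>+q. (k (fst q, snd q, z - fst q - snd q))\<^sup>2 \<partial>lborel) = (\<integral>\<^sup>+u. \<integral>\<^sup>+v. (k (u, v, z - u - v))\<^sup>2 \<partial>lborel \<partial>lborel)"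
      by (subst nn_integral_plane) simp_all
    also have "(\<integral>\<^sup>+q. (f (fst q) * g (snd q) * h (z - fst q - snd q))\<^sup>2 \<partial>lborel)
      = (\<integral>\<^sup>+u. \<integral>\<^sup>+v. (f u)\<^sup>2 * ((g v)\<^sup>2 * (h (z - u - v))\<^sup>2) \<partial>lborel \<partial>lborel)"
      by (subst nn_integral_plane) (simp_all add: power_mult_distrib mult.assoc)
    finally show "(\<integral>\<^sup>+u. \<integral>\<^sup>+v. f u * g v * h (z - u - v) * k (u, v, z - u - v) \<partial>lborel \<partial>lborel)\<^sup>2
      \<le> (\<integral>\<^sup>+u. \<integral>\<^sup>+v. (f u)\<^sup>2 * ((g v)\<^sup>2 * (h (z - u - v))\<^sup>2) \<partial>lborel \<partial>lborel) * K"
      by (rule order_trans) (intro mult_left_mono K, simp)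
  qed
  also have "\<dots> = (\<integral>\<^sup>+z. \<integral>\<^sup>+u. \<integral>\<^sup>+v. (f u)\<^sup>2 * ((g v)\<^sup>2 * (h (z - u - v))\<^sup>2) \<partial>lborel \<partial>lborel \<partial>lborel) * K"
    by (intro nn_integral_multc) measurable
  also have "(\<integral>\<^sup>+z. \<integral>\<^sup>+u. \<integral>\<^sup>+v. (f u)\<^sup>2 * ((g v)\<^sup>2 * (h (z - u - v))\<^sup>2) \<partial>lborel \<partial>lborel \<partial>lborel)
    = (\<integral>\<^sup>+u. \<integral>\<^sup>+z. \<integral>\<^sup>+v. (f u)\<^sup>2 * ((g v)\<^sup>2 * (h (z - v))\<^sup>2) \<partial>lborel \<partial>lborel \<partial>lborel)"
    using nn_integral_convolution_swap[of "\<lambda>u z. \<integral>\<^sup>+v. (f u)\<^sup>2 * ((g v)\<^sup>2 * (h (z - v))\<^sup>2) \<partial>lborel"] by simp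
  also have "\<dots> = (\<integral>\<^sup>+u. (f u)\<^sup>2 * (\<integral>\<^sup>+z. \<integral>\<^sup>+v. (g v)\<^sup>2 * (h (z - v))\<^sup>2 \<partial>lborel \<partial>lborel) \<partial>lborel)"
    by (simp add: nn_integral_cmult)
  also have "(\<integral>\<^sup>+z. \<integral>\<^sup>+v. (g v)\<^sup>2 * (h (z - v))\<^sup>2 \<partial>lborel \<partial>lborel) = (\<integral>\<^sup>+v. \<integral>\<^sup>+z. (g v)\<^sup>2 * (h z)\<^sup>2 \<partial>lborel \<partial>lborel)"
    by (rule nn_integral_convolution_swap) measurable
  also have "(\<integral>\<^sup>+u. (f u)\<^sup>2 * (\<integral>\<^sup>+v. \<integral>\<^sup>+z. (g v)\<^sup>2 * (h z)\<^sup>2 \<partial>lborel \<partial>lborel) \<partial>lborel)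
    = (\<integral>\<^sup>+z. (f z)\<^sup>2 \<partial>lborel) * (\<integral>\<^sup>+z. (g z)\<^sup>2 \<partial>lborel) * (\<integral>\<^sup>+z. (h z)\<^sup>2 \<partial>lborel)"
    by (simp add: nn_integral_cmult nn_integral_multc mult_ac)
  finally show ?thesis by (simp add: mult_ac)
qed

text \<open>The last variable is eliminated only to write the integral down: the measure on the hyperplane
  of sum zero is invariant under permutations of all five variables.\<close>

definition five_form :: "('a::euclidean_space \<times> 'a \<times> 'a \<times> 'a \<times> 'a \<Rightarrow> ennreal) \<Rightarrow> ennreal" where
  "five_form G = (\<integral>\<^sup>+a. \<integral>\<^sup>+b. \<integral>\<^sup>+c. \<integral>\<^sup>+d. G (a, b, c, d, - (a + b + c + d)) \<partial>lborel \<partial>lborel \<partial>lborel \<partial>lborel)"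

lemma five_form_swap12:
  assumes [measurable]: "G \<in> borel_measurable borel"
  shows "five_form G = five_form (\<lambda>(a, b, c, d, e). G (b, a, c, d, e))"
  unfolding five_form_def by (subst nn_integral_swap) (simp_all add: add_ac)

lemma five_form_swap23:
  assumes [measurable]: "G \<in> borel_measurable borel"
  shows "five_form G = five_form (\<lambda>(a, b, c, d, e). G (a, c, b, d, e))"
  unfolding five_form_def
  by (rule nn_integral_cong, subst nn_integral_swap) (simp_all add: add_ac)

lemma five_form_swap34:
  assumes [measurable]: "G \<in> borel_measurable borel"
  shows "five_form G = five_form (\<lambda>(a, b, c, d, e). G (a, b, d, c, e))"
  unfolding five_form_def
  by (rule nn_integral_cong, rule nn_integral_cong, subst nn_integral_swap) (simp_all add: add_ac)

text \<open>The only generator that touches the eliminated variable: replacing \<open>d\<close> by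
  \<open>- (a + b + c) - d\<close> exchanges it with the last entry and preserves Lebesgue
  measure.\<close>

lemma five_form_swap45:
  assumes [measurable]: "G \<in> borel_measurable borel"
  shows "five_form G = five_form (\<lambda>(a, b, c, d, e). G (a, b, c, e, d))"
  unfolding five_form_def
proof (rule nn_integral_cong, rule nn_integral_cong, rule nn_integral_cong)
  fix a b c :: 'a
  have "- (a + b + c + (- (a + b + c) - d)) = d" for d by simp
  then show "(\<integral>\<^sup>+d. G (a, b, c, d, - (a + b + c + d)) \<partial>lborel)
    = (\<integral>\<^sup>+d. (case (a, b, c, d, - (a + b + c + d)) of (a, b, c, d, e) \<Rightarrow> G (a, b, c, e, d)) \<partial>lborel)"
    using nn_integral_reflect[of "\<lambda>d. G (a, b, c, d, - (a + b + c + d))" "- (a + b + c)"]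
    by simp
qed

text \<open>Domination is asked for on the hyperplane only, so that the choice of pair and triple
  may use the vanishing sum.\<close>

lemma five_form_mono:
  assumes "\<And>a b c d e. a + b + c + d + e = 0 \<Longrightarrow> G (a, b, c, d, e) \<le> H (a, b, c, d, e)"
  shows "five_form G \<le> five_form H"
  unfolding five_form_def by (intro nn_integral_mono assms) simp

lemma five_form_cmult:
  assumes [measurable]: "G \<in> borel_measurable borel"
  shows "five_form (\<lambda>z. c * G z) = c * five_form G"
  unfolding five_form_def by (simp add: nn_integral_cmult)

lemma five_form_sum:
  assumes [measurable]: "\<And>i. i \<in> I \<Longrightarrow> G i \<in> borel_measurable borel"
  shows "five_form (\<lambda>z. \<Sum>i\<in>I. G i z) = (\<Sum>i\<in>I. five_form (G i))"
  unfolding five_form_def by (simp add: nn_integral_sum)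

text \<open>If the pair sums to \<open>z\<close>, the triple sums to \<open>- z\<close>. The form is
  therefore the pairing of \<open>P z\<close> with \<open>R (- z)\<close>, and Cauchy--Schwarz
  leaves one bilinear and one trilinear convolution.\<close>

lemma five_form_pair_triple:
  fixes k2 :: "'a::euclidean_space \<times> 'a \<Rightarrow> ennreal" and k3 :: "'a \<times> 'a \<times> 'a \<Rightarrow> ennreal"
  assumes [measurable]: "f1 \<in> borel_measurable borel" "f2 \<in> borel_measurable borel" "f3 \<in> borel_measurable borel"
      "f4 \<in> borel_measurable borel" "f5 \<in> borel_measurable borel" "k2 \<in> borel_measurable borel" "k3 \<in> borel_measurable borel"
    and K2: "\<And>z. (\<integral>\<^sup>+y. (k2 (y, z - y))\<^sup>2 \<partial>lborel) \<le> K2"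
    and K3: "\<And>z. (\<integral>\<^sup>+u. \<integral>\<^sup>+v. (k3 (u, v, z - u - v))\<^sup>2 \<partial>lborel \<partial>lborel) \<le> K3"
  shows "(five_form (\<lambda>(a, b, c, d, e). f1 a * (f2 b * (f3 c * (f4 d * f5 e))) * (k2 (a, b) * k3 (c, d, e))))\<^sup>2
    \<le> K2 * K3 * ((\<integral>\<^sup>+z. (f1 z)\<^sup>2 \<partial>lborel) * ((\<integral>\<^sup>+z. (f2 z)\<^sup>2 \<partial>lborel) * ((\<integral>\<^sup>+z. (f3 z)\<^sup>2 \<partial>lborel) *
        ((\<integral>\<^sup>+z. (f4 z)\<^sup>2 \<partial>lborel) * (\<integral>\<^sup>+z. (f5 z)\<^sup>2 \<partial>lborel)))))"
proof -
  define P where "P z = (\<integral>\<^sup>+y. f1 y * f2 (z - y) * k2 (y, z - y) \<partial>lborel)" for z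
  define R where "R z = (\<integral>\<^sup>+u. \<integral>\<^sup>+v. f3 u * f4 v * f5 (z - u - v) * k3 (u, v, z - u - v) \<partial>lborel \<partial>lborel)" for z
  have [measurable]: "P \<in> borel_measurable borel" "R \<in> borel_measurable borel"
    unfolding P_def R_def by measurable
  have "five_form (\<lambda>(a, b, c, d, e). f1 a * (f2 b * (f3 c * (f4 d * f5 e))) * (k2 (a, b) * k3 (c, d, e)))
    = (\<integral>\<^sup>+a. \<integral>\<^sup>+b. (f1 a * f2 b * k2 (a, b)) * R (- (a + b)) \<partial>lborel \<partial>lborel)"
    unfolding five_form_def R_def
    by (simp add: nn_integral_cmult[symmetric] algebra_simps)
  also have "\<dots> = (\<integral>\<^sup>+z. \<integral>\<^sup>+a. (f1 a * f2 (z - a) * k2 (a, z - a)) * R (- z) \<partial>lborel \<partial>lborel)"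
    by (subst nn_integral_convolution_swap[of "\<lambda>a b. (f1 a * f2 b * k2 (a, b)) * R (- (a + b))", symmetric]) simp_all
  also have "\<dots> = (\<integral>\<^sup>+z. P z * R (- z) \<partial>lborel)"
    unfolding P_def by (intro nn_integral_cong nn_integral_multc) measurable
  finally have "(five_form (\<lambda>(a, b, c, d, e). f1 a * (f2 b * (f3 c * (f4 d * f5 e))) * (k2 (a, b) * k3 (c, d, e))))\<^sup>2
    = (\<integral>\<^sup>+z. P z * R (- z) \<partial>lborel)\<^sup>2" by simp
  also have "\<dots> \<le> (\<integral>\<^sup>+z. (P z)\<^sup>2 \<partial>lborel) * (\<integral>\<^sup>+z. (R (- z))\<^sup>2 \<partial>lborel)"
    by (rule Cauchy_Schwarz_nn_integral) measurable
  also have "(\<integral>\<^sup>+z. (R (- z))\<^sup>2 \<partial>lborel) = (\<integral>\<^sup>+z. (R z)\<^sup>2 \<partial>lborel)"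
    using nn_integral_reflect[of "\<lambda>z. (R z)\<^sup>2" 0] by simp
  also have "(\<integral>\<^sup>+z. (P z)\<^sup>2 \<partial>lborel) * (\<integral>\<^sup>+z. (R z)\<^sup>2 \<partial>lborel) \<le>
     (K2 * ((\<integral>\<^sup>+z. (f1 z)\<^sup>2 \<partial>lborel) * (\<integral>\<^sup>+z. (f2 z)\<^sup>2 \<partial>lborel))) *
     (K3 * ((\<integral>\<^sup>+z. (f3 z)\<^sup>2 \<partial>lborel) * (\<integral>\<^sup>+z. (f4 z)\<^sup>2 \<partial>lborel) * (\<integral>\<^sup>+z. (f5 z)\<^sup>2 \<partial>lborel)))"
    unfolding P_def R_def
    by (intro mult_mono bilinear_convolution_L2 trilinear_convolution_L2 K2 K3) auto
  finally show ?thesis by (simp add: mult_ac)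
qed

text \<open>The index runs through the ten choices of a pair among five variables, in the order of
  \<open>splits\<close>; numbering them makes the majorant a finite sum over naturals.\<close>

definition pair_triple :: "('a \<times> 'a \<Rightarrow> ennreal) \<Rightarrow> ('a \<times> 'a \<times> 'a \<Rightarrow> ennreal) \<Rightarrow> nat \<Rightarrow> 'a \<times> 'a \<times> 'a \<times> 'a \<times> 'a \<Rightarrow> ennreal" where
  "pair_triple k2 k3 i = (\<lambda>(a, b, c, d, e). [k2 (a, b) * k3 (c, d, e), k2 (a, c) * k3 (b, d, e), k2 (a, d) * k3 (b, c, e),
     k2 (a, e) * k3 (b, c, d), k2 (b, c) * k3 (a, d, e), k2 (b, d) * k3 (a, c, e), k2 (b, e) * k3 (a, c, d),
     k2 (c, d) * k3 (a, b, e), k2 (c, e) * k3 (a, b, d), k2 (d, e) * k3 (a, b, c)] ! i)"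

text \<open>Transpositions of neighbours carry the splitting with pair \<open>(a, b)\<close> to the
  nine others, and the form is invariant under them.\<close>

lemma five_form_pair_triple_index:
  fixes k2 :: "'a::euclidean_space \<times> 'a \<Rightarrow> ennreal" and k3 :: "'a \<times> 'a \<times> 'a \<Rightarrow> ennreal"
  assumes m[measurable]: "k2 \<in> borel_measurable borel" "k3 \<in> borel_measurable borel"
    and K2: "\<And>z. (\<integral>\<^sup>+y. (k2 (y, z - y))\<^sup>2 \<partial>lborel) \<le> K2"
    and K3: "\<And>z. (\<integral>\<^sup>+u. \<integral>\<^sup>+v. (k3 (u, v, z - u - v))\<^sup>2 \<partial>lborel \<partial>lborel) \<le> K3"
    and f: "f1 \<in> borel_measurable borel" "f2 \<in> borel_measurable borel" "f3 \<in> borel_measurable borel"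
      "f4 \<in> borel_measurable borel" "f5 \<in> borel_measurable borel" and i: "i < 10"
  shows "(five_form (\<lambda>(a, b, c, d, e). f1 a * (f2 b * (f3 c * (f4 d * f5 e))) * pair_triple k2 k3 i (a, b, c, d, e)))\<^sup>2
    \<le> K2 * K3 * ((\<integral>\<^sup>+z. (f1 z)\<^sup>2 \<partial>lborel) * ((\<integral>\<^sup>+z. (f2 z)\<^sup>2 \<partial>lborel) * ((\<integral>\<^sup>+z. (f3 z)\<^sup>2 \<partial>lborel) *
        ((\<integral>\<^sup>+z. (f4 z)\<^sup>2 \<partial>lborel) * (\<integral>\<^sup>+z. (f5 z)\<^sup>2 \<partial>lborel)))))"
proof -
  define B where "B f1 f2 f3 f4 f5 =  K2 * K3 * ((\<integral>\<^sup>+z. (f1 z)\<^sup>2 \<partial>lborel) * ((\<integral>\<^sup>+z. (f2 z)\<^sup>2 \<partial>lborel) * ((\<integral>\<^sup>+z. (f3 z)\<^sup>2 \<partial>lborel) *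
        ((\<integral>\<^sup>+z. (f4 z)\<^sup>2 \<partial>lborel) * (\<integral>\<^sup>+z. (f5 z)\<^sup>2 \<partial>lborel)))))" for f1 f2 f3 f4 f5 :: "'a \<Rightarrow> ennreal"
  \<comment> \<open>Quantifying over all five functions makes the property stable under
    permutations: a permuted kernel against given functions is the original kernel against permuted
    functions.\<close>
  define Q where "Q H \<longleftrightarrow> (\<forall>f1 f2 f3 f4 f5. f1 \<in> borel_measurable borel \<longrightarrow> f2 \<in> borel_measurable borel \<longrightarrow> f3 \<in> borel_measurable borel \<longrightarrow>
      f4 \<in> borel_measurable borel \<longrightarrow> f5 \<in> borel_measurable borel \<longrightarrow> 
     (five_form (\<lambda>(a, b, c, d, e). f1 a * (f2 b * (f3 c * (f4 d * f5 e))) * H (a, b, c, d, e)))\<^sup>2 \<le> B f1 f2 f3 f4 f5)"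
    for H :: "'a \<times> 'a \<times> 'a \<times> 'a \<times> 'a \<Rightarrow> ennreal"
  have s1: "Q (\<lambda>(a, b, c, d, e). H (b, a, c, d, e))" if "Q H" and [measurable]: "H \<in> borel_measurable borel" for H
    unfolding Q_def
  proof (intro allI impI)
    fix f1 f2 f3 f4 f5 :: "'a \<Rightarrow> ennreal"
    assume [measurable]: "f1 \<in> borel_measurable borel" "f2 \<in> borel_measurable borel" "f3 \<in> borel_measurable borel"
      "f4 \<in> borel_measurable borel" "f5 \<in> borel_measurable borel"
    have "(five_form (\<lambda>(a, b, c, d, e). f2 a * (f1 b * (f3 c * (f4 d * f5 e))) * H (a, b, c, d, e)))\<^sup>2 \<le> B f2 f1 f3 f4 f5"
      using that(1) unfolding Q_def by simp
    then show "(five_form (\<lambda>(a, b, c, d, e). f1 a * (f2 b * (f3 c * (f4 d * f5 e))) *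
       (case (a, b, c, d, e) of (a, b, c, d, e) \<Rightarrow> H (b, a, c, d, e))))\<^sup>2 \<le> B f1 f2 f3 f4 f5"
      by (subst (asm) five_form_swap12) (simp_all add: case_prod_beta' B_def mult_ac)
  qed
  have s2: "Q (\<lambda>(a, b, c, d, e). H (a, c, b, d, e))" if "Q H" and [measurable]: "H \<in> borel_measurable borel" for H
    unfolding Q_def
  proof (intro allI impI)
    fix f1 f2 f3 f4 f5 :: "'a \<Rightarrow> ennreal"
    assume [measurable]: "f1 \<in> borel_measurable borel" "f2 \<in> borel_measurable borel" "f3 \<in> borel_measurable borel"
      "f4 \<in> borel_measurable borel" "f5 \<in> borel_measurable borel"
    have "(five_form (\<lambda>(a, b, c, d, e). f1 a * (f3 b * (f2 c * (f4 d * f5 e))) * H (a, b, c, d, e)))\<^sup>2 \<le> B f1 f3 f2 f4 f5"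
      using that(1) unfolding Q_def by simp
    then show "(five_form (\<lambda>(a, b, c, d, e). f1 a * (f2 b * (f3 c * (f4 d * f5 e))) *
       (case (a, b, c, d, e) of (a, b, c, d, e) \<Rightarrow> H (a, c, b, d, e))))\<^sup>2 \<le> B f1 f2 f3 f4 f5"
      by (subst (asm) five_form_swap23) (simp_all add: case_prod_beta' B_def mult_ac)
  qed
  have s3: "Q (\<lambda>(a, b, c, d, e). H (a, b, d, c, e))" if "Q H" and [measurable]: "H \<in> borel_measurable borel" for H
    unfolding Q_def
  proof (intro allI impI)
    fix f1 f2 f3 f4 f5 :: "'a \<Rightarrow> ennreal"
    assume [measurable]: "f1 \<in> borel_measurable borel" "f2 \<in> borel_measurable borel" "f3 \<in> borel_measurable borel"
      "f4 \<in> borel_measurable borel" "f5 \<in> borel_measurable borel"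
    have "(five_form (\<lambda>(a, b, c, d, e). f1 a * (f2 b * (f4 c * (f3 d * f5 e))) * H (a, b, c, d, e)))\<^sup>2 \<le> B f1 f2 f4 f3 f5"
      using that(1) unfolding Q_def by simp
    then show "(five_form (\<lambda>(a, b, c, d, e). f1 a * (f2 b * (f3 c * (f4 d * f5 e))) *
       (case (a, b, c, d, e) of (a, b, c, d, e) \<Rightarrow> H (a, b, d, c, e))))\<^sup>2 \<le> B f1 f2 f3 f4 f5"
      by (subst (asm) five_form_swap34) (simp_all add: case_prod_beta' B_def mult_ac)
  qed
  have s4: "Q (\<lambda>(a, b, c, d, e). H (a, b, c, e, d))" if "Q H" and [measurable]: "H \<in> borel_measurable borel" for H
    unfolding Q_def
  proof (intro allI impI)
    fix f1 f2 f3 f4 f5 :: "'a \<Rightarrow> ennreal"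
    assume [measurable]: "f1 \<in> borel_measurable borel" "f2 \<in> borel_measurable borel" "f3 \<in> borel_measurable borel"
      "f4 \<in> borel_measurable borel" "f5 \<in> borel_measurable borel"
    have "(five_form (\<lambda>(a, b, c, d, e). f1 a * (f2 b * (f3 c * (f5 d * f4 e))) * H (a, b, c, d, e)))\<^sup>2 \<le> B f1 f2 f3 f5 f4"
      using that(1) unfolding Q_def by simp
    then show "(five_form (\<lambda>(a, b, c, d, e). f1 a * (f2 b * (f3 c * (f4 d * f5 e))) *
       (case (a, b, c, d, e) of (a, b, c, d, e) \<Rightarrow> H (a, b, c, e, d))))\<^sup>2 \<le> B f1 f2 f3 f4 f5"
      by (subst (asm) five_form_swap45) (simp_all add: case_prod_beta' B_def mult_ac)
  qed
  have q12: "Q (\<lambda>(a, b, c, d, e). k2 (a, b) * k3 (c, d, e))"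
    unfolding Q_def B_def using five_form_pair_triple[OF _ _ _ _ _ m K2 K3] by simp
  have q13: "Q (\<lambda>(a, b, c, d, e). k2 (a, c) * k3 (b, d, e))" using s2[OF q12] by (simp add: case_prod_beta')
  have q14: "Q (\<lambda>(a, b, c, d, e). k2 (a, d) * k3 (b, c, e))" using s3[OF q13] by (simp add: case_prod_beta')
  have q15: "Q (\<lambda>(a, b, c, d, e). k2 (a, e) * k3 (b, c, d))" using s4[OF q14] by (simp add: case_prod_beta')
  have q23: "Q (\<lambda>(a, b, c, d, e). k2 (b, c) * k3 (a, d, e))" using s1[OF q13] by (simp add: case_prod_beta')
  have q24: "Q (\<lambda>(a, b, c, d, e). k2 (b, d) * k3 (a, c, e))" using s1[OF q14] by (simp add: case_prod_beta')
  have q25: "Q (\<lambda>(a, b, c, d, e). k2 (b, e) * k3 (a, c, d))" using s1[OF q15] by (simp add: case_prod_beta')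
  have q34: "Q (\<lambda>(a, b, c, d, e). k2 (c, d) * k3 (a, b, e))" using s2[OF q24] by (simp add: case_prod_beta')
  have q35: "Q (\<lambda>(a, b, c, d, e). k2 (c, e) * k3 (a, b, d))" using s2[OF q25] by (simp add: case_prod_beta')
  have q45: "Q (\<lambda>(a, b, c, d, e). k2 (d, e) * k3 (a, b, c))" using s3[OF q35] by (simp add: case_prod_beta')
  have "Q (pair_triple k2 k3 i)"
  proof -
    have "i \<in> {0, 1, 2, 3, 4, 5, 6, 7, 8, 9}" using i by auto
    then show ?thesis
      using q12 q13 q14 q15 q23 q24 q25 q34 q35 q45 by (auto simp: pair_triple_def)
  qed
  then show ?thesis using f unfolding Q_def B_def by simp
qed

lemma measurable_pair_triple[measurable]:
  fixes k2 :: "'a::euclidean_space \<times> 'a \<Rightarrow> ennreal" and k3 :: "'a \<times> 'a \<times> 'a \<Rightarrow> ennreal"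
  assumes [measurable]: "k2 \<in> borel_measurable borel" "k3 \<in> borel_measurable borel" and i: "i < 10"
  shows "pair_triple k2 k3 i \<in> borel_measurable borel"
proof -
  have "i \<in> {0, 1, 2, 3, 4, 5, 6, 7, 8, 9}" using i by auto
  then show ?thesis by (auto simp: pair_triple_def case_prod_beta')
qed

text \<open>One splitting suffices at each point, but which one varies. Adding up all ten avoids a
  measurable choice and costs \<open>10^2 = 100\<close> after squaring.\<close>

lemma five_form_majorized:
  fixes k2 :: "'a::euclidean_space \<times> 'a \<Rightarrow> ennreal" and k3 :: "'a \<times> 'a \<times> 'a \<Rightarrow> ennreal"
  assumes m[measurable]: "k2 \<in> borel_measurable borel" "k3 \<in> borel_measurable borel"
    and K2: "\<And>z. (\<integral>\<^sup>+y. (k2 (y, z - y))\<^sup>2 \<partial>lborel) \<le> K2"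
    and K3: "\<And>z. (\<integral>\<^sup>+u. \<integral>\<^sup>+v. (k3 (u, v, z - u - v))\<^sup>2 \<partial>lborel \<partial>lborel) \<le> K3"
    and K: "\<And>a b c d e. a + b + c + d + e = 0 \<Longrightarrow> K (a, b, c, d, e) \<le> C * (\<Sum>i<10. pair_triple k2 k3 i (a, b, c, d, e))"
    and f[measurable]: "f1 \<in> borel_measurable borel" "f2 \<in> borel_measurable borel" "f3 \<in> borel_measurable borel"
      "f4 \<in> borel_measurable borel" "f5 \<in> borel_measurable borel"
  shows "(five_form (\<lambda>(a, b, c, d, e). f1 a * (f2 b * (f3 c * (f4 d * f5 e))) * K (a, b, c, d, e)))\<^sup>2
    \<le> 100 * (C\<^sup>2 * (K2 * K3)) * ((\<integral>\<^sup>+z. (f1 z)\<^sup>2 \<partial>lborel) * ((\<integral>\<^sup>+z. (f2 z)\<^sup>2 \<partial>lborel) * ((\<integral>\<^sup>+z. (f3 z)\<^sup>2 \<partial>lborel) *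
        ((\<integral>\<^sup>+z. (f4 z)\<^sup>2 \<partial>lborel) * (\<integral>\<^sup>+z. (f5 z)\<^sup>2 \<partial>lborel)))))"
    (is "_ \<le> 100 * (C\<^sup>2 * (K2 * K3)) * ?F")
proof -
  let ?G = "\<lambda>i. \<lambda>(a, b, c, d, e). f1 a * (f2 b * (f3 c * (f4 d * f5 e))) * pair_triple k2 k3 i (a, b, c, d, e)"
  have G[measurable]: "?G i \<in> borel_measurable borel" if "i < 10" for i
    using measurable_pair_triple[OF m that] by (simp add: case_prod_beta')
  have "five_form (\<lambda>(a, b, c, d, e). f1 a * (f2 b * (f3 c * (f4 d * f5 e))) * K (a, b, c, d, e))
    \<le> five_form (\<lambda>z. C * (\<Sum>i<10. ?G i z))"
  proof (rule five_form_mono)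
    fix a b c d e :: 'a
    assume "a + b + c + d + e = 0"
    then have "f1 a * (f2 b * (f3 c * (f4 d * f5 e))) * K (a, b, c, d, e)
      \<le> f1 a * (f2 b * (f3 c * (f4 d * f5 e))) * (C * (\<Sum>i<10. pair_triple k2 k3 i (a, b, c, d, e)))"
      by (intro mult_left_mono K) auto
    then show "(case (a, b, c, d, e) of (a, b, c, d, e) \<Rightarrow> f1 a * (f2 b * (f3 c * (f4 d * f5 e))) * K (a, b, c, d, e))
      \<le> C * (\<Sum>i<10. ?G i (a, b, c, d, e))"
      by (simp only: prod.case sum_distrib_left mult_ac)
  qed
  also have "\<dots> = C * (\<Sum>i<10. five_form (?G i))"
    using G by (subst five_form_cmult five_form_sum, auto intro!: borel_measurable_sum)+
  finally have "(five_form (\<lambda>(a, b, c, d, e). f1 a * (f2 b * (f3 c * (f4 d * f5 e))) * K (a, b, c, d, e)))\<^sup>2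
    \<le> (C * (\<Sum>i<10. five_form (?G i)))\<^sup>2" by (rule power_mono) simp
  also have "\<dots> = C\<^sup>2 * (\<Sum>i<10. five_form (?G i))\<^sup>2" by (simp add: power_mult_distrib)
  also have "\<dots> \<le> C\<^sup>2 * ((of_nat (card {..<10::nat}))\<^sup>2 * (K2 * K3 * ?F))"
    by (intro mult_left_mono power2_sum_le_card five_form_pair_triple_index[OF m K2 K3 f]) auto
  also have "(of_nat (card {..<10::nat}))\<^sup>2 = (100::ennreal)" by (simp add: power2_eq_square)
  finally show ?thesis by (simp add: mult_ac)
qed

section \<open>The symbol as a product of pair and triple kernels\<close>

lemma modulation_square: "(modulation p z)\<^sup>2 = modulation (2 * p) z"
  by (simp add: modulation_def powr_power mult.commute)

lemma modulation_uminus[simp]: "modulation p (- z) = modulation p z"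
  using japanese_minus[of "snd z - fst z ^ 3"] by (simp add: modulation_def)

lemma modulation_mono: "p \<le> q \<Longrightarrow> modulation p z \<le> modulation q z"
  unfolding modulation_def by (intro powr_mono) (auto simp: japanese_ge1)

lemma modulation_le_1: "p \<le> 0 \<Longrightarrow> modulation p z \<le> 1"
  using modulation_mono[of p 0 z] by (simp add: modulation_def)

text \<open>The first summand squares to the transversal integrand. Each of the other two carries
  the modulation of a single variable and serves when that of the partner is already spent or has
  been discarded.\<close>

definition pair_kernel :: "real \<Rightarrow> real \<Rightarrow> (real \<times> real) \<times> (real \<times> real) \<Rightarrow> real" where
  "pair_kernel be e = (\<lambda>(u, v). sqrt \<bar>(fst u)\<^sup>2 - (fst v)\<^sup>2\<bar> * (modulation (- be) u * modulation (- be) v)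
     + japanese (fst u) powr - ((1 + e) / 2) * modulation (- be) u
     + japanese (fst v) powr - ((1 + e) / 2) * modulation (- be) v)"

text \<open>The exponent is half of the one in the three-wave integral because the kernel enters
  squared.\<close>

definition triple_kernel :: "real \<Rightarrow> real \<Rightarrow> (real \<times> real) \<times> (real \<times> real) \<times> (real \<times> real) \<Rightarrow> real" where
  "triple_kernel be e = (\<lambda>(u, v, w). japanese (max3 (fst u) (fst v) (fst w)) powr ((1 - e) / 2) *
     (modulation (- be) u * (modulation (- be) v * modulation (- be) w)))"

lemma measurable_pair_kernel[measurable]: "pair_kernel be e \<in> borel_measurable borel"
  unfolding pair_kernel_def case_prod_beta' by measurable

lemma measurable_triple_kernel[measurable]: "triple_kernel be e \<in> borel_measurable borel"
  unfolding triple_kernel_def case_prod_beta' by measurable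

lemma pair_kernel_nonneg: "0 \<le> pair_kernel be e z"
  by (auto simp: pair_kernel_def case_prod_beta')

lemma triple_kernel_nonneg: "0 \<le> triple_kernel be e z"
  by (auto simp: triple_kernel_def case_prod_beta')

lemma nn_integral_pair_kernel:
  assumes "be > 1 / 2" "e > 0"
  obtains K where "K < \<infinity>" "\<And>z. (\<integral>\<^sup>+y. (ennreal (pair_kernel be e (y, z - y)))\<^sup>2 \<partial>lborel) \<le> K"
proof -
  define p where "p = 2 * be"
  have p: "p > 1" using assms by (simp add: p_def)
  obtain K1 where K1: "K1 < \<infinity>"
    "\<And>z. (\<integral>\<^sup>+y. ennreal (\<bar>(fst y)\<^sup>2 - (fst (z - y))\<^sup>2\<bar> * modulation (- p) y * modulation (- p) (z - y)) \<partial>lborel) \<le> K1"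
    using nn_integral_pair_transversal[OF p] by blast
  let ?q = "\<lambda>z. ennreal (japanese (fst z) powr - (1 + e) * modulation (- p) z)"
  obtain K2 where K2: "K2 < \<infinity>" "(\<integral>\<^sup>+z. ?q z \<partial>lborel) \<le> K2"
    using nn_integral_pair_frequency[OF p, of "1 + e"] assms by auto
  show thesis
  proof (rule that[of "3 * (K1 + K2 + K2)"])
    show "3 * (K1 + K2 + K2) < \<infinity>" using K1 K2 by (auto simp: ennreal_mult_less_top)
    fix z :: "real \<times> real"
    let ?p = "\<lambda>y. ennreal (\<bar>(fst y)\<^sup>2 - (fst (z - y))\<^sup>2\<bar> * modulation (- p) y * modulation (- p) (z - y))"
    have "(ennreal (pair_kernel be e (y, z - y)))\<^sup>2 \<le> 3 * (?p y + ?q y + ?q (z - y))" for y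
    proof -
      have sq: "(u + v + w)\<^sup>2 \<le> 3 * (u\<^sup>2 + v\<^sup>2 + w\<^sup>2)" for u v w :: real
      proof -
        have "0 \<le> (u - v)\<^sup>2 + (v - w)\<^sup>2 + (w - u)\<^sup>2" by simp
        then show ?thesis by (simp add: power2_eq_square algebra_simps)
      qed
      have pw: "(japanese x powr - ((1 + e) / 2))\<^sup>2 = japanese x powr - (1 + e)" for x
        unfolding power2_eq_square powr_add[symmetric] by (rule arg_cong) (simp add: field_simps)
      have "(pair_kernel be e (y, z - y))\<^sup>2 \<le> 3 * (\<bar>(fst y)\<^sup>2 - (fst (z - y))\<^sup>2\<bar> * modulation (- p) y * modulation (- p) (z - y)
        + japanese (fst y) powr - (1 + e) * modulation (- p) y + japanese (fst (z - y)) powr - (1 + e) * modulation (- p) (z - y))"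
        unfolding pair_kernel_def prod.case
        by (rule order_trans[OF sq]) (simp only: power_mult_distrib real_sqrt_pow2 abs_ge_zero modulation_square pw p_def
            mult_minus_right mult.assoc order_refl)
      then show ?thesis
        by (simp add: ennreal_power pair_kernel_nonneg ennreal_plus[symmetric] ennreal_mult'[symmetric]
            ennreal_leI del: ennreal_plus flip: ennreal_numeral)
    qed
    then have "(\<integral>\<^sup>+y. (ennreal (pair_kernel be e (y, z - y)))\<^sup>2 \<partial>lborel) \<le> (\<integral>\<^sup>+y. 3 * (?p y + ?q y + ?q (z - y)) \<partial>lborel)"
      by (intro nn_integral_mono)
    also have "\<dots> = 3 * ((\<integral>\<^sup>+y. ?p y \<partial>lborel) + (\<integral>\<^sup>+y. ?q y \<partial>lborel) + (\<integral>\<^sup>+y. ?q (z - y) \<partial>lborel))"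
      by (subst nn_integral_cmult, measurable, subst nn_integral_add, measurable, subst nn_integral_add, measurable)
    also have "(\<integral>\<^sup>+y. ?q (z - y) \<partial>lborel) = (\<integral>\<^sup>+y. ?q y \<partial>lborel)"
      by (rule nn_integral_reflect) measurable
    also have "3 * ((\<integral>\<^sup>+y. ?p y \<partial>lborel) + (\<integral>\<^sup>+y. ?q y \<partial>lborel) + (\<integral>\<^sup>+y. ?q y \<partial>lborel)) \<le> 3 * (K1 + K2 + K2)"
      by (intro mult_left_mono add_mono K1 K2) auto
    finally show "(\<integral>\<^sup>+y. (ennreal (pair_kernel be e (y, z - y)))\<^sup>2 \<partial>lborel) \<le> 3 * (K1 + K2 + K2)" .
  qed
qed

lemma nn_integral_triple_kernel:
  assumes "be > 1 / 2" "0 < e" "e < 1"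
  obtains K where "K < \<infinity>"
    "\<And>z. (\<integral>\<^sup>+u. \<integral>\<^sup>+v. (ennreal (triple_kernel be e (u, v, z - u - v)))\<^sup>2 \<partial>lborel \<partial>lborel) \<le> K"
proof -
  have p: "2 * be > 1" using assms by simp
  obtain K where K: "K < \<infinity>"
    "\<And>z. (\<integral>\<^sup>+u. \<integral>\<^sup>+v. ennreal (japanese (max3 (fst u) (fst v) (fst (z - u - v))) powr (1 - e) *
       (modulation (- (2 * be)) u * (modulation (- (2 * be)) v * modulation (- (2 * be)) (z - u - v)))) \<partial>lborel \<partial>lborel) \<le> K"
    using nn_integral_triple[OF p assms(2,3)] by blast
  have pw: "(japanese x powr ((1 - e) / 2))\<^sup>2 = japanese x powr (1 - e)" for x
    unfolding power2_eq_square powr_add[symmetric] by (rule arg_cong) (simp add: field_simps)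
  have "(ennreal (triple_kernel be e (u, v, w)))\<^sup>2 = ennreal (japanese (max3 (fst u) (fst v) (fst w)) powr (1 - e) *
       (modulation (- (2 * be)) u * (modulation (- (2 * be)) v * modulation (- (2 * be)) w)))" for u v w
    by (simp add: ennreal_power triple_kernel_def power_mult_distrib pw modulation_square)
  then show thesis using that K by simp
qed

text \<open>The arguments of \<open>pair_triple\<close> without the kernels, so that the splitting
  found at a point can be named before a kernel is applied.\<close>

definition splits :: "'a \<times> 'a \<times> 'a \<times> 'a \<times> 'a \<Rightarrow> (('a \<times> 'a) \<times> ('a \<times> 'a \<times> 'a)) list" where
  "splits = (\<lambda>(a, b, c, d, e). [((a, b), (c, d, e)), ((a, c), (b, d, e)), ((a, d), (b, c, e)),
     ((a, e), (b, c, d)), ((b, c), (a, d, e)), ((b, d), (a, c, e)), ((b, e), (a, c, d)),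
     ((c, d), (a, b, e)), ((c, e), (a, b, d)), ((d, e), (a, b, c))])"

lemma splits_le_sum:
  assumes "(p, t) \<in> set (splits z)"
  shows "k2 p * k3 t \<le> (\<Sum>i<10. pair_triple k2 k3 i z)"
proof -
  obtain a b c d e where z: "z = (a, b, c, d, e)" by (cases z)
  have "\<exists>i<10. k2 p * k3 t = pair_triple k2 k3 i z"
  proof -
    obtain i where "i < length (splits z)" and i: "splits z ! i = (p, t)"
      using assms by (metis in_set_conv_nth)
    then have i10: "i < 10" by (simp add: splits_def z)
    then have "i \<in> {0, 1, 2, 3, 4, 5, 6, 7, 8, 9}" by auto
    then have "k2 p * k3 t = pair_triple k2 k3 i z"
      using i by (auto simp: splits_def pair_triple_def z)
    then show ?thesis using i10 by blast
  qed
  then obtain i where "i < 10" "k2 p * k3 t = pair_triple k2 k3 i z" by blast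
  then show ?thesis using member_le_sum[of i "{..<10}" "\<lambda>i. pair_triple k2 k3 i z"] by simp
qed

lemma splits_prod:
  fixes f :: "'a \<Rightarrow> real"
  assumes "((u, v), (w, y, z)) \<in> set (splits (a, b, c, d, e))"
  shows "(f u * f v) * (f w * (f y * f z)) = f a * (f b * (f c * (f d * f e)))"
  using assms by (auto simp: splits_def)

text \<open>A parity obstruction. Four numbers with moduli in \<open>(9/10 X, X]\<close> have a sum
  whose modulus is within \<open>2/5 X\<close> of \<open>0\<close>, \<open>2 X\<close> or
  \<open>4 X\<close>, hence never equal to \<open>X\<close>.\<close>

lemma five_signs: fixes x y1 y2 y3 y4 :: real
 assumes s: "x + y1 + y2 + y3 + y4 = 0" and n: "9 / 10 * \<bar>x\<bar> < \<bar>y1\<bar>" "9 / 10 * \<bar>x\<bar> < \<bar>y2\<bar>" "9 / 10 * \<bar>x\<bar> < \<bar>y3\<bar>" "9 / 10 * \<bar>x\<bar> < \<bar>y4\<bar>"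
 and m: "\<bar>y1\<bar> \<le> \<bar>x\<bar>" "\<bar>y2\<bar> \<le> \<bar>x\<bar>" "\<bar>y3\<bar> \<le> \<bar>x\<bar>" "\<bar>y4\<bar> \<le> \<bar>x\<bar>"
 shows False
proof -
  define X where "X = \<bar>x\<bar>"
  have c: "9 / 10 * X < y \<and> y \<le> X \<or> - X \<le> y \<and> y < - (9 / 10) * X" if "9 / 10 * X < \<bar>y\<bar>" "\<bar>y\<bar> \<le> X" for y :: real
    using that by (cases "0 \<le> y") auto
  have x: "y1 + y2 + y3 + y4 = X \<or> y1 + y2 + y3 + y4 = - X" using s unfolding X_def by linarith
  \<comment> \<open>Grouping into two pairs leaves three ranges for each partial sum, and none of
    the nine combinations reaches \<open>X\<close> or \<open>- X\<close>.\<close>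
  have y12: "9 / 5 * X < y1 + y2 \<and> y1 + y2 \<le> 2 * X \<or> \<bar>y1 + y2\<bar> < 1 / 10 * X \<or> - 2 * X \<le> y1 + y2 \<and> y1 + y2 < - (9 / 5) * X"
    using c[of y1] c[of y2] n m unfolding X_def[symmetric] abs_less_iff by argo
  have y34: "9 / 5 * X < y3 + y4 \<and> y3 + y4 \<le> 2 * X \<or> \<bar>y3 + y4\<bar> < 1 / 10 * X \<or> - 2 * X \<le> y3 + y4 \<and> y3 + y4 < - (9 / 5) * X"
    using c[of y3] c[of y4] n m unfolding X_def[symmetric] abs_less_iff by argo
  show False using x y12 y34 unfolding abs_less_iff by argo
qed

text \<open>Two different indices are wanted: one bounded away from \<open>|x|\<close>, to form a
  transversal pair with \<open>x\<close>, and one comparable to \<open>|x|\<close>, to stay in the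
  triple.\<close>

lemma transversal_pair:
  fixes x y1 y2 y3 y4 :: real
  assumes s: "x + y1 + y2 + y3 + y4 = 0" and m: "\<bar>y1\<bar> \<le> \<bar>x\<bar>" "\<bar>y2\<bar> \<le> \<bar>x\<bar>" "\<bar>y3\<bar> \<le> \<bar>x\<bar>" "\<bar>y4\<bar> \<le> \<bar>x\<bar>"
  shows "\<bar>y1\<bar> \<le> 9 / 10 * \<bar>x\<bar> \<and> \<bar>x\<bar> \<le> 4 * max3 y2 y3 y4 \<or> \<bar>y2\<bar> \<le> 9 / 10 * \<bar>x\<bar> \<and> \<bar>x\<bar> \<le> 4 * max3 y1 y3 y4
     \<or> \<bar>y3\<bar> \<le> 9 / 10 * \<bar>x\<bar> \<and> \<bar>x\<bar> \<le> 4 * max3 y1 y2 y4 \<or> \<bar>y4\<bar> \<le> 9 / 10 * \<bar>x\<bar> \<and> \<bar>x\<bar> \<le> 4 * max3 y1 y2 y3"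
proof -
  have A: "\<bar>x\<bar> \<le> \<bar>y1\<bar> + \<bar>y2\<bar> + \<bar>y3\<bar> + \<bar>y4\<bar>" using s by linarith
  have B: "\<bar>y1\<bar> \<le> 9 / 10 * \<bar>x\<bar> \<or> \<bar>y2\<bar> \<le> 9 / 10 * \<bar>x\<bar> \<or> \<bar>y3\<bar> \<le> 9 / 10 * \<bar>x\<bar> \<or> \<bar>y4\<bar> \<le> 9 / 10 * \<bar>x\<bar>"
  proof (rule ccontr)
    assume "\<not> ?thesis"
    then have n: "9 / 10 * \<bar>x\<bar> < \<bar>y1\<bar>" "9 / 10 * \<bar>x\<bar> < \<bar>y2\<bar>" "9 / 10 * \<bar>x\<bar> < \<bar>y3\<bar>" "9 / 10 * \<bar>x\<bar> < \<bar>y4\<bar>" by auto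
    show False by (rule five_signs[OF s n m])
  qed
  define a1 a2 a3 a4 X where "a1 = \<bar>y1\<bar>" "a2 = \<bar>y2\<bar>" "a3 = \<bar>y3\<bar>" "a4 = \<bar>y4\<bar>" "X = \<bar>x\<bar>"
  note d = this
  have p: "0 \<le> a1" "0 \<le> a2" "0 \<le> a3" "0 \<le> a4" "0 \<le> X" by (auto simp: d)
  have M: "z \<le> 4 * max u (max v w) \<longleftrightarrow> z \<le> 4 * u \<or> z \<le> 4 * v \<or> z \<le> 4 * w" for u v w z :: real by auto
  have "X \<le> 4 * a1 \<or> X \<le> 4 * a2 \<or> X \<le> 4 * a3 \<or> X \<le> 4 * a4" using A unfolding d[symmetric] by linarith
  \<comment> \<open>If both properties are found at the same index, any other index has at least one
    of them because 1/4 < 9/10, and the roles can be shared.\<close>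
  moreover have "X \<le> 4 * a1 \<or> a1 \<le> 9 / 10 * X" "X \<le> 4 * a2 \<or> a2 \<le> 9 / 10 * X"
    "X \<le> 4 * a3 \<or> a3 \<le> 9 / 10 * X" "X \<le> 4 * a4 \<or> a4 \<le> 9 / 10 * X" using p by linarith+
  ultimately show ?thesis using B unfolding max3_def d[symmetric] M by blast
qed

text \<open>The five cases name the largest frequency and the four subcases its partner, so each of
  the ten splittings is reached from either member of its pair.\<close>

lemma exists_transversal_split:
  fixes f :: "'a \<Rightarrow> real"
  assumes s: "f a + f b + f c + f d + f e = 0" and M: "M = Max {\<bar>f a\<bar>, \<bar>f b\<bar>, \<bar>f c\<bar>, \<bar>f d\<bar>, \<bar>f e\<bar>}"
  obtains u v w y z where "((u, v), (w, y, z)) \<in> set (splits (a, b, c, d, e))"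
    "\<bar>f u\<bar> = M \<and> \<bar>f v\<bar> \<le> 9 / 10 * M \<or> \<bar>f v\<bar> = M \<and> \<bar>f u\<bar> \<le> 9 / 10 * M" "M \<le> 4 * max3 (f w) (f y) (f z)"
proof -
  note main = that
  have I: thesis if "((u, v), (w, y, z)) \<in> set (splits (a, b, c, d, e))"
    "\<bar>f u\<bar> = M \<and> \<bar>f v\<bar> \<le> 9 / 10 * M \<or> \<bar>f v\<bar> = M \<and> \<bar>f u\<bar> \<le> 9 / 10 * M" "M \<le> 4 * max3 (f w) (f y) (f z)" for u v w y z
    using that by (rule main)
  have le: "\<bar>f a\<bar> \<le> M" "\<bar>f b\<bar> \<le> M" "\<bar>f c\<bar> \<le> M" "\<bar>f d\<bar> \<le> M" "\<bar>f e\<bar> \<le> M"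
    unfolding M by (rule Max_ge, simp, simp)+
  have "M \<in> {\<bar>f a\<bar>, \<bar>f b\<bar>, \<bar>f c\<bar>, \<bar>f d\<bar>, \<bar>f e\<bar>}" unfolding M by (rule Max_in) auto
  then consider "M = \<bar>f a\<bar>" | "M = \<bar>f b\<bar>" | "M = \<bar>f c\<bar>" | "M = \<bar>f d\<bar>" | "M = \<bar>f e\<bar>" by blast
  then show thesis
  proof cases
    case 1
    have "\<bar>f b\<bar> \<le> 9 / 10 * M \<and> M \<le> 4 * max3 (f c) (f d) (f e) \<or> \<bar>f c\<bar> \<le> 9 / 10 * M \<and> M \<le> 4 * max3 (f b) (f d) (f e) \<or> \<bar>f d\<bar> \<le> 9 / 10 * M \<and> M \<le> 4 * max3 (f b) (f c) (f e) \<or> \<bar>f e\<bar> \<le> 9 / 10 * M \<and> M \<le> 4 * max3 (f b) (f c) (f d)"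
      by (rule transversal_pair[of "f a" "f b" "f c" "f d" "f e", folded 1]) (use s le in linarith)+
    then consider "\<bar>f b\<bar> \<le> 9 / 10 * M" "M \<le> 4 * max3 (f c) (f d) (f e)" | "\<bar>f c\<bar> \<le> 9 / 10 * M" "M \<le> 4 * max3 (f b) (f d) (f e)" | "\<bar>f d\<bar> \<le> 9 / 10 * M" "M \<le> 4 * max3 (f b) (f c) (f e)" | "\<bar>f e\<bar> \<le> 9 / 10 * M" "M \<le> 4 * max3 (f b) (f c) (f d)"
      by blast
    then show thesis
    proof cases
      case 1 show thesis by (rule I[of a b c d e]) (simp add: splits_def, use 1 \<open>M = \<bar>f a\<bar>\<close> in blast, rule 1)
    next
      case 2 show thesis by (rule I[of a c b d e]) (simp add: splits_def, use 2 \<open>M = \<bar>f a\<bar>\<close> in blast, rule 2)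
    next
      case 3 show thesis by (rule I[of a d b c e]) (simp add: splits_def, use 3 \<open>M = \<bar>f a\<bar>\<close> in blast, rule 3)
    next
      case 4 show thesis by (rule I[of a e b c d]) (simp add: splits_def, use 4 \<open>M = \<bar>f a\<bar>\<close> in blast, rule 4)
    qed
  next
    case 2
    have "\<bar>f a\<bar> \<le> 9 / 10 * M \<and> M \<le> 4 * max3 (f c) (f d) (f e) \<or> \<bar>f c\<bar> \<le> 9 / 10 * M \<and> M \<le> 4 * max3 (f a) (f d) (f e) \<or> \<bar>f d\<bar> \<le> 9 / 10 * M \<and> M \<le> 4 * max3 (f a) (f c) (f e) \<or> \<bar>f e\<bar> \<le> 9 / 10 * M \<and> M \<le> 4 * max3 (f a) (f c) (f d)"
      by (rule transversal_pair[of "f b" "f a" "f c" "f d" "f e", folded 2]) (use s le in linarith)+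
    then consider "\<bar>f a\<bar> \<le> 9 / 10 * M" "M \<le> 4 * max3 (f c) (f d) (f e)" | "\<bar>f c\<bar> \<le> 9 / 10 * M" "M \<le> 4 * max3 (f a) (f d) (f e)" | "\<bar>f d\<bar> \<le> 9 / 10 * M" "M \<le> 4 * max3 (f a) (f c) (f e)" | "\<bar>f e\<bar> \<le> 9 / 10 * M" "M \<le> 4 * max3 (f a) (f c) (f d)"
      by blast
    then show thesis
    proof cases
      case 1 show thesis by (rule I[of a b c d e]) (simp add: splits_def, use 1 \<open>M = \<bar>f b\<bar>\<close> in blast, rule 1)
    next
      case 2 show thesis by (rule I[of b c a d e]) (simp add: splits_def, use 2 \<open>M = \<bar>f b\<bar>\<close> in blast, rule 2)
    next
      case 3 show thesis by (rule I[of b d a c e]) (simp add: splits_def, use 3 \<open>M = \<bar>f b\<bar>\<close> in blast, rule 3)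
    next
      case 4 show thesis by (rule I[of b e a c d]) (simp add: splits_def, use 4 \<open>M = \<bar>f b\<bar>\<close> in blast, rule 4)
    qed
  next
    case 3
    have "\<bar>f a\<bar> \<le> 9 / 10 * M \<and> M \<le> 4 * max3 (f b) (f d) (f e) \<or> \<bar>f b\<bar> \<le> 9 / 10 * M \<and> M \<le> 4 * max3 (f a) (f d) (f e) \<or> \<bar>f d\<bar> \<le> 9 / 10 * M \<and> M \<le> 4 * max3 (f a) (f b) (f e) \<or> \<bar>f e\<bar> \<le> 9 / 10 * M \<and> M \<le> 4 * max3 (f a) (f b) (f d)"
      by (rule transversal_pair[of "f c" "f a" "f b" "f d" "f e", folded 3]) (use s le in linarith)+
    then consider "\<bar>f a\<bar> \<le> 9 / 10 * M" "M \<le> 4 * max3 (f b) (f d) (f e)" | "\<bar>f b\<bar> \<le> 9 / 10 * M" "M \<le> 4 * max3 (f a) (f d) (f e)" | "\<bar>f d\<bar> \<le> 9 / 10 * M" "M \<le> 4 * max3 (f a) (f b) (f e)" | "\<bar>f e\<bar> \<le> 9 / 10 * M" "M \<le> 4 * max3 (f a) (f b) (f d)"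
      by blast
    then show thesis
    proof cases
      case 1 show thesis by (rule I[of a c b d e]) (simp add: splits_def, use 1 \<open>M = \<bar>f c\<bar>\<close> in blast, rule 1)
    next
      case 2 show thesis by (rule I[of b c a d e]) (simp add: splits_def, use 2 \<open>M = \<bar>f c\<bar>\<close> in blast, rule 2)
    next
      case 3 show thesis by (rule I[of c d a b e]) (simp add: splits_def, use 3 \<open>M = \<bar>f c\<bar>\<close> in blast, rule 3)
    next
      case 4 show thesis by (rule I[of c e a b d]) (simp add: splits_def, use 4 \<open>M = \<bar>f c\<bar>\<close> in blast, rule 4)
    qed
  next
    case 4
    have "\<bar>f a\<bar> \<le> 9 / 10 * M \<and> M \<le> 4 * max3 (f b) (f c) (f e) \<or> \<bar>f b\<bar> \<le> 9 / 10 * M \<and> M \<le> 4 * max3 (f a) (f c) (f e) \<or> \<bar>f c\<bar> \<le> 9 / 10 * M \<and> M \<le> 4 * max3 (f a) (f b) (f e) \<or> \<bar>f e\<bar> \<le> 9 / 10 * M \<and> M \<le> 4 * max3 (f a) (f b) (f c)"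
      by (rule transversal_pair[of "f d" "f a" "f b" "f c" "f e", folded 4]) (use s le in linarith)+
    then consider "\<bar>f a\<bar> \<le> 9 / 10 * M" "M \<le> 4 * max3 (f b) (f c) (f e)" | "\<bar>f b\<bar> \<le> 9 / 10 * M" "M \<le> 4 * max3 (f a) (f c) (f e)" | "\<bar>f c\<bar> \<le> 9 / 10 * M" "M \<le> 4 * max3 (f a) (f b) (f e)" | "\<bar>f e\<bar> \<le> 9 / 10 * M" "M \<le> 4 * max3 (f a) (f b) (f c)"
      by blast
    then show thesis
    proof cases
      case 1 show thesis by (rule I[of a d b c e]) (simp add: splits_def, use 1 \<open>M = \<bar>f d\<bar>\<close> in blast, rule 1)
    next
      case 2 show thesis by (rule I[of b d a c e]) (simp add: splits_def, use 2 \<open>M = \<bar>f d\<bar>\<close> in blast, rule 2)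
    next
      case 3 show thesis by (rule I[of c d a b e]) (simp add: splits_def, use 3 \<open>M = \<bar>f d\<bar>\<close> in blast, rule 3)
    next
      case 4 show thesis by (rule I[of d e a b c]) (simp add: splits_def, use 4 \<open>M = \<bar>f d\<bar>\<close> in blast, rule 4)
    qed
  next
    case 5
    have "\<bar>f a\<bar> \<le> 9 / 10 * M \<and> M \<le> 4 * max3 (f b) (f c) (f d) \<or> \<bar>f b\<bar> \<le> 9 / 10 * M \<and> M \<le> 4 * max3 (f a) (f c) (f d) \<or> \<bar>f c\<bar> \<le> 9 / 10 * M \<and> M \<le> 4 * max3 (f a) (f b) (f d) \<or> \<bar>f d\<bar> \<le> 9 / 10 * M \<and> M \<le> 4 * max3 (f a) (f b) (f c)"
      by (rule transversal_pair[of "f e" "f a" "f b" "f c" "f d", folded 5]) (use s le in linarith)+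
    then consider "\<bar>f a\<bar> \<le> 9 / 10 * M" "M \<le> 4 * max3 (f b) (f c) (f d)" | "\<bar>f b\<bar> \<le> 9 / 10 * M" "M \<le> 4 * max3 (f a) (f c) (f d)" | "\<bar>f c\<bar> \<le> 9 / 10 * M" "M \<le> 4 * max3 (f a) (f b) (f d)" | "\<bar>f d\<bar> \<le> 9 / 10 * M" "M \<le> 4 * max3 (f a) (f b) (f c)"
      by blast
    then show thesis
    proof cases
      case 1 show thesis by (rule I[of a e b c d]) (simp add: splits_def, use 1 \<open>M = \<bar>f e\<bar>\<close> in blast, rule 1)
    next
      case 2 show thesis by (rule I[of b e a c d]) (simp add: splits_def, use 2 \<open>M = \<bar>f e\<bar>\<close> in blast, rule 2)
    next
      case 3 show thesis by (rule I[of c e a b d]) (simp add: splits_def, use 3 \<open>M = \<bar>f e\<bar>\<close> in blast, rule 3)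
    next
      case 4 show thesis by (rule I[of d e a b c]) (simp add: splits_def, use 4 \<open>M = \<bar>f e\<bar>\<close> in blast, rule 4)
    qed
  qed
qed

lemma pair_kernel_transversal:
  assumes M: "\<bar>fst u\<bar> = M \<and> \<bar>fst v\<bar> \<le> 9 / 10 * M \<or> \<bar>fst v\<bar> = M \<and> \<bar>fst u\<bar> \<le> 9 / 10 * M"
  shows "M / 4 * (modulation (- be) u * modulation (- be) v) \<le> pair_kernel be e (u, v)"
proof -
  \<comment> \<open>The gap \<open>1 - 81 / 100 = 19 / 100\<close> exceeds \<open>1 / 16\<close>,
    the square of the constant 1/4.\<close>
  have g: "M / 4 \<le> sqrt \<bar>x\<^sup>2 - y\<^sup>2\<bar>" if "\<bar>x\<bar> = M" "\<bar>y\<bar> \<le> 9 / 10 * M" for x y :: real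
  proof (rule real_le_rsqrt)
    have "\<bar>y\<bar>\<^sup>2 \<le> (9 / 10 * M)\<^sup>2" using that by (intro power_mono) auto
    moreover have "x\<^sup>2 = M\<^sup>2" using that(1) by auto
    moreover have "(9 / 10 * M)\<^sup>2 = 81 / 100 * M\<^sup>2" "(M / 4)\<^sup>2 = M\<^sup>2 / 16"
      by (simp_all add: power_mult_distrib power_divide)
    moreover have "0 \<le> M\<^sup>2" by simp
    ultimately show "(M / 4)\<^sup>2 \<le> \<bar>x\<^sup>2 - y\<^sup>2\<bar>" unfolding power2_abs by linarith
  qed
  have "M / 4 \<le> sqrt \<bar>(fst u)\<^sup>2 - (fst v)\<^sup>2\<bar>"
    using M g[of "fst u" "fst v"] g[of "fst v" "fst u"] by (auto simp: abs_minus_commute)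
  then have "M / 4 * (modulation (- be) u * modulation (- be) v) \<le> sqrt \<bar>(fst u)\<^sup>2 - (fst v)\<^sup>2\<bar> * (modulation (- be) u * modulation (- be) v)"
    by (intro mult_right_mono) auto
  also have "\<dots> \<le> pair_kernel be e (u, v)" by (simp add: pair_kernel_def)
  finally show ?thesis .
qed

lemma japanese_le_mult:
  assumes "1 \<le> c" "0 \<le> M" "M \<le> c * \<bar>m\<bar>"
  shows "japanese M \<le> c * japanese m"
proof -
  have "japanese M \<le> japanese (c * m)" using assms by (intro japanese_mono) (simp add: abs_mult)
  also have "\<dots> \<le> c * japanese m"
  proof -
    have "1 + \<bar>c * m\<bar>\<^sup>2 \<le> c\<^sup>2 * (1 + \<bar>m\<bar>\<^sup>2)" using assms by (simp add: power_mult_distrib algebra_simps)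
    then have "sqrt (1 + \<bar>c * m\<bar>\<^sup>2) \<le> sqrt (c\<^sup>2 * (1 + \<bar>m\<bar>\<^sup>2))" by (rule real_sqrt_le_mono)
    then show ?thesis using assms by (simp add: japanese_def real_sqrt_mult)
  qed
  finally show ?thesis .
qed

lemma triple_kernel_lower:
  assumes "0 \<le> M" "M \<le> 4 * max3 (fst u) (fst v) (fst w)" "0 < e" "e < 1"
  shows "1 / 4 * japanese M powr ((1 - e) / 2) * (modulation (- be) u * (modulation (- be) v * modulation (- be) w))
    \<le> triple_kernel be e (u, v, w)"
proof -
  let ?m = "max3 (fst u) (fst v) (fst w)"
  have "0 \<le> ?m" by (auto simp: max3_def)
  then have "japanese M powr ((1 - e) / 2) \<le> (4 * japanese ?m) powr ((1 - e) / 2)"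
    using assms by (intro powr_mono2 japanese_le_mult) auto
  also have "\<dots> = 4 powr ((1 - e) / 2) * japanese ?m powr ((1 - e) / 2)" by (simp add: powr_mult)
  also have "\<dots> \<le> 4 powr 1 * japanese ?m powr ((1 - e) / 2)" using assms by (intro mult_right_mono powr_mono) auto
  finally have "1 / 4 * japanese M powr ((1 - e) / 2) \<le> japanese ?m powr ((1 - e) / 2)" by simp
  then show ?thesis unfolding triple_kernel_def prod.case by (intro mult_right_mono) auto
qed

lemma pair_kernel_frequency:
  "japanese (fst u) powr - ((1 + e) / 2) * modulation (- be) u \<le> pair_kernel be e (u, v)"
  "japanese (fst v) powr - ((1 + e) / 2) * modulation (- be) v \<le> pair_kernel be e (u, v)"
  by (auto simp: pair_kernel_def)

text \<open>The exponent splits as \<open>1 + (1 - e) / 2\<close>: a transversal pair is worth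
  \<open>japanese M\<close>, and the triple, which keeps a frequency comparable to \<open>M\<close>,
  the rest. All five modulations are consumed. The 32 is 2 from
  \<open>japanese M \<le> 2 * M\<close> times 4 from each kernel.\<close>

lemma kernel_resonant:
  fixes a b c d z :: "real \<times> real"
  assumes s: "a + b + c + d + z = 0" and M: "M = Max {\<bar>fst a\<bar>, \<bar>fst b\<bar>, \<bar>fst c\<bar>, \<bar>fst d\<bar>, \<bar>fst z\<bar>}"
    and e: "0 < e" "e < 1" and be: "0 \<le> be"
  obtains p t where "(p, t) \<in> set (splits (a, b, c, d, z))"
    "japanese M powr (3 / 2 - e / 2) * (modulation (- be) a * (modulation (- be) b * (modulation (- be) c *
       (modulation (- be) d * modulation (- be) z)))) \<le> 32 * (pair_kernel be e p * triple_kernel be e t)"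
proof -
  have le: "\<bar>fst a\<bar> \<le> M" unfolding M by (rule Max_ge, simp, simp)
  have M0: "0 \<le> M" using le by linarith
  let ?P = "modulation (- be) a * (modulation (- be) b * (modulation (- be) c * (modulation (- be) d * modulation (- be) z)))"
  have s': "fst a + fst b + fst c + fst d + fst z = 0" using arg_cong[OF s, of fst] by simp
  show thesis
  proof (cases "1 \<le> M")
    case True
    obtain u v w x y where *: "((u, v), (w, x, y)) \<in> set (splits (a, b, c, d, z))"
      "\<bar>fst u\<bar> = M \<and> \<bar>fst v\<bar> \<le> 9 / 10 * M \<or> \<bar>fst v\<bar> = M \<and> \<bar>fst u\<bar> \<le> 9 / 10 * M" "M \<le> 4 * max3 (fst w) (fst x) (fst y)"
      by (rule exists_transversal_split[where f = fst, OF s' M]) blast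
    have "japanese M \<le> 2 * M" using japanese_le[of M] True by simp
    moreover have "japanese M powr (3 / 2 - e / 2) = japanese M * japanese M powr ((1 - e) / 2)"
      by (simp add: powr_mult_base algebra_simps diff_divide_distrib)
    ultimately have "japanese M powr (3 / 2 - e / 2) \<le> 2 * M * japanese M powr ((1 - e) / 2)"
      by (metis mult_right_mono powr_ge_zero)
    then have "japanese M powr (3 / 2 - e / 2) * ?P \<le> 2 * M * japanese M powr ((1 - e) / 2) * ?P"
      by (intro mult_right_mono) auto
    also have "\<dots> = 32 * ((M / 4 * (modulation (- be) u * modulation (- be) v)) *
      (1 / 4 * japanese M powr ((1 - e) / 2) * (modulation (- be) w * (modulation (- be) x * modulation (- be) y))))"
      by (simp add: splits_prod[OF *(1), of "modulation (- be)", symmetric])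
    also have "\<dots> \<le> 32 * (pair_kernel be e (u, v) * triple_kernel be e (w, x, y))"
      using M0 by (intro mult_left_mono mult_mono pair_kernel_transversal triple_kernel_lower * e pair_kernel_nonneg) auto
    finally show thesis using that *(1) by blast
  next
    case False
    have j2: "japanese M \<le> 2" using japanese_le[of M] False M0 by simp
    have fa: "\<bar>fst a\<bar> \<le> \<bar>M\<bar>" using le by linarith
    have ja: "japanese (fst a) \<le> 2" using japanese_mono[OF fa] j2 by simp
    \<comment> \<open>For bounded frequencies every splitting works. The summand of the pair kernel
      belonging to \<open>a\<close> is taken and the modulation of \<open>b\<close> is estimated by
      1.\<close>
    have in_splits: "((a, b), (c, d, z)) \<in> set (splits (a, b, c, d, z))" by (simp add: splits_def)
    have "japanese M powr (3 / 2 - e / 2) \<le> 2 powr (3 / 2 - e / 2)" using j2 e by (intro powr_mono2) auto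
    also have "\<dots> \<le> 2 powr 2" using e by (intro powr_mono) auto
    finally have "japanese M powr (3 / 2 - e / 2) \<le> 4" by simp
    then have "japanese M powr (3 / 2 - e / 2) * ?P \<le> 4 * ?P" by (intro mult_right_mono) auto
    also have "\<dots> = 8 * ((1 / 2 * modulation (- be) a) * (modulation (- be) b * (modulation (- be) c * (modulation (- be) d * modulation (- be) z))))"
      by simp
    also have "\<dots> \<le> 8 * ((japanese (fst a) powr - ((1 + e) / 2) * modulation (- be) a) *
       (1 * (modulation (- be) c * (modulation (- be) d * modulation (- be) z))))"
    proof (intro mult_left_mono mult_mono)
      have "2 powr - 1 \<le> 2 powr - ((1 + e) / 2)" using e by (intro powr_mono) auto
      also have "\<dots> \<le> japanese (fst a) powr - ((1 + e) / 2)" using ja e by (intro powr_mono2') auto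
      finally show "1 / 2 \<le> japanese (fst a) powr - ((1 + e) / 2)" by (simp add: powr_minus)
      show "modulation (- be) b \<le> 1" using be by (intro modulation_le_1) simp
    qed auto
    also have "\<dots> \<le> 8 * (pair_kernel be e (a, b) * triple_kernel be e (c, d, z))"
    proof (intro mult_left_mono mult_mono pair_kernel_frequency pair_kernel_nonneg)
      show "1 * (modulation (- be) c * (modulation (- be) d * modulation (- be) z)) \<le> triple_kernel be e (c, d, z)"
        unfolding triple_kernel_def prod.case using e by (intro mult_right_mono ge_one_powr_ge_zero) (auto simp: japanese_ge1)
    qed auto
    also have "\<dots> \<le> 32 * (pair_kernel be e (a, b) * triple_kernel be e (c, d, z))"
      by (intro mult_right_mono mult_nonneg_nonneg pair_kernel_nonneg triple_kernel_nonneg) auto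
    finally show thesis using that in_splits by blast
  qed
qed

text \<open>The left side carries no modulation of \<open>z\<close>, so \<open>z\<close> goes into
  the pair, where the summand of its partner does not see it. The exponent \<open>- e\<close> is the
  sum of the loss \<open>- (1 + e) / 2\<close> in the pair and the gain \<open>(1 - e) / 2\<close>
  in the triple.\<close>

lemma kernel_nonresonant:
  fixes a b c d z :: "real \<times> real"
  assumes s: "a + b + c + d + z = 0" and M: "M = Max {\<bar>fst a\<bar>, \<bar>fst b\<bar>, \<bar>fst c\<bar>, \<bar>fst d\<bar>, \<bar>fst z\<bar>}"
    and e: "0 < e" "e < 1"
  obtains p t where "(p, t) \<in> set (splits (a, b, c, d, z))"
    "japanese M powr - e * (modulation (- be) a * (modulation (- be) b * (modulation (- be) c *
       modulation (- be) d))) \<le> 4 * (pair_kernel be e p * triple_kernel be e t)"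
proof -
  have le: "\<bar>fst a\<bar> \<le> M" "\<bar>fst b\<bar> \<le> M" "\<bar>fst c\<bar> \<le> M" "\<bar>fst d\<bar> \<le> M" "\<bar>fst z\<bar> \<le> M"
    unfolding M by (rule Max_ge, simp, simp)+
  have M0: "0 \<le> M" using le by linarith
  have s': "fst a + fst b + fst c + fst d + fst z = 0" using arg_cong[OF s, of fst] by simp
  have "M \<in> {\<bar>fst a\<bar>, \<bar>fst b\<bar>, \<bar>fst c\<bar>, \<bar>fst d\<bar>, \<bar>fst z\<bar>}" unfolding M by (rule Max_in) auto
  moreover have "\<bar>fst z\<bar> \<le> \<bar>fst a\<bar> + \<bar>fst b\<bar> + \<bar>fst c\<bar> + \<bar>fst d\<bar>" using s' by linarith
  \<comment> \<open>Even if \<open>z\<close> has the largest frequency, one of the other four has at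
    least a quarter of it, as they sum to \<open>- z\<close>. The partner of \<open>z\<close> is
    later chosen so that this one stays in the triple.\<close>
  ultimately have big: "M \<le> 4 * \<bar>fst a\<bar> \<or> M \<le> 4 * \<bar>fst b\<bar> \<or> M \<le> 4 * \<bar>fst c\<bar> \<or> M \<le> 4 * \<bar>fst d\<bar>"
    using M0 by (elim insertE emptyE) linarith+
  have P: "japanese M powr - e * (modulation (- be) j * (modulation (- be) u * (modulation (- be) v * modulation (- be) w)))
     \<le> 4 * (pair_kernel be e (j, z) * triple_kernel be e (u, v, w))"
    if "\<bar>fst j\<bar> \<le> M" "M \<le> 4 * max3 (fst u) (fst v) (fst w)" for j u v w
  proof -
    have "japanese M powr - ((1 + e) / 2) \<le> japanese (fst j) powr - ((1 + e) / 2)"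
      using that(1) e M0 by (intro powr_mono2' japanese_mono) auto
    then have 1: "japanese M powr - ((1 + e) / 2) * modulation (- be) j \<le> pair_kernel be e (j, z)"
      by (intro order_trans[OF _ pair_kernel_frequency(1)] mult_right_mono) auto
    have "japanese M powr - e = japanese M powr - ((1 + e) / 2) * japanese M powr ((1 - e) / 2)"
      by (subst powr_add[symmetric]) (simp add: field_simps)
    then have "japanese M powr - e * (modulation (- be) j * (modulation (- be) u * (modulation (- be) v * modulation (- be) w)))
      = 4 * ((japanese M powr - ((1 + e) / 2) * modulation (- be) j) *
          (1 / 4 * japanese M powr ((1 - e) / 2) * (modulation (- be) u * (modulation (- be) v * modulation (- be) w))))"
      by simp
    also have "\<dots> \<le> 4 * (pair_kernel be e (j, z) * triple_kernel be e (u, v, w))"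
      by (intro mult_left_mono mult_mono 1 triple_kernel_lower that e M0 pair_kernel_nonneg) auto
    finally show ?thesis .
  qed
  have iff: "M \<le> 4 * max3 u v w \<longleftrightarrow> M \<le> 4 * \<bar>u\<bar> \<or> M \<le> 4 * \<bar>v\<bar> \<or> M \<le> 4 * \<bar>w\<bar>" for u v w
    unfolding max3_def by linarith
  from big consider "M \<le> 4 * max3 (fst a) (fst b) (fst c)" | "M \<le> 4 * max3 (fst b) (fst c) (fst d)"
    unfolding iff by blast
  then show thesis
  proof cases
    case 1
    show thesis
      by (rule that[of "(d, z)" "(a, b, c)"]) (use P[OF le(4) 1] in \<open>simp_all add: splits_def mult_ac\<close>)
  next
    case 2
    show thesis
      by (rule that[of "(a, z)" "(b, c, d)"]) (use P[OF le(1) 2] in \<open>simp_all add: splits_def mult_ac\<close>)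
  qed
qed

section \<open>Weights, the bound of the symbol and the multilinear estimates\<close>

definition weight :: "real \<Rightarrow> real \<Rightarrow> real \<times> real \<Rightarrow> real" where
  "weight s b z = japanese (fst z) powr s * modulation b z"

lemma measurable_weight[measurable]:
  assumes [measurable]: "f \<in> borel_measurable M"
  shows "(\<lambda>z. weight s b (f z)) \<in> borel_measurable M"
  unfolding weight_def by measurable

lemma weight_pos[simp]: "0 < weight s b z" "0 \<le> weight s b z" "weight s b z \<noteq> 0"
  by (auto simp: weight_def)

lemma weight_uminus[simp]: "weight s b (- z) = weight s b z"
  by (simp add: weight_def)

lemma weight_inverse: "weight s b z * weight (- s) (- b) z = 1"
  by (simp add: weight_def modulation_def powr_minus field_simps)

lemma japanese_add_le: "japanese (x + y) \<le> 2 * (japanese x * japanese y)"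
proof -
  have "1 + (x + y)\<^sup>2 \<le> 2 * ((1 + x\<^sup>2) * (1 + y\<^sup>2))"
  proof -
    have "0 \<le> (x - y)\<^sup>2" "0 \<le> (x * y)\<^sup>2" by auto
    then show ?thesis by (simp add: power2_eq_square algebra_simps)
  qed
  also have "\<dots> \<le> 4 * ((1 + x\<^sup>2) * (1 + y\<^sup>2))" by (intro mult_right_mono) auto
  finally have "sqrt (1 + (x + y)\<^sup>2) \<le> sqrt (4 * ((1 + x\<^sup>2) * (1 + y\<^sup>2)))" by (rule real_sqrt_le_mono)
  then show ?thesis by (simp only: japanese_def power2_abs real_sqrt_mult) simp
qed

text \<open>For \<open>s \<le> 0\<close> every input weight is at most
  \<open>japanese M powr (- s)\<close>; four of them together with the output
  \<open>1 + s + al\<close> produce \<open>- 3 * s\<close>. For \<open>s > 0\<close> the output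
  bracket is at most 8 times the product of the input brackets, so the regularity costs only a
  constant.\<close>

lemma frequency_weight_bound:
  fixes s al M :: real
  assumes s: "s > - 1 / 6" "0 \<le> al" and z: "x1 + x2 + x3 + x4 + z = 0"
    and M: "\<bar>x1\<bar> \<le> M" "\<bar>x2\<bar> \<le> M" "\<bar>x3\<bar> \<le> M" "\<bar>x4\<bar> \<le> M" "\<bar>z\<bar> \<le> M"
  shows "\<bar>z\<bar> * japanese z powr (s + al) * (japanese x1 powr - s * (japanese x2 powr - s * (japanese x3 powr - s * japanese x4 powr - s)))
    \<le> 8 powr \<bar>s\<bar> * japanese M powr (1 + al - 3 * min 0 s)"
proof -
  have j: "japanese y \<le> japanese M" if "\<bar>y\<bar> \<le> M" for y using that by (intro japanese_mono) linarith
  show ?thesis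
  proof (cases "s \<le> 0")
    case True
    have "\<bar>z\<bar> * japanese z powr (s + al) * (japanese x1 powr - s * (japanese x2 powr - s * (japanese x3 powr - s * japanese x4 powr - s)))
      \<le> japanese z * japanese z powr (s + al) * (japanese M powr - s * (japanese M powr - s * (japanese M powr - s * japanese M powr - s)))"
      using True M by (intro mult_mono order_refl abs_le_japanese powr_mono2 j) auto
    also have "japanese z * japanese z powr (s + al) = japanese z powr (1 + s + al)"
      by (simp add: powr_mult_base add_ac)
    also have "\<dots> \<le> japanese M powr (1 + s + al)" using s M by (intro powr_mono2 j) auto
    also have "japanese M powr (1 + s + al) * (japanese M powr - s * (japanese M powr - s * (japanese M powr - s * japanese M powr - s)))
       = 1 * japanese M powr (1 + al - 3 * min 0 s)"
      using True by (simp add: powr_add[symmetric])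
    also have "\<dots> \<le> 8 powr \<bar>s\<bar> * japanese M powr (1 + al - 3 * min 0 s)"
      by (intro mult_right_mono ge_one_powr_ge_zero) auto
    finally show ?thesis by simp
  next
    case False
    have "japanese z = japanese (- z)" by simp
    also have "- z = x1 + (x2 + (x3 + x4))" using z by simp
    also have "japanese \<dots> \<le> 2 * (japanese x1 * (2 * (japanese x2 * (2 * (japanese x3 * japanese x4)))))"
      by (intro order_trans[OF japanese_add_le] mult_left_mono japanese_add_le) auto
    finally have "japanese z powr s \<le> (8 * (japanese x1 * (japanese x2 * (japanese x3 * japanese x4)))) powr s"
      using False by (intro powr_mono2) (auto simp: mult_ac)
    also have "\<dots> = 8 powr s * (japanese x1 powr s * (japanese x2 powr s * (japanese x3 powr s * japanese x4 powr s)))"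
      by (simp add: powr_mult)
    finally have 1: "japanese z powr s * (japanese x1 powr - s * (japanese x2 powr - s * (japanese x3 powr - s * japanese x4 powr - s))) \<le> 8 powr s"
      by (simp add: powr_minus field_simps)
    have "\<bar>z\<bar> * japanese z powr al \<le> japanese M * japanese M powr al"
      using M s abs_le_japanese[of z] j[OF M(5)] by (intro mult_mono powr_mono2 j) auto
    then have 2: "\<bar>z\<bar> * japanese z powr al \<le> japanese M powr (1 + al)" by (simp add: powr_mult_base)
    have "\<bar>z\<bar> * japanese z powr (s + al) * (japanese x1 powr - s * (japanese x2 powr - s * (japanese x3 powr - s * japanese x4 powr - s)))
      = (japanese z powr s * (japanese x1 powr - s * (japanese x2 powr - s * (japanese x3 powr - s * japanese x4 powr - s)))) * (\<bar>z\<bar> * japanese z powr al)"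
      by (simp add: powr_add)
    also have "\<dots> \<le> 8 powr s * japanese M powr (1 + al)"
      by (intro mult_mono 1 2) auto
    finally show ?thesis using False by simp
  qed
qed

lemma quintic_kernel_bound:
  fixes s b b' al :: real
  assumes s: "s > - 1 / 6" and b: "b > 1 / 2" and b': "b' < 1 / 2" and al: "0 \<le> al" "al < 1 / 2 * (3 * min 0 s + 6 * b' - 5 / 2)"
  obtains be e where "1 / 2 < be" "0 < e" "e < 1"
    "\<And>u1 u2 u3 u4 z. u1 + u2 + u3 + u4 + z = 0 \<Longrightarrow> \<exists>(p, t)\<in>set (splits (u1, u2, u3, u4, z)).
       \<bar>fst z\<bar> * weight (s + al) (- b') z * (weight (- s) (- b) u1 * (weight (- s) (- b) u2 * (weight (- s) (- b) u3 * weight (- s) (- b) u4)))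
        \<le> 8 powr \<bar>s\<bar> * 32 * (pair_kernel be e p * triple_kernel be e t)"
proof -
  define s0 where "s0 = min 0 s"
  \<comment> \<open>The exponent left when the gain \<open>3 * b'\<close> has paid for derivative
    and regularity. The bound on \<open>al\<close> gives
    \<open>3 * b' > al - 3 / 2 * s0 + 5 / 4\<close>, and
    \<open>5 / 4 - 3 / 2 * s0 \<ge> 1 - 3 * s0\<close> means \<open>s0 \<ge> - 1 / 6\<close>; hence
    \<open>e > 0\<close>.\<close>
  define e where "e = 3 * b' - (1 + al - 3 * s0)"
  have s0: "s0 > - 1 / 6" "s0 \<le> 0" using s by (auto simp: s0_def)
  have e: "0 < e" "e < 1" using al b' s0 unfolding e_def s0_def[symmetric] by (simp_all add: field_simps)
  have b'0: "0 < b'" using e al s0 unfolding e_def by simp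
  \<comment> \<open>Below \<open>b\<close>, so that the input modulations may be weakened to
    exponent \<open>be\<close>, and so close to 1/2 that \<open>3 * be - e\<close> does not exceed
    the power \<open>3 / 2 - e / 2\<close> supplied by the resonant kernel.\<close>
  define be where "be = min b (1 / 2 + e / 6)"
  have be: "1 / 2 < be" "be \<le> b" "3 * be - e \<le> 3 / 2 - e / 2" using b e by (auto simp: be_def min_def)
  have be0: "0 \<le> be" using be by simp
  define C where "C = 8 powr \<bar>s\<bar>"
  have C: "0 < C" by (simp add: C_def)
  show thesis
  proof (rule that[OF be(1) e], unfold C_def[symmetric])
    fix u1 u2 u3 u4 z :: "real \<times> real"
    assume z: "u1 + u2 + u3 + u4 + z = 0"
    define M where "M = Max {\<bar>fst u1\<bar>, \<bar>fst u2\<bar>, \<bar>fst u3\<bar>, \<bar>fst u4\<bar>, \<bar>fst z\<bar>}"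
    have le: "\<bar>fst u1\<bar> \<le> M" "\<bar>fst u2\<bar> \<le> M" "\<bar>fst u3\<bar> \<le> M" "\<bar>fst u4\<bar> \<le> M" "\<bar>fst z\<bar> \<le> M"
      unfolding M_def by (rule Max_ge, simp, simp)+
    have z': "fst u1 + fst u2 + fst u3 + fst u4 + fst z = 0" using arg_cong[OF z, of fst] by simp
    let ?j = "japanese M"
    let ?F = "\<bar>fst z\<bar> * japanese (fst z) powr (s + al) * (japanese (fst u1) powr - s * (japanese (fst u2) powr - s * (japanese (fst u3) powr - s * japanese (fst u4) powr - s)))"
    have F: "?F \<le> C * ?j powr (3 * b' - e)"
    proof -
      have eq: "3 * b' - e = 1 + al - 3 * min 0 s" by (simp add: e_def s0_def)
      show ?thesis unfolding C_def eq by (rule frequency_weight_bound[OF s al(1) z' le])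
    qed
    let ?m = "\<lambda>b. modulation (- b) u1 * (modulation (- b) u2 * (modulation (- b) u3 * modulation (- b) u4))"
    have m: "?m b \<le> ?m be" using be by (intro mult_mono modulation_mono) auto
    let ?L = "\<bar>fst z\<bar> * weight (s + al) (- b') z * (weight (- s) (- b) u1 * (weight (- s) (- b) u2 * (weight (- s) (- b) u3 * weight (- s) (- b) u4)))"
    have L: "?L = ?F * (modulation (- b') z * ?m b)" by (simp add: weight_def mult_ac)
    have j1: "1 \<le> ?j" by (rule japanese_ge1)
    show "\<exists>(p, t)\<in>set (splits (u1, u2, u3, u4, z)). ?L \<le> C * 32 * (pair_kernel be e p * triple_kernel be e t)"
    proof (cases "?j powr 3 \<le> japanese (snd z - fst z ^ 3)")
      \<comment> \<open>The large modulation of \<open>z\<close> is exchanged for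
        \<open>?j powr - (3 * b')\<close>, which cancels the frequency growth and leaves the factor
        \<open>?j powr - e\<close>.\<close>
      case True
      have "modulation (- b') z \<le> (?j powr 3) powr - b'"
        unfolding modulation_def using True b'0 by (intro powr_mono2') auto
      then have mz: "modulation (- b') z \<le> ?j powr - (3 * b')" unfolding powr_powr by simp
      obtain p t where pt: "(p, t) \<in> set (splits (u1, u2, u3, u4, z))" "?j powr - e * ?m be \<le> 4 * (pair_kernel be e p * triple_kernel be e t)"
        by (rule kernel_nonresonant[OF z M_def e]) blast
      have "?L \<le> (C * ?j powr (3 * b' - e)) * (?j powr - (3 * b') * ?m be)"
        unfolding L using C by (intro mult_mono F mz m) auto
      also have "\<dots> = C * ((?j powr (3 * b' - e) * ?j powr - (3 * b')) * ?m be)" by (simp only: mult_ac)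
      also have "?j powr (3 * b' - e) * ?j powr - (3 * b') = ?j powr - e" by (simp add: powr_add[symmetric])
      also have "C * (?j powr - e * ?m be) \<le> C * (4 * (pair_kernel be e p * triple_kernel be e t))"
        using C pt by (intro mult_left_mono) auto
      also have "\<dots> \<le> C * 32 * (pair_kernel be e p * triple_kernel be e t)"
        using C mult_nonneg_nonneg[OF pair_kernel_nonneg triple_kernel_nonneg, of be e p be e t] by simp
      finally show ?thesis using pt(1) by blast
    next
      \<comment> \<open>The exponent of the modulation of \<open>z\<close> is raised from
        \<open>b'\<close> to \<open>be\<close>; the missing power of the bracket is at most
        \<open>?j powr (3 * (be - b'))\<close>.\<close>
      case False
      have "modulation (- b') z = japanese (snd z - fst z ^ 3) powr (be - b') * modulation (- be) z"
        by (simp add: modulation_def powr_add[symmetric])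
      also have "\<dots> \<le> (?j powr 3) powr (be - b') * modulation (- be) z"
        using False be b' by (intro mult_right_mono powr_mono2) auto
      finally have mz: "modulation (- b') z \<le> ?j powr (3 * (be - b')) * modulation (- be) z" unfolding powr_powr .
      obtain p t where pt: "(p, t) \<in> set (splits (u1, u2, u3, u4, z))"
        "?j powr (3 / 2 - e / 2) * (modulation (- be) u1 * (modulation (- be) u2 * (modulation (- be) u3 *
           (modulation (- be) u4 * modulation (- be) z)))) \<le> 32 * (pair_kernel be e p * triple_kernel be e t)"
        using kernel_resonant[OF z M_def e be0] by metis
      have "?L \<le> (C * ?j powr (3 * b' - e)) * ((?j powr (3 * (be - b')) * modulation (- be) z) * ?m be)"
        unfolding L using C by (intro mult_mono F mz m) auto
      also have "\<dots> = C * ((?j powr (3 * b' - e) * ?j powr (3 * (be - b'))) * (?m be * modulation (- be) z))" by (simp only: mult_ac)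
      also have "?j powr (3 * b' - e) * ?j powr (3 * (be - b')) = ?j powr (3 * be - e)"
        by (simp add: powr_add[symmetric] algebra_simps)
      also have "C * (?j powr (3 * be - e) * (?m be * modulation (- be) z)) \<le> C * (?j powr (3 / 2 - e / 2) * (?m be * modulation (- be) z))"
        using C be j1 by (intro mult_left_mono mult_right_mono powr_mono) auto
      also have "\<dots> \<le> C * (32 * (pair_kernel be e p * triple_kernel be e t))"
        using C pt by (intro mult_left_mono) (auto simp: mult_ac)
      finally show ?thesis using pt(1) by (auto simp: mult_ac)
    qed
  qed
qed

lemma ennreal_cancel5:
  fixes a a' :: ennreal
  assumes "a * a' = 1" "b * b' = 1" "c * c' = 1" "d * d' = 1" "e * e' = 1"
  shows "(a * h1) * ((b * h2) * ((c * h3) * ((d * h4) * (e * h5)))) * (k * e' * (a' * (b' * (c' * d')))) = h1 * (h2 * (h3 * (h4 * (k * h5))))"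
proof -
  have "(a * h1) * ((b * h2) * ((c * h3) * ((d * h4) * (e * h5)))) * (k * e' * (a' * (b' * (c' * d'))))
    = (a * a') * ((b * b') * ((c * c') * ((d * d') * (e * e')))) * (h1 * (h2 * (h3 * (h4 * (k * h5)))))"
    by (simp only: mult_ac)
  then show ?thesis by (simp add: assms)
qed

text \<open>Each function is multiplied by its weight and the kernel by the inverse weights, so that
  the pair and triple kernels apply. On the hyperplane the output variable is minus the sum of the
  inputs, hence the reflected \<open>h0\<close>.\<close>

lemma quintic_form_bound:
  fixes s b b' al :: real
  assumes s: "s > - 1 / 6" and b: "b > 1 / 2" and b': "b' < 1 / 2" and al: "0 \<le> al" "al < 1 / 2 * (3 * min 0 s + 6 * b' - 5 / 2)"
  obtains C where "0 < C" "\<And>h1 h2 h3 h4 h0. h1 \<in> borel_measurable borel \<Longrightarrow> h2 \<in> borel_measurable borel \<Longrightarrow> h3 \<in> borel_measurable borel \<Longrightarrow>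
    h4 \<in> borel_measurable borel \<Longrightarrow> h0 \<in> borel_measurable borel \<Longrightarrow>
    (\<integral>\<^sup>+u1. \<integral>\<^sup>+u2. \<integral>\<^sup>+u3. \<integral>\<^sup>+u4. h1 u1 * (h2 u2 * (h3 u3 * (h4 u4 * (ennreal \<bar>fst (u1 + u2 + u3 + u4)\<bar> * h0 (u1 + u2 + u3 + u4)))))
        \<partial>lborel \<partial>lborel \<partial>lborel \<partial>lborel)\<^sup>2
    \<le> ennreal C * ((\<integral>\<^sup>+z. (ennreal (weight s b z) * h1 z)\<^sup>2 \<partial>lborel) * ((\<integral>\<^sup>+z. (ennreal (weight s b z) * h2 z)\<^sup>2 \<partial>lborel) *
       ((\<integral>\<^sup>+z. (ennreal (weight s b z) * h3 z)\<^sup>2 \<partial>lborel) * ((\<integral>\<^sup>+z. (ennreal (weight s b z) * h4 z)\<^sup>2 \<partial>lborel) *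
         (\<integral>\<^sup>+z. (ennreal (weight (- (s + al)) b' z) * h0 z)\<^sup>2 \<partial>lborel)))))"
proof -
  obtain be e where be: "1 / 2 < be" "0 < e" "e < 1" and
    kb: "\<And>u1 u2 u3 u4 z. u1 + u2 + u3 + u4 + z = 0 \<Longrightarrow> \<exists>(p, t)\<in>set (splits (u1, u2, u3, u4, z)).
       \<bar>fst z\<bar> * weight (s + al) (- b') z * (weight (- s) (- b) u1 * (weight (- s) (- b) u2 * (weight (- s) (- b) u3 * weight (- s) (- b) u4)))
        \<le> 8 powr \<bar>s\<bar> * 32 * (pair_kernel be e p * triple_kernel be e t)"
    using quintic_kernel_bound[OF assms] by blast
  let ?k2 = "\<lambda>z. ennreal (pair_kernel be e z)" and ?k3 = "\<lambda>z. ennreal (triple_kernel be e z)"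
  obtain K2 where K2: "K2 < \<infinity>" "\<And>z. (\<integral>\<^sup>+y. (?k2 (y, z - y))\<^sup>2 \<partial>lborel) \<le> K2"
    using nn_integral_pair_kernel[OF be(1,2)] by blast
  obtain K3 where K3: "K3 < \<infinity>" "\<And>z. (\<integral>\<^sup>+u. \<integral>\<^sup>+v. (?k3 (u, v, z - u - v))\<^sup>2 \<partial>lborel \<partial>lborel) \<le> K3"
    using nn_integral_triple_kernel[OF be] by blast
  define c where "c = 8 powr \<bar>s\<bar> * (32::real)"
  have c: "0 < c" by (simp add: c_def)
  define D where "D = 100 * ((ennreal c)\<^sup>2 * (K2 * K3))"
  have D: "D < \<infinity>" using K2 K3 by (auto simp: D_def ennreal_mult_less_top power2_eq_square)
  \<comment> \<open>Adding 1 keeps the constant positive even if \<open>D\<close> vanishes.\<close>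
  obtain C where C: "0 < C" "D \<le> ennreal C"
  proof -
    have "D = ennreal (enn2real D)" using D by simp
    also have "\<dots> \<le> ennreal (enn2real D + 1)" by (intro ennreal_leI) simp
    finally have "D \<le> ennreal (enn2real D + 1)" .
    then show thesis using that[of "enn2real D + 1"] by (simp add: add_nonneg_pos)
  qed
  show thesis
  proof (rule that[OF C(1)])
    fix h1 h2 h3 h4 h0 :: "real \<times> real \<Rightarrow> ennreal"
    assume [measurable]: "h1 \<in> borel_measurable borel" "h2 \<in> borel_measurable borel" "h3 \<in> borel_measurable borel"
      "h4 \<in> borel_measurable borel" "h0 \<in> borel_measurable borel"
    let ?w = "\<lambda>h z. ennreal (weight s b z) * h z"
    let ?wz = "\<lambda>z. ennreal (weight (- (s + al)) b' z) * h0 (- z)"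
    let ?K = "\<lambda>(u1, u2, u3, u4, z). ennreal \<bar>fst z\<bar> * ennreal (weight (s + al) (- b') z) * (ennreal (weight (- s) (- b) u1) *
       (ennreal (weight (- s) (- b) u2) * (ennreal (weight (- s) (- b) u3) * ennreal (weight (- s) (- b) u4))))"
    have Kb: "?K (u1, u2, u3, u4, z) \<le> ennreal c * (\<Sum>i<10. pair_triple ?k2 ?k3 i (u1, u2, u3, u4, z))"
      if "u1 + u2 + u3 + u4 + z = 0" for u1 u2 u3 u4 z
    proof -
      note kz = kb[OF that, folded c_def]
      obtain q where q: "q \<in> set (splits (u1, u2, u3, u4, z))" "case q of (p, t) \<Rightarrow>
        \<bar>fst z\<bar> * weight (s + al) (- b') z * (weight (- s) (- b) u1 * (weight (- s) (- b) u2 * (weight (- s) (- b) u3 * weight (- s) (- b) u4)))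
        \<le> c * (pair_kernel be e p * triple_kernel be e t)" using kz by (rule bexE)
      obtain p t where qpt: "q = (p, t)" by (cases q)
      note pt = q[unfolded qpt prod.case]
      have "?K (u1, u2, u3, u4, z) = ennreal (\<bar>fst z\<bar> * weight (s + al) (- b') z * (weight (- s) (- b) u1 * (weight (- s) (- b) u2 * (weight (- s) (- b) u3 * weight (- s) (- b) u4))))"
        by (simp add: ennreal_mult)
      also have "\<dots> \<le> ennreal (c * (pair_kernel be e p * triple_kernel be e t))" using pt(2) by (rule ennreal_leI)
      also have "\<dots> = ennreal c * (?k2 p * ?k3 t)"
        using c by (simp add: ennreal_mult pair_kernel_nonneg triple_kernel_nonneg)
      also have "\<dots> \<le> ennreal c * (\<Sum>i<10. pair_triple ?k2 ?k3 i (u1, u2, u3, u4, z))"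
        by (intro mult_left_mono splits_le_sum[OF pt(1)]) auto
      finally show ?thesis .
    qed
    have wi: "ennreal (weight s b z) * ennreal (weight (- s) (- b) z) = 1" for s b z
      by (simp add: ennreal_mult'[symmetric] weight_inverse)
    have eq: "(\<integral>\<^sup>+u1. \<integral>\<^sup>+u2. \<integral>\<^sup>+u3. \<integral>\<^sup>+u4. h1 u1 * (h2 u2 * (h3 u3 * (h4 u4 * (ennreal \<bar>fst (u1 + u2 + u3 + u4)\<bar> * h0 (u1 + u2 + u3 + u4)))))
        \<partial>lborel \<partial>lborel \<partial>lborel \<partial>lborel)
      = five_form (\<lambda>(u1, u2, u3, u4, z). ?w h1 u1 * (?w h2 u2 * (?w h3 u3 * (?w h4 u4 * ?wz z))) * ?K (u1, u2, u3, u4, z))"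
    proof -
      have "?w h1 u1 * (?w h2 u2 * (?w h3 u3 * (?w h4 u4 * ?wz z))) * ?K (u1, u2, u3, u4, z)
         = h1 u1 * (h2 u2 * (h3 u3 * (h4 u4 * (ennreal \<bar>fst z\<bar> * h0 (- z)))))" for u1 u2 u3 u4 z
        unfolding prod.case
        by (rule ennreal_cancel5[OF wi wi wi wi wi[of "- (s + al)" b' z, unfolded minus_minus]])
      moreover have "\<bar>fst (- (u1 + u2 + u3 + u4))\<bar> = \<bar>fst (u1 + u2 + u3 + u4)\<bar>" for u1 u2 u3 u4 :: "real \<times> real"
        unfolding fst_uminus by (rule abs_minus_cancel)
      ultimately show ?thesis unfolding five_form_def by (simp only: prod.case minus_minus)
    qed
    have "(\<integral>\<^sup>+u1. \<integral>\<^sup>+u2. \<integral>\<^sup>+u3. \<integral>\<^sup>+u4. h1 u1 * (h2 u2 * (h3 u3 * (h4 u4 * (ennreal \<bar>fst (u1 + u2 + u3 + u4)\<bar> * h0 (u1 + u2 + u3 + u4)))))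
        \<partial>lborel \<partial>lborel \<partial>lborel \<partial>lborel)\<^sup>2 \<le> D * ((\<integral>\<^sup>+z. (?w h1 z)\<^sup>2 \<partial>lborel) * ((\<integral>\<^sup>+z. (?w h2 z)\<^sup>2 \<partial>lborel) * ((\<integral>\<^sup>+z. (?w h3 z)\<^sup>2 \<partial>lborel) *
        ((\<integral>\<^sup>+z. (?w h4 z)\<^sup>2 \<partial>lborel) * (\<integral>\<^sup>+z. (?wz z)\<^sup>2 \<partial>lborel)))))"
      unfolding D_def eq by (rule five_form_majorized[OF _ _ K2(2) K3(2) Kb]) simp_all
    also have "(\<integral>\<^sup>+z. (?wz z)\<^sup>2 \<partial>lborel) = (\<integral>\<^sup>+z. (ennreal (weight (- (s + al)) b' z) * h0 z)\<^sup>2 \<partial>lborel)"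
      using nn_integral_reflect[of "\<lambda>z. (ennreal (weight (- (s + al)) b' z) * h0 z)\<^sup>2" 0] by simp
    also have "D * ((\<integral>\<^sup>+z. (?w h1 z)\<^sup>2 \<partial>lborel) * ((\<integral>\<^sup>+z. (?w h2 z)\<^sup>2 \<partial>lborel) * ((\<integral>\<^sup>+z. (?w h3 z)\<^sup>2 \<partial>lborel) *
        ((\<integral>\<^sup>+z. (?w h4 z)\<^sup>2 \<partial>lborel) * (\<integral>\<^sup>+z. (ennreal (weight (- (s + al)) b' z) * h0 z)\<^sup>2 \<partial>lborel)))))
      \<le> ennreal C * ((\<integral>\<^sup>+z. (?w h1 z)\<^sup>2 \<partial>lborel) * ((\<integral>\<^sup>+z. (?w h2 z)\<^sup>2 \<partial>lborel) * ((\<integral>\<^sup>+z. (?w h3 z)\<^sup>2 \<partial>lborel) *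
        ((\<integral>\<^sup>+z. (?w h4 z)\<^sup>2 \<partial>lborel) * (\<integral>\<^sup>+z. (ennreal (weight (- (s + al)) b' z) * h0 z)\<^sup>2 \<partial>lborel)))))"
      by (intro mult_right_mono C(2)) simp
    finally show "(\<integral>\<^sup>+u1. \<integral>\<^sup>+u2. \<integral>\<^sup>+u3. \<integral>\<^sup>+u4. h1 u1 * (h2 u2 * (h3 u3 * (h4 u4 * (ennreal \<bar>fst (u1 + u2 + u3 + u4)\<bar> * h0 (u1 + u2 + u3 + u4)))))
        \<partial>lborel \<partial>lborel \<partial>lborel \<partial>lborel)\<^sup>2
    \<le> ennreal C * ((\<integral>\<^sup>+z. (?w h1 z)\<^sup>2 \<partial>lborel) * ((\<integral>\<^sup>+z. (?w h2 z)\<^sup>2 \<partial>lborel) *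
       ((\<integral>\<^sup>+z. (?w h3 z)\<^sup>2 \<partial>lborel) * ((\<integral>\<^sup>+z. (?w h4 z)\<^sup>2 \<partial>lborel) *
         (\<integral>\<^sup>+z. (ennreal (weight (- (s + al)) b' z) * h0 z)\<^sup>2 \<partial>lborel)))))" .
  qed
qed

text \<open>Without a derivative to pay for, the triple kernel alone suffices: three input weights
  grow at most like the power \<open>- 3 * min 0 s\<close> of the largest frequency, which lies
  below 1/2 for \<open>s > - 1 / 6\<close>.\<close>

lemma trilinear_L2_bound:
  fixes s b :: real
  assumes s: "s > - 1 / 6" and b: "b > 1 / 2"
  obtains C where "C < \<infinity>" "\<And>h1 h2 h3. h1 \<in> borel_measurable borel \<Longrightarrow> h2 \<in> borel_measurable borel \<Longrightarrow> h3 \<in> borel_measurable borel \<Longrightarrow>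
    (\<integral>\<^sup>+z. (\<integral>\<^sup>+u. \<integral>\<^sup>+v. h1 u * h2 v * h3 (z - u - v) \<partial>lborel \<partial>lborel)\<^sup>2 \<partial>lborel)
    \<le> C * ((\<integral>\<^sup>+z. (ennreal (weight s b z) * h1 z)\<^sup>2 \<partial>lborel) * (\<integral>\<^sup>+z. (ennreal (weight s b z) * h2 z)\<^sup>2 \<partial>lborel) *
       (\<integral>\<^sup>+z. (ennreal (weight s b z) * h3 z)\<^sup>2 \<partial>lborel))"
proof -
  \<comment> \<open>The condition \<open>- 3 * min 0 s \<le> (1 - e) / 2\<close> holds up to
    \<open>e = 1 + 6 * min 0 s\<close>; the cap 1/2 keeps \<open>e\<close> below 1.\<close>
  define e where "e = min (1 / 2) (1 + 6 * min 0 s)"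
  have e: "0 < e" "e < 1" using s by (auto simp: e_def)
  obtain K where K: "K < \<infinity>" "\<And>z. (\<integral>\<^sup>+u. \<integral>\<^sup>+v. (ennreal (triple_kernel b e (u, v, z - u - v)))\<^sup>2 \<partial>lborel \<partial>lborel) \<le> K"
    using nn_integral_triple_kernel[OF b e] by blast
  show thesis
  proof (rule that[OF K(1)])
    fix h1 h2 h3 :: "real \<times> real \<Rightarrow> ennreal"
    assume [measurable]: "h1 \<in> borel_measurable borel" "h2 \<in> borel_measurable borel" "h3 \<in> borel_measurable borel"
    let ?w = "\<lambda>h z. ennreal (weight s b z) * h z"
    have k: "weight (- s) (- b) u * (weight (- s) (- b) v * weight (- s) (- b) w) \<le> triple_kernel b e (u, v, w)" for u v w
    proof -
      let ?m = "max3 (fst u) (fst v) (fst w)"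
      have j: "japanese x powr - s \<le> japanese ?m powr - (min 0 s)" if "\<bar>x\<bar> \<le> ?m" for x
      proof -
        have "japanese x powr - s \<le> japanese x powr - (min 0 s)" by (intro powr_mono) (auto simp: japanese_ge1)
        also have "\<dots> \<le> japanese ?m powr - (min 0 s)" using that by (intro powr_mono2 japanese_mono) auto
        finally show ?thesis .
      qed
      have "japanese (fst u) powr - s * (japanese (fst v) powr - s * japanese (fst w) powr - s)
        \<le> japanese ?m powr - (min 0 s) * (japanese ?m powr - (min 0 s) * japanese ?m powr - (min 0 s))"
        by (intro mult_mono j) (auto simp: max3_def)
      also have "\<dots> = japanese ?m powr - (3 * min 0 s)" by (simp add: powr_add[symmetric])
      also have "\<dots> \<le> japanese ?m powr ((1 - e) / 2)"
        by (intro powr_mono) (auto simp: japanese_ge1 e_def min_def field_simps)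
      finally have "(japanese (fst u) powr - s * (japanese (fst v) powr - s * japanese (fst w) powr - s)) *
          (modulation (- b) u * (modulation (- b) v * modulation (- b) w))
        \<le> japanese ?m powr ((1 - e) / 2) * (modulation (- b) u * (modulation (- b) v * modulation (- b) w))"
        by (intro mult_right_mono) auto
      then show ?thesis by (simp add: weight_def triple_kernel_def mult_ac)
    qed
    have "h1 u * h2 v * h3 w \<le> ?w h1 u * ?w h2 v * ?w h3 w * ennreal (triple_kernel b e (u, v, w))" for u v w
    proof -
      have wi: "ennreal (weight s b z) * ennreal (weight (- s) (- b) z) = 1" for z
        by (simp add: ennreal_mult'[symmetric] weight_inverse)
      have "h1 u * h2 v * h3 w = (ennreal (weight s b u) * ennreal (weight (- s) (- b) u)) *
         ((ennreal (weight s b v) * ennreal (weight (- s) (- b) v)) * (ennreal (weight s b w) * ennreal (weight (- s) (- b) w))) * (h1 u * h2 v * h3 w)"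
        unfolding wi by simp
      also have "\<dots> = ?w h1 u * ?w h2 v * ?w h3 w * (ennreal (weight (- s) (- b) u) * (ennreal (weight (- s) (- b) v) * ennreal (weight (- s) (- b) w)))"
        by (simp only: mult_ac)
      also have "ennreal (weight (- s) (- b) u) * (ennreal (weight (- s) (- b) v) * ennreal (weight (- s) (- b) w)) =
         ennreal (weight (- s) (- b) u * (weight (- s) (- b) v * weight (- s) (- b) w))"
        by (simp add: ennreal_mult)
      also have "?w h1 u * ?w h2 v * ?w h3 w * \<dots> \<le> ?w h1 u * ?w h2 v * ?w h3 w * ennreal (triple_kernel b e (u, v, w))"
        by (intro mult_left_mono ennreal_leI k) simp
      finally show ?thesis .
    qed
    then have "(\<integral>\<^sup>+z. (\<integral>\<^sup>+u. \<integral>\<^sup>+v. h1 u * h2 v * h3 (z - u - v) \<partial>lborel \<partial>lborel)\<^sup>2 \<partial>lborel)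
      \<le> (\<integral>\<^sup>+z. (\<integral>\<^sup>+u. \<integral>\<^sup>+v. ?w h1 u * ?w h2 v * ?w h3 (z - u - v) * ennreal (triple_kernel b e (u, v, z - u - v)) \<partial>lborel \<partial>lborel)\<^sup>2 \<partial>lborel)"
      by (intro nn_integral_mono power_mono) auto
    also have "\<dots> \<le> K * ((\<integral>\<^sup>+z. (?w h1 z)\<^sup>2 \<partial>lborel) * (\<integral>\<^sup>+z. (?w h2 z)\<^sup>2 \<partial>lborel) * (\<integral>\<^sup>+z. (?w h3 z)\<^sup>2 \<partial>lborel))"
      by (rule trilinear_convolution_L2[OF _ _ _ _ K(2)]) simp_all
    finally show "(\<integral>\<^sup>+z. (\<integral>\<^sup>+u. \<integral>\<^sup>+v. h1 u * h2 v * h3 (z - u - v) \<partial>lborel \<partial>lborel)\<^sup>2 \<partial>lborel)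
      \<le> K * ((\<integral>\<^sup>+z. (?w h1 z)\<^sup>2 \<partial>lborel) * (\<integral>\<^sup>+z. (?w h2 z)\<^sup>2 \<partial>lborel) * (\<integral>\<^sup>+z. (?w h3 z)\<^sup>2 \<partial>lborel))" .
  qed
qed

section \<open>Fourier analysis in the plane\<close>

lemma lborel_Fubini:
  fixes f :: "'a::euclidean_space \<times> 'b::euclidean_space \<Rightarrow> 'c::{banach, second_countable_topology}"
  assumes "integrable lborel f"
  shows lborel_Fubini_fst: "(LINT x|lborel. LINT y|lborel. f (x, y)) = (LINT z|lborel. f z)"
    and lborel_Fubini_snd: "(LINT y|lborel. LINT x|lborel. f (x, y)) = (LINT z|lborel. f z)"
    and lborel_Fubini_integrable_fst: "integrable lborel (\<lambda>x. LINT y|lborel. f (x, y))"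
    and lborel_Fubini_integrable_snd: "integrable lborel (\<lambda>y. LINT x|lborel. f (x, y))"
proof -
  have i: "integrable (lborel \<Otimes>\<^sub>M lborel) f" using assms by (simp add: lborel_prod)
  have i': "integrable (lborel \<Otimes>\<^sub>M lborel) (\<lambda>(x, y). f (x, y))" using i by simp
  show "(LINT x|lborel. LINT y|lborel. f (x, y)) = (LINT z|lborel. f z)"
    using lborel_pair.integral_fst'[OF i] by (simp add: lborel_prod)
  show "(LINT y|lborel. LINT x|lborel. f (x, y)) = (LINT z|lborel. f z)"
    using lborel_pair.integral_snd[OF i'] by (simp add: lborel_prod)
  show "integrable lborel (\<lambda>x. LINT y|lborel. f (x, y))" by (rule lborel_pair.integrable_fst'[OF i])
  show "integrable lborel (\<lambda>y. LINT x|lborel. f (x, y))" by (rule lborel_pair.integrable_snd[OF i'])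
qed

lemma integrable_plane_iff:
  fixes f :: "'a::euclidean_space \<times> 'b::euclidean_space \<Rightarrow> 'c::{banach, second_countable_topology}"
  assumes [measurable]: "f \<in> borel_measurable borel"
  shows "integrable lborel f \<longleftrightarrow> (\<integral>\<^sup>+x. \<integral>\<^sup>+y. ennreal (norm (f (x, y))) \<partial>lborel \<partial>lborel) < \<infinity>"
  by (simp add: integrable_iff_bounded nn_integral_plane)

lemma integral_translate:
  fixes f :: "'a::euclidean_space \<Rightarrow> 'c::{banach, second_countable_topology}"
  assumes [measurable]: "f \<in> borel_measurable borel"
  shows "(LINT x|lborel. f (c + x)) = (LINT x|lborel. f x)"
  by (subst (2) lborel_distr_plus[of c, symmetric]) (simp add: integral_distr)

lemma integral_reflect:
  fixes f :: "'a::euclidean_space \<Rightarrow> 'c::{banach, second_countable_topology}"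
  assumes [measurable]: "f \<in> borel_measurable borel"
  shows "(LINT x|lborel. f (c - x)) = (LINT x|lborel. f x)"
proof -
  have "(LINT x|lborel. f x) = (LINT x|lborel. f (c + x))"
    by (rule integral_translate[symmetric]) fact
  also have "\<dots> = (LINT x|lborel. f (c + - x))"
    by (subst lborel_distr_uminus_euclidean[symmetric]) (simp add: integral_distr)
  finally show ?thesis by simp
qed

lemma integrable_translate:
  fixes f :: "'a::euclidean_space \<Rightarrow> 'c::{banach, second_countable_topology}"
  assumes "integrable lborel f"
  shows "integrable lborel (\<lambda>x. f (c + x))"
proof -
  have [measurable]: "f \<in> borel_measurable borel" using assms by auto
  show ?thesis using assms nn_integral_translate[of "\<lambda>x. ennreal (norm (f x))" c]
    by (simp add: integrable_iff_bounded)
qed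

lemma integrable_reflect:
  fixes f :: "'a::euclidean_space \<Rightarrow> 'c::{banach, second_countable_topology}"
  assumes "integrable lborel f"
  shows "integrable lborel (\<lambda>x. f (c - x))"
proof -
  have [measurable]: "f \<in> borel_measurable borel" using assms by auto
  show ?thesis using assms nn_integral_reflect[of "\<lambda>x. ennreal (norm (f x))" c]
    by (simp add: integrable_iff_bounded)
qed

lemma borel_measurable_cis[measurable (raw)]:
  "f \<in> borel_measurable M \<Longrightarrow> (\<lambda>x. cis (f x)) \<in> borel_measurable M"
  unfolding cis_conv_exp by measurable

text \<open>Unnormalised: the factor \<open>1 / (2 * pi)^2\<close> of the inverse transform in the
  plane is carried separately.\<close>

definition inv_fourier :: "(real \<times> real \<Rightarrow> complex) \<Rightarrow> real \<times> real \<Rightarrow> complex" where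
  "inv_fourier h z = (LINT w|lborel. cis (z \<bullet> w) * h w)"

lemma fourier_eq_inv_fourier: "fourier f z = (LINT w|lborel. cis (- (z \<bullet> w)) * f w)"
  by (simp add: fourier_def case_prod_beta' cis_conv_exp inner_prod_def algebra_simps)

lemma fourier_inv_fourier_reflect: 
  assumes [measurable]: "f \<in> borel_measurable borel"
  shows "fourier f z = inv_fourier (\<lambda>w. f (- w)) z"
  using integral_reflect[of "\<lambda>w. cis (- (z \<bullet> w)) * f w" 0]
  by (simp add: fourier_eq_inv_fourier inv_fourier_def)

lemma measurable_inv_fourier[measurable]:
  assumes [measurable]: "h \<in> borel_measurable borel"
  shows "inv_fourier h \<in> borel_measurable borel"
  unfolding inv_fourier_def by measurable

lemma integrable_cis_mult:
  fixes h :: "'a::euclidean_space \<Rightarrow> complex"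
  assumes "integrable lborel h" and [measurable]: "g \<in> borel_measurable borel"
  shows "integrable lborel (\<lambda>w. cis (g w) * h w)"
  by (rule Bochner_Integration.integrable_bound[OF assms(1)]) (use assms in \<open>auto simp: norm_mult\<close>)

lemma norm_inv_fourier_le:
  assumes "integrable lborel h"
  shows "norm (inv_fourier h z) \<le> (LINT w|lborel. norm (h w))"
  unfolding inv_fourier_def by (rule order_trans[OF integral_norm_bound]) (simp add: norm_mult)

definition convolve :: "(real \<times> real \<Rightarrow> complex) \<Rightarrow> (real \<times> real \<Rightarrow> complex) \<Rightarrow> real \<times> real \<Rightarrow> complex" where
  "convolve f g w = (LINT y|lborel. f y * g (w - y))"

lemma measurable_convolve[measurable]:
  assumes [measurable]: "f \<in> borel_measurable borel" "g \<in> borel_measurable borel"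
  shows "convolve f g \<in> borel_measurable borel"
  unfolding convolve_def by measurable

lemma
  assumes f: "integrable lborel f" and g: "integrable lborel g"
  shows integrable_convolve: "integrable lborel (convolve f g)"
    and inv_fourier_convolve: "inv_fourier (convolve f g) z = inv_fourier f z * inv_fourier g z"
proof -
  have [measurable]: "f \<in> borel_measurable borel" "g \<in> borel_measurable borel" using f g by auto
  have nn: "(\<integral>\<^sup>+w. \<integral>\<^sup>+y. ennreal (norm (f y)) * ennreal (norm (g (w - y))) \<partial>lborel \<partial>lborel) < \<infinity>"
  proof -
    have "(\<integral>\<^sup>+w. \<integral>\<^sup>+y. ennreal (norm (f y)) * ennreal (norm (g (w - y))) \<partial>lborel \<partial>lborel)
      = (\<integral>\<^sup>+y. \<integral>\<^sup>+w. ennreal (norm (f y)) * ennreal (norm (g w)) \<partial>lborel \<partial>lborel)"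
      by (rule nn_integral_convolution_swap[of "\<lambda>y w. ennreal (norm (f y)) * ennreal (norm (g w))"]) measurable
    also have "\<dots> = (\<integral>\<^sup>+y. ennreal (norm (f y)) \<partial>lborel) * (\<integral>\<^sup>+w. ennreal (norm (g w)) \<partial>lborel)"
      by (simp add: nn_integral_cmult nn_integral_multc)
    also have "\<dots> < \<infinity>" using f g by (auto simp: integrable_iff_bounded ennreal_mult_less_top)
    finally show ?thesis .
  qed
  let ?F = "\<lambda>(w, y). f y * g (w - y)"
  have F: "integrable lborel ?F"
    using nn by (subst integrable_plane_iff) (simp_all add: case_prod_beta' norm_mult ennreal_mult)
  show "integrable lborel (convolve f g)"
    unfolding convolve_def using lborel_Fubini_integrable_fst[OF F] by simp
  let ?G = "\<lambda>(w, y). cis (z \<bullet> w) * (f y * g (w - y))"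
  have G: "integrable lborel ?G"
    using nn by (subst integrable_plane_iff) (simp_all add: case_prod_beta' norm_mult ennreal_mult)
  have "inv_fourier (convolve f g) z = (LINT w|lborel. LINT y|lborel. ?G (w, y))"
    by (simp add: inv_fourier_def convolve_def)
  also have "\<dots> = (LINT y|lborel. LINT w|lborel. ?G (w, y))"
    using lborel_Fubini_fst[OF G] lborel_Fubini_snd[OF G] by simp
  also have "\<dots> = (LINT y|lborel. cis (z \<bullet> y) * f y * inv_fourier g z)"
  proof (rule Bochner_Integration.integral_cong[OF refl])
    fix y
    have "(LINT w|lborel. ?G (w, y)) = (LINT w|lborel. ?G (y + w, y))"
      by (rule integral_translate[symmetric]) simp
    also have "\<dots> = (LINT w|lborel. (cis (z \<bullet> y) * f y) * (cis (z \<bullet> w) * g w))"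
      by (simp add: inner_add_right cis_mult[symmetric] mult_ac)
    finally show "(LINT w|lborel. ?G (w, y)) = cis (z \<bullet> y) * f y * inv_fourier g z"
      by (simp add: inv_fourier_def)
  qed
  also have "\<dots> = inv_fourier f z * inv_fourier g z" by (simp add: inv_fourier_def)
  finally show "inv_fourier (convolve f g) z = inv_fourier f z * inv_fourier g z" .
qed

text \<open>The kernel \<open>cis (z \<bullet> w)\<close> is symmetric, so Fubini moves the
  transform from one factor to the other. This passes between the physical and the frequency side
  without any inversion theorem.\<close>

lemma inv_fourier_multiplication:
  assumes f: "integrable lborel f" and g: "integrable lborel g"
  shows "(LINT z|lborel. inv_fourier f z * g z) = (LINT w|lborel. f w * inv_fourier g w)"
proof -
  have [measurable]: "f \<in> borel_measurable borel" "g \<in> borel_measurable borel" using f g by auto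
  let ?F = "\<lambda>(z, w). cis (z \<bullet> w) * f w * g z"
  have F: "integrable lborel ?F"
  proof (subst integrable_plane_iff)
    have "(\<integral>\<^sup>+x. \<integral>\<^sup>+y. ennreal (norm (?F (x, y))) \<partial>lborel \<partial>lborel)
      = (\<integral>\<^sup>+x. ennreal (norm (f x)) \<partial>lborel) * (\<integral>\<^sup>+x. ennreal (norm (g x)) \<partial>lborel)"
      by (simp add: norm_mult ennreal_mult nn_integral_cmult nn_integral_multc)
    then show "(\<integral>\<^sup>+x. \<integral>\<^sup>+y. ennreal (norm (?F (x, y))) \<partial>lborel \<partial>lborel) < \<infinity>"
      using f g by (auto simp: integrable_iff_bounded ennreal_mult_less_top)
  qed (simp add: case_prod_beta')
  have "(LINT z|lborel. inv_fourier f z * g z) = (LINT z|lborel. LINT w|lborel. ?F (z, w))"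
    by (simp add: inv_fourier_def)
  also have "\<dots> = (LINT w|lborel. LINT z|lborel. ?F (z, w))"
    using lborel_Fubini_fst[OF F] lborel_Fubini_snd[OF F] by simp
  also have "\<dots> = (LINT w|lborel. LINT z|lborel. f w * (cis (w \<bullet> z) * g z))"
    by (simp add: inner_commute mult_ac)
  finally show ?thesis by (simp add: inv_fourier_def)
qed

section \<open>Gaussians, inversion at a point and the Plancherel inequality\<close>

definition gauss :: "real \<Rightarrow> real \<times> real \<Rightarrow> real" where
  "gauss c z = exp (- c * (norm z)\<^sup>2 / 2)"

lemma gauss_bounds: "0 < gauss c z" "0 \<le> c \<Longrightarrow> gauss c z \<le> 1"
  by (auto simp: gauss_def)

lemma measurable_gauss[measurable]: "gauss c \<in> borel_measurable borel"
  unfolding gauss_def by measurable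

text \<open>Scaling by \<open>sqrt c\<close> reduces the integral to the characteristic function of
  the standard normal distribution.\<close>

lemma gauss_1d:
  fixes c t :: real
  assumes c: "0 < c"
  shows "integrable lborel (\<lambda>x. exp (- c * x\<^sup>2 / 2))"
    and "(LINT x|lborel. cis (t * x) * of_real (exp (- c * x\<^sup>2 / 2))) = of_real (sqrt (2 * pi / c) * exp (- t\<^sup>2 / (2 * c)))"
proof -
  let ?s = "sqrt c"
  have s: "?s > 0" "?s \<noteq> 0" "?s\<^sup>2 = c" using c by auto
  have i: "integrable lborel (\<lambda>x::real. exp (- x\<^sup>2 / 2))"
  proof -
    have "integrable lborel (\<lambda>x. 1 / sqrt (2 * pi) * exp (- x\<^sup>2 / 2))"
      using integrable_std_normal_distribution_moment[of 0]
      by (subst (asm) integrable_density) (auto simp: std_normal_density_def)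
    then have "integrable lborel (\<lambda>x. sqrt (2 * pi) * (1 / sqrt (2 * pi) * exp (- x\<^sup>2 / 2)))"
      by (rule integrable_mult_right)
    then show ?thesis by simp
  qed
  have sq: "(?s * x)\<^sup>2 = c * x\<^sup>2" for x using s by (simp add: power_mult_distrib)
  show "integrable lborel (\<lambda>x. exp (- c * x\<^sup>2 / 2))"
    using lborel_integrable_real_affine[OF i s(2), of 0] by (simp add: sq)
  have "char std_normal_distribution (t / ?s) = complex_of_real (exp (- ((t / ?s)\<^sup>2) / 2))"
    by (simp add: char_std_normal_distribution)
  moreover have "char std_normal_distribution (t / ?s) = (LINT x|lborel. (1 / sqrt (2 * pi) * exp (- x\<^sup>2 / 2)) *\<^sub>R cis (t / ?s * x))"
    unfolding char_def
    by (subst integral_density) (auto simp: std_normal_density_def cis_conv_exp)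
  ultimately have "(LINT x|lborel. (1 / sqrt (2 * pi) * exp (- x\<^sup>2 / 2)) *\<^sub>R cis (t / ?s * x)) = of_real (exp (- ((t / ?s)\<^sup>2) / 2))"
    by simp
  also have "(LINT x|lborel. (1 / sqrt (2 * pi) * exp (- x\<^sup>2 / 2)) *\<^sub>R cis (t / ?s * x))
    = \<bar>?s\<bar> *\<^sub>R (LINT x|lborel. (1 / sqrt (2 * pi) * exp (- (0 + ?s * x)\<^sup>2 / 2)) *\<^sub>R cis (t / ?s * (0 + ?s * x)))"
    by (rule lborel_integral_real_affine) (use s in auto)
  also have "\<dots> = (LINT x|lborel. (?s / sqrt (2 * pi)) *\<^sub>R (cis (t * x) * of_real (exp (- c * x\<^sup>2 / 2))))"
    using s c by (simp add: power_mult_distrib scaleR_conv_of_real mult_ac)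
  also have "\<dots> = (?s / sqrt (2 * pi)) *\<^sub>R (LINT x|lborel. cis (t * x) * of_real (exp (- c * x\<^sup>2 / 2)))" by simp
  finally have "of_real (?s / sqrt (2 * pi)) * (LINT x|lborel. cis (t * x) * of_real (exp (- c * x\<^sup>2 / 2))) = complex_of_real (exp (- ((t / ?s)\<^sup>2) / 2))"
    by (simp add: scaleR_conv_of_real)
  then have "(LINT x|lborel. cis (t * x) * of_real (exp (- c * x\<^sup>2 / 2))) = of_real (sqrt (2 * pi) / ?s) * complex_of_real (exp (- ((t / ?s)\<^sup>2) / 2))"
    using s by (simp add: field_simps)
  also have "\<dots> = of_real (sqrt (2 * pi / c) * exp (- t\<^sup>2 / (2 * c)))"
    using s c by (simp add: real_sqrt_divide power_divide)
  finally show "(LINT x|lborel. cis (t * x) * of_real (exp (- c * x\<^sup>2 / 2))) = of_real (sqrt (2 * pi / c) * exp (- t\<^sup>2 / (2 * c)))" .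
qed

lemma gauss_split: "gauss c (x, t) = exp (- c * x\<^sup>2 / 2) * exp (- c * t\<^sup>2 / 2)"
proof -
  have "- c * (norm (x, t))\<^sup>2 / 2 = - c * x\<^sup>2 / 2 + - c * t\<^sup>2 / 2" by (simp add: norm_prod_def field_simps)
  then show ?thesis unfolding gauss_def by (simp only: exp_add)
qed

lemma integrable_gauss:
  assumes c: "0 < c"
  shows "integrable lborel (gauss c)"
proof (subst integrable_plane_iff)
  let ?e = "\<lambda>x::real. exp (- c * x\<^sup>2 / 2)"
  have "(\<integral>\<^sup>+x. \<integral>\<^sup>+y. ennreal (norm (gauss c (x, y))) \<partial>lborel \<partial>lborel) = (\<integral>\<^sup>+x. ennreal (?e x) \<partial>lborel) * (\<integral>\<^sup>+x. ennreal (?e x) \<partial>lborel)"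
    unfolding gauss_split by (simp add: ennreal_mult nn_integral_cmult nn_integral_multc)
  then show "(\<integral>\<^sup>+x. \<integral>\<^sup>+y. ennreal (norm (gauss c (x, y))) \<partial>lborel \<partial>lborel) < \<infinity>"
    using gauss_1d(1)[OF c] by (auto simp: integrable_iff_bounded ennreal_mult_less_top)
qed simp

lemma inv_fourier_gauss:
  assumes c: "0 < c"
  shows "inv_fourier (\<lambda>w. of_real (gauss c w)) z = of_real (2 * pi / c * gauss (1 / c) z)"
proof -
  let ?f = "\<lambda>w. cis (z \<bullet> w) * of_real (gauss c w)"
  have i: "integrable lborel ?f"
    by (rule integrable_cis_mult) (use integrable_gauss[OF c] in auto)
  have "inv_fourier (\<lambda>w. of_real (gauss c w)) z = (LINT x|lborel. LINT t|lborel. ?f (x, t))"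
    unfolding inv_fourier_def by (rule lborel_Fubini_fst[OF i, symmetric])
  also have "\<dots> = (LINT x|lborel. LINT t|lborel. (cis (fst z * x) * of_real (exp (- c * x\<^sup>2 / 2))) * (cis (snd z * t) * of_real (exp (- c * t\<^sup>2 / 2))))"
    by (simp add: gauss_split inner_prod_def cis_mult[symmetric] mult_ac)
  also have "\<dots> = of_real (sqrt (2 * pi / c) * exp (- (fst z)\<^sup>2 / (2 * c))) * of_real (sqrt (2 * pi / c) * exp (- (snd z)\<^sup>2 / (2 * c)))"
    by (simp only: integral_mult_right_zero integral_mult_left_zero gauss_1d(2)[OF c])
  also have "\<dots> = of_real ((sqrt (2 * pi / c) * sqrt (2 * pi / c)) * (exp (- (fst z)\<^sup>2 / (2 * c)) * exp (- (snd z)\<^sup>2 / (2 * c))))"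
    by (simp only: of_real_mult mult_ac)
  also have "sqrt (2 * pi / c) * sqrt (2 * pi / c) = 2 * pi / c" using c by simp
  also have "exp (- (fst z)\<^sup>2 / (2 * c)) * exp (- (snd z)\<^sup>2 / (2 * c)) = gauss (1 / c) z"
    using gauss_split[of "1 / c" "fst z" "snd z"] c by (simp add: field_simps)
  finally show ?thesis .
qed

lemma integral_gauss:
  assumes c: "0 < c"
  shows "(LINT w|lborel. gauss c w) = 2 * pi / c"
proof -
  have "complex_of_real (LINT w|lborel. gauss c w) = inv_fourier (\<lambda>w. of_real (gauss c w)) 0"
    by (simp add: inv_fourier_def)
  also have "\<dots> = of_real (2 * pi / c)" unfolding inv_fourier_gauss[OF c] by (simp add: gauss_def)
  finally show ?thesis using of_real_eq_iff by blast
qed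

lemma integral_scale:
  fixes f :: "real \<times> real \<Rightarrow> 'c::{banach, second_countable_topology}"
  assumes [measurable]: "f \<in> borel_measurable borel" and c: "0 < c"
  shows "(LINT w|lborel. f w) = c\<^sup>2 *\<^sub>R (LINT w|lborel. f (c *\<^sub>R w))"
proof -
  have "(LINT w|lborel. f w) = integral\<^sup>L (density (distr lborel borel (\<lambda>x. 0 + c *\<^sub>R x)) (\<lambda>_. \<bar>c\<bar> ^ DIM(real \<times> real))) f"
    using c by (subst lborel_affine[of c 0]) auto
  also have "\<dots> = (LINT x|distr lborel borel (\<lambda>x. 0 + c *\<^sub>R x). (\<bar>c\<bar> ^ DIM(real \<times> real)) *\<^sub>R f x)"
    by (rule integral_density) auto
  also have "\<dots> = (LINT x|lborel. (\<bar>c\<bar> ^ DIM(real \<times> real)) *\<^sub>R f (0 + c *\<^sub>R x))"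
    by (rule integral_distr) auto
  finally show ?thesis by (simp add: power2_eq_square)
qed

text \<open>Gaussian summability: \<open>\<integral> inv_fourier H * gauss \<epsilon> = \<integral> H * (2\<pi>/\<epsilon>) gauss (1/\<epsilon>)\<close> and the right
  hand side is an approximate identity.\<close>

lemma inv_fourier_inversion_0:
  fixes H :: "real \<times> real \<Rightarrow> complex"
  assumes H: "integrable lborel H" and b: "\<And>w. norm (H w) \<le> B" and c: "isCont H 0"
    and iH: "integrable lborel (inv_fourier H)"
  shows "(LINT z|lborel. inv_fourier H z) = (2 * pi)\<^sup>2 * H 0"
proof -
  have [measurable]: "H \<in> borel_measurable borel" using H by auto
  \<comment> \<open>The Gaussian parameter will be \<open>(d n)^2\<close>: scaling by
    \<open>d n\<close> then turns the transformed Gaussian into the fixed \<open>gauss 1\<close>,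
    and only the argument of \<open>H\<close> depends on \<open>n\<close>.\<close>
  define d where "d n = 1 / real (Suc n)" for n
  have d: "0 < d n" for n by (simp add: d_def)
  have d0: "d \<longlonglongrightarrow> 0" unfolding d_def by (rule LIMSEQ_Suc) (rule lim_1_over_n)
  let ?A = "\<lambda>n. LINT z|lborel. inv_fourier H z * of_real (gauss ((d n)\<^sup>2) z)"
  have 1: "?A \<longlonglongrightarrow> (LINT z|lborel. inv_fourier H z * 1)"
  proof (rule integral_dominated_convergence[where w = "\<lambda>z. norm (inv_fourier H z)"])
    show "AE z in lborel. (\<lambda>n. inv_fourier H z * of_real (gauss ((d n)\<^sup>2) z)) \<longlonglongrightarrow> inv_fourier H z * 1"
    proof (intro AE_I2 tendsto_mult tendsto_const)
      fix z
      have "(\<lambda>n. complex_of_real (gauss ((d n)\<^sup>2) z)) \<longlonglongrightarrow> of_real (exp (- (0\<^sup>2) * (norm z)\<^sup>2 / 2))"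
        unfolding gauss_def by (intro tendsto_intros d0) simp
      then show "(\<lambda>n. complex_of_real (gauss ((d n)\<^sup>2) z)) \<longlonglongrightarrow> 1" by simp
    qed
    show "AE z in lborel. norm (inv_fourier H z * of_real (gauss ((d n)\<^sup>2) z)) \<le> norm (inv_fourier H z)" for n
      by (intro AE_I2) (auto simp: norm_mult gauss_bounds less_imp_le intro!: mult_left_le)
  qed (use iH in auto)
  have 2: "?A n = (LINT w|lborel. H (d n *\<^sub>R w) * of_real (2 * pi * gauss 1 w))" for n
  proof -
    have "?A n = (LINT w|lborel. H w * inv_fourier (\<lambda>w. of_real (gauss ((d n)\<^sup>2) w)) w)"
      using d[of n] by (intro inv_fourier_multiplication H) (auto intro!: integrable_gauss)
    also have "\<dots> = (LINT w|lborel. H w * of_real (2 * pi / (d n)\<^sup>2 * gauss (1 / (d n)\<^sup>2) w))"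
      using d[of n] by (subst inv_fourier_gauss) auto
    also have "\<dots> = (d n)\<^sup>2 *\<^sub>R (LINT w|lborel. H (d n *\<^sub>R w) * of_real (2 * pi / (d n)\<^sup>2 * gauss (1 / (d n)\<^sup>2) (d n *\<^sub>R w)))"
      by (rule integral_scale) (use d[of n] in auto)
    also have "\<dots> = (LINT w|lborel. (d n)\<^sup>2 *\<^sub>R (H (d n *\<^sub>R w) * of_real (2 * pi / (d n)\<^sup>2 * gauss (1 / (d n)\<^sup>2) (d n *\<^sub>R w))))"
      by simp
    also have "\<dots> = (LINT w|lborel. H (d n *\<^sub>R w) * of_real (2 * pi * gauss 1 w))"
    proof (rule Bochner_Integration.integral_cong[OF refl])
      fix w :: "real \<times> real"
      have "gauss (1 / (d n)\<^sup>2) (d n *\<^sub>R w) = gauss 1 w" using d[of n] by (simp add: gauss_def power_mult_distrib)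
      then show "(d n)\<^sup>2 *\<^sub>R (H (d n *\<^sub>R w) * of_real (2 * pi / (d n)\<^sup>2 * gauss (1 / (d n)\<^sup>2) (d n *\<^sub>R w))) = H (d n *\<^sub>R w) * of_real (2 * pi * gauss 1 w)"
        using d[of n] by (simp add: scaleR_conv_of_real)
    qed
    finally show ?thesis .
  qed
  have "(\<lambda>n. LINT w|lborel. H (d n *\<^sub>R w) * of_real (2 * pi * gauss 1 w)) \<longlonglongrightarrow> (LINT w|lborel. H 0 * of_real (2 * pi * gauss 1 w))"
  proof (rule integral_dominated_convergence[where w = "\<lambda>w. B * (2 * pi * gauss 1 w)"])
    show "AE w in lborel. (\<lambda>n. H (d n *\<^sub>R w) * of_real (2 * pi * gauss 1 w)) \<longlonglongrightarrow> H 0 * of_real (2 * pi * gauss 1 w)"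
    proof (intro AE_I2 tendsto_mult tendsto_const)
      fix w :: "real \<times> real"
      have "(\<lambda>n. d n *\<^sub>R w) \<longlonglongrightarrow> 0 *\<^sub>R w" by (intro tendsto_intros d0)
      then show "(\<lambda>n. H (d n *\<^sub>R w)) \<longlonglongrightarrow> H 0" by (intro isCont_tendsto_compose[OF c]) simp
    qed
    show "AE w in lborel. norm (H (d n *\<^sub>R w) * of_real (2 * pi * gauss 1 w)) \<le> B * (2 * pi * gauss 1 w)" for n
      by (intro AE_I2) (auto simp: norm_mult gauss_bounds less_imp_le abs_mult intro!: mult_right_mono b)
    show "integrable lborel (\<lambda>w. B * (2 * pi * gauss 1 w))" using integrable_gauss[of 1] by simp
  qed auto
  then have 3: "?A \<longlonglongrightarrow> (LINT w|lborel. H 0 * of_real (2 * pi * gauss 1 w))" unfolding 2 .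
  have "(LINT w|lborel. H 0 * of_real (2 * pi * gauss 1 w)) = H 0 * of_real (LINT w|lborel. 2 * pi * gauss 1 w)"
    by (simp del: of_real_mult)
  also have "(LINT w|lborel. 2 * pi * gauss 1 w) = (2 * pi)\<^sup>2" using integral_gauss[of 1] by (simp add: power2_eq_square)
  finally show ?thesis using LIMSEQ_unique[OF 1 3] by (simp add: mult.commute)
qed

lemma inv_fourier_translate:
  fixes H :: "real \<times> real \<Rightarrow> complex"
  assumes [measurable]: "H \<in> borel_measurable borel"
  shows "inv_fourier (\<lambda>w. H (a + w)) z = cis (- (z \<bullet> a)) * inv_fourier H z"
proof -
  have "inv_fourier H z = (LINT w|lborel. cis (z \<bullet> (a + w)) * H (a + w))"
    unfolding inv_fourier_def by (rule integral_translate[symmetric]) measurable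
  also have "\<dots> = cis (z \<bullet> a) * inv_fourier (\<lambda>w. H (a + w)) z"
    by (simp add: inner_add_right cis_mult[symmetric] inv_fourier_def mult.assoc)
  finally show ?thesis by (simp add: mult.assoc[symmetric] cis_mult)
qed

text \<open>Translating \<open>H\<close> by \<open>a\<close> multiplies its transform by a
  character, so inversion at \<open>a\<close> is inversion at 0.\<close>

lemma fourier_inv_fourier:
  fixes H :: "real \<times> real \<Rightarrow> complex"
  assumes H: "integrable lborel H" and b: "\<And>w. norm (H w) \<le> B" and c: "continuous_on UNIV H"
    and iH: "integrable lborel (inv_fourier H)"
  shows "fourier (inv_fourier H) a = (2 * pi)\<^sup>2 * H a"
proof -
  have [measurable]: "H \<in> borel_measurable borel" using H by auto
  have eq: "inv_fourier (\<lambda>w. H (a + w)) z = cis (- (a \<bullet> z)) * inv_fourier H z" for z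
    by (simp add: inv_fourier_translate inner_commute)
  have "fourier (inv_fourier H) a = (LINT z|lborel. inv_fourier (\<lambda>w. H (a + w)) z)"
    by (simp add: fourier_eq_inv_fourier eq)
  also have "\<dots> = (2 * pi)\<^sup>2 * H (a + 0)"
  proof (rule inv_fourier_inversion_0)
    show "integrable lborel (\<lambda>w. H (a + w))" by (rule integrable_translate[OF H])
    show "norm (H (a + w)) \<le> B" for w by (rule b)
    have "continuous_on UNIV (\<lambda>w. H (a + w))"
      by (rule continuous_on_compose2[OF c]) (auto intro!: continuous_intros)
    then show "isCont (\<lambda>w. H (a + w)) 0" by (simp add: continuous_on_eq_continuous_at del: split_paired_All)
    show "integrable lborel (inv_fourier (\<lambda>w. H (a + w)))"
      unfolding eq by (rule integrable_cis_mult[OF iH]) simp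
  qed
  finally show ?thesis by simp
qed

text \<open>The transform of the autocorrelation \<open>H\<close> of \<open>h\<close> is the squared
  modulus of \<open>inv_fourier h\<close>, and \<open>H\<close> is bounded by the squared
  \<open>L^2\<close> norm of \<open>h\<close>. Gaussian means of that transform are Gaussian
  averages of \<open>H\<close> up to \<open>(2 * pi)^2\<close>; Fatou removes the Gaussian.\<close>

lemma Plancherel_le:
  fixes h :: "real \<times> real \<Rightarrow> complex"
  assumes h: "integrable lborel h"
  shows "(\<integral>\<^sup>+z. (ennreal (norm (inv_fourier h z)))\<^sup>2 \<partial>lborel) \<le> ennreal ((2 * pi)\<^sup>2) * (\<integral>\<^sup>+w. (ennreal (norm (h w)))\<^sup>2 \<partial>lborel)"
proof (cases "(\<integral>\<^sup>+w. (ennreal (norm (h w)))\<^sup>2 \<partial>lborel) = \<infinity>")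
  case True
  then show ?thesis by (simp add: ennreal_mult_top)
next
  case False
  have [measurable]: "h \<in> borel_measurable borel" using h by auto
  obtain A where A: "0 \<le> A" "(\<integral>\<^sup>+w. (ennreal (norm (h w)))\<^sup>2 \<partial>lborel) = ennreal A"
    using False by (cases "\<integral>\<^sup>+w. (ennreal (norm (h w)))\<^sup>2 \<partial>lborel") auto
  let ?h' = "\<lambda>w. cnj (h (- w))"
  have h': "integrable lborel ?h'"
    using integrable_reflect[OF h, of 0] by (auto intro: integrable_cnj)
  define H where "H = convolve h ?h'"
  have H: "integrable lborel H" unfolding H_def by (rule integrable_convolve[OF h h'])
  have [measurable]: "H \<in> borel_measurable borel" using H by auto
  have cnj: "inv_fourier ?h' z = cnj (inv_fourier h z)" for z
  proof -
    have "cnj (inv_fourier h z) = (LINT w|lborel. cnj (cis (z \<bullet> w) * h w))"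
      unfolding inv_fourier_def by (rule Bochner_Integration.integral_cnj[symmetric])
    also have "\<dots> = (LINT w|lborel. cis (z \<bullet> (0 - w)) * cnj (h w))"
      by (simp add: cis_cnj)
    also have "\<dots> = inv_fourier ?h' z"
      using integral_reflect[of "\<lambda>w. cis (z \<bullet> w) * cnj (h (- w))" 0]
        borel_measurable_integrable[OF integrable_cis_mult[OF h', of "\<lambda>w. z \<bullet> w"]]
      by (simp add: inv_fourier_def)
    finally show ?thesis by simp
  qed
  have EH: "inv_fourier H z = of_real ((norm (inv_fourier h z))\<^sup>2)" for z
    unfolding H_def inv_fourier_convolve[OF h h'] cnj by (rule complex_norm_square[symmetric])
  have HA: "norm (H w) \<le> A" for w
  proof -
    have "ennreal (norm (H w)) \<le> (\<integral>\<^sup>+y. ennreal (norm (h y * ?h' (w - y))) \<partial>lborel)"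
      unfolding H_def convolve_def
      by (cases "integrable lborel (\<lambda>y. h y * ?h' (w - y))")
        (auto intro: integral_norm_bound_ennreal simp: not_integrable_integral_eq)
    also have "\<dots> = (\<integral>\<^sup>+y. ennreal (norm (h y)) * ennreal (norm (h (- w + y))) \<partial>lborel)"
      by (simp add: norm_mult ennreal_mult)
    finally have "(ennreal (norm (H w)))\<^sup>2 \<le> (\<integral>\<^sup>+y. ennreal (norm (h y)) * ennreal (norm (h (- w + y))) \<partial>lborel)\<^sup>2"
      by (rule power_mono) simp
    also have "\<dots> \<le> (\<integral>\<^sup>+y. (ennreal (norm (h y)))\<^sup>2 \<partial>lborel) * (\<integral>\<^sup>+y. (ennreal (norm (h (- w + y))))\<^sup>2 \<partial>lborel)"
      by (rule Cauchy_Schwarz_nn_integral) measurable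
    also have "(\<integral>\<^sup>+y. (ennreal (norm (h (- w + y))))\<^sup>2 \<partial>lborel) = ennreal A"
      using nn_integral_translate[of "\<lambda>y. (ennreal (norm (h y)))\<^sup>2" "- w"] A by simp
    finally have "ennreal ((norm (H w))\<^sup>2) \<le> ennreal (A\<^sup>2)"
      using A by (simp add: ennreal_power ennreal_mult'[symmetric] power2_eq_square)
    then have "(norm (H w))\<^sup>2 \<le> A\<^sup>2" using A by simp
    then show ?thesis using A(1) by (rule power2_le_imp_le)
  qed
  define d where "d n = 1 / real (Suc n)" for n
  have d: "0 < d n" for n by (simp add: d_def)
  have d0: "d \<longlonglongrightarrow> 0" unfolding d_def by (rule LIMSEQ_Suc) (rule lim_1_over_n)
  let ?f = "\<lambda>n z. (norm (inv_fourier h z))\<^sup>2 * gauss (d n) z"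
  have le: "(\<integral>\<^sup>+z. ennreal (?f n z) \<partial>lborel) \<le> ennreal ((2 * pi)\<^sup>2 * A)" for n
  proof -
    have i: "integrable lborel (\<lambda>z. inv_fourier H z * of_real (gauss (d n) z))"
    proof (rule Bochner_Integration.integrable_bound)
      show "integrable lborel (\<lambda>z. (LINT w|lborel. norm (H w)) * gauss (d n) z)"
        using integrable_gauss[OF d] by simp
      show "AE z in lborel. norm (inv_fourier H z * of_real (gauss (d n) z)) \<le> norm ((LINT w|lborel. norm (H w)) * gauss (d n) z)"
        using norm_inv_fourier_le[OF H] by (auto simp: norm_mult abs_mult intro!: mult_right_mono)
    qed simp
    have eq: "inv_fourier H z * of_real (gauss (d n) z) = of_real (?f n z)" for z by (simp add: EH)
    have ir: "integrable lborel (?f n)" using i unfolding eq by (simp only: complex_of_real_integrable_eq)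
    have "(\<integral>\<^sup>+z. ennreal (?f n z) \<partial>lborel) = ennreal (LINT z|lborel. ?f n z)"
      by (rule nn_integral_eq_integral[OF ir]) (auto simp: gauss_bounds less_imp_le)
    also have "\<dots> \<le> ennreal ((2 * pi)\<^sup>2 * A)"
    proof (rule ennreal_leI)
      have "complex_of_real (LINT z|lborel. ?f n z) = (LINT z|lborel. inv_fourier H z * of_real (gauss (d n) z))"
        unfolding eq by (rule integral_complex_of_real[symmetric])
      also have "\<dots> = (LINT w|lborel. H w * inv_fourier (\<lambda>w. of_real (gauss (d n) w)) w)"
        by (intro inv_fourier_multiplication H) (use integrable_gauss[OF d] in auto)
      also have "\<dots> = (LINT w|lborel. H w * of_real (2 * pi / d n * gauss (1 / d n) w))"
        by (subst inv_fourier_gauss[OF d]) simp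
      finally have c: "complex_of_real (LINT z|lborel. ?f n z) = (LINT w|lborel. H w * of_real (2 * pi / d n * gauss (1 / d n) w))" .
      have "\<bar>LINT z|lborel. ?f n z\<bar> = norm (LINT w|lborel. H w * of_real (2 * pi / d n * gauss (1 / d n) w))"
        unfolding c[symmetric] norm_of_real ..
      also have "\<dots> \<le> (LINT w|lborel. norm (H w * of_real (2 * pi / d n * gauss (1 / d n) w)))"
        by (rule integral_norm_bound)
      also have "\<dots> \<le> (LINT w|lborel. A * (2 * pi / d n * gauss (1 / d n) w))"
      proof (rule integral_mono_AE')
        show "integrable lborel (\<lambda>w. A * (2 * pi / d n * gauss (1 / d n) w))"
          using integrable_gauss[of "1 / d n"] d[of n] by simp
        show "AE w in lborel. norm (H w * of_real (2 * pi / d n * gauss (1 / d n) w)) \<le> A * (2 * pi / d n * gauss (1 / d n) w)"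
        proof (rule AE_I2)
          fix w
          have r: "0 \<le> 2 * pi / d n * gauss (1 / d n) w" using d[of n] gauss_bounds(1)[of "1 / d n" w] by simp
          show "norm (H w * of_real (2 * pi / d n * gauss (1 / d n) w)) \<le> A * (2 * pi / d n * gauss (1 / d n) w)"
            unfolding norm_mult norm_of_real abs_of_nonneg[OF r] by (rule mult_right_mono[OF HA r])
        qed
      qed (use A d[of n] in \<open>auto simp: gauss_bounds less_imp_le intro!: AE_I2\<close>)
      also have "\<dots> = A * (2 * pi / d n * (LINT w|lborel. gauss (1 / d n) w))" by simp
      also have "\<dots> = (2 * pi)\<^sup>2 * A" using d[of n] by (subst integral_gauss) (auto simp: power2_eq_square)
      finally show "(LINT z|lborel. ?f n z) \<le> (2 * pi)\<^sup>2 * A" by simp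
    qed
    finally show ?thesis .
  qed
  have "(\<integral>\<^sup>+z. (ennreal (norm (inv_fourier h z)))\<^sup>2 \<partial>lborel) = (\<integral>\<^sup>+z. liminf (\<lambda>n. ennreal (?f n z)) \<partial>lborel)"
  proof (rule nn_integral_cong)
    fix z
    have "(\<lambda>n. ?f n z) \<longlonglongrightarrow> (norm (inv_fourier h z))\<^sup>2 * exp (- 0 * (norm z)\<^sup>2 / 2)"
      unfolding gauss_def by (intro tendsto_intros d0) simp
    then have "(\<lambda>n. ennreal (?f n z)) \<longlonglongrightarrow> (ennreal (norm (inv_fourier h z)))\<^sup>2"
      by (auto simp: ennreal_power intro!: tendsto_ennrealI)
    then show "(ennreal (norm (inv_fourier h z)))\<^sup>2 = liminf (\<lambda>n. ennreal (?f n z))"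
      by (intro lim_imp_Liminf[symmetric]) auto
  qed
  also have "\<dots> \<le> liminf (\<lambda>n. \<integral>\<^sup>+z. ennreal (?f n z) \<partial>lborel)"
    by (rule nn_integral_liminf) simp
  also have "\<dots> \<le> ennreal ((2 * pi)\<^sup>2 * A)"
  proof (rule order_trans[OF Liminf_le_Limsup Limsup_bounded])
    show "\<forall>\<^sub>F n in sequentially. (\<integral>\<^sup>+z. ennreal (?f n z) \<partial>lborel) \<le> ennreal ((2 * pi)\<^sup>2 * A)"
      by (intro always_eventually allI le)
  qed simp
  also have "\<dots> = ennreal ((2 * pi)\<^sup>2) * (\<integral>\<^sup>+w. (ennreal (norm (h w)))\<^sup>2 \<partial>lborel)"
    using A by (simp add: ennreal_mult)
  finally show ?thesis .
qed

section \<open>Schwartz functions\<close>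

text \<open>The decay half of \<open>schwartz\<close> for a single function; the other half is
  differentiability of all mixed partials.\<close>

definition rapid :: "(real \<times> real \<Rightarrow> complex) \<Rightarrow> bool" where
  "rapid f \<longleftrightarrow> (\<forall>m. \<exists>B. \<forall>z. (1 + norm z) ^ m * norm (f z) \<le> B)"

lemma rapid_iff_bounded: "rapid f \<longleftrightarrow> (\<forall>m::nat. bounded (range (\<lambda>z. (1 + norm z) ^ m * norm (f z))))"
  unfolding rapid_def bounded_iff by (auto simp: abs_mult)

lemma rapidE:
  assumes "rapid f"
  obtains B where "0 \<le> B" "\<And>z. (1 + norm z) ^ m * norm (f z) \<le> B"
proof -
  obtain B where B: "\<And>z. (1 + norm z) ^ m * norm (f z) \<le> B" using assms unfolding rapid_def by blast
  have "0 \<le> B" using B[of 0] by (rule order_trans[rotated]) simp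
  then show thesis using B that by blast
qed

lemma rapid_add:
  assumes "rapid f" "rapid g" shows "rapid (\<lambda>z. f z + g z)"
  unfolding rapid_def
proof
  fix m
  obtain B1 where B1: "\<And>z. (1 + norm z) ^ m * norm (f z) \<le> B1" using assms unfolding rapid_def by blast
  obtain B2 where B2: "\<And>z. (1 + norm z) ^ m * norm (g z) \<le> B2" using assms unfolding rapid_def by blast
  have "(1 + norm z) ^ m * norm (f z + g z) \<le> B1 + B2" for z
  proof -
    have "(1 + norm z) ^ m * norm (f z + g z) \<le> (1 + norm z) ^ m * (norm (f z) + norm (g z))"
      by (intro mult_left_mono norm_triangle_ineq) simp
    then show ?thesis using B1[of z] B2[of z] by (simp add: distrib_left)
  qed
  then show "\<exists>B. \<forall>z. (1 + norm z) ^ m * norm (f z + g z) \<le> B" by blast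
qed

lemma rapid_growth_mult:
  assumes f: "rapid f" and p: "\<And>z. norm (p z) \<le> C * (1 + norm z) ^ N"
  shows "rapid (\<lambda>z. p z * f z)"
  unfolding rapid_def
proof
  fix m
  obtain B where B: "0 \<le> B" "\<And>z. (1 + norm z) ^ (m + N) * norm (f z) \<le> B"
    by (rule rapidE[OF f, where m = "m + N"]) blast
  have C: "0 \<le> C" using order_trans[OF norm_ge_zero p[of 0]] by simp
  have "(1 + norm z) ^ m * norm (p z * f z) \<le> C * B" for z
  proof -
    have "(1 + norm z) ^ m * norm (p z * f z) \<le> (1 + norm z) ^ m * ((C * (1 + norm z) ^ N) * norm (f z))"
      unfolding norm_mult by (intro mult_left_mono mult_right_mono p) auto
    also have "\<dots> = C * ((1 + norm z) ^ (m + N) * norm (f z))" by (simp add: power_add mult_ac)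
    also have "\<dots> \<le> C * B" using B C by (intro mult_left_mono) auto
    finally show ?thesis .
  qed
  then show "\<exists>B. \<forall>z. (1 + norm z) ^ m * norm (p z * f z) \<le> B" by blast
qed

lemma abs_fst_le_norm: "\<bar>fst z\<bar> \<le> norm z" and abs_snd_le_norm: "\<bar>snd z\<bar> \<le> norm z"
  for z :: "real \<times> real"
  using norm_fst_le[of "fst z" "snd z"] norm_snd_le[of "snd z" "fst z"] by auto

text \<open>The fourth power of \<open>1 + norm z\<close> dominates the product of the squared
  brackets of the coordinates. The resulting majorant separates, so it can be used in one coordinate
  while the other is frozen.\<close>

lemma rapid_bound:
  assumes "rapid f"
  obtains B where "0 \<le> B" "\<And>x t. norm (f (x, t)) \<le> B * (japanese x powr - 2 * japanese t powr - 2)"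
proof -
  obtain B where B: "0 \<le> B" "\<And>z. (1 + norm z) ^ 4 * norm (f z) \<le> B"
    by (rule rapidE[OF assms, where m = 4]) blast
  have "norm (f (x, t)) \<le> B * (japanese x powr - 2 * japanese t powr - 2)" for x t
  proof -
    have j: "japanese x \<le> 1 + norm (x, t)" "japanese t \<le> 1 + norm (x, t)"
      using japanese_le[of x] japanese_le[of t] abs_fst_le_norm[of "(x, t)"] abs_snd_le_norm[of "(x, t)"] by auto
    have "(japanese x ^ 2 * japanese t ^ 2) * norm (f (x, t)) \<le> ((1 + norm (x, t)) ^ 2 * (1 + norm (x, t)) ^ 2) * norm (f (x, t))"
      using j by (intro mult_right_mono mult_mono power_mono) auto
    also have "\<dots> = (1 + norm (x, t)) ^ 4 * norm (f (x, t))" by (simp add: power_add[symmetric])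
    also have "\<dots> \<le> B" by (rule B)
    finally show ?thesis by (simp add: powr_minus field_simps)
  qed
  then show thesis using that B(1) by blast
qed

lemma integrable_japanese_2: "integrable lborel (\<lambda>x. japanese x powr - 2)"
proof -
  obtain K where "\<And>c. (\<integral>\<^sup>+x. ennreal (japanese (x - c) powr - 2) \<partial>lborel) \<le> ennreal K"
    using nn_integral_japanese_powr[of 2] by auto
  from this[of 0] show ?thesis
    by (auto simp: integrable_iff_bounded intro: le_less_trans[OF _ ennreal_less_top])
qed

lemma integrable_rapid:
  assumes f: "rapid f" and [measurable]: "f \<in> borel_measurable borel"
  shows "integrable lborel f"
proof -
  obtain B where B: "0 \<le> B" "\<And>x t. norm (f (x, t)) \<le> B * (japanese x powr - 2 * japanese t powr - 2)"
    using rapid_bound[OF f] by blast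
  have "(\<integral>\<^sup>+x. \<integral>\<^sup>+t. ennreal (norm (f (x, t))) \<partial>lborel \<partial>lborel)
    \<le> (\<integral>\<^sup>+x. \<integral>\<^sup>+t. ennreal B * (ennreal (japanese x powr - 2) * ennreal (japanese t powr - 2)) \<partial>lborel \<partial>lborel)"
    using B by (intro nn_integral_mono) (simp add: ennreal_mult'[symmetric] ennreal_leI)
  also have "\<dots> = ennreal B * ((\<integral>\<^sup>+x. ennreal (japanese x powr - 2) \<partial>lborel) * (\<integral>\<^sup>+x. ennreal (japanese x powr - 2) \<partial>lborel))"
    by (simp add: nn_integral_cmult nn_integral_multc)
  also have "\<dots> < \<infinity>"
    using integrable_japanese_2 by (auto simp: integrable_iff_bounded ennreal_mult_less_top)
  finally show ?thesis by (subst integrable_plane_iff) auto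
qed

section \<open>Partial derivatives and integration by parts\<close>

lemma partial_x_has_vector_derivative:
  assumes "f differentiable (at (x, t))"
  shows "((\<lambda>s. f (s, t)) has_vector_derivative partial_x f (x, t)) (at x)"
proof -
  have D: "(f has_derivative frechet_derivative f (at (x, t))) (at (x, t))"
    using assms by (simp add: frechet_derivative_works)
  then have l: "linear (frechet_derivative f (at (x, t)))" by (rule has_derivative_linear)
  have "((\<lambda>s. (s, t)) has_derivative (\<lambda>s. (s, 0))) (at x)"
    by (auto intro!: derivative_eq_intros)
  from has_derivative_compose[OF this, of f] D
  have "((\<lambda>s. f (s, t)) has_derivative (\<lambda>s. frechet_derivative f (at (x, t)) (s, 0))) (at x)" by simp
  moreover have "frechet_derivative f (at (x, t)) (s, 0) = s *\<^sub>R partial_x f (x, t)" for s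
    using linear_scale[OF l, of s "(1, 0)"] by (simp add: partial_x_def)
  ultimately show ?thesis by (simp add: has_vector_derivative_def)
qed

lemma partial_t_has_vector_derivative:
  assumes "f differentiable (at (x, t))"
  shows "((\<lambda>s. f (x, s)) has_vector_derivative partial_t f (x, t)) (at t)"
proof -
  have D: "(f has_derivative frechet_derivative f (at (x, t))) (at (x, t))"
    using assms by (simp add: frechet_derivative_works)
  then have l: "linear (frechet_derivative f (at (x, t)))" by (rule has_derivative_linear)
  have "((\<lambda>s. (x, s)) has_derivative (\<lambda>s. (0, s))) (at t)"
    by (auto intro!: derivative_eq_intros)
  from has_derivative_compose[OF this, of f] D
  have "((\<lambda>s. f (x, s)) has_derivative (\<lambda>s. frechet_derivative f (at (x, t)) (0, s))) (at t)" by simp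
  moreover have "frechet_derivative f (at (x, t)) (0, s) = s *\<^sub>R partial_t f (x, t)" for s
    using linear_scale[OF l, of s "(0, 1)"] by (simp add: partial_t_def)
  ultimately show ?thesis by (simp add: has_vector_derivative_def)
qed

lemma partial_eqI:
  assumes "(f has_derivative (\<lambda>v. of_real (fst v) * a + of_real (snd v) * b)) (at z)"
  shows "partial_x f z = a" "partial_t f z = b" "f differentiable (at z)"
proof -
  have "frechet_derivative f (at z) = (\<lambda>v. of_real (fst v) * a + of_real (snd v) * b)"
    using frechet_derivative_at[OF assms] by simp
  then show "partial_x f z = a" "partial_t f z = b" by (simp_all add: partial_x_def partial_t_def)
  show "f differentiable (at z)" using assms by (auto simp: differentiable_def)
qed

text \<open>A closure criterion: any class of differentiable, rapidly decreasing functions stable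
  under both partials contains all mixed partials of its members. Each use exhibits such a class,
  and no higher derivative has to be computed.\<close>

lemma schwartzI:
  assumes "f \<in> S" and diff: "\<And>h z. h \<in> S \<Longrightarrow> h differentiable (at z)"
    and cl: "\<And>h. h \<in> S \<Longrightarrow> partial_x h \<in> S" "\<And>h. h \<in> S \<Longrightarrow> partial_t h \<in> S"
    and rapid: "\<And>h. h \<in> S \<Longrightarrow> rapid h"
  shows "schwartz f"
proof -
  have "mixed_partial j k f \<in> S" for j k
  proof -
    have "(partial_t ^^ k) f \<in> S" by (induction k) (use assms(1) cl in auto)
    then show ?thesis unfolding mixed_partial_def by (induction j) (use cl in auto)
  qed
  then show ?thesis
    unfolding schwartz_def rapid_iff_bounded[symmetric] using diff rapid
    by (auto intro: differentiable_at_imp_differentiable_on)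
qed

context
  fixes f :: "real \<times> real \<Rightarrow> complex"
  assumes f: "schwartz f"
begin

lemma schwartz_mixed:
  "mixed_partial j k f differentiable (at z)" "rapid (mixed_partial j k f)"
  "continuous_on UNIV (mixed_partial j k f)" "mixed_partial j k f \<in> borel_measurable borel"
proof -
  show d: "mixed_partial j k f differentiable (at z)" for z
    using f unfolding schwartz_def by (simp add: differentiable_on_eq_differentiable_at del: split_paired_All)
  show "rapid (mixed_partial j k f)" using f unfolding schwartz_def rapid_iff_bounded by blast
  show c: "continuous_on UNIV (mixed_partial j k f)"
    using d by (intro differentiable_imp_continuous_on) (simp add: differentiable_on_eq_differentiable_at)
  show "mixed_partial j k f \<in> borel_measurable borel" by (rule borel_measurable_continuous_onI[OF c])
qed

lemma schwartz_basic:
  "f differentiable (at z)" "rapid f" "continuous_on UNIV f" "f \<in> borel_measurable borel" "integrable lborel f"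
proof -
  have "mixed_partial 0 0 f = f" by (simp add: mixed_partial_def)
  then show "f differentiable (at z)" "rapid f" "continuous_on UNIV f" "f \<in> borel_measurable borel"
    using schwartz_mixed[of 0 0] by auto
  then show "integrable lborel f" by (intro integrable_rapid)
qed

end

text \<open>The quadratic decay makes \<open>F'\<close> integrable and forces \<open>F\<close> to
  vanish at both ends, so the fundamental theorem gives 0.\<close>

lemma has_vector_derivative_whole_line:
  fixes F F' :: "real \<Rightarrow> complex"
  assumes F: "\<And>x. (F has_vector_derivative F' x) (at x)" and c: "\<And>x. isCont F' x"
    and b: "\<And>x. norm (F x) \<le> B * japanese x powr - 2" "\<And>x. norm (F' x) \<le> B * japanese x powr - 2"
  shows "(LINT x|lborel. F' x) = 0"
proof -
  have [measurable]: "F' \<in> borel_measurable borel"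
    using c by (intro borel_measurable_continuous_onI) (simp add: continuous_at_imp_continuous_on)
  have i: "integrable lborel F'"
  proof (rule Bochner_Integration.integrable_bound)
    show "integrable lborel (\<lambda>x. B * japanese x powr - 2)" using integrable_japanese_2 by simp
    show "AE x in lborel. norm (F' x) \<le> norm (B * japanese x powr - 2)"
      using b(2) by (intro AE_I2) (metis abs_ge_self order_trans real_norm_def)
  qed simp
  have lim: "((\<lambda>x. B * japanese x powr - 2) \<longlongrightarrow> 0) at_top" "((\<lambda>x. B * japanese x powr - 2) \<longlongrightarrow> 0) at_bot"
  proof -
    have "((\<lambda>x::real. inverse (1 + x\<^sup>2)) \<longlongrightarrow> 0) at_top"
      by (rule tendsto_inverse_0_at_top, rule filterlim_tendsto_add_at_top[OF tendsto_const], rule filterlim_pow_at_top)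
        (auto intro: filterlim_ident)
    then have t: "((\<lambda>x::real. B * inverse (1 + x\<^sup>2)) \<longlongrightarrow> 0) at_top"
      by (rule tendsto_mult_right_zero)
    moreover have "((\<lambda>x::real. B * inverse (1 + x\<^sup>2)) \<longlongrightarrow> 0) at_bot"
      unfolding filterlim_at_bot_mirror using t by simp
    moreover have "japanese x powr - 2 = inverse (1 + x\<^sup>2)" for x
      by (simp add: powr_minus japanese_def add_nonneg_nonneg)
    ultimately show "((\<lambda>x. B * japanese x powr - 2) \<longlongrightarrow> 0) at_top" "((\<lambda>x. B * japanese x powr - 2) \<longlongrightarrow> 0) at_bot"
      by simp_all
  qed
  have "(LBINT x=-\<infinity>..\<infinity>. F' x) = 0 - 0"
  proof (rule interval_integral_FTC_integrable)
    show "set_integrable lborel (einterval (- \<infinity>) \<infinity>) F'" using i by (simp add: set_integrable_def)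
    show "((F \<circ> real_of_ereal) \<longlongrightarrow> 0) (at_right (- \<infinity>))"
      unfolding ereal_tendsto_simps1 by (rule Lim_null_comparison[OF _ lim(2)]) (use b(1) in auto)
    show "((F \<circ> real_of_ereal) \<longlongrightarrow> 0) (at_left \<infinity>)"
      unfolding ereal_tendsto_simps1 by (rule Lim_null_comparison[OF _ lim(1)]) (use b(1) in auto)
  qed (use F c in auto)
  then show ?thesis by (simp add: interval_lebesgue_integral_def set_lebesgue_integral_def)
qed

text \<open>Along each horizontal line the derivative of \<open>cis (z \<bullet> w) * k w\<close>
  integrates to 0. The product rule and Fubini turn this into
  \<open>\<i> * x * inv_fourier k z + inv_fourier k' z = 0\<close> with \<open>x = fst z\<close>,
  and multiplication by \<open>\<i>\<close> gives the claim.\<close>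

lemma inv_fourier_by_parts_x:
  assumes k: "rapid k" "k \<in> borel_measurable borel" and k': "rapid k'" "continuous_on UNIV k'"
    and d: "\<And>x t. ((\<lambda>s. k (s, t)) has_vector_derivative k' (x, t)) (at x)"
  shows "of_real (fst z) * inv_fourier k z = \<i> * inv_fourier k' z"
proof -
  have [measurable]: "k \<in> borel_measurable borel" "k' \<in> borel_measurable borel"
    by (rule k(2), rule borel_measurable_continuous_onI[OF k'(2)])
  obtain x t where z: "z = (x, t)" by (cases z)
  let ?F = "\<lambda>w. \<i> * of_real x * (cis (z \<bullet> w) * k w) + cis (z \<bullet> w) * k' w"
  have i: "integrable lborel (\<lambda>w. cis (z \<bullet> w) * k w)" "integrable lborel (\<lambda>w. cis (z \<bullet> w) * k' w)"
    by (rule integrable_cis_mult, rule integrable_rapid[OF k], measurable)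
      (rule integrable_cis_mult, rule integrable_rapid[OF k'(1)], measurable)
  have iF: "integrable lborel ?F" by (intro Bochner_Integration.integrable_add integrable_mult_right i)
  obtain B1 where B1: "0 \<le> B1" "\<And>x t. norm (k (x, t)) \<le> B1 * (japanese x powr - 2 * japanese t powr - 2)"
    using rapid_bound[OF k(1)] by blast
  obtain B2 where B2: "0 \<le> B2" "\<And>x t. norm (k' (x, t)) \<le> B2 * (japanese x powr - 2 * japanese t powr - 2)"
    using rapid_bound[OF k'(1)] by blast
  have "(LINT r|lborel. ?F (r, v)) = 0" for v
  proof (rule has_vector_derivative_whole_line[where F = "\<lambda>r. cis (z \<bullet> (r, v)) * k (r, v)"])
    fix r
    have "((\<lambda>r. cis (x * r + t * v) * k (r, v)) has_vector_derivative
       cis (x * r + t * v) * k' (r, v) + (\<i> * of_real x * cis (x * r + t * v)) * k (r, v)) (at r)"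
    proof (rule has_vector_derivative_mult)
      have "((\<lambda>q. exp (\<i> * (of_real x * q + of_real (t * v)))) has_field_derivative
          \<i> * of_real x * exp (\<i> * (of_real x * of_real r + of_real (t * v)))) (at (of_real r))"
        by (rule derivative_eq_intros refl)+ simp
      from has_vector_derivative_real_field[OF this, of UNIV] show "((\<lambda>r. cis (x * r + t * v)) has_vector_derivative \<i> * of_real x * cis (x * r + t * v)) (at r)"
        by (simp add: cis_conv_exp)
    qed (rule d)
    then show "((\<lambda>r. cis (z \<bullet> (r, v)) * k (r, v)) has_vector_derivative ?F (r, v)) (at r)"
      by (simp add: z add_ac mult_ac)
    have dk: "isCont (\<lambda>r. k (r, v)) r" using d[of v r] by (rule has_vector_derivative_continuous)
    have "continuous_on UNIV (\<lambda>r. k' (r, v))"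
      by (rule continuous_on_compose2[OF k'(2)]) (auto intro!: continuous_intros)
    then have dk': "isCont (\<lambda>r. k' (r, v)) r" by (simp add: continuous_on_eq_continuous_at)
    have dc: "isCont (\<lambda>r. cis (z \<bullet> (r, v))) r" unfolding cis_conv_exp by (intro continuous_intros)
    show "isCont (\<lambda>r. ?F (r, v)) r" by (intro continuous_add continuous_mult continuous_const dc dk dk')
    let ?j = "japanese r powr - 2" and ?jv = "japanese v powr - 2"
    let ?B = "(\<bar>x\<bar> + 1) * (B1 + B2) * ?jv"
    have "norm (cis (z \<bullet> (r, v)) * k (r, v)) \<le> B1 * (?j * ?jv)" using B1 by (simp add: norm_mult)
    also have "\<dots> \<le> ?B * ?j"
    proof -
      have "B1 \<le> (\<bar>x\<bar> + 1) * (B1 + B2)"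
        using B1(1) B2(1) mult_nonneg_nonneg[of "\<bar>x\<bar>" "B1 + B2"] by (simp add: algebra_simps)
      then have "B1 * (?j * ?jv) \<le> ((\<bar>x\<bar> + 1) * (B1 + B2)) * (?j * ?jv)" by (intro mult_right_mono) auto
      then show ?thesis by (simp add: mult_ac)
    qed
    finally show "norm (cis (z \<bullet> (r, v)) * k (r, v)) \<le> ?B * ?j" .
    have "norm (?F (r, v)) \<le> \<bar>x\<bar> * norm (k (r, v)) + norm (k' (r, v))"
      by (rule order_trans[OF norm_triangle_ineq]) (simp add: norm_mult)
    also have "\<dots> \<le> \<bar>x\<bar> * (B1 * (?j * ?jv)) + B2 * (?j * ?jv)" by (intro add_mono mult_left_mono B1 B2) auto
    also have "\<dots> = (\<bar>x\<bar> * B1 + B2) * (?j * ?jv)" by (simp add: algebra_simps)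
    also have "\<dots> \<le> ((\<bar>x\<bar> + 1) * (B1 + B2)) * (?j * ?jv)"
      using B1(1) B2(1) by (intro mult_right_mono) (auto simp: algebra_simps)
    finally show "norm (?F (r, v)) \<le> ?B * ?j" by (simp add: mult_ac)
  qed
  then have "(LINT w|lborel. ?F w) = 0" using lborel_Fubini_snd[OF iF] by simp
  then have "\<i> * of_real x * inv_fourier k z + inv_fourier k' z = 0"
    using i by (simp add: inv_fourier_def)
  then have "\<i> * (\<i> * of_real x * inv_fourier k z + inv_fourier k' z) = 0" by simp
  then show ?thesis by (simp add: z algebra_simps)
qed

text \<open>The inner product and Lebesgue measure are invariant under the exchange
  \<open>\<sigma>\<close> of the coordinates, which reduces the claim to the first variable.\<close>

lemma inv_fourier_by_parts_t:
  assumes k: "rapid k" "k \<in> borel_measurable borel" and k': "rapid k'" "continuous_on UNIV k'"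
    and d: "\<And>x t. ((\<lambda>s. k (x, s)) has_vector_derivative k' (x, t)) (at t)"
  shows "of_real (snd z) * inv_fourier k z = \<i> * inv_fourier k' z"
proof -
  define \<sigma> where "\<sigma> = (\<lambda>w::real \<times> real. (snd w, fst w))"
  have n: "norm (\<sigma> w) = norm w" for w by (simp add: \<sigma>_def norm_prod_def add.commute)
  have rap: "rapid (\<lambda>w. g (\<sigma> w))" if "rapid g" for g
  proof -
    have "(1 + norm w) ^ m * norm (g (\<sigma> w)) \<le> B" if "\<forall>z. (1 + norm z) ^ m * norm (g z) \<le> B" for B m w
      using that[rule_format, of "\<sigma> w"] by (simp add: n)
    then show ?thesis using that unfolding rapid_def by (intro allI) blast
  qed
  have c: "continuous_on UNIV \<sigma>" unfolding \<sigma>_def by (intro continuous_intros)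
  have [measurable]: "k \<in> borel_measurable borel" "k' \<in> borel_measurable borel" "\<sigma> \<in> borel_measurable borel"
    using k k' c borel_measurable_continuous_onI by auto
  have sw: "inv_fourier (\<lambda>w. g (\<sigma> w)) (\<sigma> z) = inv_fourier g z" if g: "integrable lborel g" for g z
  proof -
    have [measurable]: "g \<in> borel_measurable borel" using g by auto
    have i: "integrable lborel (\<lambda>w. cis (z \<bullet> w) * g w)" by (intro integrable_cis_mult g) simp
    have "(\<integral>\<^sup>+x. \<integral>\<^sup>+t. ennreal (norm (g (t, x))) \<partial>lborel \<partial>lborel) = (\<integral>\<^sup>+x. \<integral>\<^sup>+t. ennreal (norm (g (x, t))) \<partial>lborel \<partial>lborel)"
      by (rule nn_integral_swap) measurable
    then have "integrable lborel (\<lambda>w. g (\<sigma> w))"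
      using g by (simp add: integrable_plane_iff \<sigma>_def)
    then have i': "integrable lborel (\<lambda>w. cis (\<sigma> z \<bullet> w) * g (\<sigma> w))"
      by (rule integrable_cis_mult) measurable
    have "inv_fourier (\<lambda>w. g (\<sigma> w)) (\<sigma> z) = (LINT x|lborel. LINT t|lborel. cis (\<sigma> z \<bullet> (x, t)) * g (\<sigma> (x, t)))"
      unfolding inv_fourier_def using lborel_Fubini_fst[OF i'] by simp
    also have "\<dots> = (LINT x|lborel. LINT t|lborel. cis (z \<bullet> (t, x)) * g (t, x))"
      by (simp add: \<sigma>_def inner_prod_def add.commute)
    also have "\<dots> = inv_fourier g z" unfolding inv_fourier_def using lborel_Fubini_snd[OF i] by simp
    finally show ?thesis .
  qed
  have "of_real (fst (\<sigma> z)) * inv_fourier (\<lambda>w. k (\<sigma> w)) (\<sigma> z) = \<i> * inv_fourier (\<lambda>w. k' (\<sigma> w)) (\<sigma> z)"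
  proof (rule inv_fourier_by_parts_x)
    show "continuous_on UNIV (\<lambda>w. k' (\<sigma> w))" by (rule continuous_on_compose2[OF k'(2) c]) simp
    show "((\<lambda>s. k (\<sigma> (s, t))) has_vector_derivative k' (\<sigma> (x, t))) (at x)" for x t
      using d[of t x] by (simp add: \<sigma>_def)
    show "rapid (\<lambda>w. k (\<sigma> w))" "rapid (\<lambda>w. k' (\<sigma> w))" by (rule rap[OF k(1)], rule rap[OF k'(1)])
  qed measurable
  moreover have "fst (\<sigma> z) = snd z" by (simp add: \<sigma>_def)
  moreover have "integrable lborel k" "integrable lborel k'"
    by (rule integrable_rapid[OF k], rule integrable_rapid[OF k'(1)], measurable)
  ultimately show ?thesis by (simp only: sw)
qed

text \<open>The second-order Taylor remainder of the exponential bounds the error of the linear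
  approximation by \<open>norm (y - z)^2\<close> times the second moment of \<open>k\<close>, which
  is finite by rapid decay.\<close>

lemma inv_fourier_has_derivative:
  assumes k: "rapid k" and [measurable]: "k \<in> borel_measurable borel"
  shows "(inv_fourier k has_derivative (\<lambda>v. of_real (fst v) * inv_fourier (\<lambda>w. \<i> * of_real (fst w) * k w) z
     + of_real (snd v) * inv_fourier (\<lambda>w. \<i> * of_real (snd w) * k w) z)) (at z)"
proof -
  let ?kx = "\<lambda>w. \<i> * of_real (fst w) * k w" and ?kt = "\<lambda>w. \<i> * of_real (snd w) * k w" and ?k2 = "\<lambda>w. of_real ((norm w)\<^sup>2) * k w"
  let ?D = "\<lambda>v. of_real (fst v) * inv_fourier ?kx z + of_real (snd v) * inv_fourier ?kt z"
  have "rapid ?kx"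
    by (rule rapid_growth_mult[OF k, of _ 1 1]) (simp add: norm_mult, rule order_trans[OF abs_fst_le_norm], simp)
  moreover have "rapid ?kt"
    by (rule rapid_growth_mult[OF k, of _ 1 1]) (simp add: norm_mult, rule order_trans[OF abs_snd_le_norm], simp)
  moreover have "rapid ?k2"
    by (rule rapid_growth_mult[OF k, of _ 1 2]) (simp add: norm_power power_mono)
  ultimately have ikx: "integrable lborel ?kx" and ikt: "integrable lborel ?kt" and ik2: "integrable lborel ?k2"
    by (intro integrable_rapid; measurable)+
  have ik: "integrable lborel k" using k by (rule integrable_rapid) simp
  define C where "C = (LINT w|lborel. norm (?k2 w))"
  have est: "norm ((inv_fourier k y - inv_fourier k z) - ?D (y - z)) \<le> C * (norm (y - z))\<^sup>2" for y
  proof -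
    let ?v = "y - z"
    have i: "integrable lborel (\<lambda>w. cis (y \<bullet> w) * k w)" "integrable lborel (\<lambda>w. cis (z \<bullet> w) * k w)"
      "integrable lborel (\<lambda>w. cis (z \<bullet> w) * ?kx w)" "integrable lborel (\<lambda>w. cis (z \<bullet> w) * ?kt w)"
      by (intro integrable_cis_mult ik ikx ikt; simp)+
    have eq0: "(inv_fourier k y - inv_fourier k z) - ?D ?v
      = (LINT w|lborel. (cis (y \<bullet> w) * k w - cis (z \<bullet> w) * k w) - (of_real (fst ?v) * (cis (z \<bullet> w) * ?kx w) + of_real (snd ?v) * (cis (z \<bullet> w) * ?kt w)))"
      unfolding inv_fourier_def using i by simp
    have "norm ((inv_fourier k y - inv_fourier k z) - ?D ?v) \<le> (LINT w|lborel. norm ((cis (y \<bullet> w) * k w - cis (z \<bullet> w) * k w) - (of_real (fst ?v) * (cis (z \<bullet> w) * ?kx w) + of_real (snd ?v) * (cis (z \<bullet> w) * ?kt w))))"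
      unfolding eq0 by (rule integral_norm_bound)
    also have "\<dots> \<le> (LINT w|lborel. (norm ?v)\<^sup>2 * norm (?k2 w))"
    proof (rule Bochner_Integration.integral_mono)
      show "integrable lborel (\<lambda>w. norm ((cis (y \<bullet> w) * k w - cis (z \<bullet> w) * k w) - (of_real (fst ?v) * (cis (z \<bullet> w) * ?kx w) + of_real (snd ?v) * (cis (z \<bullet> w) * ?kt w))))"
        by (intro integrable_norm Bochner_Integration.integrable_diff Bochner_Integration.integrable_add integrable_mult_right i)
      show "integrable lborel (\<lambda>w. (norm ?v)\<^sup>2 * norm (?k2 w))" using ik2 by (intro integrable_mult_right integrable_norm)
      fix w
      have y: "y \<bullet> w = z \<bullet> w + ?v \<bullet> w" by (simp add: inner_diff_left)
      have eq: "(cis (y \<bullet> w) * k w - cis (z \<bullet> w) * k w) - (of_real (fst ?v) * (cis (z \<bullet> w) * ?kx w) + of_real (snd ?v) * (cis (z \<bullet> w) * ?kt w))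
        = cis (z \<bullet> w) * k w * (iexp (?v \<bullet> w) - (\<Sum>k\<le>1. (\<i> * of_real (?v \<bullet> w)) ^ k / fact k))"
        unfolding y cis_mult[symmetric] by (simp add: cis_conv_exp inner_prod_def algebra_simps)
      have "norm (iexp (?v \<bullet> w) - (\<Sum>k\<le>1. (\<i> * of_real (?v \<bullet> w)) ^ k / fact k)) \<le> \<bar>?v \<bullet> w\<bar> ^ 2 / 2"
        using iexp_approx1[of "?v \<bullet> w" 1] by (simp add: numeral_2_eq_2)
      also have "\<dots> \<le> \<bar>?v \<bullet> w\<bar> ^ 2" by simp
      also have "\<dots> \<le> (norm ?v * norm w) ^ 2" by (intro power_mono Cauchy_Schwarz_ineq2) simp
      finally have "norm (k w) * norm (iexp (?v \<bullet> w) - (\<Sum>k\<le>1. (\<i> * of_real (?v \<bullet> w)) ^ k / fact k)) \<le> norm (k w) * (norm ?v * norm w) ^ 2"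
        by (rule mult_left_mono) simp
      then show "norm ((cis (y \<bullet> w) * k w - cis (z \<bullet> w) * k w) - (of_real (fst ?v) * (cis (z \<bullet> w) * ?kx w) + of_real (snd ?v) * (cis (z \<bullet> w) * ?kt w)))
        \<le> (norm ?v)\<^sup>2 * norm (?k2 w)"
        unfolding eq norm_mult by (simp add: power_mult_distrib mult_ac norm_power)
    qed
    also have "\<dots> = C * (norm ?v)\<^sup>2" by (simp add: C_def)
    finally show ?thesis .
  qed
  show ?thesis
    unfolding has_derivative_iff_norm
  proof
    show "bounded_linear ?D"
      by (intro bounded_linear_add bounded_linear_mult_const
          bounded_linear_compose[OF bounded_linear_of_real] bounded_linear_fst bounded_linear_snd)
    show "((\<lambda>y. norm ((inv_fourier k y - inv_fourier k z) - ?D (y - z)) / norm (y - z)) \<longlongrightarrow> 0) (at z)"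
    proof (rule Lim_null_comparison)
      have "((\<lambda>y. C * norm (y - z)) \<longlongrightarrow> C * norm (z - z)) (at z)" by (intro tendsto_intros)
      then show "((\<lambda>y. C * norm (y - z)) \<longlongrightarrow> 0) (at z)" by simp
      show "eventually (\<lambda>y. norm (norm ((inv_fourier k y - inv_fourier k z) - ?D (y - z)) / norm (y - z)) \<le> C * norm (y - z)) (at z)"
        unfolding eventually_at_filter
      proof (intro always_eventually allI impI)
        fix y assume "y \<noteq> z"
        then show "norm (norm ((inv_fourier k y - inv_fourier k z) - ?D (y - z)) / norm (y - z)) \<le> C * norm (y - z)"
          using est[of y] by (simp add: divide_le_eq power2_eq_square mult_ac)
      qed
    qed
  qed
qed

section \<open>Transforms of Schwartz functions\<close>

text \<open>Differentiating a transform multiplies the function by a coordinate, so the transforms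
  of all monomial multiples of \<open>f\<close>, with scalars, form a class as required by
  \<open>schwartzI\<close>.\<close>

definition monomial_mult :: "nat \<Rightarrow> nat \<Rightarrow> (real \<times> real \<Rightarrow> complex) \<Rightarrow> real \<times> real \<Rightarrow> complex" where
  "monomial_mult p q g w = of_real (fst w ^ p * snd w ^ q) * g w"

lemma measurable_monomial_mult[measurable]:
  "g \<in> borel_measurable borel \<Longrightarrow> monomial_mult p q g \<in> borel_measurable borel"
  unfolding monomial_mult_def by measurable

lemma continuous_monomial_mult:
  "continuous_on UNIV g \<Longrightarrow> continuous_on UNIV (monomial_mult p q g)"
  unfolding monomial_mult_def by (intro continuous_intros)

lemma rapid_monomial_mult:
  assumes "rapid g"
  shows "rapid (monomial_mult p q g)"
  unfolding monomial_mult_def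
proof (rule rapid_growth_mult[OF assms])
  fix w :: "real \<times> real"
  have "\<bar>fst w\<bar> ^ p * \<bar>snd w\<bar> ^ q \<le> (1 + norm w) ^ p * (1 + norm w) ^ q"
    using abs_fst_le_norm[of w] abs_snd_le_norm[of w] by (intro mult_mono power_mono) auto
  then show "norm (complex_of_real (fst w ^ p * snd w ^ q)) \<le> 1 * (1 + norm w) ^ (p + q)"
    by (simp only: norm_of_real abs_mult power_abs power_add mult_1)
qed

lemma inv_fourier_add:
  assumes "integrable lborel f" "integrable lborel g"
  shows "inv_fourier (\<lambda>w. f w + g w) z = inv_fourier f z + inv_fourier g z"
proof -
  have "integrable lborel (\<lambda>w. cis (z \<bullet> w) * f w)" "integrable lborel (\<lambda>w. cis (z \<bullet> w) * g w)"
    by (rule integrable_cis_mult[OF assms(1)], simp, rule integrable_cis_mult[OF assms(2)], simp)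
  then show ?thesis by (simp add: inv_fourier_def distrib_left)
qed

lemma inv_fourier_cmult: "inv_fourier (\<lambda>w. c * f w) z = c * inv_fourier f z"
proof -
  have "(LINT w|lborel. cis (z \<bullet> w) * (c * f w)) = (LINT w|lborel. c * (cis (z \<bullet> w) * f w))"
    by (simp add: mult_ac)
  then show ?thesis by (simp add: inv_fourier_def)
qed

lemma fourier_cmult: "fourier (\<lambda>w. c * f w) z = c * fourier f z"
proof -
  have "(LINT w|lborel. cis (- (z \<bullet> w)) * (c * f w)) = (LINT w|lborel. c * (cis (- (z \<bullet> w)) * f w))"
    by (simp add: mult_ac)
  then show ?thesis by (simp add: fourier_eq_inv_fourier)
qed

text \<open>The two terms are the product rule for the monomial and for \<open>g\<close>. At
  \<open>p = 0\<close> the truncated \<open>p - 1\<close> is harmless because its term carries the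
  factor \<open>of_nat p\<close>.\<close>

lemma inv_fourier_monomial_step_x:
  assumes g: "rapid g" "continuous_on UNIV g" "\<And>z. g differentiable (at z)"
    and g': "rapid (partial_x g)" "continuous_on UNIV (partial_x g)"
  shows "of_real (fst z) * inv_fourier (monomial_mult p q g) z
    = \<i> * (of_nat p * inv_fourier (monomial_mult (p - 1) q g) z + inv_fourier (monomial_mult p q (partial_x g)) z)"
proof -
  let ?k' = "\<lambda>w. of_nat p * monomial_mult (p - 1) q g w + monomial_mult p q (partial_x g) w"
  have m: "g \<in> borel_measurable borel" "partial_x g \<in> borel_measurable borel"
    using g(2) g'(2) by (simp_all add: borel_measurable_continuous_onI)
  have r1: "rapid (\<lambda>w. of_nat p * monomial_mult (p - 1) q g w)"
    by (rule rapid_growth_mult[OF rapid_monomial_mult[OF g(1)], of _ "real p" 0]) simp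
  have "of_real (fst z) * inv_fourier (monomial_mult p q g) z = \<i> * inv_fourier ?k' z"
  proof (rule inv_fourier_by_parts_x)
    show "rapid ?k'" by (rule rapid_add[OF r1 rapid_monomial_mult[OF g'(1)]])
    show "continuous_on UNIV ?k'"
      by (intro continuous_on_add continuous_on_mult continuous_on_const continuous_monomial_mult g g')
    fix x t
    have "((\<lambda>s. complex_of_real (s ^ p * t ^ q)) has_vector_derivative of_real (real p * x ^ (p - 1) * t ^ q)) (at x)"
      by (rule has_vector_derivative_of_real) (auto intro!: derivative_eq_intros)
    from has_vector_derivative_mult[OF this partial_x_has_vector_derivative[OF g(3)]]
    show "((\<lambda>s. monomial_mult p q g (s, t)) has_vector_derivative ?k' (x, t)) (at x)"
      by (simp add: monomial_mult_def algebra_simps)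
  qed (use m in \<open>auto intro: rapid_monomial_mult g\<close>)
  also have "inv_fourier ?k' z = inv_fourier (\<lambda>w. of_nat p * monomial_mult (p - 1) q g w) z + inv_fourier (monomial_mult p q (partial_x g)) z"
    by (rule inv_fourier_add; rule integrable_rapid) (use m r1 rapid_monomial_mult[OF g'(1)] in auto)
  finally show ?thesis by (simp only: inv_fourier_cmult)
qed

lemma inv_fourier_monomial_step_t:
  assumes g: "rapid g" "continuous_on UNIV g" "\<And>z. g differentiable (at z)"
    and g': "rapid (partial_t g)" "continuous_on UNIV (partial_t g)"
  shows "of_real (snd z) * inv_fourier (monomial_mult p q g) z
    = \<i> * (of_nat q * inv_fourier (monomial_mult p (q - 1) g) z + inv_fourier (monomial_mult p q (partial_t g)) z)"
proof -
  let ?k' = "\<lambda>w. of_nat q * monomial_mult p (q - 1) g w + monomial_mult p q (partial_t g) w"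
  have m: "g \<in> borel_measurable borel" "partial_t g \<in> borel_measurable borel"
    using g(2) g'(2) by (simp_all add: borel_measurable_continuous_onI)
  have r1: "rapid (\<lambda>w. of_nat q * monomial_mult p (q - 1) g w)"
    by (rule rapid_growth_mult[OF rapid_monomial_mult[OF g(1)], of _ "real q" 0]) simp
  have "of_real (snd z) * inv_fourier (monomial_mult p q g) z = \<i> * inv_fourier ?k' z"
  proof (rule inv_fourier_by_parts_t)
    show "rapid ?k'" by (rule rapid_add[OF r1 rapid_monomial_mult[OF g'(1)]])
    show "continuous_on UNIV ?k'"
      by (intro continuous_on_add continuous_on_mult continuous_on_const continuous_monomial_mult g g')
    fix x t
    have "((\<lambda>s. complex_of_real (x ^ p * s ^ q)) has_vector_derivative of_real (x ^ p * (real q * t ^ (q - 1)))) (at t)"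
      by (rule has_vector_derivative_of_real) (auto intro!: derivative_eq_intros)
    from has_vector_derivative_mult[OF this partial_t_has_vector_derivative[OF g(3)]]
    show "((\<lambda>s. monomial_mult p q g (x, s)) has_vector_derivative ?k' (x, t)) (at t)"
      by (simp add: monomial_mult_def algebra_simps)
  qed (use m in \<open>auto intro: rapid_monomial_mult g\<close>)
  also have "inv_fourier ?k' z = inv_fourier (\<lambda>w. of_nat q * monomial_mult p (q - 1) g w) z + inv_fourier (monomial_mult p q (partial_t g)) z"
    by (rule inv_fourier_add; rule integrable_rapid) (use m r1 rapid_monomial_mult[OF g'(1)] in auto)
  finally show ?thesis by (simp only: inv_fourier_cmult)
qed

context
  fixes f :: "real \<times> real \<Rightarrow> complex"
  assumes f: "schwartz f"
begin

lemma mixed_partial_Suc: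
  "partial_x (mixed_partial i 0 f) = mixed_partial (Suc i) 0 f"
  "partial_t (mixed_partial 0 i f) = mixed_partial 0 (Suc i) f"
  by (simp_all add: mixed_partial_def)

lemma inv_fourier_bounded:
  "\<exists>B. \<forall>z. norm (inv_fourier (monomial_mult p q (mixed_partial i j f)) z) \<le> B"
proof -
  have "integrable lborel (monomial_mult p q (mixed_partial i j f))"
    by (intro integrable_rapid rapid_monomial_mult measurable_monomial_mult schwartz_mixed[OF f])
  then show ?thesis using norm_inv_fourier_le by blast
qed

text \<open>Each power of the coordinate is traded for a derivative, which either lowers the
  monomial or raises the order of the partial; hence the induction keeps \<open>p\<close> and
  \<open>i\<close> general. Only pure \<open>x\<close>-partials of \<open>f\<close> occur.\<close>

lemma inv_fourier_power_bounded_x: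
  "\<exists>B. \<forall>z. norm (of_real (fst z) ^ m * inv_fourier (monomial_mult p q (mixed_partial i 0 f)) z) \<le> B"
proof (induction m arbitrary: p q i)
  case 0
  then show ?case using inv_fourier_bounded by simp
next
  case (Suc m)
  obtain B1 where B1: "\<And>z. norm (of_real (fst z) ^ m * inv_fourier (monomial_mult (p - 1) q (mixed_partial i 0 f)) z) \<le> B1"
    using Suc by blast
  obtain B2 where B2: "\<And>z. norm (of_real (fst z) ^ m * inv_fourier (monomial_mult p q (mixed_partial (Suc i) 0 f)) z) \<le> B2"
    using Suc by blast
  have "norm (of_real (fst z) ^ Suc m * inv_fourier (monomial_mult p q (mixed_partial i 0 f)) z) \<le> real p * B1 + B2" for z
  proof -
    have st: "of_real (fst z) * inv_fourier (monomial_mult p q (mixed_partial i 0 f)) z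
      = \<i> * (of_nat p * inv_fourier (monomial_mult (p - 1) q (mixed_partial i 0 f)) z + inv_fourier (monomial_mult p q (mixed_partial (Suc i) 0 f)) z)"
      unfolding mixed_partial_Suc[symmetric]
      by (rule inv_fourier_monomial_step_x) (unfold mixed_partial_Suc, (rule schwartz_mixed[OF f])+)
    have "of_real (fst z) ^ Suc m * inv_fourier (monomial_mult p q (mixed_partial i 0 f)) z
      = of_real (fst z) ^ m * (of_real (fst z) * inv_fourier (monomial_mult p q (mixed_partial i 0 f)) z)"
      by (simp only: power_Suc2 mult.assoc)
    also have "\<dots> = \<i> * (of_nat p * (of_real (fst z) ^ m * inv_fourier (monomial_mult (p - 1) q (mixed_partial i 0 f)) z)
       + of_real (fst z) ^ m * inv_fourier (monomial_mult p q (mixed_partial (Suc i) 0 f)) z)"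
      unfolding st by (simp only: distrib_left mult_ac)
    finally have eq: "of_real (fst z) ^ Suc m * inv_fourier (monomial_mult p q (mixed_partial i 0 f)) z = \<dots>" .
    show ?thesis
      unfolding eq norm_mult[of \<i>] norm_ii mult_1
      by (rule norm_triangle_le) (intro add_mono B2, simp only: norm_mult norm_of_nat, intro mult_left_mono, use B1[of z] in \<open>simp_all add: norm_mult\<close>)
  qed
  then show ?case by blast
qed

lemma inv_fourier_power_bounded_t:
  "\<exists>B. \<forall>z. norm (of_real (snd z) ^ m * inv_fourier (monomial_mult p q (mixed_partial 0 i f)) z) \<le> B"
proof (induction m arbitrary: p q i)
  case 0
  then show ?case using inv_fourier_bounded by simp
next
  case (Suc m)
  obtain B1 where B1: "\<And>z. norm (of_real (snd z) ^ m * inv_fourier (monomial_mult p (q - 1) (mixed_partial 0 i f)) z) \<le> B1"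
    using Suc by blast
  obtain B2 where B2: "\<And>z. norm (of_real (snd z) ^ m * inv_fourier (monomial_mult p q (mixed_partial 0 (Suc i) f)) z) \<le> B2"
    using Suc by blast
  have "norm (of_real (snd z) ^ Suc m * inv_fourier (monomial_mult p q (mixed_partial 0 i f)) z) \<le> real q * B1 + B2" for z
  proof -
    have st: "of_real (snd z) * inv_fourier (monomial_mult p q (mixed_partial 0 i f)) z
      = \<i> * (of_nat q * inv_fourier (monomial_mult p (q - 1) (mixed_partial 0 i f)) z + inv_fourier (monomial_mult p q (mixed_partial 0 (Suc i) f)) z)"
      unfolding mixed_partial_Suc[symmetric]
      by (rule inv_fourier_monomial_step_t) (unfold mixed_partial_Suc, (rule schwartz_mixed[OF f])+)
    have "of_real (snd z) ^ Suc m * inv_fourier (monomial_mult p q (mixed_partial 0 i f)) z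
      = of_real (snd z) ^ m * (of_real (snd z) * inv_fourier (monomial_mult p q (mixed_partial 0 i f)) z)"
      by (simp only: power_Suc2 mult.assoc)
    also have "\<dots> = \<i> * (of_nat q * (of_real (snd z) ^ m * inv_fourier (monomial_mult p (q - 1) (mixed_partial 0 i f)) z)
       + of_real (snd z) ^ m * inv_fourier (monomial_mult p q (mixed_partial 0 (Suc i) f)) z)"
      unfolding st by (simp only: distrib_left mult_ac)
    finally have eq: "of_real (snd z) ^ Suc m * inv_fourier (monomial_mult p q (mixed_partial 0 i f)) z = \<dots>" .
    show ?thesis
      unfolding eq norm_mult[of \<i>] norm_ii mult_1
      by (rule norm_triangle_le) (intro add_mono B2, simp only: norm_mult norm_of_nat, intro mult_left_mono, use B1[of z] in \<open>simp_all add: norm_mult\<close>)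
  qed
  then show ?case by blast
qed

text \<open>Pure powers of the coordinates suffice: \<open>1 + norm z\<close> is at most 3 times the
  maximum of 1 and the two moduli, so its power is controlled by 1 and the two pure powers.\<close>

lemma rapid_inv_fourier_monomial: "rapid (inv_fourier (monomial_mult p q f))"
  unfolding rapid_def
proof
  fix m :: nat
  have f0: "mixed_partial 0 0 f = f" by (simp add: mixed_partial_def)
  let ?F = "inv_fourier (monomial_mult p q f)"
  obtain B0 where B0: "\<And>z. norm (?F z) \<le> B0" using inv_fourier_bounded[of p q 0 0, unfolded f0] by blast
  obtain B1 where B1: "\<And>z. norm (of_real (fst z) ^ m * ?F z) \<le> B1" using inv_fourier_power_bounded_x[of m p q 0, unfolded f0] by blast
  obtain B2 where B2: "\<And>z. norm (of_real (snd z) ^ m * ?F z) \<le> B2" using inv_fourier_power_bounded_t[of m p q 0, unfolded f0] by blast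
  have "(1 + norm z) ^ m * norm (?F z) \<le> 3 ^ m * (B0 + B1 + B2)" for z
  proof -
    let ?M = "max 1 (max \<bar>fst z\<bar> \<bar>snd z\<bar>)"
    have "norm z \<le> \<bar>fst z\<bar> + \<bar>snd z\<bar>" using norm_Pair_le[of "fst z" "snd z"] by simp
    then have "1 + norm z \<le> 3 * ?M" by linarith
    then have "(1 + norm z) ^ m \<le> (3 * ?M) ^ m" by (intro power_mono) auto
    also have "\<dots> = 3 ^ m * ?M ^ m" by (simp add: power_mult_distrib)
    also have "\<dots> \<le> 3 ^ m * (1 + \<bar>fst z\<bar> ^ m + \<bar>snd z\<bar> ^ m)"
      by (intro mult_left_mono) (auto simp: max_def)
    finally have "(1 + norm z) ^ m * norm (?F z) \<le> 3 ^ m * (1 + \<bar>fst z\<bar> ^ m + \<bar>snd z\<bar> ^ m) * norm (?F z)"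
      by (rule mult_right_mono) simp
    also have "\<dots> = 3 ^ m * (norm (?F z) + norm (of_real (fst z) ^ m * ?F z) + norm (of_real (snd z) ^ m * ?F z))"
      by (simp add: norm_mult norm_power algebra_simps)
    also have "\<dots> \<le> 3 ^ m * (B0 + B1 + B2)" by (intro mult_left_mono add_mono B0 B1 B2) simp
    finally show ?thesis .
  qed
  then show "\<exists>B. \<forall>z. (1 + norm z) ^ m * norm (?F z) \<le> B" by blast
qed

lemma inv_fourier_monomial_derivative:
  "((\<lambda>z. c * inv_fourier (monomial_mult p q f) z) has_derivative
     (\<lambda>v. of_real (fst v) * (\<i> * c * inv_fourier (monomial_mult (Suc p) q f) z) + of_real (snd v) * (\<i> * c * inv_fourier (monomial_mult p (Suc q) f) z))) (at z)"
proof -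
  have "(\<lambda>w. \<i> * of_real (fst w) * monomial_mult p q f w) = (\<lambda>w. \<i> * monomial_mult (Suc p) q f w)"
    "(\<lambda>w. \<i> * of_real (snd w) * monomial_mult p q f w) = (\<lambda>w. \<i> * monomial_mult p (Suc q) f w)"
    by (auto simp: monomial_mult_def)
  note eq = this
  have "(inv_fourier (monomial_mult p q f) has_derivative (\<lambda>v. of_real (fst v) * (\<i> * inv_fourier (monomial_mult (Suc p) q f) z)
     + of_real (snd v) * (\<i> * inv_fourier (monomial_mult p (Suc q) f) z))) (at z)"
    using inv_fourier_has_derivative[OF rapid_monomial_mult[OF schwartz_basic(2)[OF f]] measurable_monomial_mult[OF schwartz_basic(4)[OF f]], of p q z]
    unfolding eq inv_fourier_cmult .
  from has_derivative_mult_right[OF this, of c] show ?thesis by (simp add: algebra_simps)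
qed

text \<open>The scalar in the class absorbs the factor \<open>\<i>\<close> that every
  differentiation produces.\<close>

lemma schwartz_inv_fourier: "schwartz (\<lambda>z. c * inv_fourier f z)"
proof (rule schwartzI[where S = "{h. \<exists>c p q. h = (\<lambda>z. c * inv_fourier (monomial_mult p q f) z)}"])
  let ?S = "{h. \<exists>c p q. h = (\<lambda>z. c * inv_fourier (monomial_mult p q f) z)}"
  have "monomial_mult 0 0 f = f" by (auto simp: monomial_mult_def)
  then show "(\<lambda>z. c * inv_fourier f z) \<in> ?S"
    by (intro CollectI exI[of _ c] exI[of _ "0::nat"]) simp
  fix h assume "h \<in> ?S"
  then obtain c p q where h: "h = (\<lambda>z. c * inv_fourier (monomial_mult p q f) z)" by blast
  note D = partial_eqI[OF inv_fourier_monomial_derivative, of c p q, folded h]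
  show "h differentiable (at z)" for z by (rule D(3))
  have "partial_x h = (\<lambda>z. (\<i> * c) * inv_fourier (monomial_mult (Suc p) q f) z)" by (rule ext) (rule D(1))
  then show "partial_x h \<in> ?S" by blast
  have "partial_t h = (\<lambda>z. (\<i> * c) * inv_fourier (monomial_mult p (Suc q) f) z)" by (rule ext) (rule D(2))
  then show "partial_t h \<in> ?S" by blast
  show "rapid h" unfolding h
    by (rule rapid_growth_mult[OF rapid_inv_fourier_monomial, of _ "norm c" 0]) simp
qed

text \<open>Writes \<open>f\<close> as the Fourier transform of a Schwartz function; this is how the
  action of \<open>U\<close> on \<open>f\<close> is recovered from
  \<open>distr_fourier U\<close>.\<close>

lemma fourier_inversion: "fourier (\<lambda>z. of_real (1 / (2 * pi)\<^sup>2) * inv_fourier f z) = f"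
proof
  fix a
  have f0: "monomial_mult 0 0 f = f" by (auto simp: monomial_mult_def)
  have i: "integrable lborel (inv_fourier f)"
    using rapid_inv_fourier_monomial[of 0 0] schwartz_basic(4)[OF f] unfolding f0 by (intro integrable_rapid) auto
  obtain B where B: "\<And>z. norm (f z) \<le> B"
    by (rule rapidE[OF schwartz_basic(2)[OF f], where m = 0]) auto
  have "fourier (\<lambda>z. of_real (1 / (2 * pi)\<^sup>2) * inv_fourier f z) a = of_real (1 / (2 * pi)\<^sup>2) * fourier (inv_fourier f) a"
    by (rule fourier_cmult)
  also have "\<dots> = f a"
    unfolding fourier_inv_fourier[OF schwartz_basic(5)[OF f] B schwartz_basic(3)[OF f] i] by simp
  finally show "fourier (\<lambda>z. of_real (1 / (2 * pi)\<^sup>2) * inv_fourier f z) a = f a" .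
qed

lemma fourier_schwartz:
  "fourier f z = inv_fourier f (- z)"
  "partial_x (fourier f) z = inv_fourier (\<lambda>w. \<i> * of_real (fst w) * f (- w)) z"
  "rapid (\<lambda>z. inv_fourier (\<lambda>w. \<i> * of_real (fst w) * f (- w)) z)"
proof -
  note m = schwartz_basic[OF f]
  show "fourier f z = inv_fourier f (- z)" by (simp add: fourier_eq_inv_fourier inv_fourier_def)
  let ?g = "\<lambda>w. f (- w)"
  have g: "rapid ?g" "?g \<in> borel_measurable borel"
  proof -
    have "(1 + norm w) ^ n * norm (f (- w)) \<le> B" if "\<forall>z. (1 + norm z) ^ n * norm (f z) \<le> B" for B n w
      using that[rule_format, of "- w"] by simp
    then show "rapid ?g" using m(2) unfolding rapid_def by (intro allI) blast
    show "?g \<in> borel_measurable borel" using m(4) by measurable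
  qed
  have "fourier f = inv_fourier ?g" by (intro ext fourier_inv_fourier_reflect m(4))
  then show "partial_x (fourier f) z = inv_fourier (\<lambda>w. \<i> * of_real (fst w) * f (- w)) z"
    using partial_eqI(1)[OF inv_fourier_has_derivative[OF g]] by simp
  have eq: "inv_fourier (\<lambda>w. \<i> * of_real (fst w) * f (- w)) z = - \<i> * inv_fourier (monomial_mult 1 0 f) (- z)" for z
  proof -
    have [measurable]: "f \<in> borel_measurable borel" by (rule m(4))
    have "inv_fourier (\<lambda>w. \<i> * of_real (fst w) * f (- w)) z = (LINT w|lborel. cis (z \<bullet> (0 - w)) * (\<i> * of_real (fst (0 - w)) * f (- (0 - w))))"
      unfolding inv_fourier_def by (rule integral_reflect[symmetric]) measurable
    also have "\<dots> = (LINT w|lborel. - \<i> * (cis (- z \<bullet> w) * monomial_mult 1 0 f w))"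
      by (rule Bochner_Integration.integral_cong) (simp_all add: monomial_mult_def mult_ac)
    also have "\<dots> = - \<i> * inv_fourier (monomial_mult 1 0 f) (- z)"
      unfolding inv_fourier_def by (rule integral_mult_right_zero)
    finally show ?thesis .
  qed
  have "rapid (\<lambda>z. inv_fourier (monomial_mult 1 0 f) (- z))"
  proof -
    have "(1 + norm w) ^ n * norm (h (- w)) \<le> B" if "\<forall>z. (1 + norm z) ^ n * norm (h z) \<le> B" for B n w and h :: "real \<times> real \<Rightarrow> complex"
      using that[rule_format, of "- w"] by simp
    then show ?thesis using rapid_inv_fourier_monomial[of 1 0] unfolding rapid_def by (intro allI) blast
  qed
  then show "rapid (\<lambda>z. inv_fourier (\<lambda>w. \<i> * of_real (fst w) * f (- w)) z)"
    unfolding eq by (rule rapid_growth_mult[of _ _ 1 0]) simp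
qed

end

section \<open>Uniqueness of the representing function\<close>

text \<open>Both partials of a polynomial are polynomials, the closure needed for the class of
  polynomials times a Gaussian.\<close>

lemma real_polynomial_has_derivative:
  fixes p :: "real \<times> real \<Rightarrow> real"
  assumes "real_polynomial_function p"
  shows "\<exists>q r. real_polynomial_function q \<and> real_polynomial_function r \<and>
    (\<forall>z. (p has_derivative (\<lambda>v. fst v * q z + snd v * r z)) (at z))"
  using assms
proof induction
  case (linear f)
  have "f v = fst v * f (1, 0) + snd v * f (0, 1)" for v
  proof -
    have "v = fst v *\<^sub>R (1, 0) + snd v *\<^sub>R (0, 1)" by (simp add: prod_eq_iff)
    then have "f v = f (fst v *\<^sub>R (1, 0) + snd v *\<^sub>R (0, 1))" by (rule arg_cong)
    also have "\<dots> = fst v * f (1, 0) + snd v * f (0, 1)"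
      using linear by (simp only: bounded_linear.linear linear_add linear_scale) simp
    finally show ?thesis .
  qed
  then have "f = (\<lambda>v. fst v * f (1, 0) + snd v * f (0, 1))" by blast
  moreover have "(f has_derivative f) (at z)" for z by (rule bounded_linear_imp_has_derivative[OF linear])
  ultimately have "\<forall>z. (f has_derivative (\<lambda>v. fst v * f (1, 0) + snd v * f (0, 1))) (at z)" by metis
  note D = this
  show ?case
    by (rule exI[of _ "\<lambda>_. f (1, 0)"], rule exI[of _ "\<lambda>_. f (0, 1)"], intro conjI D real_polynomial_function.intros(2))
next
  case (const c)
  show ?case by (intro exI[of _ "\<lambda>_. 0"]) auto
next
  case (add f g)
  then obtain q1 r1 q2 r2 where *: "real_polynomial_function q1" "real_polynomial_function r1"
     "\<And>z. (f has_derivative (\<lambda>v. fst v * q1 z + snd v * r1 z)) (at z)"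
     "real_polynomial_function q2" "real_polynomial_function r2"
     "\<And>z. (g has_derivative (\<lambda>v. fst v * q2 z + snd v * r2 z)) (at z)" by blast
  show ?case
  proof (rule exI[of _ "\<lambda>z. q1 z + q2 z"], rule exI[of _ "\<lambda>z. r1 z + r2 z"], intro conjI allI)
    show "((\<lambda>x. f x + g x) has_derivative (\<lambda>v. fst v * (q1 z + q2 z) + snd v * (r1 z + r2 z))) (at z)" for z
      using has_derivative_add[OF *(3,6), of z] by (simp add: algebra_simps)
  qed (use * in auto)
next
  case (mult f g)
  then obtain q1 r1 q2 r2 where *: "real_polynomial_function q1" "real_polynomial_function r1"
     "\<And>z. (f has_derivative (\<lambda>v. fst v * q1 z + snd v * r1 z)) (at z)"
     "real_polynomial_function q2" "real_polynomial_function r2"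
     "\<And>z. (g has_derivative (\<lambda>v. fst v * q2 z + snd v * r2 z)) (at z)" by blast
  show ?case
  proof (rule exI[of _ "\<lambda>z. f z * q2 z + q1 z * g z"], rule exI[of _ "\<lambda>z. f z * r2 z + r1 z * g z"], intro conjI allI)
    show "((\<lambda>x. f x * g x) has_derivative (\<lambda>v. fst v * (f z * q2 z + q1 z * g z) + snd v * (f z * r2 z + r1 z * g z))) (at z)" for z
      using has_derivative_mult[OF *(3,6), of z] by (simp add: algebra_simps)
  qed (use * mult in auto)
qed

lemma real_polynomial_growth:
  fixes p :: "real \<times> real \<Rightarrow> real"
  assumes "real_polynomial_function p"
  shows "\<exists>C N. 0 \<le> C \<and> (\<forall>z. \<bar>p z\<bar> \<le> C * (1 + norm z) ^ N)"
  using assms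
proof induction
  case (linear f)
  obtain K where "0 \<le> K" "\<And>x. norm (f x) \<le> norm x * K" using bounded_linear.nonneg_bounded[OF linear] by blast
  have "\<bar>f z\<bar> \<le> K * (1 + norm z) ^ 1" for z
  proof -
    have "\<bar>f z\<bar> \<le> norm z * K" using \<open>\<And>x. norm (f x) \<le> norm x * K\<close>[of z] by simp
    also have "\<dots> \<le> K * (1 + norm z) ^ 1" using \<open>0 \<le> K\<close> by (simp add: algebra_simps)
    finally show ?thesis .
  qed
  then show ?case using \<open>0 \<le> K\<close> by blast
next
  case (const c)
  show ?case by (intro exI[of _ "\<bar>c\<bar>"] exI[of _ 0]) auto
next
  case (add f g)
  then obtain C1 N1 C2 N2 where *: "0 \<le> C1" "\<And>z. \<bar>f z\<bar> \<le> C1 * (1 + norm z) ^ N1" "0 \<le> C2" "\<And>z. \<bar>g z\<bar> \<le> C2 * (1 + norm z) ^ N2" by blast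
  have "\<bar>f z + g z\<bar> \<le> (C1 + C2) * (1 + norm z) ^ (N1 + N2)" for z
  proof -
    have "\<bar>f z + g z\<bar> \<le> C1 * (1 + norm z) ^ N1 + C2 * (1 + norm z) ^ N2" using *(2,4)[of z] by linarith
    also have "\<dots> \<le> C1 * (1 + norm z) ^ (N1 + N2) + C2 * (1 + norm z) ^ (N1 + N2)"
      using *(1,3) by (intro add_mono mult_left_mono power_increasing) auto
    finally show ?thesis by (simp add: algebra_simps)
  qed
  then show ?case
    by (intro exI[of _ "C1 + C2"] exI[of _ "N1 + N2"] conjI add_nonneg_nonneg *(1,3) allI)
next
  case (mult f g)
  then obtain C1 N1 C2 N2 where *: "0 \<le> C1" "\<And>z. \<bar>f z\<bar> \<le> C1 * (1 + norm z) ^ N1" "0 \<le> C2" "\<And>z. \<bar>g z\<bar> \<le> C2 * (1 + norm z) ^ N2" by blast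
  have "\<bar>f z * g z\<bar> \<le> (C1 * C2) * (1 + norm z) ^ (N1 + N2)" for z
  proof -
    have "\<bar>f z * g z\<bar> \<le> (C1 * (1 + norm z) ^ N1) * (C2 * (1 + norm z) ^ N2)"
      unfolding abs_mult using * by (intro mult_mono) auto
    then show ?thesis by (simp add: power_add mult_ac)
  qed
  then show ?case
    by (intro exI[of _ "C1 * C2"] exI[of _ "N1 + N2"] conjI mult_nonneg_nonneg *(1,3) allI)
qed

text \<open>A single term of the exponential series gives
  \<open>(1 + r)^n \<le> fact n * exp (1 + r)\<close>, and
  \<open>1 + r - r^2 \<le> 2\<close>.\<close>

lemma power_times_gaussian_bounded: "\<exists>B. \<forall>r\<ge>0. (1 + r) ^ n * exp (- r\<^sup>2) \<le> (B::real)"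
proof (intro exI allI impI)
  fix r :: real assume r: "0 \<le> r"
  have "(1 + r) ^ n / fact n \<le> exp (1 + r)"
  proof -
    have "(\<lambda>k. (1 + r) ^ k /\<^sub>R fact k) sums exp (1 + r)" by (rule exp_converges)
    then have "summable (\<lambda>k. (1 + r) ^ k /\<^sub>R fact k)" "suminf (\<lambda>k. (1 + r) ^ k /\<^sub>R fact k) = exp (1 + r)"
      by (simp_all add: sums_iff)
    then have "(\<Sum>k\<in>{n}. (1 + r) ^ k /\<^sub>R fact k) \<le> exp (1 + r)"
      using r sum_le_suminf[of "\<lambda>k. (1 + r) ^ k /\<^sub>R fact k" "{n}"] by simp
    then show ?thesis by (simp add: field_simps)
  qed
  then have "(1 + r) ^ n \<le> fact n * exp (1 + r)" by (simp add: field_simps)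
  then have "(1 + r) ^ n * exp (- r\<^sup>2) \<le> (fact n * exp (1 + r)) * exp (- r\<^sup>2)" by (rule mult_right_mono) simp
  also have "\<dots> = fact n * exp (1 + r - r\<^sup>2)" by (simp add: exp_diff exp_minus divide_inverse)
  also have "\<dots> \<le> fact n * exp 2"
  proof -
    have "0 \<le> (r - 1 / 2)\<^sup>2" by simp
    then have "1 + r - r\<^sup>2 \<le> 2" by (simp add: power2_eq_square algebra_simps)
    then show ?thesis by (intro mult_left_mono) auto
  qed
  finally show "(1 + r) ^ n * exp (- r\<^sup>2) \<le> fact n * exp 2" .
qed

text \<open>Products \<open>p * exp (- E)\<close> with \<open>p\<close> polynomial are stable under
  partials. The exponent \<open>E\<close> stays general so that one proof covers the plain Gaussian
  and its product with a translated one.\<close>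

lemma schwartz_polynomial_gaussian:
  fixes E :: "real \<times> real \<Rightarrow> real"
  assumes E: "real_polynomial_function E" "\<And>z. (norm z)\<^sup>2 \<le> E z" and p: "real_polynomial_function p"
  shows "schwartz (\<lambda>z. of_real (p z * exp (- E z)))"
proof (rule schwartzI[where S = "{h. \<exists>p. real_polynomial_function p \<and> h = (\<lambda>z. of_real (p z * exp (- E z)))}"])
  let ?S = "{h. \<exists>p. real_polynomial_function p \<and> h = (\<lambda>z. complex_of_real (p z * exp (- E z)))}"
  show "(\<lambda>z. of_real (p z * exp (- E z))) \<in> ?S" using p by blast
  obtain qE rE where dE: "real_polynomial_function qE" "real_polynomial_function rE"
    "\<And>z. (E has_derivative (\<lambda>v. fst v * qE z + snd v * rE z)) (at z)"
    using real_polynomial_has_derivative[OF E(1)] by blast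
  fix h assume "h \<in> ?S"
  then obtain p where p: "real_polynomial_function p" and h: "h = (\<lambda>z. complex_of_real (p z * exp (- E z)))" by blast
  obtain q r where d: "real_polynomial_function q" "real_polynomial_function r"
    "\<And>z. (p has_derivative (\<lambda>v. fst v * q z + snd v * r z)) (at z)"
    using real_polynomial_has_derivative[OF p] by blast
  have D: "(h has_derivative (\<lambda>v. of_real (fst v) * of_real ((q z - p z * qE z) * exp (- E z)) + of_real (snd v) * of_real ((r z - p z * rE z) * exp (- E z)))) (at z)" for z
  proof -
    define w where "w = exp (- E z)"
    have dexp: "((\<lambda>z. exp (- E z)) has_derivative (\<lambda>v. - (fst v * qE z + snd v * rE z) * w)) (at z)"
      unfolding w_def by (rule has_derivative_exp[OF has_derivative_minus[OF dE(3)[of z]]])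
    have eq: "p z * (- (fst v * qE z + snd v * rE z) * w) + (fst v * q z + snd v * r z) * w
      = fst v * ((q z - p z * qE z) * w) + snd v * ((r z - p z * rE z) * w)" for v :: "real \<times> real"
      by (simp only: ring_distribs mult_minus_right mult_minus_left) (simp only: ac_simps diff_conv_add_uminus minus_add_distrib)
    have "((\<lambda>z. p z * exp (- E z)) has_derivative (\<lambda>v. fst v * ((q z - p z * qE z) * w) + snd v * ((r z - p z * rE z) * w))) (at z)"
    proof (rule has_derivative_eq_rhs[OF has_derivative_mult[OF d(3)[of z] dexp]], rule ext)
      fix v
      show "p z * (- (fst v * qE z + snd v * rE z) * w) + (fst v * q z + snd v * r z) * exp (- E z)
        = fst v * ((q z - p z * qE z) * w) + snd v * ((r z - p z * rE z) * w)"
        unfolding w_def[symmetric] by (rule eq)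
    qed
    from bounded_linear.has_derivative[OF bounded_linear_of_real this]
    show ?thesis unfolding h w_def[symmetric] by (simp only: of_real_add of_real_mult)
  qed
  note D' = partial_eqI[OF D]
  show "h differentiable (at z)" for z by (rule D'(3))
  have "partial_x h = (\<lambda>z. of_real ((q z - p z * qE z) * exp (- E z)))" by (rule ext) (rule D'(1))
  moreover have "real_polynomial_function (\<lambda>z. q z - p z * qE z)" using d dE p by auto
  ultimately show "partial_x h \<in> ?S" by (intro CollectI exI[of _ "\<lambda>z. q z - p z * qE z"] conjI)
  have "partial_t h = (\<lambda>z. of_real ((r z - p z * rE z) * exp (- E z)))" by (rule ext) (rule D'(2))
  moreover have "real_polynomial_function (\<lambda>z. r z - p z * rE z)" using d dE p by auto
  ultimately show "partial_t h \<in> ?S" by (intro CollectI exI[of _ "\<lambda>z. r z - p z * rE z"] conjI)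
  show "rapid h"
    unfolding rapid_def
  proof
    fix m
    obtain C N where C: "0 \<le> C" "\<And>z. \<bar>p z\<bar> \<le> C * (1 + norm z) ^ N" using real_polynomial_growth[OF p] by blast
    obtain B where B: "\<And>r::real. 0 \<le> r \<Longrightarrow> (1 + r) ^ (m + N) * exp (- r\<^sup>2) \<le> B" using power_times_gaussian_bounded[of "m + N"] by blast
    have "(1 + norm z) ^ m * norm (h z) \<le> C * B" for z
    proof -
      have "norm (h z) = \<bar>p z\<bar> * exp (- E z)" unfolding h norm_of_real by (simp add: abs_mult)
      also have "\<dots> \<le> (C * (1 + norm z) ^ N) * exp (- (norm z)\<^sup>2)"
        using C E(2)[of z] by (intro mult_mono) auto
      finally have "(1 + norm z) ^ m * norm (h z) \<le> (1 + norm z) ^ m * ((C * (1 + norm z) ^ N) * exp (- (norm z)\<^sup>2))"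
        by (rule mult_left_mono) simp
      also have "\<dots> = C * ((1 + norm z) ^ (m + N) * exp (- (norm z)\<^sup>2))" by (simp add: power_add mult_ac)
      also have "\<dots> \<le> C * B" by (intro mult_left_mono B C) simp
      finally show ?thesis .
    qed
    then show "\<exists>B. \<forall>z. (1 + norm z) ^ m * norm (h z) \<le> B" by blast
  qed
qed

text \<open>The fixed factor makes a tempered function integrable; the second factor then tests the
  integrable function with Gaussians of every width and centre.\<close>

lemma schwartz_gauss_product:
  assumes "0 < c"
  shows "schwartz (\<lambda>z. of_real (exp (- (norm z)\<^sup>2) * gauss c (z - y)))"
proof -
  let ?E = "\<lambda>z::real \<times> real. (fst z * fst z + snd z * snd z) + c / 2 * ((fst z + - fst y) * (fst z + - fst y) + (snd z + - snd y) * (snd z + - snd y))"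
  have fs: "real_polynomial_function (\<lambda>z::real \<times> real. fst z)" "real_polynomial_function (\<lambda>z::real \<times> real. snd z)"
    by (auto intro: bounded_linear_fst bounded_linear_snd)
  have n: "(norm z)\<^sup>2 = fst z * fst z + snd z * snd z" for z :: "real \<times> real"
    by (simp add: norm_prod_def power2_eq_square)
  have "schwartz (\<lambda>z. of_real (1 * exp (- ?E z)))"
  proof (rule schwartz_polynomial_gaussian)
    show "real_polynomial_function ?E"
      by (intro real_polynomial_function.intros(2-4) fs)
    show "(norm z)\<^sup>2 \<le> ?E z" for z unfolding n using assms by simp
  qed (rule real_polynomial_function.intros(2))
  moreover have "1 * exp (- ?E z) = exp (- (norm z)\<^sup>2) * gauss c (z - y)" for z
  proof -
    have "- ?E z = - (norm z)\<^sup>2 + - c * (norm (z - y))\<^sup>2 / 2" unfolding n by simp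
    then show ?thesis unfolding gauss_def by (simp only: exp_add mult_1)
  qed
  ultimately show ?thesis by (simp only:)
qed

lemma schwartz_gaussian: "schwartz (\<lambda>z. of_real (exp (- (norm z)\<^sup>2)))"
proof -
  have n: "(norm z)\<^sup>2 = fst z * fst z + snd z * snd z" for z :: "real \<times> real"
    by (simp add: norm_prod_def power2_eq_square)
  have "schwartz (\<lambda>z. of_real (1 * exp (- (norm z)\<^sup>2)))"
  proof (rule schwartz_polynomial_gaussian)
    show "real_polynomial_function (\<lambda>z::real \<times> real. (norm z)\<^sup>2)"
      unfolding n by (intro real_polynomial_function.intros(4,3) real_polynomial_function.intros(1) bounded_linear_fst bounded_linear_snd)
  qed (auto intro: real_polynomial_function.intros(2))
  then show ?thesis by simp
qed

text \<open>Integrating the centres \<open>y\<close> over the box turns the Gaussians into a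
  mollified indicator \<open>S d\<close>. It tends to \<open>2 * pi\<close> times the indicator away
  from the boundary of the box, which is a null set.\<close>

lemma gaussian_average_limit:
  fixes k :: "real \<times> real \<Rightarrow> complex"
  assumes k: "integrable lborel k" and z: "\<And>c y. 0 < c \<Longrightarrow> (LINT z|lborel. k z * of_real (gauss c (z - y))) = 0"
  shows "(LINT z|lborel. k z * of_real (indicator (cbox a b) z)) = 0"
proof -
  have [measurable]: "k \<in> borel_measurable borel" using k by auto
  let ?Q = "cbox a b"
  define S where "S d z = (LINT w|lborel. gauss 1 w * indicator ?Q (z - d *\<^sub>R w))" for d :: real and z
  have [measurable]: "S d \<in> borel_measurable borel" for d unfolding S_def by measurable
  have ig: "integrable lborel (gauss 1)" by (rule integrable_gauss) simp
  have iS: "integrable lborel (\<lambda>w. gauss 1 w * indicator ?Q (z - d *\<^sub>R w))" for d z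
    by (rule Bochner_Integration.integrable_bound[OF ig]) (auto simp: indicator_def gauss_bounds less_imp_le)
  have Sb: "\<bar>S d z\<bar> \<le> 2 * pi" for d z
  proof -
    have "\<bar>S d z\<bar> \<le> (LINT w|lborel. norm (gauss 1 w * indicator ?Q (z - d *\<^sub>R w)))"
      unfolding S_def using integral_norm_bound[of lborel "\<lambda>w. gauss 1 w * indicator ?Q (z - d *\<^sub>R w)"] by simp
    also have "\<dots> \<le> (LINT w|lborel. gauss 1 w)"
      by (rule Bochner_Integration.integral_mono[OF integrable_norm[OF iS] ig]) (auto simp: indicator_def gauss_bounds less_imp_le)
    finally show ?thesis using integral_gauss[of 1] by simp
  qed
  have zero: "(LINT z|lborel. k z * of_real (S d z)) = 0" if d: "0 < d" for d
  proof -
    let ?c = "1 / d\<^sup>2"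
    have c: "0 < ?c" using d by simp
    have Sd: "d\<^sup>2 * S d z = (LINT y|lborel. gauss ?c (z - y) * indicator ?Q y)" for z
    proof -
      have "(LINT y|lborel. gauss ?c (z - y) * indicator ?Q y) = (LINT y|lborel. gauss ?c (z - (z - y)) * indicator ?Q (z - y))"
        by (rule integral_reflect[symmetric]) measurable
      also have "\<dots> = (LINT y|lborel. gauss ?c y * indicator ?Q (z - y))" by simp
      also have "\<dots> = d\<^sup>2 *\<^sub>R (LINT y|lborel. gauss ?c (d *\<^sub>R y) * indicator ?Q (z - d *\<^sub>R y))"
        by (rule integral_scale[OF _ d]) measurable
      also have "\<dots> = d\<^sup>2 * S d z"
      proof -
        have "gauss ?c (d *\<^sub>R y) = gauss 1 y" for y using d by (simp add: gauss_def power_mult_distrib)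
        then show ?thesis by (simp add: S_def)
      qed
      finally show ?thesis ..
    qed
    let ?F = "\<lambda>(z, y). k z * of_real (gauss ?c (z - y) * indicator ?Q y)"
    have F: "integrable lborel ?F"
    proof (subst integrable_plane_iff)
      have "(\<integral>\<^sup>+z. \<integral>\<^sup>+y. ennreal (norm (?F (z, y))) \<partial>lborel \<partial>lborel) \<le> (\<integral>\<^sup>+z. \<integral>\<^sup>+y. ennreal (norm (k z)) * indicator ?Q y \<partial>lborel \<partial>lborel)"
        using c by (intro nn_integral_mono) (auto simp: norm_mult indicator_def gauss_bounds less_imp_le intro!: ennreal_leI mult_left_le)
      also have "\<dots> = (\<integral>\<^sup>+z. ennreal (norm (k z)) \<partial>lborel) * emeasure lborel ?Q"
        by (simp add: nn_integral_cmult nn_integral_multc)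
      also have "\<dots> < \<infinity>" using k emeasure_lborel_cbox_finite by (auto simp: integrable_iff_bounded ennreal_mult_less_top)
      finally show "(\<integral>\<^sup>+z. \<integral>\<^sup>+y. ennreal (norm (?F (z, y))) \<partial>lborel \<partial>lborel) < \<infinity>" .
    qed (simp add: case_prod_beta')
    have "of_real (d\<^sup>2) * (LINT z|lborel. k z * of_real (S d z)) = (LINT z|lborel. k z * of_real (d\<^sup>2 * S d z))"
      by (simp add: integral_mult_right_zero[symmetric] mult_ac del: integral_mult_right_zero)
    also have "\<dots> = (LINT z|lborel. LINT y|lborel. ?F (z, y))"
      unfolding Sd by (intro Bochner_Integration.integral_cong) (simp_all del: of_real_mult flip: integral_complex_of_real)
    also have "\<dots> = (LINT y|lborel. LINT z|lborel. ?F (z, y))"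
      using lborel_Fubini_fst[OF F] lborel_Fubini_snd[OF F] by simp
    also have "\<dots> = (LINT y|lborel. of_real (indicator ?Q y) * (LINT z|lborel. k z * of_real (gauss ?c (z - y))))"
    proof (rule Bochner_Integration.integral_cong[OF refl])
      fix y
      have "(LINT z|lborel. ?F (z, y)) = (LINT z|lborel. of_real (indicator ?Q y) * (k z * of_real (gauss ?c (z - y))))"
        by (simp add: mult_ac)
      then show "(LINT z|lborel. ?F (z, y)) = of_real (indicator ?Q y) * (LINT z|lborel. k z * of_real (gauss ?c (z - y)))"
        by simp
    qed
    also have "\<dots> = 0" unfolding z[OF c] by simp
    finally show ?thesis using d by simp
  qed
  define d where "d n = 1 / real (Suc n)" for n
  have d: "0 < d n" for n by (simp add: d_def)
  have d0: "d \<longlonglongrightarrow> 0" unfolding d_def by (rule LIMSEQ_Suc) (rule lim_1_over_n)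
  have null: "cbox a b - box a b \<in> null_sets lborel"
  proof (rule null_setsI)
    have "emeasure lborel (cbox a b - box a b) = emeasure lborel (cbox a b) - emeasure lborel (box a b)"
      by (rule emeasure_Diff) (auto simp: emeasure_lborel_box_eq box_subset_cbox)
    also have "\<dots> = 0"
    proof (cases "\<forall>i\<in>Basis. a \<bullet> i \<le> b \<bullet> i")
      case True
      then show ?thesis by (simp add: emeasure_lborel_cbox_eq emeasure_lborel_box_eq)
    qed (auto simp: emeasure_lborel_cbox_eq)
    finally show "emeasure lborel (cbox a b - box a b) = 0" .
  qed auto
  have lim: "AE z in lborel. (\<lambda>n. k z * of_real (S (d n) z)) \<longlonglongrightarrow> k z * of_real (2 * pi * indicator ?Q z)"
    using AE_not_in[OF null]
  proof eventually_elim
    case (elim z)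
    have "(\<lambda>n. S (d n) z) \<longlonglongrightarrow> (LINT w|lborel. gauss 1 w * indicator ?Q z)"
      unfolding S_def
    proof (rule integral_dominated_convergence[where w = "gauss 1"])
      show "AE w in lborel. (\<lambda>n. gauss 1 w * indicator ?Q (z - d n *\<^sub>R w)) \<longlonglongrightarrow> gauss 1 w * indicator ?Q z"
      proof (intro AE_I2 tendsto_mult tendsto_const)
        fix w
        have "(\<lambda>n. z - d n *\<^sub>R w) \<longlonglongrightarrow> z - 0 *\<^sub>R w" by (intro tendsto_intros d0)
        then have l: "(\<lambda>n. z - d n *\<^sub>R w) \<longlonglongrightarrow> z" by simp
        show "(\<lambda>n. indicator ?Q (z - d n *\<^sub>R w) :: real) \<longlonglongrightarrow> indicator ?Q z"
        proof (cases "z \<in> box a b")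
          case True
          then have "\<forall>\<^sub>F n in sequentially. z - d n *\<^sub>R w \<in> box a b"
            using l by (intro topological_tendstoD) (auto simp: open_box)
          then have "\<forall>\<^sub>F n in sequentially. indicator ?Q z = (indicator ?Q (z - d n *\<^sub>R w) :: real)"
            by eventually_elim (use True box_subset_cbox[of a b] in \<open>auto simp: indicator_def\<close>)
          then show ?thesis by (rule tendsto_eventually[OF eventually_mono]) auto
        next
          case False
          then have zq: "z \<in> - ?Q" using elim by auto
          then have "\<forall>\<^sub>F n in sequentially. z - d n *\<^sub>R w \<in> - ?Q"
            using l by (intro topological_tendstoD) (auto simp: closed_cbox)
          then have "\<forall>\<^sub>F n in sequentially. indicator ?Q z = (indicator ?Q (z - d n *\<^sub>R w) :: real)"
            by eventually_elim (use zq in \<open>auto simp: indicator_def\<close>)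
          then show ?thesis by (rule tendsto_eventually[OF eventually_mono]) auto
        qed
      qed
      show "AE w in lborel. norm (gauss 1 w * indicator ?Q (z - d n *\<^sub>R w)) \<le> gauss 1 w" for n
        by (intro AE_I2) (auto simp: indicator_def gauss_bounds less_imp_le)
    qed (use ig in auto)
    also have "(LINT w|lborel. gauss 1 w * indicator ?Q z) = 2 * pi * indicator ?Q z"
      using integral_gauss[of 1] by simp
    finally show ?case by (intro tendsto_intros)
  qed
  have "(\<lambda>n. LINT z|lborel. k z * of_real (S (d n) z)) \<longlonglongrightarrow> (LINT z|lborel. k z * of_real (2 * pi * indicator ?Q z))"
  proof (rule integral_dominated_convergence[where w = "\<lambda>z. norm (k z) * (2 * pi)"])
    show "AE z in lborel. norm (k z * of_real (S (d n) z)) \<le> norm (k z) * (2 * pi)" for n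
      by (intro AE_I2) (simp only: norm_mult norm_of_real, intro mult_left_mono Sb norm_ge_zero)
  qed (use k lim in auto)
  then have "(LINT z|lborel. k z * of_real (2 * pi * indicator ?Q z)) = 0"
    unfolding zero[OF d] using LIMSEQ_unique tendsto_const by blast
  also have "(LINT z|lborel. k z * of_real (2 * pi * indicator ?Q z)) = of_real (2 * pi) * (LINT z|lborel. k z * of_real (indicator ?Q z))"
    by (simp add: integral_mult_right_zero[symmetric] mult_ac del: integral_mult_right_zero)
  finally show ?thesis by simp
qed

text \<open>Lebesgue differentiation: almost every value of \<open>k\<close> is a limit of averages
  over shrinking cubes, and all of these vanish.\<close>

lemma AE_zero_of_cbox_integrals:
  fixes k :: "real \<times> real \<Rightarrow> complex"
  assumes k: "integrable lborel k" and z: "\<And>a b. (LINT z|lborel. k z * of_real (indicator (cbox a b) z)) = 0"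
  shows "AE z in lborel. k z = 0"
proof -
  have [measurable]: "k \<in> borel_measurable borel" using k by auto
  have si: "set_integrable lborel (cbox a b) k" for a b
    unfolding set_integrable_def by (intro integrable_mult_indicator k) simp
  have int: "k integrable_on cbox a b" "integral (cbox a b) k = 0" for a b
  proof -
    show "k integrable_on cbox a b" by (rule set_borel_integral_eq_integral(1)[OF si])
    have "integral (cbox a b) k = (LINT x:cbox a b|lborel. k x)"
      by (rule set_borel_integral_eq_integral(2)[OF si, symmetric])
    also have "\<dots> = (LINT z|lborel. k z * of_real (indicator (cbox a b) z))"
      unfolding set_lebesgue_integral_def by (simp add: scaleR_conv_of_real mult.commute)
    finally show "integral (cbox a b) k = 0" using z by simp
  qed
  obtain N where N: "negligible N" "\<And>x e. x \<notin> N \<Longrightarrow> 0 < e \<Longrightarrow> \<exists>d>0. \<forall>h. 0 < h \<and> h < d \<longrightarrow>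
     norm (integral (cbox x (x + h *\<^sub>R One)) k /\<^sub>R h ^ DIM(real \<times> real) - k x) < e"
    using integrable_ccontinuous_explicit[OF int(1)] by blast
  have kz: "k x = 0" if "x \<notin> N" for x
  proof (rule ccontr)
    assume "k x \<noteq> 0"
    then have "0 < norm (k x)" by simp
    from N(2)[OF that this] obtain d where "d > 0" "\<And>h. 0 < h \<Longrightarrow> h < d \<Longrightarrow> norm (integral (cbox x (x + h *\<^sub>R One)) k /\<^sub>R h ^ DIM(real \<times> real) - k x) < norm (k x)"
      by blast
    from this(2)[of "d / 2"] this(1) show False unfolding int(2) by simp
  qed
  have "AE x in lebesgue. x \<notin> N" using N(1) by (intro AE_not_in) (simp add: negligible_iff_null_sets)
  then have "AE x in lebesgue. k x = 0" by eventually_elim (rule kz)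
  then show ?thesis by (simp add: AE_completion_iff)
qed

text \<open>Multiplication by a fixed positive Gaussian makes \<open>h\<close> integrable and leaves
  its zero set unchanged.\<close>

lemma schwartz_test_unique:
  assumes h: "tempered_function h" and z: "\<And>f. schwartz f \<Longrightarrow> (LINT z|lborel. h z * f z) = 0"
  shows "AE z in lborel. h z = 0"
proof -
  let ?k = "\<lambda>z. h z * of_real (exp (- (norm z)\<^sup>2))"
  have k: "integrable lborel ?k" using h schwartz_gaussian unfolding tempered_function_def by blast
  have "AE z in lborel. ?k z = 0"
  proof (rule AE_zero_of_cbox_integrals[OF k gaussian_average_limit[OF k]])
    fix c :: real and y assume "0 < c"
    from z[OF schwartz_gauss_product[OF this, of y]]
    show "(LINT z|lborel. ?k z * of_real (gauss c (z - y))) = 0" by (simp add: mult.assoc)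
  qed
  then show ?thesis by eventually_elim simp
qed

lemma represents_unique:
  assumes g: "represents g U" and h: "represents h U"
  shows "AE z in lborel. g z = h z"
proof -
  have i: "integrable lborel (\<lambda>z. g z * f z)" "integrable lborel (\<lambda>z. h z * f z)" if "schwartz f" for f
    using that g h unfolding represents_def tempered_function_def by blast+
  have "AE z in lborel. g z - h z = 0"
  proof (rule schwartz_test_unique)
    show "tempered_function (\<lambda>z. g z - h z)"
      using g h i unfolding represents_def tempered_function_def
      by (auto simp: left_diff_distrib intro!: Bochner_Integration.integrable_diff)
    show "(LINT z|lborel. (g z - h z) * f z) = 0" if "schwartz f" for f
    proof -
      have "(LINT z|lborel. g z * f z) = (LINT z|lborel. h z * f z)"
        using that g h unfolding represents_def distr_of_def by metis
      then show ?thesis using i[OF that] by (simp add: left_diff_distrib)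
    qed
  qed
  then show ?thesis by eventually_elim simp
qed

text \<open>\<open>fourier_fun\<close> is an arbitrary choice of representative; through this lemma
  norms defined with it can be computed from any other one.\<close>

lemma fourier_fun_AE:
  assumes "represents g (distr_fourier U)"
  shows "represents (fourier_fun U) (distr_fourier U)" "AE z in lborel. fourier_fun U z = g z"
proof -
  show r: "represents (fourier_fun U) (distr_fourier U)"
    unfolding fourier_fun_def by (rule someI[of "\<lambda>g. represents g (distr_fourier U)", OF assms])
  show "AE z in lborel. fourier_fun U z = g z" by (rule represents_unique[OF r assms])
qed

section \<open>Elements of the Bourgain spaces as functions\<close>

lemma norm_convolve_le:
  assumes [measurable]: "f \<in> borel_measurable borel" "g \<in> borel_measurable borel"
  shows "ennreal (norm (convolve f g z)) \<le> (\<integral>\<^sup>+y. ennreal (norm (f y)) * ennreal (norm (g (z - y))) \<partial>lborel)"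
proof (cases "integrable lborel (\<lambda>y. f y * g (z - y))")
  case True
  have "ennreal (norm (convolve f g z)) \<le> (\<integral>\<^sup>+y. ennreal (norm (f y * g (z - y))) \<partial>lborel)"
    unfolding convolve_def by (rule integral_norm_bound_ennreal[OF True])
  then show ?thesis by (simp add: norm_mult ennreal_mult)
next
  case False
  then show ?thesis by (simp add: convolve_def not_integrable_integral_eq)
qed

text \<open>The cube of the transform is the transform of the threefold convolution, so its
  \<open>L^2\<close> norm is accessible to Plancherel and the trilinear bound. This is the
  Strichartz-type embedding of the space.\<close>

lemma inv_fourier_L6_bound:
  fixes s b :: real
  assumes "s > - 1 / 6" "b > 1 / 2"
  obtains C where "C < \<infinity>" "\<And>h. integrable lborel h \<Longrightarrow>
    (\<integral>\<^sup>+z. (ennreal (norm (inv_fourier h z))) ^ 6 \<partial>lborel) \<le> C * (\<integral>\<^sup>+z. (ennreal (weight s b z) * ennreal (norm (h z)))\<^sup>2 \<partial>lborel) ^ 3"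
proof -
  obtain C where C: "C < \<infinity>" "\<And>h1 h2 h3. h1 \<in> borel_measurable borel \<Longrightarrow> h2 \<in> borel_measurable borel \<Longrightarrow> h3 \<in> borel_measurable borel \<Longrightarrow>
    (\<integral>\<^sup>+z. (\<integral>\<^sup>+u. \<integral>\<^sup>+v. h1 u * h2 v * h3 (z - u - v) \<partial>lborel \<partial>lborel)\<^sup>2 \<partial>lborel)
    \<le> C * ((\<integral>\<^sup>+z. (ennreal (weight s b z) * h1 z)\<^sup>2 \<partial>lborel) * (\<integral>\<^sup>+z. (ennreal (weight s b z) * h2 z)\<^sup>2 \<partial>lborel) *
       (\<integral>\<^sup>+z. (ennreal (weight s b z) * h3 z)\<^sup>2 \<partial>lborel))"
    by (rule trilinear_L2_bound[OF assms]) blast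
  show thesis
  proof (rule that[of "ennreal ((2 * pi)\<^sup>2) * C"])
    show "ennreal ((2 * pi)\<^sup>2) * C < \<infinity>" using C by (auto simp: ennreal_mult_less_top)
    fix h :: "real \<times> real \<Rightarrow> complex"
    assume h: "integrable lborel h"
    then have [measurable]: "h \<in> borel_measurable borel" by auto
    let ?H = "convolve h (convolve h h)"
    have hh: "integrable lborel (convolve h h)" by (rule integrable_convolve[OF h h])
    have H: "integrable lborel ?H" by (rule integrable_convolve[OF h hh])
    let ?n = "\<lambda>z. ennreal (norm (h z))"
    let ?A = "\<integral>\<^sup>+z. (ennreal (weight s b z) * ?n z)\<^sup>2 \<partial>lborel"
    have "inv_fourier ?H z = inv_fourier h z * (inv_fourier h z * inv_fourier h z)" for z
      unfolding inv_fourier_convolve[OF h hh] inv_fourier_convolve[OF h h] ..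
    then have "(\<integral>\<^sup>+z. (ennreal (norm (inv_fourier h z))) ^ 6 \<partial>lborel) = (\<integral>\<^sup>+z. (ennreal (norm (inv_fourier ?H z)))\<^sup>2 \<partial>lborel)"
      by (intro nn_integral_cong) (simp add: norm_mult ennreal_mult power_mult_distrib power_add[symmetric])
    also have "\<dots> \<le> ennreal ((2 * pi)\<^sup>2) * (\<integral>\<^sup>+w. (ennreal (norm (?H w)))\<^sup>2 \<partial>lborel)"
      by (rule Plancherel_le[OF H])
    also have "(\<integral>\<^sup>+w. (ennreal (norm (?H w)))\<^sup>2 \<partial>lborel) \<le> (\<integral>\<^sup>+z. (\<integral>\<^sup>+u. \<integral>\<^sup>+v. ?n u * ?n v * ?n (z - u - v) \<partial>lborel \<partial>lborel)\<^sup>2 \<partial>lborel)"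
    proof (intro nn_integral_mono power_mono)
      fix z
      have "ennreal (norm (?H z)) \<le> (\<integral>\<^sup>+u. ?n u * ennreal (norm (convolve h h (z - u))) \<partial>lborel)"
        by (rule norm_convolve_le) measurable
      also have "\<dots> \<le> (\<integral>\<^sup>+u. ?n u * (\<integral>\<^sup>+v. ?n v * ?n (z - u - v) \<partial>lborel) \<partial>lborel)"
        by (intro nn_integral_mono mult_left_mono norm_convolve_le) auto
      also have "\<dots> = (\<integral>\<^sup>+u. \<integral>\<^sup>+v. ?n u * ?n v * ?n (z - u - v) \<partial>lborel \<partial>lborel)"
        by (simp add: nn_integral_cmult[symmetric] mult.assoc)
      finally show "ennreal (norm (?H z)) \<le> (\<integral>\<^sup>+u. \<integral>\<^sup>+v. ?n u * ?n v * ?n (z - u - v) \<partial>lborel \<partial>lborel)" .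
    qed simp
    also have "\<dots> \<le> C * (?A * ?A * ?A)" by (rule C(2)) measurable
    also have "ennreal ((2 * pi)\<^sup>2) * (C * (?A * ?A * ?A)) = ennreal ((2 * pi)\<^sup>2) * C * ?A ^ 3"
      by (simp only: power3_eq_cube mult.assoc)
    finally show "(\<integral>\<^sup>+z. (ennreal (norm (inv_fourier h z))) ^ 6 \<partial>lborel) \<le> ennreal ((2 * pi)\<^sup>2) * C * ?A ^ 3"
      by (simp add: mult_left_mono)
  qed
qed

lemma X_integrand_eq: "X_integrand s b U z = (weight s b z * norm (fourier_fun U z))\<^sup>2"
  by (simp add: X_integrand_def case_prod_beta' weight_def modulation_def)

lemma X_space_facts:
  assumes "U \<in> X_space s b"
  shows "represents (fourier_fun U) (distr_fourier U)" "fourier_fun U \<in> borel_measurable borel"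
    "(\<integral>\<^sup>+z. (ennreal (weight s b z) * ennreal (norm (fourier_fun U z)))\<^sup>2 \<partial>lborel) = ennreal ((X_norm s b U)\<^sup>2)"
proof -
  obtain g where "represents g (distr_fourier U)" using assms by (auto simp: X_space_def)
  then show r: "represents (fourier_fun U) (distr_fourier U)" by (rule fourier_fun_AE(1))
  then show "fourier_fun U \<in> borel_measurable borel" by (simp add: represents_def tempered_function_def)
  have i: "integrable lborel (X_integrand s b U)" using assms by (simp add: X_space_def)
  have p: "0 \<le> X_integrand s b U z" for z by (simp add: X_integrand_eq)
  have "(\<integral>\<^sup>+z. (ennreal (weight s b z) * ennreal (norm (fourier_fun U z)))\<^sup>2 \<partial>lborel) = (\<integral>\<^sup>+z. ennreal (X_integrand s b U z) \<partial>lborel)"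
    by (simp add: X_integrand_eq ennreal_mult ennreal_power[symmetric])
  also have "\<dots> = ennreal (LINT z|lborel. X_integrand s b U z)" by (rule nn_integral_eq_integral[OF i]) (simp add: p)
  also have "(LINT z|lborel. X_integrand s b U z) = (X_norm s b U)\<^sup>2"
    unfolding X_norm_def using p by (simp add: Bochner_Integration.integral_nonneg)
  finally show "(\<integral>\<^sup>+z. (ennreal (weight s b z) * ennreal (norm (fourier_fun U z)))\<^sup>2 \<partial>lborel) = ennreal ((X_norm s b U)\<^sup>2)" .
qed

definition truncate :: "real \<Rightarrow> (real \<times> real \<Rightarrow> complex) \<Rightarrow> real \<times> real \<Rightarrow> complex" where
  "truncate R g w = of_real (indicator (ball 0 R) w) * g w"

lemma truncate_simps: "norm w < R \<Longrightarrow> truncate R g w = g w" "R \<le> norm w \<Longrightarrow> truncate R g w = 0"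
  by (auto simp: truncate_def)

lemma norm_truncate_le: "norm (truncate R g w) \<le> norm (g w)"
  by (auto simp: truncate_def norm_mult indicator_def)

lemma measurable_truncate[measurable]: "g \<in> borel_measurable borel \<Longrightarrow> truncate R g \<in> borel_measurable borel"
proof -
  assume [measurable]: "g \<in> borel_measurable borel"
  have [measurable]: "ball 0 R \<in> sets (borel :: (real \<times> real) measure)" by simp
  show ?thesis unfolding truncate_def by measurable
qed

text \<open>Tempered functions are locally integrable: on the ball of radius \<open>R\<close> the
  Gaussian is at least \<open>exp (- R^2)\<close>, and the function times the Gaussian is
  integrable.\<close>

lemma integrable_truncate:
  assumes g: "tempered_function g"
  shows "integrable lborel (truncate R g)"
proof -
  have [measurable]: "g \<in> borel_measurable borel" using g by (simp add: tempered_function_def)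
  have i: "integrable lborel (\<lambda>z. g z * of_real (exp (- (norm z)\<^sup>2)))"
    using g schwartz_gaussian unfolding tempered_function_def by blast
  show ?thesis
  proof (rule Bochner_Integration.integrable_bound[OF integrable_mult_right[OF i, of "of_real (exp (R\<^sup>2))"]])
    show "AE w in lborel. norm (truncate R g w) \<le> norm (of_real (exp (R\<^sup>2)) * (g w * of_real (exp (- (norm w)\<^sup>2))))"
    proof (rule AE_I2)
      fix w
      show "norm (truncate R g w) \<le> norm (of_real (exp (R\<^sup>2)) * (g w * of_real (exp (- (norm w)\<^sup>2))))"
      proof (cases "norm w < R")
        case True
        then have "(norm w)\<^sup>2 \<le> R\<^sup>2" by (intro power_mono) auto
        then have "1 \<le> exp (R\<^sup>2) * exp (- (norm w)\<^sup>2)" by (simp add: exp_add[symmetric])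
        then have "norm (g w) * 1 \<le> norm (g w) * (exp (R\<^sup>2) * exp (- (norm w)\<^sup>2))" by (intro mult_left_mono) auto
        then show ?thesis using True by (simp add: truncate_simps norm_mult mult_ac)
      qed (simp add: truncate_simps)
    qed
  qed simp
qed

text \<open>The radii \<open>R n\<close> make the tails of the norm decay geometrically. The increments of the truncated
  inverse transforms then have \<open>L\<^sup>6\<close> norms that stay summable after multiplication by \<open>2\<^sup>n\<close>,
  which yields pointwise convergence and the majorant \<open>S\<close> at once.\<close>

lemma X_space_function:
  fixes s b :: real
  assumes s: "s > - 1 / 6" and b: "b > 1 / 2" and U: "U \<in> X_space s b"
  obtains u R S where "filterlim R at_top (sequentially :: nat filter)" "represents u U" "S \<in> borel_measurable borel"
    "\<And>z. 0 \<le> S z" "(\<integral>\<^sup>+z. ennreal (S z ^ 6) \<partial>lborel) < \<infinity>"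
    "AE z in lborel. \<forall>n. norm (of_real (1 / (2 * pi)\<^sup>2) * inv_fourier (truncate (R n) (fourier_fun U)) z) \<le> S z"
    "AE z in lborel. (\<lambda>n. of_real (1 / (2 * pi)\<^sup>2) * inv_fourier (truncate (R n) (fourier_fun U)) z) \<longlonglongrightarrow> u z"
    "AE z in lborel. norm (u z) \<le> S z"
proof -
  define g where "g = fourier_fun U"
  have rg: "represents g (distr_fourier U)" and g[measurable]: "g \<in> borel_measurable borel"
    unfolding g_def by (rule X_space_facts[OF U])+
  have tg: "tempered_function g" using rg by (simp add: represents_def)
  define X where "X z = (weight s b z * norm (g z))\<^sup>2" for z
  have X0: "0 \<le> X z" for z by (simp add: X_def)
  have X[measurable]: "integrable lborel X"
    using U unfolding X_space_def X_def g_def by (simp add: X_integrand_eq[abs_def])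
  define T where "T N = (LINT z|lborel. X z * indicator {z. real N \<le> norm z} z)" for N :: nat
  have iT: "integrable lborel (\<lambda>z. X z * indicator {z. r \<le> norm z} z)" for r
    by (rule Bochner_Integration.integrable_bound[OF X]) (auto simp: indicator_def X_def)
  have Tmono: "T N \<le> T M" if "M \<le> N" for M N
    unfolding T_def by (rule Bochner_Integration.integral_mono[OF iT iT]) (use that X0 in \<open>auto simp: indicator_def\<close>)
  have "T \<longlonglongrightarrow> (LINT z::real \<times> real|lborel. (0::real))"
    unfolding T_def
  proof (rule integral_dominated_convergence[where w = X])
    show "AE z in lborel. (\<lambda>N. X z * indicator {z. real N \<le> norm z} z) \<longlonglongrightarrow> 0"
    proof (rule AE_I2, rule tendsto_eventually)
      fix z :: "real \<times> real"
      obtain N :: nat where N: "norm z < real N" using reals_Archimedean2 by blast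
      show "\<forall>\<^sub>F n in sequentially. X z * indicator {z. real n \<le> norm z} z = 0"
        using eventually_ge_at_top[of N] by eventually_elim (use N in \<open>auto simp: indicator_def\<close>)
    qed
  qed (use X X0 in \<open>auto simp: indicator_def X_def\<close>)
  then have T0: "T \<longlonglongrightarrow> 0" by simp
  \<comment> \<open>The rate is dictated by the end of the estimate: the sixth power of the
    \<open>L^6\<close> norm of an increment is at most \<open>C * e n ^ 3 = C / 512^n\<close>, which
    beats the weight \<open>64^n\<close> with a factor \<open>8^n\<close> to spare.\<close>
  define e where "e n = (1 / 8 :: real) ^ n" for n :: nat
  have e: "0 < e n" "e (Suc n) \<le> e n" for n by (auto simp: e_def)
  have ex: "\<exists>N. T N \<le> e n" for n
    using order_tendstoD(2)[OF T0 e(1)[of n]] by (auto simp: eventually_sequentially intro: less_imp_le)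
  \<comment> \<open>Taking the least index makes \<open>L\<close> monotone. The summand
    \<open>n\<close> added in \<open>R\<close> sends the radii to infinity even if the tail vanishes
    early.\<close>
  define L where "L n = (LEAST N. T N \<le> e n)" for n
  have L: "T (L n) \<le> e n" for n unfolding L_def by (rule LeastI_ex[OF ex])
  have Lmono: "L n \<le> L (Suc n)" for n
    unfolding L_def[of n] by (rule Least_le) (rule order_trans[OF L e(2)])
  define R where "R n = real (n + L n)" for n
  have R: "T (n + L n) \<le> e n" for n by (rule order_trans[OF Tmono L]) simp
  have Rmono: "R n \<le> R (Suc n)" for n using Lmono[of n] by (simp add: R_def)
  have Rlim: "filterlim R at_top sequentially"
    by (rule filterlim_at_top_mono[OF filterlim_real_sequentially]) (simp add: R_def)
  define c where "c = complex_of_real (1 / (2 * pi)\<^sup>2)"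
  have c1: "norm c \<le> 1"
  proof -
    have "1 \<le> (2 * pi)\<^sup>2" using pi_ge_two by (intro one_le_power) simp
    then have "\<bar>1 / (2 * pi)\<^sup>2\<bar> \<le> 1" by (simp add: divide_le_eq)
    then show ?thesis unfolding c_def norm_of_real .
  qed
  let ?g = "\<lambda>n. truncate (R n) g"
  have ig: "integrable lborel (?g n)" for n by (rule integrable_truncate[OF tg])
  define un where "un n z = c * inv_fourier (?g n) z" for n z
  have [measurable]: "un n \<in> borel_measurable borel" for n unfolding un_def by measurable
  \<comment> \<open>Increments of the truncations, with the first truncation itself at index 0;
    hence \<open>un n\<close> is the sum over \<open>k < Suc n\<close>.\<close>
  define d where "d n = (case n of 0 \<Rightarrow> ?g 0 | Suc m \<Rightarrow> (\<lambda>w. ?g (Suc m) w - ?g m w))" for n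
  have id: "integrable lborel (d n)" for n
    by (cases n) (simp_all add: d_def ig)
  define v where "v n z = c * inv_fourier (d n) z" for n z
  have [measurable]: "d n \<in> borel_measurable borel" for n using id by auto
  have [measurable]: "v n \<in> borel_measurable borel" for n unfolding v_def by measurable
  have vS: "v (Suc n) z = un (Suc n) z - un n z" for n z
  proof -
    have "inv_fourier (\<lambda>w. ?g (Suc n) w - ?g n w) z = inv_fourier (?g (Suc n)) z - inv_fourier (?g n) z"
      unfolding inv_fourier_def right_diff_distrib
      by (rule Bochner_Integration.integral_diff; rule integrable_cis_mult; (rule ig | measurable))
    then show ?thesis by (simp add: v_def un_def d_def right_diff_distrib)
  qed
  have sum: "(\<Sum>k<Suc n. v k z) = un n z" for n z
  proof (induction n)
    case 0
    show ?case by (simp add: v_def un_def d_def)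
  next
    case (Suc n)
    then show ?case by (simp add: vS)
  qed
  obtain C where C: "C < \<infinity>" "\<And>h. integrable lborel h \<Longrightarrow>
    (\<integral>\<^sup>+z. (ennreal (norm (inv_fourier h z))) ^ 6 \<partial>lborel) \<le> C * (\<integral>\<^sup>+z. (ennreal (weight s b z) * ennreal (norm (h z)))\<^sup>2 \<partial>lborel) ^ 3"
    by (rule inv_fourier_L6_bound[OF s b]) blast
  define A where "A = (\<integral>\<^sup>+z. ennreal (X z) \<partial>lborel)"
  have A: "A < \<infinity>" using X X0 by (simp add: A_def integrable_iff_bounded)
  have nv: "(\<integral>\<^sup>+z. (ennreal (norm (v n z))) ^ 6 \<partial>lborel) \<le> C * (\<integral>\<^sup>+z. (ennreal (weight s b z) * ennreal (norm (d n z)))\<^sup>2 \<partial>lborel) ^ 3" for n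
  proof -
    have "(\<integral>\<^sup>+z. (ennreal (norm (v n z))) ^ 6 \<partial>lborel) \<le> (\<integral>\<^sup>+z. (ennreal (norm (inv_fourier (d n) z))) ^ 6 \<partial>lborel)"
    proof (intro nn_integral_mono power_mono ennreal_leI)
      show "norm (v n z) \<le> norm (inv_fourier (d n) z)" for z
        unfolding v_def norm_mult by (rule mult_left_le_one_le) (use c1 in auto)
    qed simp
    also have "\<dots> \<le> C * (\<integral>\<^sup>+z. (ennreal (weight s b z) * ennreal (norm (d n z)))\<^sup>2 \<partial>lborel) ^ 3" by (rule C(2)[OF id])
    finally show ?thesis .
  qed
  have wd: "(ennreal (weight s b z) * ennreal y)\<^sup>2 = ennreal ((weight s b z * y)\<^sup>2)" if "0 \<le> y" for z y
    using that by (simp add: ennreal_mult'[symmetric] ennreal_power)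
  have nvS: "(\<integral>\<^sup>+z. (ennreal (norm (v (Suc n) z))) ^ 6 \<partial>lborel) \<le> C * ennreal (e n ^ 3)" for n
  proof -
    have "(\<integral>\<^sup>+z. (ennreal (weight s b z) * ennreal (norm (d (Suc n) z)))\<^sup>2 \<partial>lborel)
      \<le> (\<integral>\<^sup>+z. ennreal (X z * indicator {z. real (n + L n) \<le> norm z} z) \<partial>lborel)"
    proof (rule nn_integral_mono)
      fix z
      have "norm (d (Suc n) z) \<le> norm (g z) * indicator {z. R n \<le> norm z} z"
      proof (cases "R n \<le> norm z")
        case True
        then show ?thesis using norm_truncate_le[of "R (Suc n)" g z] by (simp add: d_def truncate_simps)
      next
        case False
        then have "norm z < R n" "norm z < R (Suc n)" using Rmono[of n] by auto
        then show ?thesis by (simp add: d_def truncate_simps)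
      qed
      then have "(weight s b z * norm (d (Suc n) z))\<^sup>2 \<le> (weight s b z * (norm (g z) * indicator {z. R n \<le> norm z} z))\<^sup>2"
        by (intro power_mono mult_left_mono) auto
      also have "\<dots> = X z * indicator {z. real (n + L n) \<le> norm z} z"
        unfolding R_def by (simp add: X_def indicator_def)
      finally show "(ennreal (weight s b z) * ennreal (norm (d (Suc n) z)))\<^sup>2 \<le> ennreal (X z * indicator {z. real (n + L n) \<le> norm z} z)"
        unfolding wd[OF norm_ge_zero] by (rule ennreal_leI)
    qed
    also have "\<dots> = ennreal (T (n + L n))"
      unfolding T_def by (rule nn_integral_eq_integral[OF iT]) (simp add: X0)
    also have "\<dots> \<le> ennreal (e n)" by (rule ennreal_leI[OF R])
    finally have "(\<integral>\<^sup>+z. (ennreal (weight s b z) * ennreal (norm (d (Suc n) z)))\<^sup>2 \<partial>lborel) ^ 3 \<le> ennreal (e n) ^ 3"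
      by (rule power_mono) simp
    then have "C * (\<integral>\<^sup>+z. (ennreal (weight s b z) * ennreal (norm (d (Suc n) z)))\<^sup>2 \<partial>lborel) ^ 3 \<le> C * ennreal (e n) ^ 3"
      by (rule mult_left_mono) simp
    with nv[of "Suc n"] show ?thesis using e(1)[of n] by (simp add: ennreal_power less_imp_le)
  qed
  have nv0: "(\<integral>\<^sup>+z. (ennreal (norm (v 0 z))) ^ 6 \<partial>lborel) < \<infinity>"
  proof -
    have "(\<integral>\<^sup>+z. (ennreal (weight s b z) * ennreal (norm (d 0 z)))\<^sup>2 \<partial>lborel) \<le> A"
      unfolding A_def
    proof (rule nn_integral_mono)
      fix z
      have "(weight s b z * norm (d 0 z))\<^sup>2 \<le> X z"
        unfolding X_def d_def using norm_truncate_le[of "R 0" g z] by (intro power_mono mult_left_mono) auto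
      then show "(ennreal (weight s b z) * ennreal (norm (d 0 z)))\<^sup>2 \<le> ennreal (X z)"
        unfolding wd[OF norm_ge_zero] by (rule ennreal_leI)
    qed
    then have "C * (\<integral>\<^sup>+z. (ennreal (weight s b z) * ennreal (norm (d 0 z)))\<^sup>2 \<partial>lborel) ^ 3 \<le> C * A ^ 3"
      by (intro mult_left_mono power_mono) auto
    also have "\<dots> < \<infinity>" using C(1) A by (auto simp: ennreal_mult_less_top power_less_top_ennreal)
    finally show ?thesis using nv[of 0] by (rule le_less_trans[rotated])
  qed
  \<comment> \<open>Sums of sixth powers can be integrated term by term, and the weights
    \<open>2^(6 k)\<close> turn pointwise finiteness of \<open>Z\<close> into geometric decay of
    \<open>v k z\<close>.\<close>
  define Z where "Z z = (\<Sum>k. ennreal (2 ^ (6 * k)) * (ennreal (norm (v k z))) ^ 6)" for z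
  have [measurable]: "Z \<in> borel_measurable borel" unfolding Z_def by measurable
  have Zfin: "(\<integral>\<^sup>+z. Z z \<partial>lborel) < \<infinity>"
  proof -
    let ?a = "\<lambda>k. ennreal (2 ^ (6 * k)) * (\<integral>\<^sup>+z. (ennreal (norm (v k z))) ^ 6 \<partial>lborel)"
    have "(\<integral>\<^sup>+z. Z z \<partial>lborel) = (\<Sum>k. ?a k)"
      unfolding Z_def by (simp add: nn_integral_suminf nn_integral_cmult)
    also have "\<dots> = (\<Sum>k. ?a (Suc k)) + ?a 0"
      using suminf_offset[of ?a 1] by (simp add: add.commute)
    also have "\<dots> < \<infinity>"
    proof -
      have "(\<Sum>k. ?a (Suc k)) \<le> (\<Sum>k. (C * 64) * ennreal ((1 / 8) ^ k))"
      proof (rule suminf_le)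
        fix k
        have "?a (Suc k) \<le> ennreal (2 ^ (6 * Suc k)) * (C * ennreal (e k ^ 3))"
          by (intro mult_left_mono nvS) simp
        also have "\<dots> = C * ennreal (2 ^ (6 * Suc k) * e k ^ 3)"
          using e(1)[of k] by (simp add: ennreal_mult less_imp_le mult_ac)
        also have "2 ^ (6 * Suc k) * e k ^ 3 = 64 * (1 / 8) ^ k"
        proof -
          have "2 ^ (6 * Suc k) = 64 * (64::real) ^ k" by (simp add: power_mult power_add)
          moreover have "e k ^ 3 = (1 / 512) ^ k"
            unfolding e_def power_mult[symmetric] by (subst mult.commute, subst power_mult) (simp add: power3_eq_cube)
          moreover have "(64::real) ^ k * (1 / 512) ^ k = (1 / 8) ^ k" by (simp add: power_mult_distrib[symmetric])
          ultimately show ?thesis by simp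
        qed
        also have "C * ennreal (64 * (1 / 8) ^ k) = (C * 64) * ennreal ((1 / 8) ^ k)"
          by (subst ennreal_mult) (auto simp: mult_ac)
        finally show "?a (Suc k) \<le> (C * 64) * ennreal ((1 / 8) ^ k)" .
      qed auto
      also have "\<dots> = (C * 64) * (\<Sum>k. ennreal ((1 / 8) ^ k))" by simp
      also have "(\<Sum>k. ennreal ((1 / 8 :: real) ^ k)) = ennreal (\<Sum>k. (1 / 8) ^ k)"
        by (rule suminf_ennreal2) (auto intro: summable_geometric)
      finally have "(\<Sum>k. ?a (Suc k)) \<le> (C * 64) * ennreal (\<Sum>k. (1 / 8) ^ k)" .
      moreover have "(C * 64) * ennreal (\<Sum>k. (1 / 8) ^ k) < \<infinity>" using C(1) by (auto simp: ennreal_mult_less_top)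
      ultimately have "(\<Sum>k. ?a (Suc k)) < \<infinity>" by (rule le_less_trans)
      moreover have "?a 0 < \<infinity>" using nv0 by simp
      ultimately show ?thesis by simp
    qed
    finally show ?thesis .
  qed
  \<comment> \<open>Each \<open>2^k * norm (v k z)\<close> is at most the sixth root of
    \<open>Z z\<close>, and the geometric series of ratio 1/2 contributes the factor 2. Where
    \<open>Z\<close> is infinite, on a null set, \<open>S\<close> is 0.\<close>
  define S where "S z = 2 * root 6 (enn2real (Z z))" for z
  have S0: "0 \<le> S z" for z by (simp add: S_def)
  have [measurable]: "S \<in> borel_measurable borel" unfolding S_def by measurable
  have S6: "S z ^ 6 = 64 * enn2real (Z z)" for z
    by (simp add: S_def power_mult_distrib real_root_pow_pos2)
  have Sfin: "(\<integral>\<^sup>+z. ennreal (S z ^ 6) \<partial>lborel) < \<infinity>"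
  proof -
    have "(\<integral>\<^sup>+z. ennreal (S z ^ 6) \<partial>lborel) \<le> (\<integral>\<^sup>+z. 64 * Z z \<partial>lborel)"
    proof (rule nn_integral_mono)
      fix z
      show "ennreal (S z ^ 6) \<le> 64 * Z z"
        unfolding S6 by (cases "Z z") (auto simp: ennreal_mult)
    qed
    also have "\<dots> = 64 * (\<integral>\<^sup>+z. Z z \<partial>lborel)" by (rule nn_integral_cmult) measurable
    also have "\<dots> < \<infinity>" using Zfin by (auto simp: ennreal_mult_less_top)
    finally show ?thesis .
  qed
  have AEZ: "AE z in lborel. Z z < \<infinity>"
    using nn_integral_PInf_AE[of Z lborel] Zfin by (auto simp: less_top)
  have vb: "norm (v k z) \<le> (S z / 2) * (1 / 2) ^ k" if "Z z < \<infinity>" for k z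
  proof -
    have "ennreal (2 ^ (6 * k)) * (ennreal (norm (v k z))) ^ 6 \<le> Z z"
      unfolding Z_def using sum_le_suminf[of "\<lambda>k. ennreal (2 ^ (6 * k)) * (ennreal (norm (v k z))) ^ 6" "{k}"] by simp
    also have "Z z = ennreal (enn2real (Z z))" using that by simp
    finally have "2 ^ (6 * k) * norm (v k z) ^ 6 \<le> enn2real (Z z)"
      by (simp add: ennreal_power ennreal_mult'[symmetric])
    then have "(2 ^ k * norm (v k z)) ^ 6 \<le> enn2real (Z z)"
      by (simp add: power_mult_distrib power_mult[symmetric] mult.commute)
    also have "\<dots> = (root 6 (enn2real (Z z))) ^ 6" by (simp add: real_root_pow_pos2)
    finally have "2 ^ k * norm (v k z) \<le> root 6 (enn2real (Z z))"
      by (rule power_le_imp_le_base[of _ 5, simplified numeral_eq_Suc, simplified]) simp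
    then show ?thesis by (simp add: S_def power_divide field_simps)
  qed
  define u where "u z = (\<Sum>k. v k z)" for z
  have [measurable]: "u \<in> borel_measurable borel" unfolding u_def by measurable
  have conv: "(\<lambda>n. un n z) \<longlonglongrightarrow> u z" "norm (un n z) \<le> S z" if z: "Z z < \<infinity>" for n z
  proof -
    have sg: "summable (\<lambda>k. (S z / 2) * (1 / 2 :: real) ^ k)" by (intro summable_mult summable_geometric) simp
    have sv: "summable (\<lambda>k. norm (v k z))"
      by (rule summable_comparison_test'[OF sg, of 0]) (use vb[OF z] in simp)
    have "(\<lambda>n. \<Sum>k<n. v k z) \<longlonglongrightarrow> u z"
      unfolding u_def by (rule summable_LIMSEQ[OF summable_norm_cancel[OF sv]])
    from LIMSEQ_Suc[OF this] show "(\<lambda>n. un n z) \<longlonglongrightarrow> u z" unfolding sum .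
    have "norm (un n z) \<le> (\<Sum>k<Suc n. norm (v k z))" unfolding sum[symmetric] by (rule norm_sum)
    also have "\<dots> \<le> (\<Sum>k. norm (v k z))" by (rule sum_le_suminf[OF sv]) auto
    also have "\<dots> \<le> (\<Sum>k. (S z / 2) * (1 / 2 :: real) ^ k)" by (rule suminf_le[OF _ sv sg]) (rule vb[OF z])
    also have "\<dots> = S z" by (subst suminf_mult) (simp_all add: suminf_geometric summable_geometric)
    finally show "norm (un n z) \<le> S z" .
  qed
  have a1: "AE z in lborel. \<forall>n. norm (un n z) \<le> S z" using AEZ by eventually_elim (use conv in auto)
  have a2: "AE z in lborel. (\<lambda>n. un n z) \<longlonglongrightarrow> u z" using AEZ by eventually_elim (use conv in auto)
  have a3: "AE z in lborel. norm (u z) \<le> S z"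
    using a1 a2 by eventually_elim (rule Lim_bounded[OF tendsto_norm, where M = 0], auto)
  have iS: "integrable lborel (\<lambda>z. S z ^ 6)"
    using Sfin S0 by (simp add: integrable_iff_bounded)
  \<comment> \<open>A majorant in \<open>L^6\<close> is integrable against test functions because
    \<open>S z \<le> 1 + S z ^ 6\<close> and \<open>f\<close> is both bounded and
    integrable.\<close>
  have iSf: "integrable lborel (\<lambda>z. S z * norm (f z))" if f: "schwartz f" for f
  proof -
    have [measurable]: "f \<in> borel_measurable borel" by (rule schwartz_basic(4)[OF f])
    obtain B where B: "\<And>z. norm (f z) \<le> B"
      by (rule rapidE[OF schwartz_basic(2)[OF f], where m = 0]) auto
    have i: "integrable lborel (\<lambda>z. norm (f z) + B * S z ^ 6)"
      using schwartz_basic(5)[OF f] iS by simp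
    show ?thesis
    proof (rule Bochner_Integration.integrable_bound[OF i])
      show "AE z in lborel. norm (S z * norm (f z)) \<le> norm (norm (f z) + B * S z ^ 6)"
      proof (rule AE_I2)
        fix z
        have B0: "0 \<le> B" using order_trans[OF norm_ge_zero B] by blast
        have "S z \<le> 1 + S z ^ 6"
        proof (cases "S z \<le> 1")
          case False
          then have "S z ^ 1 \<le> S z ^ 6" by (intro power_increasing) auto
          then show ?thesis by simp
        qed (use S0[of z] in \<open>simp add: add_increasing2\<close>)
        then have "S z * norm (f z) \<le> (1 + S z ^ 6) * norm (f z)" by (rule mult_right_mono) simp
        also have "\<dots> = norm (f z) + norm (f z) * S z ^ 6" by (simp add: algebra_simps)
        also have "\<dots> \<le> norm (f z) + B * S z ^ 6" using B S0 by (intro add_left_mono mult_right_mono) auto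
        finally show "norm (S z * norm (f z)) \<le> norm (norm (f z) + B * S z ^ 6)"
          using S0[of z] B0 by simp
      qed
    qed simp
  qed
  have tu: "tempered_function u"
    unfolding tempered_function_def
  proof (intro conjI allI impI)
    fix f assume f: "schwartz f"
    have [measurable]: "f \<in> borel_measurable borel" by (rule schwartz_basic(4)[OF f])
    show "integrable lborel (\<lambda>z. u z * f z)"
    proof (rule Bochner_Integration.integrable_bound[OF iSf[OF f]])
      show "AE z in lborel. norm (u z * f z) \<le> norm (S z * norm (f z))"
        using a3 by eventually_elim (simp add: norm_mult S0 mult_right_mono)
    qed simp
  qed simp
  have "U f = distr_of u f" if f: "schwartz f" for f
  proof -
    have [measurable]: "f \<in> borel_measurable borel" by (rule schwartz_basic(4)[OF f])
    let ?h = "\<lambda>z. c * inv_fourier f z"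
    have h: "schwartz ?h" by (rule schwartz_inv_fourier[OF f])
    \<comment> \<open>Inversion writes \<open>f\<close> as a transform, on which \<open>U\<close>
      acts by integration against \<open>g\<close>. The multiplication formula for the truncations
      then leads back to the physical side.\<close>
    have "U f = U (fourier ?h)" unfolding c_def fourier_inversion[OF f] ..
    also have "\<dots> = (LINT w|lborel. g w * ?h w)"
      using rg h unfolding represents_def distr_fourier_def distr_of_def by blast
    finally have Uf: "U f = (LINT w|lborel. g w * ?h w)" .
    have igh: "integrable lborel (\<lambda>w. g w * ?h w)" using tg h unfolding tempered_function_def by blast
    have "(\<lambda>n. LINT w|lborel. ?g n w * ?h w) \<longlonglongrightarrow> (LINT w|lborel. g w * ?h w)"
    proof (rule integral_dominated_convergence[where w = "\<lambda>w. norm (g w * ?h w)"])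
      show "AE w in lborel. (\<lambda>n. ?g n w * ?h w) \<longlonglongrightarrow> g w * ?h w"
      proof (rule AE_I2, rule tendsto_eventually)
        fix w :: "real \<times> real"
        have "\<forall>\<^sub>F n in sequentially. norm w < R n" using Rlim by (simp add: filterlim_at_top_dense)
        then show "\<forall>\<^sub>F n in sequentially. ?g n w * ?h w = g w * ?h w" by eventually_elim (simp add: truncate_simps)
      qed
      show "AE w in lborel. norm (?g n w * ?h w) \<le> norm (g w * ?h w)" for n
        using norm_truncate_le[of "R n" g] by (intro AE_I2) (auto simp: norm_mult intro!: mult_right_mono)
    qed (use igh in auto)
    moreover have "(LINT w|lborel. ?g n w * ?h w) = (LINT z|lborel. un n z * f z)" for n
    proof -
      have "(LINT w|lborel. ?g n w * ?h w) = (LINT w|lborel. c * (?g n w * inv_fourier f w))"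
        by (rule Bochner_Integration.integral_cong) (simp_all add: mult_ac)
      also have "\<dots> = c * (LINT w|lborel. ?g n w * inv_fourier f w)" by (rule integral_mult_right_zero)
      also have "(LINT w|lborel. ?g n w * inv_fourier f w) = (LINT z|lborel. inv_fourier (?g n) z * f z)"
        by (rule inv_fourier_multiplication[OF ig schwartz_basic(5)[OF f], symmetric])
      also have "c * (LINT z|lborel. inv_fourier (?g n) z * f z) = (LINT z|lborel. c * (inv_fourier (?g n) z * f z))"
        by (rule integral_mult_right_zero[symmetric])
      finally show ?thesis by (simp only: un_def mult.assoc)
    qed
    moreover have "(\<lambda>n. LINT z|lborel. un n z * f z) \<longlonglongrightarrow> (LINT z|lborel. u z * f z)"
    proof (rule integral_dominated_convergence[OF _ _ iSf[OF f]])
      show "AE z in lborel. (\<lambda>n. un n z * f z) \<longlonglongrightarrow> u z * f z"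
        using a2 by eventually_elim (intro tendsto_intros)
      show "AE z in lborel. norm (un n z * f z) \<le> S z * norm (f z)" for n
        using a1 by eventually_elim (simp add: norm_mult mult_right_mono)
    qed auto
    ultimately have "(LINT w|lborel. g w * ?h w) = (LINT z|lborel. u z * f z)"
      by (simp only:) (rule LIMSEQ_unique)
    then show ?thesis unfolding Uf distr_of_def .
  qed
  then have ru: "represents u U" using tu by (simp add: represents_def)
  show thesis
    by (rule that[OF Rlim ru _ S0 Sfin a1[unfolded un_def c_def g_def] a2[unfolded un_def c_def g_def] a3]) measurable
qed

section \<open>The product of four functions\<close>

text \<open>The function \<open>Y\<close> is tested with itself after truncation in height and in
  space. The integral \<open>I\<close> of the squared truncation is then finite, so
  \<open>I^2 \<le> D * I\<close> can be divided by \<open>I\<close>.\<close>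

lemma L2_duality:
  fixes Y :: "'a::euclidean_space \<Rightarrow> ennreal"
  assumes [measurable]: "Y \<in> borel_measurable borel" and D: "D < \<infinity>"
    and dual: "\<And>\<phi>. \<phi> \<in> borel_measurable borel \<Longrightarrow> (\<integral>\<^sup>+z. Y z * \<phi> z \<partial>lborel)\<^sup>2 \<le> D * (\<integral>\<^sup>+z. (\<phi> z)\<^sup>2 \<partial>lborel)"
  shows "(\<integral>\<^sup>+z. (Y z)\<^sup>2 \<partial>lborel) \<le> D"
proof -
  define \<phi> where "\<phi> n z = min (Y z) (of_nat n) * indicator (ball 0 (real n)) z" for n :: nat and z
  have [measurable]: "ball 0 r \<in> sets (borel :: 'a measure)" for r by simp
  have [measurable]: "\<phi> n \<in> borel_measurable borel" for n unfolding \<phi>_def by measurable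
  have le: "\<phi> n z \<le> Y z" for n z by (auto simp: \<phi>_def indicator_def)
  have mono: "\<phi> n z \<le> \<phi> (Suc n) z" for n z
    unfolding \<phi>_def by (intro mult_mono min.mono) (auto simp: indicator_def)
  have bd: "(\<integral>\<^sup>+z. (\<phi> n z)\<^sup>2 \<partial>lborel) \<le> D" for n
  proof -
    let ?I = "\<integral>\<^sup>+z. (\<phi> n z)\<^sup>2 \<partial>lborel"
    have "?I \<le> (\<integral>\<^sup>+z. (of_nat n)\<^sup>2 * indicator (ball 0 (real n)) (z::'a) \<partial>lborel)"
    proof (rule nn_integral_mono)
      fix z
      have "\<phi> n z \<le> of_nat n * indicator (ball 0 (real n)) z" unfolding \<phi>_def by (intro mult_right_mono) auto
      then have "(\<phi> n z)\<^sup>2 \<le> (of_nat n * indicator (ball 0 (real n)) z)\<^sup>2" by (rule power_mono) simp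
      then show "(\<phi> n z)\<^sup>2 \<le> (of_nat n)\<^sup>2 * indicator (ball 0 (real n)) z" by (cases "z \<in> ball 0 (real n)") auto
    qed
    also have "\<dots> = (of_nat n)\<^sup>2 * emeasure lborel (ball 0 (real n) :: 'a set)" by (simp add: nn_integral_cmult)
    also have "\<dots> < \<infinity>"
      using emeasure_lborel_ball_finite[of "0::'a" "real n"]
      by (auto simp: ennreal_mult_less_top power2_eq_square of_nat_less_top)
    finally have fin: "?I < \<infinity>" .
    have "?I \<le> (\<integral>\<^sup>+z. Y z * \<phi> n z \<partial>lborel)"
      unfolding power2_eq_square by (intro nn_integral_mono mult_right_mono le) simp
    then have "?I\<^sup>2 \<le> (\<integral>\<^sup>+z. Y z * \<phi> n z \<partial>lborel)\<^sup>2" by (rule power_mono) simp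
    also have "\<dots> \<le> D * ?I" by (rule dual) measurable
    finally have sq: "?I * ?I \<le> D * ?I" by (simp add: power2_eq_square)
    show "?I \<le> D"
    proof (cases "?I = 0")
      case False
      obtain i where i: "?I = ennreal i" "0 \<le> i" using fin by (cases ?I) auto
      obtain d where d: "D = ennreal d" "0 \<le> d" using D by (cases D) auto
      have "i * i \<le> d * i" using sq unfolding i d using i(2) d(2) by (simp add: ennreal_mult[symmetric])
      moreover have "0 < i" using False i by (cases "i = 0") auto
      ultimately have "i \<le> d" by simp
      then show ?thesis unfolding i d by (rule ennreal_leI)
    qed simp
  qed
  have "(\<integral>\<^sup>+z. (Y z)\<^sup>2 \<partial>lborel) = (\<integral>\<^sup>+z. (SUP n. (\<phi> n z)\<^sup>2) \<partial>lborel)"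
  proof (rule nn_integral_cong)
    fix z :: 'a
    show "(Y z)\<^sup>2 = (SUP n. (\<phi> n z)\<^sup>2)"
    proof (rule antisym)
      show "(SUP n. (\<phi> n z)\<^sup>2) \<le> (Y z)\<^sup>2" by (intro SUP_least power_mono le) simp
      obtain N :: nat where N: "norm z < real N" using reals_Archimedean2 by blast
      have eq: "\<phi> n z = min (Y z) (of_nat n)" if "N \<le> n" for n
        using N that by (simp add: \<phi>_def indicator_def)
      show "(Y z)\<^sup>2 \<le> (SUP n. (\<phi> n z)\<^sup>2)"
      proof (cases "Y z")
        case (real r)
        obtain n :: nat where "r \<le> real n" using real_arch_simple by blast
        then have "Y z \<le> of_nat (max n N)"
          unfolding real(2) ennreal_of_nat_eq_real_of_nat by (intro ennreal_leI) simp
        then have "\<phi> (max n N) z = Y z" by (simp add: eq min_absorb1)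
        then show ?thesis by (metis SUP_upper UNIV_I)
      next
        case top
        have "of_nat n \<le> (SUP n. (\<phi> n z)\<^sup>2)" for n :: nat
        proof -
          have "(of_nat n :: ennreal) \<le> (of_nat (Suc (max n N)))\<^sup>2"
          proof -
            have "Suc (max n N) \<le> (Suc (max n N))\<^sup>2" by (rule self_le_power) simp_all
            then have "n \<le> (Suc (max n N))\<^sup>2" by linarith
            from of_nat_mono[OF this, where 'a = ennreal] show ?thesis by (simp only: of_nat_power)
          qed
          also have "\<dots> = (\<phi> (Suc (max n N)) z)\<^sup>2" by (simp add: eq top)
          also have "\<dots> \<le> (SUP n. (\<phi> n z)\<^sup>2)" by (rule SUP_upper) simp
          finally show ?thesis .
        qed
        then have "(SUP n. (of_nat n :: ennreal)) \<le> (SUP n. (\<phi> n z)\<^sup>2)" by (rule SUP_least)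
        then have "(SUP n. (\<phi> n z)\<^sup>2) = top"
          unfolding ennreal_SUP_of_nat_eq_top by (rule top.extremum_uniqueI)
        then show ?thesis by (simp only: top_greatest)
      qed
    qed
  qed
  also have "\<dots> = (SUP n. \<integral>\<^sup>+z. (\<phi> n z)\<^sup>2 \<partial>lborel)"
    by (intro nn_integral_monotone_convergence_SUP incseq_SucI le_funI power_mono mono) auto
  also have "\<dots> \<le> D" by (intro SUP_least bd)
  finally show ?thesis .
qed

lemma convolve_bounded:
  assumes f: "integrable lborel f" and [measurable]: "g \<in> borel_measurable borel" and g: "\<And>z. norm (g z) \<le> B"
  shows "norm (convolve f g z) \<le> (LINT y|lborel. norm (f y)) * B"
proof -
  have [measurable]: "f \<in> borel_measurable borel" using f by auto
  have B: "0 \<le> B" by (rule order_trans[OF norm_ge_zero g])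
  have "norm (convolve f g z) \<le> (LINT y|lborel. norm (f y * g (z - y)))"
    unfolding convolve_def by (rule integral_norm_bound)
  also have "\<dots> \<le> (LINT y|lborel. norm (f y) * B)"
  proof (rule integral_mono_AE')
    show "integrable lborel (\<lambda>y. norm (f y) * B)" using f by simp
    show "AE y in lborel. norm (f y * g (z - y)) \<le> norm (f y) * B"
      unfolding norm_mult by (intro AE_I2 mult_left_mono g norm_ge_zero)
  qed (use B in auto)
  also have "\<dots> = (LINT y|lborel. norm (f y)) * B" by simp
  finally show ?thesis .
qed

lemma convolve_continuous:
  assumes f: "integrable lborel f" and g: "\<And>z. norm (g z) \<le> B" and c: "continuous_on UNIV g"
  shows "continuous_on UNIV (convolve f g)"
proof -
  have [measurable]: "f \<in> borel_measurable borel" "g \<in> borel_measurable borel"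
    using f borel_measurable_continuous_onI[OF c] by auto
  have "(\<lambda>n. convolve f g (x n)) \<longlonglongrightarrow> convolve f g a" if x: "x \<longlonglongrightarrow> a" for x :: "nat \<Rightarrow> real \<times> real" and a
    unfolding convolve_def
  proof (rule integral_dominated_convergence[where w = "\<lambda>y. norm (f y) * B"])
    show "AE y in lborel. (\<lambda>n. f y * g (x n - y)) \<longlonglongrightarrow> f y * g (a - y)"
    proof (intro AE_I2 tendsto_mult tendsto_const)
      fix y
      have "isCont g (a - y)" using c by (simp add: continuous_on_eq_continuous_at del: split_paired_All)
      then show "(\<lambda>n. g (x n - y)) \<longlonglongrightarrow> g (a - y)"
        by (rule isCont_tendsto_compose) (intro tendsto_intros x)
    qed
    show "AE y in lborel. norm (f y * g (x n - y)) \<le> norm (f y) * B" for n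
      unfolding norm_mult by (intro AE_I2 mult_left_mono g norm_ge_zero)
  qed (use f in auto)
  then show ?thesis
    by (intro continuous_at_imp_continuous_on ballI) (simp add: continuous_at_sequentially o_def)
qed

lemma
  fixes g :: "'a::euclidean_space \<Rightarrow> complex" and q :: "'b::euclidean_space \<Rightarrow> complex"
  assumes g: "integrable lborel g" and q: "integrable lborel q"
    and [measurable]: "K \<in> borel_measurable borel" and K: "\<And>p. norm (K p) \<le> B"
  shows integrable_product_bounded: "integrable lborel (\<lambda>p. g (fst p) * q (snd p) * K p)"
    and integral_product_bounded: "(LINT p|lborel. g (fst p) * q (snd p) * K p) = (LINT x|lborel. g x * (LINT y|lborel. q y * K (x, y)))"
proof -
  have [measurable]: "g \<in> borel_measurable borel" "q \<in> borel_measurable borel" using g q by auto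
  have B: "0 \<le> B" by (rule order_trans[OF norm_ge_zero K])
  show i: "integrable lborel (\<lambda>p. g (fst p) * q (snd p) * K p)"
  proof (subst integrable_plane_iff)
    have "(\<integral>\<^sup>+x. \<integral>\<^sup>+y. ennreal (norm (g (fst (x, y)) * q (snd (x, y)) * K (x, y))) \<partial>lborel \<partial>lborel)
      \<le> (\<integral>\<^sup>+x. \<integral>\<^sup>+y. ennreal B * (ennreal (norm (g x)) * ennreal (norm (q y))) \<partial>lborel \<partial>lborel)"
    proof (intro nn_integral_mono)
      fix x y
      have "norm (g x * q y * K (x, y)) \<le> B * (norm (g x) * norm (q y))"
        unfolding norm_mult using mult_left_mono[OF K[of "(x, y)"], of "norm (g x) * norm (q y)"] by (simp add: mult_ac)
      then show "ennreal (norm (g (fst (x, y)) * q (snd (x, y)) * K (x, y))) \<le> ennreal B * (ennreal (norm (g x)) * ennreal (norm (q y)))"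
        using B by (simp add: ennreal_mult[symmetric] ennreal_leI)
    qed
    also have "\<dots> = ennreal B * ((\<integral>\<^sup>+x. ennreal (norm (g x)) \<partial>lborel) * (\<integral>\<^sup>+x. ennreal (norm (q x)) \<partial>lborel))"
      by (simp add: nn_integral_cmult nn_integral_multc)
    also have "\<dots> < \<infinity>" using g q by (auto simp: integrable_iff_bounded ennreal_mult_less_top)
    finally show "(\<integral>\<^sup>+x. \<integral>\<^sup>+y. ennreal (norm (g (fst (x, y)) * q (snd (x, y)) * K (x, y))) \<partial>lborel \<partial>lborel) < \<infinity>" .
  qed measurable
  show "(LINT p|lborel. g (fst p) * q (snd p) * K p) = (LINT x|lborel. g x * (LINT y|lborel. q y * K (x, y)))"
    unfolding lborel_Fubini_fst[OF i, symmetric] by (simp add: mult.assoc)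
qed

lemma integrable_inverse_power: "integrable lborel (\<lambda>z::real \<times> real. inverse ((1 + norm z) ^ 4))"
proof -
  have "inverse ((1 + norm (x, t)) ^ 4) \<le> japanese x powr - 2 * japanese t powr - 2" for x t :: real
  proof -
    have j: "japanese x \<le> 1 + norm (x, t)" "japanese t \<le> 1 + norm (x, t)"
      using japanese_le[of x] japanese_le[of t] abs_fst_le_norm[of "(x, t)"] abs_snd_le_norm[of "(x, t)"] by auto
    have "japanese x ^ 2 * japanese t ^ 2 \<le> (1 + norm (x, t)) ^ 2 * (1 + norm (x, t)) ^ 2"
      using j by (intro mult_mono power_mono) auto
    also have "\<dots> = (1 + norm (x, t)) ^ 4" by (simp add: power_add[symmetric])
    finally have "inverse ((1 + norm (x, t)) ^ 4) \<le> inverse (japanese x ^ 2 * japanese t ^ 2)"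
      by (rule le_imp_inverse_le) simp
    then show ?thesis by (simp add: powr_minus)
  qed
  then have "(\<integral>\<^sup>+x. \<integral>\<^sup>+t. ennreal (norm (inverse ((1 + norm (x::real, t::real)) ^ 4))) \<partial>lborel \<partial>lborel)
    \<le> (\<integral>\<^sup>+x. \<integral>\<^sup>+t. ennreal (japanese x powr - 2) * ennreal (japanese t powr - 2) \<partial>lborel \<partial>lborel)"
    by (intro nn_integral_mono) (simp add: ennreal_mult'[symmetric] ennreal_leI abs_of_nonneg del: norm_Pair)
  also have "\<dots> = (\<integral>\<^sup>+x. ennreal (japanese x powr - 2) \<partial>lborel) * (\<integral>\<^sup>+x. ennreal (japanese x powr - 2) \<partial>lborel)"
    by (simp add: nn_integral_cmult nn_integral_multc)
  also have "\<dots> < \<infinity>"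
    using integrable_japanese_2 by (auto simp: integrable_iff_bounded ennreal_mult_less_top)
  finally show ?thesis by (subst integrable_plane_iff) auto
qed

text \<open>Dominates a product of four \<open>L^6\<close> functions by an integrable function plus
  a constant; the constant is left to the decay of the test function.\<close>

lemma prod4_le_sum6:
  fixes a b c d :: real
  assumes "0 \<le> a" "0 \<le> b" "0 \<le> c" "0 \<le> d"
  shows "a * (b * (c * d)) \<le> 1 + (a ^ 6 + (b ^ 6 + (c ^ 6 + d ^ 6)))"
proof -
  define M where "M = max a (max b (max c d))"
  have M: "a \<le> M" "b \<le> M" "c \<le> M" "d \<le> M" "0 \<le> M" using assms by (auto simp: M_def)
  have "a * (b * (c * d)) \<le> M * (M * (M * M))" using M assms by (intro mult_mono) auto
  also have "\<dots> = M ^ 4" by (simp add: numeral_eq_Suc)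
  also have "\<dots> \<le> 1 + M ^ 6"
  proof (cases "M \<le> 1")
    case True
    then have "M ^ 4 \<le> 1" using M by (simp add: power_le_one)
    then show ?thesis using M by (simp add: add_increasing2)
  next
    case False
    then have "M ^ 4 \<le> M ^ 6" by (intro power_increasing) auto
    then show ?thesis by simp
  qed
  also have "M ^ 6 \<le> a ^ 6 + (b ^ 6 + (c ^ 6 + d ^ 6))"
  proof -
    have p: "0 \<le> a ^ 6" "0 \<le> b ^ 6" "0 \<le> c ^ 6" "0 \<le> d ^ 6" using assms by auto
    have "M = a \<or> M = b \<or> M = c \<or> M = d" by (auto simp: M_def max_def)
    then show ?thesis using p by (elim disjE) simp_all
  qed
  finally show ?thesis by simp
qed

text \<open>For \<open>b \<le> 1\<close> the modulation grows at most like
  \<open>snd z - fst z ^ 3\<close>, that is cubically, which accounts for the exponent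
  \<open>N + 3\<close>.\<close>

lemma weight_growth:
  assumes "b \<le> 1"
  shows "\<exists>C N. \<forall>z. weight r b z \<le> C * (1 + norm z) ^ N"
proof -
  obtain N :: nat where N: "r \<le> real N" using real_arch_simple by blast
  have "weight r b z \<le> 2 * (1 + norm z) ^ (N + 3)" for z
  proof -
    let ?n = "1 + norm z"
    have n1: "1 \<le> ?n" by simp
    have "japanese (fst z) powr r \<le> japanese (fst z) powr real N" by (intro powr_mono N japanese_ge1)
    also have "\<dots> = japanese (fst z) ^ N" by (simp add: powr_realpow)
    also have "\<dots> \<le> ?n ^ N" using japanese_le[of "fst z"] abs_fst_le_norm[of z] by (intro power_mono) auto
    finally have 1: "japanese (fst z) powr r \<le> ?n ^ N" .
    have "modulation b z \<le> modulation 1 z" using assms by (rule modulation_mono)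
    also have "\<dots> = japanese (snd z - fst z ^ 3)" by (simp add: modulation_def)
    also have "\<dots> \<le> 1 + \<bar>snd z - fst z ^ 3\<bar>" by (rule japanese_le)
    also have "\<dots> \<le> 1 + (\<bar>snd z\<bar> + \<bar>fst z\<bar> ^ 3)"
      unfolding power_abs[symmetric] by (intro add_left_mono abs_triangle_ineq4)
    also have "\<dots> \<le> ?n + ?n ^ 3"
    proof -
      have "\<bar>fst z\<bar> ^ 3 \<le> ?n ^ 3" using abs_fst_le_norm[of z] by (intro power_mono) auto
      then show ?thesis using abs_snd_le_norm[of z] by linarith
    qed
    also have "\<dots> \<le> 2 * ?n ^ 3" using self_le_power[OF n1, of 3] by simp
    finally have 2: "modulation b z \<le> 2 * ?n ^ 3" .
    have "weight r b z \<le> ?n ^ N * (2 * ?n ^ 3)" unfolding weight_def using 1 2 by (intro mult_mono) auto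
    then show ?thesis by (simp add: power_add mult_ac)
  qed
  then show ?thesis by blast
qed

text \<open>Polynomial growth of the weight keeps the product rapidly decreasing, hence bounded and
  integrable, and its square is at most the bound times its modulus.\<close>

lemma nn_integral_weight_schwartz:
  assumes "b \<le> 1" and f: "schwartz f"
  shows "(\<integral>\<^sup>+z. (ennreal (weight r b z) * ennreal (norm (f z)))\<^sup>2 \<partial>lborel) < \<infinity>"
proof -
  note m = schwartz_basic[OF f]
  have [measurable]: "f \<in> borel_measurable borel" by (rule m(4))
  obtain C N where CN: "\<And>z. weight r b z \<le> C * (1 + norm z) ^ N" using weight_growth[OF assms(1)] by blast
  let ?h = "\<lambda>z. of_real (weight r b z) * f z"
  have h: "rapid ?h" by (rule rapid_growth_mult[OF m(2), of _ C N]) (use CN in simp)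
  have i: "integrable lborel ?h" by (rule integrable_rapid[OF h]) measurable
  obtain B where B: "0 \<le> B" "\<And>z. norm (?h z) \<le> B" by (rule rapidE[OF h, where m = 0]) auto
  have "(\<integral>\<^sup>+z. (ennreal (weight r b z) * ennreal (norm (f z)))\<^sup>2 \<partial>lborel) \<le> (\<integral>\<^sup>+z. ennreal B * ennreal (norm (?h z)) \<partial>lborel)"
  proof (rule nn_integral_mono)
    fix z
    have "ennreal (weight r b z) * ennreal (norm (f z)) = ennreal (norm (?h z))"
      by (simp add: norm_mult ennreal_mult)
    then show "(ennreal (weight r b z) * ennreal (norm (f z)))\<^sup>2 \<le> ennreal B * ennreal (norm (?h z))"
      unfolding power2_eq_square by (simp only:) (intro mult_right_mono ennreal_leI B; simp)
  qed
  also have "\<dots> = ennreal B * (\<integral>\<^sup>+z. ennreal (norm (?h z)) \<partial>lborel)" by (rule nn_integral_cmult) measurable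
  also have "\<dots> < \<infinity>" using i by (auto simp: integrable_iff_bounded ennreal_mult_less_top)
  finally show ?thesis .
qed

lemma partial_x_add:
  assumes "f differentiable (at z)" "g differentiable (at z)"
  shows "partial_x (\<lambda>z. f z + g z) z = partial_x f z + partial_x g z"
proof -
  have "((\<lambda>z. f z + g z) has_derivative (\<lambda>v. frechet_derivative f (at z) v + frechet_derivative g (at z) v)) (at z)"
    using assms by (intro has_derivative_add) (simp_all add: frechet_derivative_works)
  from frechet_derivative_at[OF this] show ?thesis by (simp add: partial_x_def fun_eq_iff)
qed

lemma partial_x_cmult:
  assumes "f differentiable (at z)"
  shows "partial_x (\<lambda>z. c * f z) z = c * partial_x f z"
proof -
  have "((\<lambda>z. c * f z) has_derivative (\<lambda>v. c * frechet_derivative f (at z) v)) (at z)"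
    using assms by (intro has_derivative_mult_right) (simp add: frechet_derivative_works)
  from frechet_derivative_at[OF this] show ?thesis by (simp add: partial_x_def fun_eq_iff)
qed

lemma schwartz_norm_partial_x:
  assumes f: "schwartz f"
  shows "(1 + norm z) ^ 4 * norm (partial_x f z) \<le> schwartz_norm 4 f"
proof -
  let ?t = "\<lambda>j k. SUP z. (1 + norm z) ^ 4 * norm (mixed_partial j k f z)"
  have bdd: "bdd_above (range (\<lambda>z. (1 + norm z) ^ 4 * norm (mixed_partial j k f z)))" for j k
    using f unfolding schwartz_def by (intro bounded_imp_bdd_above) blast
  have t0: "0 \<le> ?t j k" for j k
    by (rule order_trans[OF _ cSUP_upper[OF UNIV_I[of 0] bdd]]) simp
  have "partial_x f = mixed_partial 1 0 f" by (simp add: mixed_partial_def)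
  then have "(1 + norm z) ^ 4 * norm (partial_x f z) \<le> ?t 1 0"
    by (simp only:) (rule cSUP_upper[OF UNIV_I bdd])
  also have "\<dots> \<le> (\<Sum>k\<le>4. ?t 1 k)" by (rule member_le_sum) (auto intro: t0)
  also have "\<dots> \<le> (\<Sum>j\<le>4. \<Sum>k\<le>4. ?t j k)"
    by (rule member_le_sum[of "1::nat" "{..4}" "\<lambda>j. \<Sum>k\<le>4. ?t j k"]) (auto intro: t0 sum_nonneg)
  finally show ?thesis unfolding schwartz_norm_def .
qed

lemma rapid_uminus:
  assumes "rapid f"
  shows "rapid (\<lambda>z. f (- z))"
  unfolding rapid_def
proof
  fix m
  obtain B where "0 \<le> B" and B: "\<And>z. (1 + norm z) ^ m * norm (f z) \<le> B" by (rule rapidE[OF assms, where m = m]) blast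
  have "(1 + norm z) ^ m * norm (f (- z)) \<le> B" for z using B[of "- z"] by simp
  then show "\<exists>B. \<forall>z. (1 + norm z) ^ m * norm (f (- z)) \<le> B" by blast
qed

text \<open>The conditions under which inversion at a point is available. The class is stable under
  convolution with integrable functions, so an iterated convolution stays inside once its innermost
  factor does.\<close>

definition fourier_regular :: "(real \<times> real \<Rightarrow> complex) \<Rightarrow> bool" where
  "fourier_regular h \<longleftrightarrow> integrable lborel h \<and> (\<exists>B. \<forall>z. norm (h z) \<le> B) \<and> continuous_on UNIV h
     \<and> integrable lborel (inv_fourier h)"

lemma fourier_regularD:
  assumes "fourier_regular h"
  shows "integrable lborel h" "continuous_on UNIV h" "integrable lborel (inv_fourier h)" "h \<in> borel_measurable borel"
  using assms by (auto simp: fourier_regular_def)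

lemma fourier_regular_bound:
  assumes "fourier_regular h"
  obtains B where "\<And>z. norm (h z) \<le> B"
  using assms unfolding fourier_regular_def by blast

lemma fourier_regular_convolve:
  assumes f: "integrable lborel f" and h: "fourier_regular h"
  shows "fourier_regular (convolve f h)"
proof -
  have [measurable]: "f \<in> borel_measurable borel" "h \<in> borel_measurable borel" using f fourier_regularD(4)[OF h] by auto
  obtain B where B: "\<And>z. norm (h z) \<le> B" by (rule fourier_regular_bound[OF h]) blast
  have "integrable lborel (\<lambda>z. inv_fourier f z * inv_fourier h z)"
  proof (rule Bochner_Integration.integrable_bound[OF integrable_mult_right[of "of_real (LINT w|lborel. norm (f w)) :: complex", OF fourier_regularD(3)[OF h]]])
    have "0 \<le> (LINT w|lborel. norm (f w))" by (rule Bochner_Integration.integral_nonneg) simp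
    then show "AE z in lborel. norm (inv_fourier f z * inv_fourier h z) \<le> norm (of_real (LINT w|lborel. norm (f w)) * inv_fourier h z)"
      using norm_inv_fourier_le[OF f] by (intro AE_I2) (auto simp: norm_mult intro!: mult_right_mono)
  qed measurable
  then have "integrable lborel (inv_fourier (convolve f h))"
    unfolding inv_fourier_convolve[OF f fourier_regularD(1)[OF h], abs_def] .
  moreover have "integrable lborel (convolve f h)" by (rule integrable_convolve[OF f fourier_regularD(1)[OF h]])
  moreover have "\<forall>z. norm (convolve f h z) \<le> (LINT y|lborel. norm (f y)) * B"
    by (intro allI convolve_bounded[OF f _ B]) measurable
  moreover have "continuous_on UNIV (convolve f h)" by (rule convolve_continuous[OF f B fourier_regularD(2)[OF h]])
  ultimately show ?thesis unfolding fourier_regular_def by blast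
qed

lemma integral_inv_fourier_regular:
  fixes h :: "real \<times> real \<Rightarrow> complex"
  assumes "fourier_regular h"
  shows "(LINT z|lborel. inv_fourier h z) = (2 * pi)\<^sup>2 * h 0"
proof -
  obtain B where B: "\<And>z. norm (h z) \<le> B" by (rule fourier_regular_bound[OF assms]) blast
  have "isCont h 0"
    using fourier_regularD(2)[OF assms] by (simp add: continuous_on_eq_continuous_at del: split_paired_All)
  then show ?thesis
    by (rule inv_fourier_inversion_0[OF fourier_regularD(1)[OF assms] B _ fourier_regularD(3)[OF assms]])
qed

text \<open>Written with a leading 0 and successive differences because this is literally the
  argument that nested convolutions evaluated at 0 produce.\<close>

definition neg_sum3 :: "(real \<times> real) \<times> (real \<times> real) \<times> (real \<times> real) \<Rightarrow> real \<times> real" where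
  "neg_sum3 q = 0 - fst q - fst (snd q) - snd (snd q)"

lemma measurable_neg_sum3[measurable]: "neg_sum3 \<in> borel_measurable borel"
  unfolding neg_sum3_def[abs_def] by (intro borel_measurable_continuous_onI continuous_intros)

text \<open>The product of the transforms is the transform of an iterated convolution, to which
  regularity of \<open>k\<close> passes outwards step by step. Inversion evaluates its integral as
  \<open>(2 * pi)^2\<close> times the convolution at 0.\<close>

lemma integral_product_inv_fourier:
  fixes g1 g2 g3 g4 k :: "real \<times> real \<Rightarrow> complex"
  assumes g1: "integrable lborel g1" and g2: "integrable lborel g2" and g3: "integrable lborel g3" and g4: "integrable lborel g4"
    and k: "fourier_regular k"
  shows "(LINT z|lborel. inv_fourier g1 z * (inv_fourier g2 z * (inv_fourier g3 z * (inv_fourier g4 z * inv_fourier k z))))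
    = (2 * pi)\<^sup>2 * (LINT p|lborel. g1 (fst (fst p)) * (g2 (fst (snd (fst p))) * g3 (snd (snd (fst p)))) * g4 (snd p)
        * k (neg_sum3 (fst p) - snd p))"
proof -
  have [measurable]: "g1 \<in> borel_measurable borel" "g2 \<in> borel_measurable borel" "g3 \<in> borel_measurable borel" "g4 \<in> borel_measurable borel"
    using g1 g2 g3 g4 by auto
  have k'[measurable]: "k \<in> borel_measurable borel" by (rule fourier_regularD(4)[OF k])
  note r4 = fourier_regular_convolve[OF g4 k]
  note r3 = fourier_regular_convolve[OF g3 r4]
  note r2 = fourier_regular_convolve[OF g2 r3]
  note r1 = fourier_regular_convolve[OF g1 r2]
  have "(LINT z|lborel. inv_fourier g1 z * (inv_fourier g2 z * (inv_fourier g3 z * (inv_fourier g4 z * inv_fourier k z))))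
      = (LINT z|lborel. inv_fourier (convolve g1 (convolve g2 (convolve g3 (convolve g4 k)))) z)"
    by (simp only: inv_fourier_convolve[OF g1 fourier_regularD(1)[OF r2]] inv_fourier_convolve[OF g2 fourier_regularD(1)[OF r3]]
        inv_fourier_convolve[OF g3 fourier_regularD(1)[OF r4]] inv_fourier_convolve[OF g4 fourier_regularD(1)[OF k]])
  also have "\<dots> = (2 * pi)\<^sup>2 * convolve g1 (convolve g2 (convolve g3 (convolve g4 k))) 0"
    by (rule integral_inv_fourier_regular[OF r1])
  also have "convolve g1 (convolve g2 (convolve g3 (convolve g4 k))) 0
    = (LINT p|lborel. g1 (fst (fst p)) * (g2 (fst (snd (fst p))) * g3 (snd (snd (fst p)))) * g4 (snd p) * k (neg_sum3 (fst p) - snd p))"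
  proof -
    let ?q2 = "\<lambda>r. g2 (fst r) * g3 (snd r)"
    let ?q3 = "\<lambda>q. g1 (fst q) * ?q2 (snd q)"
    have i2: "integrable lborel ?q2" using integrable_product_bounded[OF g2 g3, of "\<lambda>_. 1" 1] by simp
    have i3: "integrable lborel ?q3" using integrable_product_bounded[OF g1 i2, of "\<lambda>_. 1" 1] by simp
    obtain B where B: "\<And>z. norm (k z) \<le> B" by (rule fourier_regular_bound[OF k]) blast
    obtain B4 where B4: "\<And>z. norm (convolve g4 k z) \<le> B4" by (rule fourier_regular_bound[OF r4]) blast
    have "(LINT p|lborel. ?q3 (fst p) * g4 (snd p) * k (neg_sum3 (fst p) - snd p))
      = (LINT q|lborel. ?q3 q * (LINT w|lborel. g4 w * k (neg_sum3 (fst (q, w)) - snd (q, w))))"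
      by (rule integral_product_bounded[OF i3 g4 _ B]) measurable
    also have "\<dots> = (LINT q|lborel. ?q3 q * convolve g4 k (neg_sum3 q))" by (simp add: convolve_def)
    also have "\<dots> = (LINT x|lborel. g1 x * (LINT r|lborel. ?q2 r * convolve g4 k (neg_sum3 (x, r))))"
      by (rule integral_product_bounded[OF g1 i2 _ B4]) measurable
    also have "\<dots> = (LINT x|lborel. g1 x * convolve g2 (convolve g3 (convolve g4 k)) (0 - x))"
    proof -
      have "(LINT r|lborel. ?q2 r * convolve g4 k (neg_sum3 (x, r))) = convolve g2 (convolve g3 (convolve g4 k)) (0 - x)" for x
      proof -
        have "(LINT r|lborel. ?q2 r * convolve g4 k (neg_sum3 (x, r)))
          = (LINT y|lborel. g2 y * (LINT z|lborel. g3 z * convolve g4 k (neg_sum3 (x, (y, z)))))"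
          by (rule integral_product_bounded[OF g2 g3 _ B4]) measurable
        then show ?thesis by (simp add: convolve_def[of g2] convolve_def[of g3] neg_sum3_def)
      qed
      then show ?thesis by simp
    qed
    also have "\<dots> = convolve g1 (convolve g2 (convolve g3 (convolve g4 k))) 0" by (simp add: convolve_def[of g1])
    finally show ?thesis ..
  qed
  finally show ?thesis .
qed

text \<open>Substituting \<open>snd p = L (fst p) + v\<close> frees the argument of
  \<open>k\<close>. With \<open>L\<close> the negated sum of three inputs, the inner integral
  becomes the fourfold convolution at \<open>v\<close>, tested against
  \<open>k (- v)\<close>.\<close>

lemma integral_product_translate:
  fixes G :: "'a::euclidean_space \<Rightarrow> complex" and h k :: "'b::euclidean_space \<Rightarrow> complex"
  assumes [measurable]: "G \<in> borel_measurable borel" "h \<in> borel_measurable borel" "k \<in> borel_measurable borel" "L \<in> borel_measurable borel"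
    and i: "integrable lborel (\<lambda>p. G (fst p) * h (snd p) * k (L (fst p) - snd p))"
  shows "integrable lborel (\<lambda>v. (LINT q|lborel. G q * h (L q + v)) * k (- v))"
    and "(LINT p|lborel. G (fst p) * h (snd p) * k (L (fst p) - snd p)) = (LINT v|lborel. (LINT q|lborel. G q * h (L q + v)) * k (- v))"
proof -
  let ?F = "\<lambda>p. G (fst p) * h (snd p) * k (L (fst p) - snd p)"
  let ?H = "\<lambda>p. G (fst p) * h (L (fst p) + snd p) * k (- snd p)"
  have "(\<integral>\<^sup>+x. \<integral>\<^sup>+y. ennreal (norm (?H (x, y))) \<partial>lborel \<partial>lborel) = (\<integral>\<^sup>+x. \<integral>\<^sup>+y. ennreal (norm (?F (x, y))) \<partial>lborel \<partial>lborel)"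
  proof (rule nn_integral_cong)
    fix x
    have "(\<integral>\<^sup>+y. ennreal (norm (?F (x, L x + y))) \<partial>lborel) = (\<integral>\<^sup>+y. ennreal (norm (?F (x, y))) \<partial>lborel)"
      by (rule nn_integral_translate) measurable
    then show "(\<integral>\<^sup>+y. ennreal (norm (?H (x, y))) \<partial>lborel) = (\<integral>\<^sup>+y. ennreal (norm (?F (x, y))) \<partial>lborel)" by simp
  qed
  note nn = this
  have mF: "?F \<in> borel_measurable borel" by measurable
  have mH: "?H \<in> borel_measurable borel" by measurable
  have iH: "integrable lborel ?H"
    using i unfolding integrable_plane_iff[OF mF] integrable_plane_iff[OF mH] nn .
  have eq: "(LINT q|lborel. ?H (q, v)) = (LINT q|lborel. G q * h (L q + v)) * k (- v)" for v
    by simp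
  show "integrable lborel (\<lambda>v. (LINT q|lborel. G q * h (L q + v)) * k (- v))"
    using lborel_Fubini_integrable_snd[OF iH] unfolding eq .
  have "(LINT p|lborel. ?F p) = (LINT x|lborel. LINT y|lborel. ?F (x, y))" by (rule lborel_Fubini_fst[OF i, symmetric])
  also have "\<dots> = (LINT x|lborel. LINT y|lborel. ?H (x, y))"
  proof (rule Bochner_Integration.integral_cong[OF refl])
    fix x
    have "(LINT y|lborel. ?F (x, L x + y)) = (LINT y|lborel. ?F (x, y))" by (rule integral_translate) measurable
    then show "(LINT y|lborel. ?F (x, y)) = (LINT y|lborel. ?H (x, y))" by simp
  qed
  also have "\<dots> = (LINT z|lborel. ?H z)" by (rule lborel_Fubini_fst[OF iH])
  also have "\<dots> = (LINT y|lborel. LINT x|lborel. ?H (x, y))" by (rule lborel_Fubini_snd[OF iH, symmetric])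
  finally show "(LINT p|lborel. ?F p) = (LINT v|lborel. (LINT q|lborel. G q * h (L q + v)) * k (- v))" unfolding eq .
qed

text \<open>The same substitution for nonnegative integrals: the form is rewritten as a fourfold
  convolution tested against \<open>h0\<close>, ready for duality.\<close>

lemma nn_integral_form_translate:
  fixes h1 h2 h3 h4 h0 :: "real \<times> real \<Rightarrow> ennreal"
  assumes [measurable]: "h1 \<in> borel_measurable borel" "h2 \<in> borel_measurable borel" "h3 \<in> borel_measurable borel"
    "h4 \<in> borel_measurable borel" "h0 \<in> borel_measurable borel"
  shows "(\<integral>\<^sup>+x. \<integral>\<^sup>+y. \<integral>\<^sup>+z. \<integral>\<^sup>+w. h1 x * (h2 y * (h3 z * (h4 w * h0 (x + y + z + w)))) \<partial>lborel \<partial>lborel \<partial>lborel \<partial>lborel)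
    = (\<integral>\<^sup>+v. h0 v * (\<integral>\<^sup>+q. h1 (fst q) * (h2 (fst (snd q)) * h3 (snd (snd q))) * h4 (neg_sum3 q + v) \<partial>lborel) \<partial>lborel)"
proof -
  have n3: "x + y + z + w = w - neg_sum3 (x, y, z)" for x y z w by (simp add: neg_sum3_def)
  let ?G = "\<lambda>q. h1 (fst q) * (h2 (fst (snd q)) * h3 (snd (snd q)))"
  have "(\<integral>\<^sup>+x. \<integral>\<^sup>+y. \<integral>\<^sup>+z. \<integral>\<^sup>+w. h1 x * (h2 y * (h3 z * (h4 w * h0 (x + y + z + w)))) \<partial>lborel \<partial>lborel \<partial>lborel \<partial>lborel)
    = (\<integral>\<^sup>+x. \<integral>\<^sup>+y. \<integral>\<^sup>+z. \<integral>\<^sup>+w. ?G (x, y, z) * h4 w * h0 (w - neg_sum3 (x, y, z)) \<partial>lborel \<partial>lborel \<partial>lborel \<partial>lborel)"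
    by (simp only: n3 fst_conv snd_conv mult.assoc)
  also have "\<dots> = (\<integral>\<^sup>+x. \<integral>\<^sup>+r. \<integral>\<^sup>+w. ?G (x, r) * h4 w * h0 (w - neg_sum3 (x, r)) \<partial>lborel \<partial>lborel \<partial>lborel)"
    by (rule nn_integral_cong, rule nn_integral_plane[symmetric]) measurable
  also have "\<dots> = (\<integral>\<^sup>+q. \<integral>\<^sup>+w. ?G q * h4 w * h0 (w - neg_sum3 q) \<partial>lborel \<partial>lborel)"
    by (rule nn_integral_plane[symmetric]) measurable
  also have "\<dots> = (\<integral>\<^sup>+q. \<integral>\<^sup>+v. h0 v * (?G q * h4 (neg_sum3 q + v)) \<partial>lborel \<partial>lborel)"
  proof (rule nn_integral_cong)
    fix q
    have "(\<integral>\<^sup>+v. ?G q * h4 (neg_sum3 q + v) * h0 ((neg_sum3 q + v) - neg_sum3 q) \<partial>lborel) = (\<integral>\<^sup>+w. ?G q * h4 w * h0 (w - neg_sum3 q) \<partial>lborel)"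
      by (rule nn_integral_translate[of "\<lambda>w. ?G q * h4 w * h0 (w - neg_sum3 q)"]) measurable
    then show "(\<integral>\<^sup>+w. ?G q * h4 w * h0 (w - neg_sum3 q) \<partial>lborel) = (\<integral>\<^sup>+v. h0 v * (?G q * h4 (neg_sum3 q + v)) \<partial>lborel)"
      by (simp add: mult_ac)
  qed
  also have "\<dots> = (\<integral>\<^sup>+v. \<integral>\<^sup>+q. h0 v * (?G q * h4 (neg_sum3 q + v)) \<partial>lborel \<partial>lborel)"
    by (rule nn_integral_swap) measurable
  also have "\<dots> = (\<integral>\<^sup>+v. h0 v * (\<integral>\<^sup>+q. ?G q * h4 (neg_sum3 q + v) \<partial>lborel) \<partial>lborel)"
    by (intro nn_integral_cong nn_integral_cmult) measurable
  finally show ?thesis .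
qed

lemma integrable_against_decay:
  fixes W :: "real \<times> real \<Rightarrow> real" and \<psi> :: "real \<times> real \<Rightarrow> complex"
  assumes [measurable]: "W \<in> borel_measurable borel" "\<psi> \<in> borel_measurable borel"
    and W: "\<And>z. 0 \<le> W z" and i: "integrable lborel (\<lambda>z. inverse ((1 + norm z) ^ 4) * W z)"
    and B: "\<And>z. (1 + norm z) ^ 4 * norm (\<psi> z) \<le> B"
  shows "integrable lborel (\<lambda>z. W z * norm (\<psi> z))"
    and "(LINT z|lborel. W z * norm (\<psi> z)) \<le> B * (LINT z|lborel. inverse ((1 + norm z) ^ 4) * W z)"
proof -
  have le: "W z * norm (\<psi> z) \<le> B * (inverse ((1 + norm z) ^ 4) * W z)" for z
  proof -
    have p: "0 < (1 + norm z) ^ 4" using norm_ge_zero[of z] by (intro zero_less_power) linarith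
    have "norm (\<psi> z) \<le> B * inverse ((1 + norm z) ^ 4)"
      unfolding divide_inverse[symmetric] pos_le_divide_eq[OF p] using B[of z] by (simp only: mult.commute)
    from mult_left_mono[OF this W[of z]] show ?thesis by (simp only: mult_ac)
  qed
  have iB: "integrable lborel (\<lambda>z. B * (inverse ((1 + norm z) ^ 4) * W z))" by (rule integrable_mult_right[OF i])
  show 1: "integrable lborel (\<lambda>z. W z * norm (\<psi> z))"
  proof (rule Bochner_Integration.integrable_bound[OF iB])
    show "AE z in lborel. norm (W z * norm (\<psi> z)) \<le> norm (B * (inverse ((1 + norm z) ^ 4) * W z))"
      using le W by (intro AE_I2) (smt (verit) mult_nonneg_nonneg norm_ge_zero real_norm_def)
  qed measurable
  show "(LINT z|lborel. W z * norm (\<psi> z)) \<le> B * (LINT z|lborel. inverse ((1 + norm z) ^ 4) * W z)"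
    using Bochner_Integration.integral_mono[OF 1 iB le] by simp
qed

text \<open>Four powers of decay of \<open>partial_x f\<close> make the pairing with
  \<open>W\<close> converge, so \<open>schwartz_norm 4\<close> controls the derivative.\<close>

lemma tempered_distr_dx:
  assumes P[measurable]: "P \<in> borel_measurable borel" and [measurable]: "W \<in> borel_measurable borel"
    and W: "\<And>z. 0 \<le> W z" and i: "integrable lborel (\<lambda>z. inverse ((1 + norm z) ^ 4) * W z)"
    and PW: "AE z in lborel. norm (P z) \<le> W z"
  shows "tempered_function P" and "tempered (distr_dx (distr_of P))"
proof -
  have iP: "integrable lborel (\<lambda>z. P z * \<psi> z)" "norm (LINT z|lborel. P z * \<psi> z) \<le> B * (LINT z|lborel. inverse ((1 + norm z) ^ 4) * W z)"
    if [measurable]: "\<psi> \<in> borel_measurable borel" and B: "\<And>z. (1 + norm z) ^ 4 * norm (\<psi> z) \<le> B" for \<psi> B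
  proof -
    note d = integrable_against_decay[OF \<open>W \<in> borel_measurable borel\<close> that(1) W i B]
    have le: "AE z in lborel. norm (P z * \<psi> z) \<le> W z * norm (\<psi> z)"
      using PW by eventually_elim (simp add: norm_mult mult_right_mono)
    show 1: "integrable lborel (\<lambda>z. P z * \<psi> z)"
    proof (rule Bochner_Integration.integrable_bound[OF d(1)])
      show "AE z in lborel. norm (P z * \<psi> z) \<le> norm (W z * norm (\<psi> z))"
        using le by eventually_elim simp
    qed measurable
    have "norm (LINT z|lborel. P z * \<psi> z) \<le> (LINT z|lborel. norm (P z * \<psi> z))" by (rule integral_norm_bound)
    also have "\<dots> \<le> (LINT z|lborel. W z * norm (\<psi> z))" by (rule integral_mono_AE[OF integrable_norm[OF 1] d(1) le])
    also note d(2)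
    finally show "norm (LINT z|lborel. P z * \<psi> z) \<le> B * (LINT z|lborel. inverse ((1 + norm z) ^ 4) * W z)" .
  qed
  show "tempered_function P"
    unfolding tempered_function_def
  proof (intro conjI allI impI P)
    fix f assume f: "schwartz f"
    obtain B where "0 \<le> B" and B: "\<And>z. (1 + norm z) ^ 4 * norm (f z) \<le> B" by (rule rapidE[OF schwartz_basic(2)[OF f], where m = 4]) blast
    show "integrable lborel (\<lambda>z. P z * f z)" by (rule iP(1)[OF schwartz_basic(4)[OF f] B])
  qed
  have m: "partial_x f \<in> borel_measurable borel" if "schwartz f" for f
    using schwartz_mixed(4)[OF that, of 1 0] by (simp add: mixed_partial_def)
  note ix = iP[OF m schwartz_norm_partial_x]
  let ?I = "LINT z|lborel. inverse ((1 + norm z) ^ 4) * W z"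
  show "tempered (distr_dx (distr_of P))"
    unfolding tempered_def
  proof (intro conjI allI impI)
    fix f g assume f: "schwartz f" and g: "schwartz g"
    have "partial_x (\<lambda>z. f z + g z) = (\<lambda>z. partial_x f z + partial_x g z)"
      by (rule ext, rule partial_x_add[OF schwartz_basic(1)[OF f] schwartz_basic(1)[OF g]])
    then show "distr_dx (distr_of P) (\<lambda>z. f z + g z) = distr_dx (distr_of P) f + distr_dx (distr_of P) g"
      by (simp add: distr_dx_def distr_of_def distrib_left Bochner_Integration.integral_add[OF ix(1)[OF f f] ix(1)[OF g g]])
  next
    fix c f assume f: "schwartz f"
    have "partial_x (\<lambda>z. c * f z) = (\<lambda>z. c * partial_x f z)"
      by (rule ext, rule partial_x_cmult[OF schwartz_basic(1)[OF f]])
    then show "distr_dx (distr_of P) (\<lambda>z. c * f z) = c * distr_dx (distr_of P) f"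
      by (simp add: distr_dx_def distr_of_def mult.left_commute)
  next
    have "\<forall>f. schwartz f \<longrightarrow> norm (distr_dx (distr_of P) f) \<le> ?I * schwartz_norm 4 f"
    proof (intro allI impI)
      fix f assume f: "schwartz f"
      show "norm (distr_dx (distr_of P) f) \<le> ?I * schwartz_norm 4 f"
        using ix(2)[OF f f] by (simp add: distr_dx_def distr_of_def mult.commute)
    qed
    then show "\<exists>C N. \<forall>f. schwartz f \<longrightarrow> norm (distr_dx (distr_of P) f) \<le> C * schwartz_norm N f" by blast
  qed
qed

section \<open>The Fourier transform of the differentiated product\<close>

definition partial_inverse :: "real \<Rightarrow> (real \<times> real \<Rightarrow> complex) \<Rightarrow> real \<times> real \<Rightarrow> complex" where
  "partial_inverse R g z = of_real (1 / (2 * pi)\<^sup>2) * inv_fourier (truncate R g) z"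

text \<open>Chosen so that its \<open>inv_fourier\<close> is the \<open>x\<close>-derivative of
  \<open>fourier f\<close>; the reflection of \<open>f\<close> comes from expressing
  \<open>fourier\<close> by \<open>inv_fourier\<close>.\<close>

definition dx_symbol :: "(real \<times> real \<Rightarrow> complex) \<Rightarrow> real \<times> real \<Rightarrow> complex" where
  "dx_symbol f v = \<i> * of_real (fst v) * f (- v)"

text \<open>The first three inputs form one component and the fourth the other, the product shape in
  which the fourth can be translated by the other three.\<close>

definition quintic_integrand where
  "quintic_integrand g k p = g (1::nat) (fst (fst p)) * (g 2 (fst (snd (fst p))) * g 3 (snd (snd (fst p)))) * g 4 (snd p)
     * (k (neg_sum3 (fst p) - snd p) :: complex)"

lemma measurable_quintic_integrand:
  assumes [measurable]: "\<And>j. g j \<in> borel_measurable borel" "k \<in> borel_measurable borel"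
  shows "quintic_integrand g k \<in> borel_measurable borel"
  unfolding quintic_integrand_def[abs_def] by measurable

lemma fourier_regular_dx_symbol:
  assumes f: "schwartz f"
  shows "fourier_regular (dx_symbol f)" and "rapid (inv_fourier (dx_symbol f))"
    and "partial_x (fourier f) = inv_fourier (dx_symbol f)"
proof -
  have k: "dx_symbol f = (\<lambda>v. \<i> * of_real (fst v) * f (- v))" by (simp add: dx_symbol_def fun_eq_iff)
  have [measurable]: "f \<in> borel_measurable borel" by (rule schwartz_basic(4)[OF f])
  have m[measurable]: "dx_symbol f \<in> borel_measurable borel" unfolding k by measurable
  have r: "rapid (dx_symbol f)"
    unfolding k
  proof (rule rapid_growth_mult[OF rapid_uminus[OF schwartz_basic(2)[OF f]], of _ 1 1])
    fix z :: "real \<times> real"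
    show "norm (\<i> * of_real (fst z) :: complex) \<le> 1 * (1 + norm z) ^ 1"
      using abs_fst_le_norm[of z] by (simp add: norm_mult)
  qed
  show r': "rapid (inv_fourier (dx_symbol f))" using fourier_schwartz(3)[OF f] by (simp add: k[symmetric])
  show "partial_x (fourier f) = inv_fourier (dx_symbol f)" using fourier_schwartz(2)[OF f] by (simp add: k[symmetric] fun_eq_iff)
  obtain B where "0 \<le> B" and B: "\<And>z. (1 + norm z) ^ 0 * norm (dx_symbol f z) \<le> B" by (rule rapidE[OF r, where m = 0]) blast
  have "\<forall>z. norm (dx_symbol f z) \<le> B" using B by simp
  moreover have "continuous_on UNIV (dx_symbol f)"
    unfolding k by (intro continuous_intros continuous_on_compose2[OF schwartz_basic(3)[OF f]]) auto
  moreover have "integrable lborel (dx_symbol f)" by (rule integrable_rapid[OF r m])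
  moreover have "integrable lborel (inv_fourier (dx_symbol f))" by (rule integrable_rapid[OF r']) measurable
  ultimately show "fourier_regular (dx_symbol f)" unfolding fourier_regular_def by blast
qed

lemma integrable_decay_product:
  fixes S :: "nat \<Rightarrow> real \<times> real \<Rightarrow> real"
  assumes [measurable]: "\<And>j. S j \<in> borel_measurable borel" and S: "\<And>j z. 0 \<le> S j z" "\<And>j. (\<integral>\<^sup>+z. ennreal (S j z ^ 6) \<partial>lborel) < \<infinity>"
  shows "integrable lborel (\<lambda>z. inverse ((1 + norm z) ^ 4) * (S 1 z * (S 2 z * (S 3 z * S 4 z))))"
proof -
  have i6: "integrable lborel (\<lambda>z. S j z ^ 6)" for j
    using S by (simp add: integrable_iff_bounded)
  have i: "integrable lborel (\<lambda>z. inverse ((1 + norm z) ^ 4) + (S 1 z ^ 6 + (S 2 z ^ 6 + (S 3 z ^ 6 + S 4 z ^ 6))))"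
    by (intro Bochner_Integration.integrable_add i6 integrable_inverse_power)
  show ?thesis
  proof (rule Bochner_Integration.integrable_bound[OF i])
    show "AE z in lborel. norm (inverse ((1 + norm z) ^ 4) * (S 1 z * (S 2 z * (S 3 z * S 4 z))))
      \<le> norm (inverse ((1 + norm z) ^ 4) + (S 1 z ^ 6 + (S 2 z ^ 6 + (S 3 z ^ 6 + S 4 z ^ 6))))"
    proof (rule AE_I2)
      fix z :: "real \<times> real"
      define r where "r = inverse ((1 + norm z) ^ 4)"
      define p where "p = S 1 z * (S 2 z * (S 3 z * S 4 z))"
      define q where "q = S 1 z ^ 6 + (S 2 z ^ 6 + (S 3 z ^ 6 + S 4 z ^ 6))"
      have r: "0 \<le> r" "r \<le> 1" unfolding r_def by (auto intro!: inverse_le_1_iff[THEN iffD2] one_le_power)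
      have p: "0 \<le> p" "p \<le> 1 + q" unfolding p_def q_def by (intro mult_nonneg_nonneg S(1), intro prod4_le_sum6 S(1))
      have q: "0 \<le> q" unfolding q_def by (intro add_nonneg_nonneg zero_le_power S(1))
      have "r * p \<le> r * (1 + q)" by (rule mult_left_mono[OF p(2) r(1)])
      also have "\<dots> \<le> r + q" using mult_right_mono[OF r(2) q] by (simp add: distrib_left)
      finally show "norm (r * p) \<le> norm (r + q)" using r p q by simp
    qed
  qed measurable
qed

text \<open>The data of the waves: transforms \<open>g\<close>, truncation radii \<open>R\<close>,
  limits \<open>u\<close> of the truncated inverse transforms and their \<open>L^6\<close> majorants
  \<open>S\<close>. The assumption \<open>quint\<close>, absolute convergence on the frequency side,
  is supplied later by the form bound.\<close>

context
  fixes g u :: "nat \<Rightarrow> real \<times> real \<Rightarrow> complex" and S :: "nat \<Rightarrow> real \<times> real \<Rightarrow> real" and R :: "nat \<Rightarrow> nat \<Rightarrow> real"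
  assumes tg: "\<And>j. tempered_function (g j)" and R: "\<And>j. filterlim (R j) at_top sequentially"
    and u: "\<And>j. u j \<in> borel_measurable borel" and S: "\<And>j. S j \<in> borel_measurable borel" "\<And>j z. 0 \<le> S j z"
      "\<And>j. (\<integral>\<^sup>+z. ennreal (S j z ^ 6) \<partial>lborel) < \<infinity>"
    and bd: "\<And>j. AE z in lborel. \<forall>n. norm (partial_inverse (R j n) (g j) z) \<le> S j z"
    and lim: "\<And>j. AE z in lborel. (\<lambda>n. partial_inverse (R j n) (g j) z) \<longlonglongrightarrow> u j z"
    and us: "\<And>j. AE z in lborel. norm (u j z) \<le> S j z"
    and quint: "\<And>f. schwartz f \<Longrightarrow> integrable lborel (quintic_integrand g (dx_symbol f))"
begin

lemma measurable_waves: "g j \<in> borel_measurable borel" "u j \<in> borel_measurable borel" "S j \<in> borel_measurable borel"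
  "partial_inverse r (g j) \<in> borel_measurable borel"
proof -
  show [measurable]: "g j \<in> borel_measurable borel" using tg[of j] by (simp add: tempered_function_def)
  show "partial_inverse r (g j) \<in> borel_measurable borel" unfolding partial_inverse_def[abs_def] by measurable
qed (rule u S)+

lemmas [measurable] = measurable_waves

lemma tempered_product:
  "tempered_function (\<lambda>z. u 1 z * (u 2 z * (u 3 z * u 4 z)))"
  "tempered (distr_dx (distr_of (\<lambda>z. u 1 z * (u 2 z * (u 3 z * u 4 z)))))"
proof -
  have 1: "(\<lambda>z. u 1 z * (u 2 z * (u 3 z * u 4 z))) \<in> borel_measurable borel" by measurable
  have 2: "(\<lambda>z. S 1 z * (S 2 z * (S 3 z * S 4 z))) \<in> borel_measurable borel" by measurable
  have 3: "0 \<le> S 1 z * (S 2 z * (S 3 z * S 4 z))" for z by (intro mult_nonneg_nonneg S(2))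
  have 4: "AE z in lborel. norm (u 1 z * (u 2 z * (u 3 z * u 4 z))) \<le> S 1 z * (S 2 z * (S 3 z * S 4 z))"
    using us[of 1] us[of 2] us[of 3] us[of 4]
    by eventually_elim (simp only: norm_mult, intro mult_mono mult_nonneg_nonneg norm_ge_zero S(2))
  show "tempered_function (\<lambda>z. u 1 z * (u 2 z * (u 3 z * u 4 z)))"
    "tempered (distr_dx (distr_of (\<lambda>z. u 1 z * (u 2 z * (u 3 z * u 4 z)))))"
    by (rule tempered_distr_dx[OF 1 2 3 integrable_decay_product[OF S(1) S(2) S(3)] 4])+
qed

text \<open>The identity for truncations passes to the limit on both sides: the product of the
  majorants dominates in physical space, and the full quintic integrand on the frequency side, since
  truncation only shrinks moduli.\<close>

lemma integral_product_dx:
  assumes f: "schwartz f"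
  shows "(LINT z|lborel. u 1 z * (u 2 z * (u 3 z * u 4 z)) * inv_fourier (dx_symbol f) z)
    = of_real (1 / (2 * pi)\<^sup>2) ^ 4 * ((2 * pi)\<^sup>2 * (LINT p|lborel. quintic_integrand g (dx_symbol f) p))"
proof -
  let ?k = "dx_symbol f" and ?c = "complex_of_real (1 / (2 * pi)\<^sup>2)"
  note k = fourier_regular_dx_symbol[OF f]
  have [measurable]: "?k \<in> borel_measurable borel" by (rule fourier_regularD(4)[OF k(1)])
  let ?U = "\<lambda>n j. partial_inverse (R j n) (g j)"
  let ?t = "\<lambda>n j. truncate (R j n) (g j)"
  have it: "integrable lborel (?t n j)" for n j by (rule integrable_truncate[OF tg])
  define l where "l n = (LINT z|lborel. ?U n 1 z * (?U n 2 z * (?U n 3 z * ?U n 4 z)) * inv_fourier ?k z)" for n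
  have eq: "l n = ?c ^ 4 * ((2 * pi)\<^sup>2 * (LINT p|lborel. quintic_integrand (?t n) ?k p))" for n
  proof -
    have "l n = (LINT z|lborel. ?c ^ 4 * (inv_fourier (?t n 1) z * (inv_fourier (?t n 2) z * (inv_fourier (?t n 3) z * (inv_fourier (?t n 4) z * inv_fourier ?k z)))))"
      unfolding l_def partial_inverse_def
    proof (rule Bochner_Integration.integral_cong[OF refl])
      fix z
      have "c * a1 * (c * a2 * (c * a3 * (c * a4))) * q = c ^ 4 * (a1 * (a2 * (a3 * (a4 * q))))" for c a1 a2 a3 a4 q :: complex
        by (simp add: power4_eq_xxxx mult_ac)
      then show "?c * inv_fourier (?t n 1) z * (?c * inv_fourier (?t n 2) z * (?c * inv_fourier (?t n 3) z * (?c * inv_fourier (?t n 4) z))) * inv_fourier ?k z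
        = ?c ^ 4 * (inv_fourier (?t n 1) z * (inv_fourier (?t n 2) z * (inv_fourier (?t n 3) z * (inv_fourier (?t n 4) z * inv_fourier ?k z))))" .
    qed
    also have "\<dots> = ?c ^ 4 * (LINT z|lborel. inv_fourier (?t n 1) z * (inv_fourier (?t n 2) z * (inv_fourier (?t n 3) z * (inv_fourier (?t n 4) z * inv_fourier ?k z))))"
      by (rule integral_mult_right_zero)
    also note integral_product_inv_fourier[OF it it it it k(1)]
    finally show ?thesis unfolding quintic_integrand_def .
  qed
  have l1: "l \<longlonglongrightarrow> (LINT z|lborel. u 1 z * (u 2 z * (u 3 z * u 4 z)) * inv_fourier ?k z)"
    unfolding l_def
  proof (rule integral_dominated_convergence[where w = "\<lambda>z. S 1 z * (S 2 z * (S 3 z * S 4 z)) * norm (inv_fourier ?k z)"])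
    obtain B where "0 \<le> B" and B: "\<And>z. (1 + norm z) ^ 4 * norm (inv_fourier ?k z) \<le> B" by (rule rapidE[OF k(2), where m = 4]) blast
    show "integrable lborel (\<lambda>z. S 1 z * (S 2 z * (S 3 z * S 4 z)) * norm (inv_fourier ?k z))"
      by (rule integrable_against_decay(1)[OF _ _ _ integrable_decay_product[OF S(1) S(2) S(3)] B]) (measurable, intro mult_nonneg_nonneg S(2))
    show "AE z in lborel. norm (?U n 1 z * (?U n 2 z * (?U n 3 z * ?U n 4 z)) * inv_fourier ?k z) \<le> S 1 z * (S 2 z * (S 3 z * S 4 z)) * norm (inv_fourier ?k z)" for n
      using bd[of 1] bd[of 2] bd[of 3] bd[of 4]
    proof eventually_elim
      case (elim z)
      then show ?case
        unfolding norm_mult by (intro mult_mono mult_nonneg_nonneg norm_ge_zero S(2) order_refl; blast)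
    qed
    show "AE z in lborel. (\<lambda>n. ?U n 1 z * (?U n 2 z * (?U n 3 z * ?U n 4 z)) * inv_fourier ?k z) \<longlonglongrightarrow> u 1 z * (u 2 z * (u 3 z * u 4 z)) * inv_fourier ?k z"
      using lim[of 1] lim[of 2] lim[of 3] lim[of 4] by eventually_elim (intro tendsto_mult tendsto_const; assumption)
  qed measurable
  have "(\<lambda>n. LINT p|lborel. quintic_integrand (?t n) ?k p) \<longlonglongrightarrow> (LINT p|lborel. quintic_integrand g ?k p)"
  proof (rule integral_dominated_convergence[where w = "\<lambda>p. norm (quintic_integrand g ?k p)"])
    show "integrable lborel (\<lambda>p. norm (quintic_integrand g ?k p))" by (rule integrable_norm[OF quint[OF f]])
    show "quintic_integrand g ?k \<in> borel_measurable lborel"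
      using measurable_quintic_integrand[of g ?k] by simp
    show "quintic_integrand (?t n) ?k \<in> borel_measurable lborel" for n
      using measurable_quintic_integrand[of "?t n" ?k] by simp
    show "AE p in lborel. norm (quintic_integrand (?t n) ?k p) \<le> norm (quintic_integrand g ?k p)" for n
      unfolding quintic_integrand_def norm_mult
      by (intro AE_I2 mult_mono mult_nonneg_nonneg norm_ge_zero order_refl norm_truncate_le)
    show "AE p in lborel. (\<lambda>n. quintic_integrand (?t n) ?k p) \<longlonglongrightarrow> quintic_integrand g ?k p"
    proof (rule AE_I2)
      fix p :: "((real \<times> real) \<times> (real \<times> real) \<times> (real \<times> real)) \<times> (real \<times> real)"
      have t: "(\<lambda>n. ?t n j w) \<longlonglongrightarrow> g j w" for j w
      proof (rule tendsto_eventually)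
        have "\<forall>\<^sub>F n in sequentially. norm w < R j n" using R[of j] by (simp add: filterlim_at_top_dense)
        then show "\<forall>\<^sub>F n in sequentially. ?t n j w = g j w" by eventually_elim (simp add: truncate_simps)
      qed
      show "(\<lambda>n. quintic_integrand (?t n) ?k p) \<longlonglongrightarrow> quintic_integrand g ?k p"
        unfolding quintic_integrand_def by (intro tendsto_mult t tendsto_const)
    qed
  qed
  then have "l \<longlonglongrightarrow> ?c ^ 4 * ((2 * pi)\<^sup>2 * (LINT p|lborel. quintic_integrand g ?k p))"
    unfolding eq[abs_def] by (intro tendsto_mult tendsto_const)
  with l1 show ?thesis by (rule LIMSEQ_unique)
qed

text \<open>The minus sign of \<open>distr_dx\<close> cancels against the one from evaluating
  \<open>dx_symbol f\<close> at \<open>- v\<close>. What remains is the multiplier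
  \<open>\<i> * fst v\<close> on the fourfold convolution of the transforms.\<close>

lemma represents_product_dx:
  "represents (\<lambda>v. of_real (1 / (2 * pi)\<^sup>2) ^ 4 * of_real ((2 * pi)\<^sup>2) * \<i> * of_real (fst v)
      * (LINT q|lborel. g 1 (fst q) * (g 2 (fst (snd q)) * g 3 (snd (snd q))) * g 4 (neg_sum3 q + v)))
    (distr_fourier (distr_dx (distr_of (\<lambda>z. u 1 z * (u 2 z * (u 3 z * u 4 z))))))"
proof -
  let ?c = "of_real (1 / (2 * pi)\<^sup>2) ^ 4 * of_real ((2 * pi)\<^sup>2) :: complex"
  let ?G3 = "\<lambda>q. g 1 (fst q) * (g 2 (fst (snd q)) * g 3 (snd (snd q)))"
  define G0 where "G0 v = (LINT q|lborel. ?G3 q * g 4 (neg_sum3 q + v))" for v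
  have [measurable]: "G0 \<in> borel_measurable borel" unfolding G0_def[abs_def] by measurable
  have *: "integrable lborel (\<lambda>v. ?c * \<i> * of_real (fst v) * G0 v * f v)"
    "distr_fourier (distr_dx (distr_of (\<lambda>z. u 1 z * (u 2 z * (u 3 z * u 4 z))))) f = (LINT v|lborel. ?c * \<i> * of_real (fst v) * G0 v * f v)"
    if f: "schwartz f" for f
  proof -
    let ?k = "dx_symbol f"
    have [measurable]: "?k \<in> borel_measurable borel" by (rule fourier_regularD(4)[OF fourier_regular_dx_symbol(1)[OF f]])
    have G3: "?G3 \<in> borel_measurable borel" by measurable
    note q = quint[OF f, unfolded quintic_integrand_def[abs_def]]
    note tr = integral_product_translate[OF G3 measurable_waves(1) _ measurable_neg_sum3 q, folded G0_def]
    have k: "?k \<in> borel_measurable borel" by measurable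
    have eq: "- (?c * (G0 v * ?k (- v))) = ?c * \<i> * of_real (fst v) * G0 v * f v" for v
      by (simp add: dx_symbol_def mult_ac)
    have i: "integrable lborel (\<lambda>v. - (?c * (G0 v * ?k (- v))))"
      by (intro integrable_minus integrable_mult_right tr(1)[OF k])
    show "integrable lborel (\<lambda>v. ?c * \<i> * of_real (fst v) * G0 v * f v)" using i unfolding eq .
    have "distr_fourier (distr_dx (distr_of (\<lambda>z. u 1 z * (u 2 z * (u 3 z * u 4 z))))) f
      = - (LINT z|lborel. u 1 z * (u 2 z * (u 3 z * u 4 z)) * inv_fourier ?k z)"
      by (simp only: distr_fourier_def distr_dx_def distr_of_def fourier_regular_dx_symbol(3)[OF f])
    also have "\<dots> = - (?c * (LINT p|lborel. quintic_integrand g ?k p))"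
      unfolding integral_product_dx[OF f] by (simp only: mult.assoc of_real_power of_real_mult of_real_numeral)
    also have "(LINT p|lborel. quintic_integrand g ?k p) = (LINT v|lborel. G0 v * ?k (- v))"
      unfolding quintic_integrand_def by (rule tr(2)[OF k])
    also have "- (?c * (LINT v|lborel. G0 v * ?k (- v))) = (LINT v|lborel. - (?c * (G0 v * ?k (- v))))"
      by (simp only: integral_mult_right_zero integral_minus)
    finally show "distr_fourier (distr_dx (distr_of (\<lambda>z. u 1 z * (u 2 z * (u 3 z * u 4 z))))) f = (LINT v|lborel. ?c * \<i> * of_real (fst v) * G0 v * f v)"
      unfolding eq .
  qed
  let ?G = "\<lambda>v. ?c * \<i> * of_real (fst v) * G0 v"
  let ?V = "distr_dx (distr_of (\<lambda>z. u 1 z * (u 2 z * (u 3 z * u 4 z))))"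
  have "tempered_function ?G"
    unfolding tempered_function_def by (intro conjI allI impI *(1)) measurable
  moreover have "distr_fourier ?V f = distr_of ?G f" if "schwartz f" for f
    unfolding distr_of_def[of ?G] by (rule *(2)[OF that])
  ultimately have "represents ?G (distr_fourier ?V)" unfolding represents_def by (intro conjI allI impI)
  then show ?thesis unfolding G0_def .
qed

end

section \<open>Duality and the estimate of the norm\<close>

context
  fixes s b b' al C :: real
  assumes form: "\<And>h1 h2 h3 h4 h0. h1 \<in> borel_measurable borel \<Longrightarrow> h2 \<in> borel_measurable borel \<Longrightarrow> h3 \<in> borel_measurable borel \<Longrightarrow>
    h4 \<in> borel_measurable borel \<Longrightarrow> h0 \<in> borel_measurable borel \<Longrightarrow>
    (\<integral>\<^sup>+u1. \<integral>\<^sup>+u2. \<integral>\<^sup>+u3. \<integral>\<^sup>+u4. h1 u1 * (h2 u2 * (h3 u3 * (h4 u4 * (ennreal \<bar>fst (u1 + u2 + u3 + u4)\<bar> * h0 (u1 + u2 + u3 + u4)))))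
        \<partial>lborel \<partial>lborel \<partial>lborel \<partial>lborel)\<^sup>2
    \<le> ennreal C * ((\<integral>\<^sup>+z. (ennreal (weight s b z) * h1 z)\<^sup>2 \<partial>lborel) * ((\<integral>\<^sup>+z. (ennreal (weight s b z) * h2 z)\<^sup>2 \<partial>lborel) *
       ((\<integral>\<^sup>+z. (ennreal (weight s b z) * h3 z)\<^sup>2 \<partial>lborel) * ((\<integral>\<^sup>+z. (ennreal (weight s b z) * h4 z)\<^sup>2 \<partial>lborel) *
         (\<integral>\<^sup>+z. (ennreal (weight (- (s + al)) b' z) * h0 z)\<^sup>2 \<partial>lborel)))))"
begin

text \<open>The form bound with a Schwartz function as fifth entry, whose dual norm is finite; it
  yields absolute convergence of the integral that dominates the truncations.\<close>

lemma integrable_quintic_integrand: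
  fixes g :: "nat \<Rightarrow> real \<times> real \<Rightarrow> complex"
  assumes b': "b' \<le> 1" and [measurable]: "\<And>j. g j \<in> borel_measurable borel"
    and A: "\<And>j. (\<integral>\<^sup>+z. (ennreal (weight s b z) * ennreal (norm (g j z)))\<^sup>2 \<partial>lborel) < \<infinity>" and f: "schwartz f"
  shows "integrable lborel (quintic_integrand g (dx_symbol f))"
proof -
  have f'[measurable]: "f \<in> borel_measurable borel" by (rule schwartz_basic(4)[OF f])
  have m[measurable]: "quintic_integrand g (dx_symbol f) \<in> borel_measurable borel"
    by (rule measurable_quintic_integrand[OF _ fourier_regularD(4)[OF fourier_regular_dx_symbol(1)[OF f]]]) measurable
  let ?h = "\<lambda>j z. ennreal (norm (g j z))"
  let ?F = "\<lambda>p. ennreal (norm (quintic_integrand g (dx_symbol f) p))"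
  let ?I = "\<integral>\<^sup>+u1. \<integral>\<^sup>+u2. \<integral>\<^sup>+u3. \<integral>\<^sup>+u4. ?h 1 u1 * (?h 2 u2 * (?h 3 u3 * (?h 4 u4 * (ennreal \<bar>fst (u1 + u2 + u3 + u4)\<bar> * ennreal (norm (f (u1 + u2 + u3 + u4))))))) \<partial>lborel \<partial>lborel \<partial>lborel \<partial>lborel"
  have "(\<integral>\<^sup>+p. ?F p \<partial>lborel) = (\<integral>\<^sup>+q. \<integral>\<^sup>+w. ?F (q, w) \<partial>lborel \<partial>lborel)" by (rule nn_integral_plane) measurable
  also have "\<dots> = (\<integral>\<^sup>+x. \<integral>\<^sup>+r. \<integral>\<^sup>+w. ?F ((x, r), w) \<partial>lborel \<partial>lborel \<partial>lborel)"
    by (rule nn_integral_plane) measurable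
  also have "\<dots> = (\<integral>\<^sup>+x. \<integral>\<^sup>+y. \<integral>\<^sup>+z. \<integral>\<^sup>+w. ?F ((x, (y, z)), w) \<partial>lborel \<partial>lborel \<partial>lborel \<partial>lborel)"
    by (rule nn_integral_cong, rule nn_integral_plane) measurable
  also have "\<dots> = ?I"
  proof (intro nn_integral_cong)
    fix x y z w :: "real \<times> real"
    have n: "neg_sum3 (x, y, z) - w = - (x + y + z + w)" by (simp add: neg_sum3_def)
    show "?F ((x, (y, z)), w) = ?h 1 x * (?h 2 y * (?h 3 z * (?h 4 w * (ennreal \<bar>fst (x + y + z + w)\<bar> * ennreal (norm (f (x + y + z + w)))))))"
      unfolding quintic_integrand_def fst_conv snd_conv n dx_symbol_def
      by (simp add: norm_mult ennreal_mult mult_ac del: minus_add_distrib fst_add)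
  qed
  finally have eq: "(\<integral>\<^sup>+p. ?F p \<partial>lborel) = ?I" .
  have "?I\<^sup>2 \<le> ennreal C * ((\<integral>\<^sup>+z. (ennreal (weight s b z) * ?h 1 z)\<^sup>2 \<partial>lborel) * ((\<integral>\<^sup>+z. (ennreal (weight s b z) * ?h 2 z)\<^sup>2 \<partial>lborel) *
       ((\<integral>\<^sup>+z. (ennreal (weight s b z) * ?h 3 z)\<^sup>2 \<partial>lborel) * ((\<integral>\<^sup>+z. (ennreal (weight s b z) * ?h 4 z)\<^sup>2 \<partial>lborel) *
         (\<integral>\<^sup>+z. (ennreal (weight (- (s + al)) b' z) * ennreal (norm (f z)))\<^sup>2 \<partial>lborel)))))"
    by (rule form) measurable
  also have "\<dots> < \<infinity>"
    using A[of 1] A[of 2] A[of 3] A[of 4] nn_integral_weight_schwartz[OF b' f, of "- (s + al)"]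
    by (simp add: ennreal_mult_less_top)
  finally have "?I < \<infinity>" by (simp add: power_less_top_ennreal)
  then show ?thesis unfolding eq[symmetric] using m by (simp add: integrable_iff_bounded)
qed

text \<open>Duality with the fifth entry \<open>?w * \<phi>\<close>: its dual weight in the form
  cancels \<open>?w\<close>, which leaves the plain \<open>L^2\<close> norm of
  \<open>\<phi>\<close>.\<close>

lemma weighted_convolution_bound:
  fixes h1 h2 h3 h4 :: "real \<times> real \<Rightarrow> ennreal"
  assumes [measurable]: "h1 \<in> borel_measurable borel" "h2 \<in> borel_measurable borel" "h3 \<in> borel_measurable borel" "h4 \<in> borel_measurable borel"
    and A: "(\<integral>\<^sup>+z. (ennreal (weight s b z) * h1 z)\<^sup>2 \<partial>lborel) < \<infinity>" "(\<integral>\<^sup>+z. (ennreal (weight s b z) * h2 z)\<^sup>2 \<partial>lborel) < \<infinity>"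
      "(\<integral>\<^sup>+z. (ennreal (weight s b z) * h3 z)\<^sup>2 \<partial>lborel) < \<infinity>" "(\<integral>\<^sup>+z. (ennreal (weight s b z) * h4 z)\<^sup>2 \<partial>lborel) < \<infinity>"
  shows "(\<integral>\<^sup>+v. (ennreal (weight (s + al) (- b') v) * (ennreal \<bar>fst v\<bar> *
      (\<integral>\<^sup>+q. h1 (fst q) * (h2 (fst (snd q)) * h3 (snd (snd q))) * h4 (neg_sum3 q + v) \<partial>lborel)))\<^sup>2 \<partial>lborel)
    \<le> ennreal C * ((\<integral>\<^sup>+z. (ennreal (weight s b z) * h1 z)\<^sup>2 \<partial>lborel) * ((\<integral>\<^sup>+z. (ennreal (weight s b z) * h2 z)\<^sup>2 \<partial>lborel) *
       ((\<integral>\<^sup>+z. (ennreal (weight s b z) * h3 z)\<^sup>2 \<partial>lborel) * (\<integral>\<^sup>+z. (ennreal (weight s b z) * h4 z)\<^sup>2 \<partial>lborel))))" (is "_ \<le> ?D")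
proof (rule L2_duality)
  let ?N = "\<lambda>v. \<integral>\<^sup>+q. h1 (fst q) * (h2 (fst (snd q)) * h3 (snd (snd q))) * h4 (neg_sum3 q + v) \<partial>lborel"
  let ?w = "\<lambda>v. ennreal (weight (s + al) (- b') v)"
  show "(\<lambda>v. ?w v * (ennreal \<bar>fst v\<bar> * ?N v)) \<in> borel_measurable borel" by measurable
  show "?D < \<infinity>" using A by (simp add: ennreal_mult_less_top)
  fix \<phi> :: "real \<times> real \<Rightarrow> ennreal" assume [measurable]: "\<phi> \<in> borel_measurable borel"
  let ?I = "\<integral>\<^sup>+u1. \<integral>\<^sup>+u2. \<integral>\<^sup>+u3. \<integral>\<^sup>+u4. h1 u1 * (h2 u2 * (h3 u3 * (h4 u4 * (ennreal \<bar>fst (u1 + u2 + u3 + u4)\<bar> * (?w (u1 + u2 + u3 + u4) * \<phi> (u1 + u2 + u3 + u4)))))) \<partial>lborel \<partial>lborel \<partial>lborel \<partial>lborel"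
  have "(\<integral>\<^sup>+v. ?w v * (ennreal \<bar>fst v\<bar> * ?N v) * \<phi> v \<partial>lborel) = (\<integral>\<^sup>+v. (ennreal \<bar>fst v\<bar> * (?w v * \<phi> v)) * ?N v \<partial>lborel)"
    by (simp only: mult_ac)
  also have "\<dots> = ?I"
    by (rule nn_integral_form_translate[symmetric, where ?h0.0 = "\<lambda>v. ennreal \<bar>fst v\<bar> * (?w v * \<phi> v)"]) measurable
  finally have eq: "(\<integral>\<^sup>+v. ?w v * (ennreal \<bar>fst v\<bar> * ?N v) * \<phi> v \<partial>lborel) = ?I" .
  have "?I\<^sup>2 \<le> ennreal C * ((\<integral>\<^sup>+z. (ennreal (weight s b z) * h1 z)\<^sup>2 \<partial>lborel) * ((\<integral>\<^sup>+z. (ennreal (weight s b z) * h2 z)\<^sup>2 \<partial>lborel) *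
       ((\<integral>\<^sup>+z. (ennreal (weight s b z) * h3 z)\<^sup>2 \<partial>lborel) * ((\<integral>\<^sup>+z. (ennreal (weight s b z) * h4 z)\<^sup>2 \<partial>lborel) *
         (\<integral>\<^sup>+z. (ennreal (weight (- (s + al)) b' z) * (?w z * \<phi> z))\<^sup>2 \<partial>lborel)))))"
    by (rule form) measurable
  also have "(\<lambda>z. (ennreal (weight (- (s + al)) b' z) * (?w z * \<phi> z))\<^sup>2) = (\<lambda>z. (\<phi> z)\<^sup>2)"
  proof
    fix z
    have "ennreal (weight (- (s + al)) b' z) * ?w z = 1"
      using weight_inverse[of "- (s + al)" b' z] by (simp only: minus_minus ennreal_mult'[OF weight_pos(2), symmetric] ennreal_1)
    then show "(ennreal (weight (- (s + al)) b' z) * (?w z * \<phi> z))\<^sup>2 = (\<phi> z)\<^sup>2"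
      by (simp only: mult.assoc[symmetric] mult_1_left)
  qed
  finally show "(\<integral>\<^sup>+v. ?w v * (ennreal \<bar>fst v\<bar> * ?N v) * \<phi> v \<partial>lborel)\<^sup>2 \<le> ?D * (\<integral>\<^sup>+z. (\<phi> z)\<^sup>2 \<partial>lborel)"
    unfolding eq by (simp only: mult.assoc)
qed

end

lemma norm_integral_le_nn_integral:
  fixes f :: "'a \<Rightarrow> 'b::{banach, second_countable_topology}"
  shows "ennreal (norm (LINT x|M. f x)) \<le> (\<integral>\<^sup>+x. ennreal (norm (f x)) \<partial>M)"
proof (cases "integrable M f")
  case True
  then show ?thesis by (rule integral_norm_bound_ennreal)
next
  case False
  then show ?thesis by (simp add: not_integrable_integral_eq)
qed

text \<open>The explicit transform \<open>G\<close> agrees almost everywhere with the chosen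
  \<open>fourier_fun V\<close>, so its weighted integral is the squared norm.\<close>

lemma X_space_estimate:
  assumes g: "represents G (distr_fourier V)" and V: "tempered V" and D: "0 \<le> D"
    and Y: "(\<integral>\<^sup>+v. (ennreal (weight r p v) * ennreal (norm (G v)))\<^sup>2 \<partial>lborel) \<le> ennreal D"
  shows "V \<in> X_space r p" and "X_norm r p V \<le> sqrt D"
proof -
  note F = fourier_fun_AE[OF g]
  have [measurable]: "fourier_fun V \<in> borel_measurable borel" using F(1) unfolding represents_def tempered_function_def by (elim conjE)
  have X: "X_integrand r p V = (\<lambda>z. (weight r p z * norm (fourier_fun V z))\<^sup>2)" by (simp add: X_integrand_eq fun_eq_iff)
  have [measurable]: "X_integrand r p V \<in> borel_measurable borel" unfolding X by measurable
  have X0: "0 \<le> X_integrand r p V z" for z by (simp add: X)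
  have "(\<integral>\<^sup>+z. ennreal (X_integrand r p V z) \<partial>lborel) = (\<integral>\<^sup>+v. (ennreal (weight r p v) * ennreal (norm (G v)))\<^sup>2 \<partial>lborel)"
  proof (rule nn_integral_cong_AE)
    show "AE z in lborel. ennreal (X_integrand r p V z) = (ennreal (weight r p z) * ennreal (norm (G z)))\<^sup>2"
      using F(2) by eventually_elim (simp add: X ennreal_mult'[symmetric] ennreal_power)
  qed
  also note Y
  finally have le: "(\<integral>\<^sup>+z. ennreal (X_integrand r p V z) \<partial>lborel) \<le> ennreal D" .
  have "(\<integral>\<^sup>+z. ennreal (X_integrand r p V z) \<partial>lborel) < \<infinity>"
    by (rule le_less_trans[OF le]) simp
  then have i: "integrable lborel (X_integrand r p V)" using X0 by (simp add: integrable_iff_bounded)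
  then show "V \<in> X_space r p" using V g unfolding X_space_def by blast
  have "ennreal (LINT z|lborel. X_integrand r p V z) \<le> ennreal D"
    using le nn_integral_eq_integral[OF i] X0 by simp
  then have "(LINT z|lborel. X_integrand r p V z) \<le> D" using D by simp
  then show "X_norm r p V \<le> sqrt D" unfolding X_norm_def by (rule real_sqrt_le_mono)
qed

lemma prod_1_to_4: "(\<Prod>j\<in>{1..4::nat}. f j) = f 1 * (f 2 * (f 3 * f 4))"
proof -
  have "{1..4::nat} = {1, 2, 3, 4}" by auto
  then show ?thesis by simp
qed

text \<open>Four inverse transforms and one inversion leave \<open>(2 * pi)^(-6)\<close> in modulus,
  which may be replaced by 1 in the estimate.\<close>

lemma inverse_transform_constant:
  "norm (of_real (1 / (2 * pi)\<^sup>2) ^ 4 * of_real ((2 * pi)\<^sup>2) * \<i> :: complex) \<le> 1"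
proof -
  have 1: "1 \<le> (2 * pi)\<^sup>2" using pi_ge_two by (intro one_le_power) simp
  then have "0 \<le> 1 / (2 * pi)\<^sup>2" "1 / (2 * pi)\<^sup>2 \<le> 1" by (simp_all add: divide_le_eq)
  then have 3: "(1 / (2 * pi)\<^sup>2) ^ 3 \<le> 1" by (rule power_le_one)
  have "norm (of_real (1 / (2 * pi)\<^sup>2) ^ 4 * of_real ((2 * pi)\<^sup>2) * \<i> :: complex) = (1 / (2 * pi)\<^sup>2) ^ 4 * (2 * pi)\<^sup>2"
    by (simp only: norm_mult norm_power norm_of_real norm_ii mult_1_right) simp
  also have "\<dots> = (1 / (2 * pi)\<^sup>2) ^ 3"
    using 1 by (simp add: field_simps power_numeral_reduce)
  finally show ?thesis using 3 by simp
qed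

lemma norm_product_convolution_le:
  fixes g :: "nat \<Rightarrow> real \<times> real \<Rightarrow> complex"
  shows "ennreal (norm (of_real (1 / (2 * pi)\<^sup>2) ^ 4 * of_real ((2 * pi)\<^sup>2) * \<i> * of_real (fst v)
      * (LINT q|lborel. g 1 (fst q) * (g 2 (fst (snd q)) * g 3 (snd (snd q))) * g 4 (neg_sum3 q + v))))
    \<le> ennreal \<bar>fst v\<bar> * (\<integral>\<^sup>+q. ennreal (norm (g 1 (fst q))) * (ennreal (norm (g 2 (fst (snd q)))) * ennreal (norm (g 3 (snd (snd q)))))
        * ennreal (norm (g 4 (neg_sum3 q + v))) \<partial>lborel)"
proof -
  have 1: "ennreal (norm (c * of_real x * y)) \<le> ennreal \<bar>x\<bar> * ennreal (norm y)" if "norm c \<le> 1" for c y :: complex and x :: real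
  proof -
    have "norm (c * of_real x * y) = norm c * (\<bar>x\<bar> * norm y)" by (simp add: norm_mult)
    also have "\<dots> \<le> \<bar>x\<bar> * norm y" by (rule mult_left_le_one_le) (use that in auto)
    finally show ?thesis by (simp add: ennreal_mult[symmetric] ennreal_leI)
  qed
  let ?f = "\<lambda>q. g 1 (fst q) * (g 2 (fst (snd q)) * g 3 (snd (snd q))) * g 4 (neg_sum3 q + v)"
  have 2: "ennreal (norm (?f q)) = ennreal (norm (g 1 (fst q))) * (ennreal (norm (g 2 (fst (snd q)))) * ennreal (norm (g 3 (snd (snd q)))))
        * ennreal (norm (g 4 (neg_sum3 q + v)))" for q
    by (simp only: norm_mult ennreal_mult' norm_ge_zero mult_nonneg_nonneg)
  have "ennreal (norm (LINT q|lborel. ?f q)) \<le> (\<integral>\<^sup>+q. ennreal (norm (?f q)) \<partial>lborel)" by (rule norm_integral_le_nn_integral)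
  from order_trans[OF 1[OF inverse_transform_constant, of "fst v" "LINT q|lborel. ?f q"] mult_left_mono[OF this zero_le]]
  show ?thesis unfolding 2 .
qed

theorem proposition4p7:
  fixes s b b' a :: real
  assumes "s > - 1 / 6"
    and "b > 1 / 2"
    and "b' \<in> {(5 - 6 * s) / 12 <..< 1 / 2}"
    and "0 \<le> a"
    and "a < 1 / 2 * (3 * min 0 s + 6 * b' - 5 / 2)"
  shows "\<exists>C>0. \<forall>U :: nat \<Rightarrow> distr. (\<forall>j\<in>{1..4}. U j \<in> X_space s b) \<longrightarrow>
    (\<exists>u. (\<forall>j\<in>{1..4}. represents (u j) (U j)) \<and>
         tempered_function (\<lambda>z. \<Prod>j\<in>{1..4}. u j z) \<and>
         distr_dx (distr_of (\<lambda>z. \<Prod>j\<in>{1..4}. u j z)) \<in> X_space (s + a) (- b') \<and>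
         X_norm (s + a) (- b') (distr_dx (distr_of (\<lambda>z. \<Prod>j\<in>{1..4}. u j z)))
           \<le> C * (\<Prod>j\<in>{1..4}. X_norm s b (U j)))"
proof -
  have b': "b' < 1 / 2" "b' \<le> 1" using assms(3) by auto
  obtain C where C: "0 < C" and form: "\<And>h1 h2 h3 h4 h0. h1 \<in> borel_measurable borel \<Longrightarrow> h2 \<in> borel_measurable borel \<Longrightarrow> h3 \<in> borel_measurable borel \<Longrightarrow>
    h4 \<in> borel_measurable borel \<Longrightarrow> h0 \<in> borel_measurable borel \<Longrightarrow>
    (\<integral>\<^sup>+u1. \<integral>\<^sup>+u2. \<integral>\<^sup>+u3. \<integral>\<^sup>+u4. h1 u1 * (h2 u2 * (h3 u3 * (h4 u4 * (ennreal \<bar>fst (u1 + u2 + u3 + u4)\<bar> * h0 (u1 + u2 + u3 + u4)))))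
        \<partial>lborel \<partial>lborel \<partial>lborel \<partial>lborel)\<^sup>2
    \<le> ennreal C * ((\<integral>\<^sup>+z. (ennreal (weight s b z) * h1 z)\<^sup>2 \<partial>lborel) * ((\<integral>\<^sup>+z. (ennreal (weight s b z) * h2 z)\<^sup>2 \<partial>lborel) *
       ((\<integral>\<^sup>+z. (ennreal (weight s b z) * h3 z)\<^sup>2 \<partial>lborel) * ((\<integral>\<^sup>+z. (ennreal (weight s b z) * h4 z)\<^sup>2 \<partial>lborel) *
         (\<integral>\<^sup>+z. (ennreal (weight (- (s + a)) b' z) * h0 z)\<^sup>2 \<partial>lborel)))))"
    by (rule quintic_form_bound[OF assms(1,2) b'(1) assms(4,5)]) blast
  have "\<exists>u. (\<forall>j\<in>{1..4}. represents (u j) (U j)) \<and>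
         tempered_function (\<lambda>z. \<Prod>j\<in>{1..4}. u j z) \<and>
         distr_dx (distr_of (\<lambda>z. \<Prod>j\<in>{1..4}. u j z)) \<in> X_space (s + a) (- b') \<and>
         X_norm (s + a) (- b') (distr_dx (distr_of (\<lambda>z. \<Prod>j\<in>{1..4}. u j z)))
           \<le> sqrt C * (\<Prod>j\<in>{1..4}. X_norm s b (U j))"
    if U: "\<forall>j\<in>{1..4}. U j \<in> X_space s b" for U :: "nat \<Rightarrow> distr"
  proof -
    \<comment> \<open>Repeating \<open>U 1\<close> at the other indices lets all hypotheses and
      choices be made uniformly in \<open>j\<close>.\<close>
    define U' where "U' j = (if j \<in> {1..4} then U j else U 1)" for j
    have U': "U' j \<in> X_space s b" for j using U by (simp add: U'_def)
    have U'eq: "U' j = U j" if "j \<in> {1..4}" for j using that by (simp add: U'_def)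
    define g where "g j = fourier_fun (U' j)" for j
    note X = X_space_facts[OF U', folded g_def]
    have tg: "tempered_function (g j)" for j using X(1)[of j] by (simp add: represents_def)
    \<comment> \<open>Function, radii and majorant of one index belong together, so they are chosen
      as a single triple.\<close>
    define Q where "Q j t \<longleftrightarrow> filterlim (fst (snd t)) at_top (sequentially :: nat filter) \<and> represents (fst t) (U' j) \<and> snd (snd t) \<in> borel_measurable borel \<and>
      (\<forall>z. 0 \<le> snd (snd t) z) \<and> (\<integral>\<^sup>+z. ennreal (snd (snd t) z ^ 6) \<partial>lborel) < \<infinity> \<and>
      (AE z in lborel. \<forall>n. norm (partial_inverse (fst (snd t) n) (g j) z) \<le> snd (snd t) z) \<and>
      (AE z in lborel. (\<lambda>n. partial_inverse (fst (snd t) n) (g j) z) \<longlonglongrightarrow> fst t z) \<and>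
      (AE z in lborel. norm (fst t z) \<le> snd (snd t) z)" for j t
    have ex: "\<exists>t. Q j t" for j
    proof (rule X_space_function[OF assms(1,2) U'[of j]])
      fix u R S
      assume a: "filterlim R at_top (sequentially :: nat filter)" "represents u (U' j)" "S \<in> borel_measurable borel"
        "\<And>z. 0 \<le> S z" "(\<integral>\<^sup>+z. ennreal (S z ^ 6) \<partial>lborel) < \<infinity>"
        "AE z in lborel. \<forall>n. norm (of_real (1 / (2 * pi)\<^sup>2) * inv_fourier (truncate (R n) (fourier_fun (U' j))) z) \<le> S z"
        "AE z in lborel. (\<lambda>n. of_real (1 / (2 * pi)\<^sup>2) * inv_fourier (truncate (R n) (fourier_fun (U' j))) z) \<longlonglongrightarrow> u z"
        "AE z in lborel. norm (u z) \<le> S z"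
      have "Q j (u, R, S)"
        unfolding Q_def fst_conv snd_conv partial_inverse_def g_def by (intro conjI allI a)
      then show "\<exists>t. Q j t" ..
    qed
    have "\<forall>j. \<exists>t. Q j t" using ex ..
    then obtain t where t: "\<forall>j. Q j (t j)" using choice[of Q] by blast
    define u where "u j = fst (t j)" for j
    define R where "R j = fst (snd (t j))" for j
    define S where "S j = snd (snd (t j))" for j
    note Qt = t[THEN spec, unfolded Q_def] and defs = u_def R_def S_def
    have Q1: "filterlim (R j) at_top sequentially" for j unfolding defs using Qt[of j] by (elim conjE)
    have Q2: "represents (u j) (U' j)" for j unfolding defs using Qt[of j] by (elim conjE)
    have Q3: "S j \<in> borel_measurable borel" for j unfolding defs using Qt[of j] by (elim conjE)
    have Q4: "0 \<le> S j z" for j z unfolding defs using Qt[of j] by (elim conjE) (erule spec)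
    have Q5: "(\<integral>\<^sup>+z. ennreal (S j z ^ 6) \<partial>lborel) < \<infinity>" for j unfolding defs using Qt[of j] by (elim conjE)
    have Q6: "AE z in lborel. \<forall>n. norm (partial_inverse (R j n) (g j) z) \<le> S j z" for j unfolding defs using Qt[of j] by (elim conjE)
    have Q7: "AE z in lborel. (\<lambda>n. partial_inverse (R j n) (g j) z) \<longlonglongrightarrow> u j z" for j unfolding defs using Qt[of j] by (elim conjE)
    have Q8: "AE z in lborel. norm (u j z) \<le> S j z" for j unfolding defs using Qt[of j] by (elim conjE)
    have um: "u j \<in> borel_measurable borel" for j using Q2[of j] unfolding represents_def tempered_function_def by (elim conjE)
    have A: "(\<integral>\<^sup>+z. (ennreal (weight s b z) * ennreal (norm (g j z)))\<^sup>2 \<partial>lborel) < \<infinity>" for j by (simp add: X(3))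
    have quint: "integrable lborel (quintic_integrand g (dx_symbol f))" if "schwartz f" for f
      by (rule integrable_quintic_integrand[OF form b'(2) X(2) A that])
    note facts = tg Q1 um Q3 Q4 Q5 Q6 Q7 Q8 quint
    let ?P = "\<lambda>z. u 1 z * (u 2 z * (u 3 z * u 4 z))"
    let ?c = "of_real (1 / (2 * pi)\<^sup>2) ^ 4 * of_real ((2 * pi)\<^sup>2) * \<i> :: complex"
    let ?G0 = "\<lambda>v. LINT q|lborel. g 1 (fst q) * (g 2 (fst (snd q)) * g 3 (snd (snd q))) * g 4 (neg_sum3 q + v)"
    let ?G = "\<lambda>v. ?c * of_real (fst v) * ?G0 v"
    let ?h = "\<lambda>j z. ennreal (norm (g j z))"
    let ?N = "\<lambda>v. \<integral>\<^sup>+q. ?h 1 (fst q) * (?h 2 (fst (snd q)) * ?h 3 (snd (snd q))) * ?h 4 (neg_sum3 q + v) \<partial>lborel"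
    let ?x = "\<lambda>j. X_norm s b (U' j)"
    note [measurable] = X(2)
    have rep: "represents ?G (distr_fourier (distr_dx (distr_of ?P)))" by (rule represents_product_dx[OF facts])
    have le1: "(\<integral>\<^sup>+v. (ennreal (weight (s + a) (- b') v) * ennreal (norm (?G v)))\<^sup>2 \<partial>lborel)
      \<le> (\<integral>\<^sup>+v. (ennreal (weight (s + a) (- b') v) * (ennreal \<bar>fst v\<bar> * ?N v))\<^sup>2 \<partial>lborel)"
      by (intro nn_integral_mono power_mono mult_left_mono norm_product_convolution_le) simp_all
    have hm: "?h j \<in> borel_measurable borel" for j by measurable
    let ?A = "\<lambda>j. \<integral>\<^sup>+z. (ennreal (weight s b z) * ?h j z)\<^sup>2 \<partial>lborel"
    have le2: "(\<integral>\<^sup>+v. (ennreal (weight (s + a) (- b') v) * (ennreal \<bar>fst v\<bar> * ?N v))\<^sup>2 \<partial>lborel) \<le> ennreal C * (?A 1 * (?A 2 * (?A 3 * ?A 4)))"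
      by (rule weighted_convolution_bound[where ?h1.0 = "?h 1" and ?h2.0 = "?h 2" and ?h3.0 = "?h 3" and ?h4.0 = "?h 4", OF form hm hm hm hm A A A A])
    have eq: "ennreal C * (?A 1 * (?A 2 * (?A 3 * ?A 4))) = ennreal (C * (?x 1 * (?x 2 * (?x 3 * ?x 4)))\<^sup>2)"
      unfolding X(3) using C by (simp add: ennreal_mult power_mult_distrib)
    note le = order_trans[OF le1 le2, unfolded eq]
    have D: "0 \<le> C * (?x 1 * (?x 2 * (?x 3 * ?x 4)))\<^sup>2" using C by simp
    have tf: "tempered_function ?P" by (rule tempered_product(1)[OF facts])
    have te: "tempered (distr_dx (distr_of ?P))" by (rule tempered_product(2)[OF facts])
    note est = X_space_estimate[OF rep te D le]
    have x0: "0 \<le> ?x j" for j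
      unfolding X_norm_def by (intro real_sqrt_ge_zero Bochner_Integration.integral_nonneg) (simp add: X_integrand_eq)
    have "sqrt (C * (?x 1 * (?x 2 * (?x 3 * ?x 4)))\<^sup>2) = sqrt C * (?x 1 * (?x 2 * (?x 3 * ?x 4)))"
      using x0 by (simp add: real_sqrt_mult)
    moreover have "?x 1 = X_norm s b (U 1)" "?x 2 = X_norm s b (U 2)" "?x 3 = X_norm s b (U 3)" "?x 4 = X_norm s b (U 4)"
      by (simp_all add: U'_def)
    ultimately have norm: "X_norm (s + a) (- b') (distr_dx (distr_of ?P))
      \<le> sqrt C * (X_norm s b (U 1) * (X_norm s b (U 2) * (X_norm s b (U 3) * X_norm s b (U 4))))"
      using est(2) by simp
    have ru: "\<forall>j\<in>{1..4}. represents (u j) (U j)"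
    proof
      fix j :: nat assume "j \<in> {1..4}"
      from U'eq[OF this] Q2[of j] show "represents (u j) (U j)" by (simp only:)
    qed
    show ?thesis
      unfolding prod_1_to_4 by (intro exI[of _ u] conjI ru tf est(1) norm)
  qed
  note main = this
  \<comment> \<open>The form bound is quadratic in each norm, so the estimate of the norm itself has
    the square root as constant.\<close>
  have "0 < sqrt C" using C by simp
  then show ?thesis by (intro exI[of _ "sqrt C"] conjI allI impI main)
qed

end
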